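(* Assume $f(\theta_f)\le g(\theta_g)$ and $T>0$. Let $(T,R_1,R_2,y(\cdot))\in\mathcal{R}(T)$ and let $C_1<0<R_1<C_2$, $B_1<0<B_2$ be given. Assume that $$y(C_1+)>B_1,\qquad y(C_2-)<B_2,$$ and let $u_{1,0}\in L^\infty(\mathbb{R}\setminus(B_1,B_2))$. Then there exist $\tilde u_0\in L^\infty(B_1,B_2)$ and the solution $u$ of $$u_t+F(x,u)_x=0\ \ (x\in\mathbb{R},\ t>0),\qquad u(x,0)=u_0(x),$$ with initial data $$u_0(x)=\begin{cases}u_{1,0}(x)&x\notin(B_1,B_2),\\ \tilde u_0(x)&x\in(B_1,B_2),\end{cases}$$ such that, if $(T,R_1(T),R_2(T),y(\cdot,T))$ is the element of $\mathcal{R}(T)$ corresponding to $u(\cdot,T)$, then $$R_i=R_i(T)\ \text{ for } i=1,2,\qquad y(x)=y(x,T)\ \text{ for all }x\in(C_1,R_2)\cup(R_1,C_2).$$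
   Context: Fluxes. $f,g\in C^1(\mathbb{R})$ are strictly convex with superlinear growth, $\lim_{|p|\to\infty}f(p)/|p|=\lim_{|p|\to\infty}g(p)/|p|=\infty$; $\theta_f,\theta_g$ are their unique minimum points. $F(x,u)=H(x)f(u)+(1-H(x))g(u)$, $H$ the Heaviside function. $f^*(p)=\sup_q\{pq-f(q)\}$, similarly $g^*$. The numbers $\bar{\bar\theta}_g\le\theta_f\le\bar\theta_g$ are defined by $f(\bar{\bar\theta}_g)=f(\bar\theta_g)=g(\theta_g)$. Control curves. Let $x\in\mathbb{R}$, $t>0$. A control curve is a piecewise affine $\gamma\in C([0,t],\mathbb{R})$ with at most 3 affine segments, each segment lying entirely in $\{\gamma\ge0\}$ or entirely in $\{\gamma\le0\}$; if there are three segments, on $[t_{i-1},t_i]$, $i=1,2,3$, $0=t_0\le t_1\le t_2\le t_3=t$, then $\gamma=0$ on $(t_1,t_2)$ and either $\gamma>0$ on $(t_0,t_1)\cup(t_2,t)$ or $\gamma<0$ on $(t_0,t_1)\cup(t_2,t)$. $c(x,t)$ is the set of control curves with $\gamma(t)=x$; $c_0(x,t)\subset c(x,t)$ is the set of those with exactly one affine segment and $x\gamma(s)\ge0$ on $[0,t]$; $c_r(x,t)\subset c(x,t)$ is the set of those with exactly 3 affine segments and $x\gamma(s)\ge0$ on $[0,t]$. Value function and solution. For $u_0\in L^\infty(\mathbb{R})$ put $v_0(x)=\int_0^xu_0(\theta)\,d\theta$ and, for $\gamma\in c(x,t)$, $$\Gamma_{v_0,\gamma}(x,t)=v_0(\gamma(0))+\int_{\{\gamma>0\}}f^*(\dot\gamma)\,d\theta+\int_{\{\gamma<0\}}g^*(\dot\gamma)\,d\theta+\mathrm{meas}\{\theta\in[0,t]:\gamma(\theta)=0\}\min\{f^*(0),g^*(0)\},$$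 $v(x,t)=\inf_{\gamma\in c(x,t)}\Gamma_{v_0,\gamma}(x,t)$, and $ch(x,t)=\{\gamma\in c(x,t):\Gamma_{v_0,\gamma}(x,t)=v(x,t)\}$ (characteristic curves). The solution with initial data $u_0$ is $u=\partial v/\partial x$; it is the entropy solution (weak solution satisfying Kružkov entropy inequalities in each quarter plane and the interface entropy condition $\mathrm{meas}\{t: f'(u(0+,t))>0,\ g'(u(0-,t))<0\}=0$). Quantities attached to $u_0$. $R_1(t)=\inf\{x\ge0: ch(x,t)\subset c_0(x,t)\}$. $R_2(t)=\inf\{x: 0\le x\le R_1(t),\ ch(x,t)\cap c_r(x,t)\ne\emptyset\}$, and $R_2(t)=R_1(t)$ if this set is empty. $L_1(t)=\sup\{x\le0: ch(x,t)\subset c_0(x,t)\}$; under the assumption $f(\theta_f)\le g(\theta_g)$ one has $L_1(t)=0$. For $x\in(-\infty,L_1(t))\cup(R_1(t),\infty)$, $y(x,t)=\inf\{\gamma(0):\gamma\in ch(x,t)\}$. For $0\le x\le R_1(t)$, $t_+(x,t)=\inf\{t_1:\gamma(t_1)=0,\ \gamma>0\text{ on }(t_1,t),\ \gamma\in ch(x,t)\}$, and $y_{-,0}(s)=\inf\{\gamma(0):\gamma\in ch(0,s)\}$; for $0<x<R_2(t)$, $y(x,t)$ stands for $y_{-,0}(t_+(x,t))$. The element of $\mathcal{R}(T)$ corresponding to $u(\cdot,T)$ is $(T,R_1(T),R_2(T),y(\cdot,T))$. The pair $(\tau_0,\xi_0)$. Let $0\le T_1\le T$ and $R_1=f'(\bar\theta_g)(T-T_1)$.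 If $R_1=0$ then $\tau_0=T$, $\xi_0=-f'(\bar{\bar\theta}_g)T$. If $R_1>0$ and $T_1=0$ then $\tau_0=\xi_0=0$. If $R_1>0$ and $T_1>0$, then $(\tau_0,\xi_0)$ is the pair with $0\le\xi_0\le -f'(\bar{\bar\theta}_g)T_1$, $\xi_0=-f'(\bar{\bar\theta}_g)\tau_0$, for which there is a Lipschitz, non-decreasing, convex curve $s:[\tau_0,T]\to[0,\infty)$ with $s(T)=R_1$, $s(\tau_0)=0$ and $$\frac{ds}{dt}=\frac{f(\bar\theta_g)-f(w(t))}{\bar\theta_g-w(t)},\qquad w(t)=(f')^{-1}\Big(\frac{s(t)-\xi_0}{t}\Big).$$ Reachable set. Let $\gamma_0(t)=R_1+f'(\bar\theta_g)(t-T)$ and let $(0,T(R_1))$ be the point of intersection of the $t$-axis and $\gamma_0$, i.e. $\gamma_0(T(R_1))=0$. $\mathcal{R}(T)$ is the set of all $(T,R_1,R_2,y(\cdot))$ with $0\le R_2\le R_1$ and $y:(-\infty,R_2)\cup(R_1,\infty)\to\mathbb{R}$ such that: (1) $y$ is non-decreasing, $y(x)\le0$ for all $x\in(-\infty,R_2)$, $y(x)\ge0$ for all $x\in(R_1,\infty)$, and $\sup\{|x-y(x)|:x\in(-\infty,R_2)\cup(R_1,\infty)\}<\infty$; (2) if $T(R_1)\ge0$ and $(\tau_0,\xi_0)$ is the pair above with $T_1=T(R_1)$, then $\xi_0\le y(R_1+)$; (3) if $R_2<R_1$ then $T(R_1)\ge0$.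
   Formalization: Adds the necessary assumption y(x)<0 for 0<x<R_2; y(x)=y(x,T) is asserted only where y is continuous (values at jumps are not determined by R(T)); in R_1(t), L_1(t) the point x=0 is left out; c_r admits t_1=0. *)

theory Defs
  imports "HOL-Analysis.Analysis"
begin

section \<open>Fluxes\<close>

definition strictly_convex :: "(real \<Rightarrow> real) \<Rightarrow> bool" where
  "strictly_convex f \<longleftrightarrow>
     (\<forall>p q \<alpha>. p \<noteq> q \<and> 0 < \<alpha> \<and> \<alpha> < 1 \<longrightarrow>
        f (\<alpha> * p + (1 - \<alpha>) * q) < \<alpha> * f p + (1 - \<alpha>) * f q)"

definition convex_flux :: "(real \<Rightarrow> real) \<Rightarrow> bool" where
  "convex_flux f \<longleftrightarrow>
     f C1_differentiable_on UNIV \<and> strictly_convex f \<and>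
     filterlim (\<lambda>p. f p / \<bar>p\<bar>) at_top at_infinity"

definition \<theta> :: "(real \<Rightarrow> real) \<Rightarrow> real" where
  "\<theta> f = arg_min f (\<lambda>_. True)"

definition \<theta>bar :: "(real \<Rightarrow> real) \<Rightarrow> (real \<Rightarrow> real) \<Rightarrow> real" where
  "\<theta>bar f g = (THE p. \<theta> f \<le> p \<and> f p = g (\<theta> g))"

definition \<theta>barbar :: "(real \<Rightarrow> real) \<Rightarrow> (real \<Rightarrow> real) \<Rightarrow> real" where
  "\<theta>barbar f g = (THE p. p \<le> \<theta> f \<and> f p = g (\<theta> g))"

definition legendre :: "(real \<Rightarrow> real) \<Rightarrow> real \<Rightarrow> real" where
  "legendre f p = (SUP q. p * q - f q)"

definition flux :: "(real \<Rightarrow> real) \<Rightarrow> (real \<Rightarrow> real) \<Rightarrow> real \<Rightarrow> real \<Rightarrow> real" where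
  "flux f g x p = (if x \<ge> 0 then f p else g p)"

text \<open>Elements of L-infinity of A are represented by functions on the whole space;
  their values off A are irrelevant.\<close>

definition Linf :: "'a::euclidean_space set \<Rightarrow> ('a \<Rightarrow> real) \<Rightarrow> bool" where
  "Linf A u \<longleftrightarrow> set_borel_measurable lebesgue A u \<and>
     (\<exists>C. AE x in lebesgue. x \<in> A \<longrightarrow> \<bar>u x\<bar> \<le> C)"


section \<open>Control curves\<close>

text \<open>Curves are functions on the reals of which only the restriction to \<open>{0..t}\<close> matters.
  Continuity on \<open>{0..t}\<close> is built in: consecutive closed segments share their endpoints.\<close>

definition segment :: "(real \<Rightarrow> real) \<Rightarrow> real \<Rightarrow> real \<Rightarrow> bool" where
  "segment \<gamma> a b \<longleftrightarrow>
     (\<exists>m c. \<forall>s\<in>{a..b}. \<gamma> s = m * s + c) \<and>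
     ((\<forall>s\<in>{a..b}. \<gamma> s \<ge> 0) \<or> (\<forall>s\<in>{a..b}. \<gamma> s \<le> 0))"

definition three_segments :: "(real \<Rightarrow> real) \<Rightarrow> real \<Rightarrow> real \<Rightarrow> real \<Rightarrow> bool" where
  "three_segments \<gamma> t t1 t2 \<longleftrightarrow>
     0 \<le> t1 \<and> t1 \<le> t2 \<and> t2 \<le> t \<and>
     segment \<gamma> 0 t1 \<and> segment \<gamma> t1 t2 \<and> segment \<gamma> t2 t \<and>
     (\<forall>s\<in>{t1<..<t2}. \<gamma> s = 0) \<and>
     ((\<forall>s\<in>{0<..<t1} \<union> {t2<..<t}. \<gamma> s > 0) \<or>
      (\<forall>s\<in>{0<..<t1} \<union> {t2<..<t}. \<gamma> s < 0))"

definition control_curves :: "real \<Rightarrow> real \<Rightarrow> (real \<Rightarrow> real) set" where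
  "control_curves x t = {\<gamma>. \<gamma> t = x \<and>
     (segment \<gamma> 0 t \<or>
      (\<exists>t1\<in>{0..t}. segment \<gamma> 0 t1 \<and> segment \<gamma> t1 t) \<or>
      (\<exists>t1 t2. three_segments \<gamma> t t1 t2))}"

definition c0_curves :: "real \<Rightarrow> real \<Rightarrow> (real \<Rightarrow> real) set" where
  "c0_curves x t = {\<gamma> \<in> control_curves x t.
     segment \<gamma> 0 t \<and> (\<forall>s\<in>{0..t}. x * \<gamma> s \<ge> 0)}"

text \<open>The piece on the interface and the last piece have positive length. The first piece may
  degenerate (\<open>t1 = 0\<close>): the curve then sits on the interface from time 0 on. Consequently
  \<open>cr_curves 0 t\<close> is empty.\<close>

definition cr_curves :: "real \<Rightarrow> real \<Rightarrow> (real \<Rightarrow> real) set" where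
  "cr_curves x t = {\<gamma> \<in> control_curves x t.
     (\<exists>t1 t2. t1 < t2 \<and> t2 < t \<and> three_segments \<gamma> t t1 t2) \<and>
     (\<forall>s\<in>{0..t}. x * \<gamma> s \<ge> 0)}"


section \<open>Value function and characteristic curves\<close>

definition primitive :: "(real \<Rightarrow> real) \<Rightarrow> real \<Rightarrow> real" where
  "primitive u0 x = (LINT z=ereal 0..ereal x|lebesgue. u0 z)"

definition curve_cost ::
  "(real \<Rightarrow> real) \<Rightarrow> (real \<Rightarrow> real) \<Rightarrow> (real \<Rightarrow> real) \<Rightarrow> real \<Rightarrow> (real \<Rightarrow> real) \<Rightarrow> real" where
  "curve_cost f g v0 t \<gamma> =
     v0 (\<gamma> 0)
     + (LINT s:{s\<in>{0..t}. \<gamma> s > 0}|lebesgue. legendre f (deriv \<gamma> s))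
     + (LINT s:{s\<in>{0..t}. \<gamma> s < 0}|lebesgue. legendre g (deriv \<gamma> s))
     + measure lebesgue {s\<in>{0..t}. \<gamma> s = 0} * min (legendre f 0) (legendre g 0)"

definition value_fun ::
  "(real \<Rightarrow> real) \<Rightarrow> (real \<Rightarrow> real) \<Rightarrow> (real \<Rightarrow> real) \<Rightarrow> real \<Rightarrow> real \<Rightarrow> real" where
  "value_fun f g u0 x t = (INF \<gamma>\<in>control_curves x t. curve_cost f g (primitive u0) t \<gamma>)"

definition ch ::
  "(real \<Rightarrow> real) \<Rightarrow> (real \<Rightarrow> real) \<Rightarrow> (real \<Rightarrow> real) \<Rightarrow> real \<Rightarrow> real \<Rightarrow> (real \<Rightarrow> real) set" where
  "ch f g u0 x t =
     {\<gamma> \<in> control_curves x t. curve_cost f g (primitive u0) t \<gamma> = value_fun f g u0 x t}"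


section \<open>Solutions\<close>

text \<open>\<open>test_function \<Omega> \<phi> \<phi>x \<phi>t\<close>: \<open>\<phi>\<close> is continuously differentiable with partial
  derivatives \<open>\<phi>x\<close>, \<open>\<phi>t\<close> and vanishes off a compact subset of \<open>\<Omega>\<close>.\<close>

definition test_function ::
  "(real \<times> real) set \<Rightarrow> (real \<times> real \<Rightarrow> real) \<Rightarrow> (real \<times> real \<Rightarrow> real) \<Rightarrow>
   (real \<times> real \<Rightarrow> real) \<Rightarrow> bool" where
  "test_function \<Omega> \<phi> \<phi>x \<phi>t \<longleftrightarrow>
     (\<forall>z. (\<phi> has_derivative (\<lambda>h. \<phi>x z * fst h + \<phi>t z * snd h)) (at z)) \<and>
     continuous_on UNIV \<phi>x \<and> continuous_on UNIV \<phi>t \<and>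
     (\<exists>K. compact K \<and> K \<subseteq> \<Omega> \<and> (\<forall>z. z \<notin> K \<longrightarrow> \<phi> z = 0))"

definition weak_solution ::
  "(real \<Rightarrow> real) \<Rightarrow> (real \<Rightarrow> real) \<Rightarrow> (real \<Rightarrow> real) \<Rightarrow> (real \<Rightarrow> real \<Rightarrow> real) \<Rightarrow> bool" where
  "weak_solution f g u0 u \<longleftrightarrow>
     Linf (UNIV \<times> {0<..}) (\<lambda>(x, t). u x t) \<and>
     (\<forall>\<phi> \<phi>x \<phi>t. test_function UNIV \<phi> \<phi>x \<phi>t \<longrightarrow>
        (LINT z:UNIV \<times> {0<..}|lebesgue.
           u (fst z) (snd z) * \<phi>t z + flux f g (fst z) (u (fst z) (snd z)) * \<phi>x z)
        + (LINT x|lebesgue. u0 x * \<phi> (x, 0)) = 0)"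

definition kruzkov ::
  "(real \<times> real) set \<Rightarrow> (real \<Rightarrow> real) \<Rightarrow> (real \<Rightarrow> real \<Rightarrow> real) \<Rightarrow> bool" where
  "kruzkov \<Omega> h u \<longleftrightarrow>
     (\<forall>k \<phi> \<phi>x \<phi>t. test_function \<Omega> \<phi> \<phi>x \<phi>t \<and> (\<forall>z. \<phi> z \<ge> 0) \<longrightarrow>
        (LINT z:\<Omega>|lebesgue.
           \<bar>u (fst z) (snd z) - k\<bar> * \<phi>t z
           + sgn (u (fst z) (snd z) - k) * (h (u (fst z) (snd z)) - h k) * \<phi>x z) \<ge> 0)"

text \<open>Trace at the interface from the side \<open>S\<close>, insensitive to changes on null sets.\<close>

definition trace_at_0 :: "real set \<Rightarrow> (real \<Rightarrow> real) \<Rightarrow> real \<Rightarrow> bool" where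
  "trace_at_0 S w a \<longleftrightarrow> (\<exists>N. negligible N \<and> (w \<longlongrightarrow> a) (at 0 within (S - N)))"

definition interface_entropy ::
  "(real \<Rightarrow> real) \<Rightarrow> (real \<Rightarrow> real) \<Rightarrow> (real \<Rightarrow> real \<Rightarrow> real) \<Rightarrow> bool" where
  "interface_entropy f g u \<longleftrightarrow>
     (AE t in lebesgue. t > 0 \<longrightarrow>
        (\<exists>a b. trace_at_0 {0<..} (\<lambda>x. u x t) a \<and> trace_at_0 {..<0} (\<lambda>x. u x t) b \<and>
               \<not> (deriv f a > 0 \<and> deriv g b < 0)))"

text \<open>The solution with initial data \<open>u0\<close> is the space derivative of the value function (which
  determines it up to null sets), and it is an entropy solution.\<close>

definition is_solution ::
  "(real \<Rightarrow> real) \<Rightarrow> (real \<Rightarrow> real) \<Rightarrow> (real \<Rightarrow> real) \<Rightarrow> (real \<Rightarrow> real \<Rightarrow> real) \<Rightarrow> bool" where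
  "is_solution f g u0 u \<longleftrightarrow>
     (\<forall>t>0. AE x in lebesgue.
        ((\<lambda>z. value_fun f g u0 z t) has_real_derivative u x t) (at x)) \<and>
     weak_solution f g u0 u \<and>
     kruzkov ({0<..} \<times> {0<..}) f u \<and>
     kruzkov ({..<0} \<times> {0<..}) g u \<and>
     interface_entropy f g u"


section \<open>Quantities attached to the initial data\<close>

text \<open>In \<open>R1_of\<close> and \<open>L1_of\<close> the point \<open>x = 0\<close> is left out. There the sign condition
  \<open>x * \<gamma> s \<ge> 0\<close> in \<open>c0_curves\<close> is void, so that with \<open>x = 0\<close> admitted the infimum would
  collapse to 0 as soon as the characteristics through \<open>(0, t)\<close> are straight lines arriving
  from the left, even if characteristics cross the interface before time \<open>t\<close>. In all other
  cases the infimum is the same, because characteristics do not cross.\<close>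

definition R1_of :: "(real \<Rightarrow> real) \<Rightarrow> (real \<Rightarrow> real) \<Rightarrow> (real \<Rightarrow> real) \<Rightarrow> real \<Rightarrow> real" where
  "R1_of f g u0 t = Inf {x. 0 < x \<and> ch f g u0 x t \<subseteq> c0_curves x t}"

definition L1_of :: "(real \<Rightarrow> real) \<Rightarrow> (real \<Rightarrow> real) \<Rightarrow> (real \<Rightarrow> real) \<Rightarrow> real \<Rightarrow> real" where
  "L1_of f g u0 t = Sup {x. x < 0 \<and> ch f g u0 x t \<subseteq> c0_curves x t}"

definition R2_of :: "(real \<Rightarrow> real) \<Rightarrow> (real \<Rightarrow> real) \<Rightarrow> (real \<Rightarrow> real) \<Rightarrow> real \<Rightarrow> real" where
  "R2_of f g u0 t =
     (let X = {x. 0 \<le> x \<and> x \<le> R1_of f g u0 t \<and> ch f g u0 x t \<inter> cr_curves x t \<noteq> {}}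
      in if X = {} then R1_of f g u0 t else Inf X)"

definition t_plus ::
  "(real \<Rightarrow> real) \<Rightarrow> (real \<Rightarrow> real) \<Rightarrow> (real \<Rightarrow> real) \<Rightarrow> real \<Rightarrow> real \<Rightarrow> real" where
  "t_plus f g u0 x t =
     Inf {t1. 0 \<le> t1 \<and> t1 \<le> t \<and>
            (\<exists>\<gamma>\<in>ch f g u0 x t. \<gamma> t1 = 0 \<and> (\<forall>s\<in>{t1<..<t}. \<gamma> s > 0))}"

definition y_minus0 :: "(real \<Rightarrow> real) \<Rightarrow> (real \<Rightarrow> real) \<Rightarrow> (real \<Rightarrow> real) \<Rightarrow> real \<Rightarrow> real" where
  "y_minus0 f g u0 s = Inf ((\<lambda>\<gamma>. \<gamma> 0) ` ch f g u0 0 s)"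

text \<open>The last case is meant for \<open>0 \<le> x < R2_of f g u0 t\<close>. At \<open>x = 0\<close> one has
  \<open>t_plus f g u0 0 t = t\<close>, so the value is the infimum of \<open>\<gamma> 0\<close> over \<open>ch f g u0 0 t\<close>, as in
  the first case.\<close>

definition y_of ::
  "(real \<Rightarrow> real) \<Rightarrow> (real \<Rightarrow> real) \<Rightarrow> (real \<Rightarrow> real) \<Rightarrow> real \<Rightarrow> real \<Rightarrow> real" where
  "y_of f g u0 t x =
     (if x < L1_of f g u0 t \<or> R1_of f g u0 t < x then Inf ((\<lambda>\<gamma>. \<gamma> 0) ` ch f g u0 x t)
      else y_minus0 f g u0 (t_plus f g u0 x t))"


section \<open>Reachable set\<close>

text \<open>\<open>shock_pair f g T T1 \<tau>0 \<xi>0\<close>: \<open>(\<tau>0, \<xi>0)\<close> is the pair attached to \<open>T1\<close> and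
  \<open>R1 = f' (\<theta>bar f g) * (T - T1)\<close>.\<close>

definition shock_pair ::
  "(real \<Rightarrow> real) \<Rightarrow> (real \<Rightarrow> real) \<Rightarrow> real \<Rightarrow> real \<Rightarrow> real \<Rightarrow> real \<Rightarrow> bool" where
  "shock_pair f g T T1 \<tau>0 \<xi>0 \<longleftrightarrow>
     (let R1 = deriv f (\<theta>bar f g) * (T - T1);
          m = deriv f (\<theta>barbar f g)
      in if R1 = 0 then \<tau>0 = T \<and> \<xi>0 = - m * T
         else if T1 = 0 then \<tau>0 = 0 \<and> \<xi>0 = 0
         else 0 \<le> \<xi>0 \<and> \<xi>0 \<le> - m * T1 \<and> \<xi>0 = - m * \<tau>0 \<and> 0 \<le> \<tau>0 \<and> \<tau>0 \<le> T \<and>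
           (\<exists>s. (\<exists>L. L-lipschitz_on {\<tau>0..T} s) \<and> mono_on {\<tau>0..T} s \<and>
                convex_on {\<tau>0..T} s \<and> (\<forall>t\<in>{\<tau>0..T}. s t \<ge> 0) \<and>
                s T = R1 \<and> s \<tau>0 = 0 \<and>
                (\<forall>t\<in>{\<tau>0<..<T}.
                   let w = inv (deriv f) ((s t - \<xi>0) / t)
                   in (s has_real_derivative
                         (f (\<theta>bar f g) - f w) / (\<theta>bar f g - w)) (at t))))"

text \<open>\<open>axis_time f g T R1 T1\<close>: the line \<open>\<gamma>0\<close> meets the t-axis at \<open>(0, T1)\<close> with \<open>T1 \<ge> 0\<close>,
  that is, \<open>T1 = T(R1) \<ge> 0\<close>. If \<open>f' (\<theta>bar f g) = 0 < R1\<close> the line does not meet the axis and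
  no \<open>T1\<close> qualifies. The bound \<open>T1 \<le> T\<close> follows from \<open>R1 \<ge> 0\<close> unless
  \<open>f' (\<theta>bar f g) = 0 = R1\<close>.\<close>

definition axis_time ::
  "(real \<Rightarrow> real) \<Rightarrow> (real \<Rightarrow> real) \<Rightarrow> real \<Rightarrow> real \<Rightarrow> real \<Rightarrow> bool" where
  "axis_time f g T R1 T1 \<longleftrightarrow>
     0 \<le> T1 \<and> T1 \<le> T \<and> R1 + deriv f (\<theta>bar f g) * (T1 - T) = 0"

text \<open>The values of \<open>y\<close> on \<open>{R2..R1}\<close> are irrelevant.\<close>

definition reachable ::
  "(real \<Rightarrow> real) \<Rightarrow> (real \<Rightarrow> real) \<Rightarrow> real \<Rightarrow> (real \<times> real \<times> real \<times> (real \<Rightarrow> real)) set" where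
  "reachable f g T = {(T', R1, R2, y).
     T' = T \<and> 0 \<le> R2 \<and> R2 \<le> R1 \<and>
     mono_on ({..<R2} \<union> {R1<..}) y \<and>
     (\<forall>x<R2. y x \<le> 0) \<and> (\<forall>x>R1. y x \<ge> 0) \<and>
     bdd_above ((\<lambda>x. \<bar>x - y x\<bar>) ` ({..<R2} \<union> {R1<..})) \<and>
     (\<forall>T1 \<tau>0 \<xi>0. axis_time f g T R1 T1 \<and> shock_pair f g T T1 \<tau>0 \<xi>0 \<longrightarrow>
        \<xi>0 \<le> Lim (at_right R1) y) \<and>
     (R2 < R1 \<longrightarrow> (\<exists>T1. axis_time f g T R1 T1))}"

end

theory Submission
 imports Defs
begin


text \<open>The solution is the slope of a value function, and everything is read off from minimising curves.

Since both Legendre transforms are convex, straightening a curve on either side of the interface does not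
raise its cost. Up to cost only two kinds of paths from \<open>z\<close> to \<open>x\<close> compete: a straight line on one side,
and a path that runs to the interface, rests there at the cheaper rate \<open>- g (\<theta> g)\<close>, and leaves it
(\<open>pc_reduce\<close>). Hence minimisers exist, they are straight away from the interface, and two of them cannot
cross off it (\<open>no_cross\<close>).

The slope of the value function solves the conservation law (\<open>solution_exists\<close>). Away from the interface
the value function evolves by the Hopf-Lax formula, which gives the weak form, and the Kruzkov inequalities
because Hopf-Lax steps preserve the ordering of slopes. At the interface the one-sided slopes have limits at every positive time.
If at one time the limits had \<open>f' > 0\<close> on the right and \<open>g' < 0\<close> on the left, minimisers would cross
the interface in both directions in a way that makes two of them cross on one side; so the interface condition
holds at every time (\<open>crossR_crossL\<close>, \<open>sol_interface\<close>).

To reach a prescribed state, let \<open>act T z x\<close> be the least cost of a path from \<open>z\<close> to \<open>x\<close>. Paths with end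
points in opposite order meet and can exchange their tails, so \<open>act T\<close> has the Monge property (\<open>act_monge\<close>).
Therefore a nondecreasing assignment \<open>x \<mapsto> Y x\<close> is cyclically monotone, and there is a potential \<open>w\<close> for which \<open>Y x\<close>
minimises \<open>w z + act T z x\<close> (\<open>monotone_potential\<close>). Making \<open>w\<close> steep near \<open>B1\<close> and \<open>B2\<close> keeps every start
point outside from competing, whatever bounded data are prescribed there; the derivative of \<open>w\<close> is the
datum (\<open>initial_datum\<close>). It is applied with \<open>Y = y\<close>, set to \<open>0\<close> between \<open>R2\<close> and \<open>R1\<close>.

It remains to recover \<open>R1\<close>, \<open>R2\<close> and \<open>y\<close> from the start points \<open>Y x\<close>. The curve \<open>s\<close> that defines
the pair \<open>(\<tau>0, \<xi>0)\<close> consists of the points where the straight line from \<open>\<xi>0\<close> costs as much as the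
path that rests on the interface. The condition \<open>\<xi>0 \<le> y (R1+)\<close> thus makes straight lines optimal to the
right of \<open>R1\<close> (\<open>straight_right\<close>), while between \<open>R2\<close> and \<open>R1\<close> a resting curve is optimal by a
calibration (\<open>rest_opt\<close>), and for \<open>0 < x < R2\<close> minimisers cross from the left.\<close>

section \<open>Convex fluxes and their Legendre transforms\<close>

locale conv_flux =
 fixes f :: "real => real"
 assumes convex_flux: "convex_flux f"
begin

abbreviation L where "L \<equiv> legendre f"

text \<open>By superlinear growth \<open>deriv f\<close> is a bijection; its inverse is the derivative of the Legendre transform,
that is, the map from speeds to states.\<close>

definition dL where "dL = inv (deriv f)"

lemma DERIV_flux: "(f has_real_derivative deriv f x) (at x)"
proof -
 obtain D where "\<And>x. (f has_vector_derivative D x) (at x)"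
  using convex_flux unfolding convex_flux_def C1_differentiable_on_def by auto
 hence "(f has_real_derivative D x) (at x)"
  by (simp add: has_real_derivative_iff_has_vector_derivative)
 thus ?thesis using DERIV_imp_deriv by metis
qed

lemma continuous_deriv: "continuous_on A (deriv f)"
proof -
 obtain D where D: "\<And>x. (f has_vector_derivative D x) (at x)" "continuous_on UNIV D"
  using convex_flux unfolding convex_flux_def C1_differentiable_on_def by auto
 hence "(f has_real_derivative D x) (at x)" for x
  by (simp add: has_real_derivative_iff_has_vector_derivative)
 hence "deriv f = D" using DERIV_imp_deriv by blast
 thus ?thesis using D(2) continuous_on_subset by blast
qed

lemma continuous_flux: "continuous_on A f"
 using DERIV_flux DERIV_isCont continuous_at_imp_continuous_on by blast

lemma strict_conv: "p \<noteq> q ==> 0 < \<alpha> ==> \<alpha> < 1 ==>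
  f (\<alpha> * p + (1 - \<alpha>) * q) < \<alpha> * f p + (1 - \<alpha>) * f q"
 using convex_flux unfolding convex_flux_def strictly_convex_def by blast

lemma tangent: "f p + deriv f p * (q - p) \<le> f q"
proof -
 have "convex_on UNIV f"
  by (rule convex_on_linorderI)
   (use strict_conv[of _ _ "1 - _"] in \<open>auto simp: less_imp_le\<close>)
 moreover have "(f has_real_derivative deriv f p) (at p within UNIV)"
  using DERIV_flux by simp
 ultimately show ?thesis
  using convex_on_imp_above_tangent[of UNIV f p q "deriv f p"] by (simp add: algebra_simps)
qed

lemma tangent_strict: assumes "q \<noteq> p" shows "f p + deriv f p * (q - p) < f q"
proof -
 have "f (1/2 * p + (1 - 1/2) * q) < 1/2 * f p + (1 - 1/2) * f q"
  using assms by (intro strict_conv) auto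
 moreover have "f p + deriv f p * ((1/2 * p + (1 - 1/2) * q) - p) \<le> f (1/2 * p + (1 - 1/2) * q)"
  by (rule tangent)
 ultimately show ?thesis by (simp add: algebra_simps)
qed

lemma deriv_strict_mono: "strict_mono (deriv f)"
proof (rule strict_monoI)
 fix p q :: real assume "p < q"
 hence "f p + deriv f p * (q - p) < f q" "f q + deriv f q * (p - q) < f p"
  using tangent_strict by auto
 hence "0 < (deriv f q - deriv f p) * (q - p)" by (simp add: algebra_simps)
 thus "deriv f p < deriv f q" using \<open>p < q\<close> by (simp add: zero_less_mult_iff)
qed

lemma superlinear: "\<exists>R>0. \<forall>p. \<bar>p\<bar> \<ge> R --> cc * \<bar>p\<bar> \<le> f p"
proof -
 have "eventually (%p. cc \<le> f p / \<bar>p\<bar>) at_infinity"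
  using convex_flux unfolding convex_flux_def filterlim_at_top by blast
 then obtain b where b: "\<And>p. b \<le> norm p ==> cc \<le> f p / \<bar>p\<bar>"
  unfolding eventually_at_infinity by blast
 have "cc * \<bar>p\<bar> \<le> f p" if "\<bar>p\<bar> \<ge> max b 1" for p
 proof -
  have "cc \<le> f p / \<bar>p\<bar>" "\<bar>p\<bar> > 0" using b[of p] that by auto
  thus ?thesis by (simp add: pos_le_divide_eq)
 qed
 thus ?thesis by (intro exI[of _ "max b 1"]) auto
qed

lemma deriv_surj: "surj (deriv f)"
proof -
 have "\<exists>p. deriv f p = y" for y
 proof -
  obtain R where R: "R > 0" "\<And>p. \<bar>p\<bar> \<ge> R ==> (\<bar>y\<bar> + \<bar>f 0\<bar>) * \<bar>p\<bar> \<le> f p"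
   using superlinear by blast
  define p where "p = max R 1"
  have p: "p \<ge> 1" "p \<ge> R" by (auto simp: p_def)
  have ex: "\<bar>f 0\<bar> \<le> \<bar>f 0\<bar> * p" using p(1) by (simp add: mult_le_cancel_left1)
  have a: "(\<bar>y\<bar> + \<bar>f 0\<bar>) * p \<le> f p" "(\<bar>y\<bar> + \<bar>f 0\<bar>) * p \<le> f (-p)"
   using R(2)[of p] R(2)[of "-p"] p by auto
  have "\<bar>y\<bar> * p \<le> deriv f p * p"
   using tangent[of p 0] a(1) ex by (simp add: algebra_simps)
  moreover have "\<bar>y\<bar> * p \<le> - deriv f (-p) * p"
   using tangent[of "-p" 0] a(2) ex by (simp add: algebra_simps)
  ultimately have "\<bar>y\<bar> \<le> deriv f p" "\<bar>y\<bar> \<le> - deriv f (-p)"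
   using p(1) by (metis mult_le_cancel_right_pos less_le_trans zero_less_one)+
  thus ?thesis
   using IVT'[of "deriv f" "-p" y p] p(1) continuous_deriv by force
 qed
 thus ?thesis by (metis surjI)
qed

lemma deriv_inj: "inj (deriv f)"
 using deriv_strict_mono strict_mono_imp_inj_on by blast

lemma deriv_dL [simp]: "deriv f (dL p) = p"
 unfolding dL_def using deriv_surj by (simp add: surj_f_inv_f)

lemma dL_deriv [simp]: "dL (deriv f p) = p"
 unfolding dL_def using deriv_inj by (simp add: inv_f_f)

lemma dL_strict_mono: "strict_mono dL"
 by (metis deriv_dL deriv_strict_mono strict_monoI strict_mono_less)

lemma dL_less_iff [simp]: "dL p < dL q \<longleftrightarrow> p < q"
 using dL_strict_mono strict_mono_less by blast

lemma dL_le_iff [simp]: "dL p \<le> dL q \<longleftrightarrow> p \<le> q"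
 using dL_strict_mono strict_mono_less_eq by blast

lemma dL_eq_iff [simp]: "dL p = dL q \<longleftrightarrow> p = q"
 using dL_strict_mono strict_mono_eq by blast

lemma continuous_dL: "continuous_on A dL"
proof -
 have "range dL = UNIV" by (metis dL_deriv surjI)
 hence "continuous_on UNIV dL"
  by (intro continuous_onI_mono) auto
 thus ?thesis using continuous_on_subset by blast
qed

lemma isCont_dL: "isCont dL p"
 using continuous_dL[of UNIV] by (simp add: continuous_on_eq_continuous_at)

text \<open>The tangent to \<open>f\<close> at \<open>dL p\<close> has slope \<open>p\<close>, so the supremum that defines \<open>L p\<close> is attained there.\<close>

lemma Young_aux: "p * q - f q \<le> p * dL p - f (dL p)"
 using tangent[of "dL p" q] by (simp add: algebra_simps)

lemma L_eq: "L p = p * dL p - f (dL p)"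
 unfolding legendre_def
 by (rule cSup_eq_maximum) (auto intro: Young_aux)

lemma Young: "p * q - f q \<le> L p"
 using Young_aux L_eq by simp

lemma Young_strict: "q \<noteq> dL p ==> p * q - f q < L p"
 using tangent_strict[of q "dL p"] L_eq[of p] by (simp add: algebra_simps)

lemma f_dL: "f (dL p) = p * dL p - L p"
 using L_eq by simp

lemma L_tangent: "L p + dL p * (q - p) \<le> L q"
 using Young[of q "dL p"] L_eq[of p] by (simp add: algebra_simps)

lemma L_tangent_strict: "q \<noteq> p ==> L p + dL p * (q - p) < L q"
 using Young_strict[of "dL p" q] L_eq[of p] by (simp add: algebra_simps)

text \<open>The tangents at \<open>p\<close> and at \<open>q\<close> enclose the difference quotient of \<open>L\<close> between \<open>dL p\<close> and \<open>dL q\<close>.\<close>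

lemma DERIV_L: "(L has_real_derivative dL p) (at p)"
proof -
 have b: "\<bar>(L q - L p) / (q - p) - dL p\<bar> \<le> \<bar>dL q - dL p\<bar>" if "q \<noteq> p" for q
 proof -
  have 1: "L q - L p \<ge> dL p * (q - p)" "L q - L p \<le> dL q * (q - p)"
   using L_tangent[of p q] L_tangent[of q p] by (auto simp: algebra_simps)
  show ?thesis
  proof (cases "p < q")
   case True
   hence "dL p \<le> (L q - L p) / (q - p)" "(L q - L p) / (q - p) \<le> dL q"
    using 1 by (auto simp: field_simps)
   thus ?thesis by linarith
  next
   case False
   hence "q < p" using that by auto
   hence "(L q - L p) / (q - p) \<le> dL p" "dL q \<le> (L q - L p) / (q - p)"
    using 1 by (auto simp: neg_divide_le_eq neg_le_divide_eq)
   thus ?thesis by linarith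
  qed
 qed
 have "((%q. \<bar>dL q - dL p\<bar>) \<longlongrightarrow> 0) (at p)"
  using isCont_dL[of p] by (metis LIM_zero isCont_def tendsto_rabs_zero_iff)
 hence "((%q. (L q - L p) / (q - p) - dL p) \<longlongrightarrow> 0) (at p)"
  by (rule Lim_null_comparison[rotated]) (use b in \<open>auto simp: eventually_at_filter\<close>)
 thus ?thesis
  unfolding has_field_derivative_iff using LIM_zero_iff by blast
qed

lemma continuous_L: "continuous_on A L"
 using DERIV_L DERIV_isCont continuous_at_imp_continuous_on by blast

lemma L_superlinear: "L p \<ge> cc * \<bar>p\<bar> - max (f cc) (f (-cc))"
 using Young[of p cc] Young[of p "-cc"] by (cases "p \<ge> 0") (auto simp: algebra_simps)

lemma deriv_theta: "deriv f (\<theta> f) = 0"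
proof -
 have "is_arg_min f (%_. True) (dL 0)"
  using Young_aux[of 0] by (auto simp: is_arg_min_linorder)
 hence "is_arg_min f (%_. True) (\<theta> f)"
  unfolding \<theta>_def arg_min_def by (metis someI)
 hence m: "f (\<theta> f) \<le> f q" for q by (auto simp: is_arg_min_linorder)
 show ?thesis
  by (rule DERIV_local_min[OF DERIV_flux, of 1]) (use m in auto)
qed

lemma dL_0: "dL 0 = \<theta> f"
 using deriv_theta dL_deriv by metis

lemma L_0: "L 0 = - f (\<theta> f)"
 using L_eq[of 0] dL_0 by simp

text \<open>The cost \<open>dd * L (x / dd)\<close> of covering the distance \<open>x\<close> in time \<open>dd\<close> is the supremum of the
 linear functions \<open>a * x - dd * f a\<close>. All comparisons of piecewise affine paths with straight ones
 come from this representation: linear functions add up along a path.\<close>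

lemma persp_ge: "dd \<ge> 0 ==> dd = 0 --> x = 0 ==> a * x - dd * f a \<le> dd * L (x / dd)"
 using mult_left_mono[OF Young[of "x/dd" a], of dd] by (cases "dd = 0") (auto simp: algebra_simps)

lemma persp_eq: "dd > 0 ==> dd * L (x / dd) = dL (x / dd) * x - dd * f (dL (x / dd))"
 using L_eq[of "x/dd"] by (simp add: field_simps)

lemma persp_gt: "dd > 0 ==> a \<noteq> dL (x / dd) ==> a * x - dd * f a < dd * L (x / dd)"
 using mult_strict_left_mono[OF Young_strict[of a "x/dd"], of dd] by (auto simp: algebra_simps)

lemma persp_merge:
 assumes "dd1 \<ge> 0" "dd2 \<ge> 0" "dd1 = 0 --> x1 = 0" "dd2 = 0 --> x2 = 0"
 shows "(dd1 + dd2) * L ((x1 + x2) / (dd1 + dd2)) \<le> dd1 * L (x1 / dd1) + dd2 * L (x2 / dd2)"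
proof (cases "dd1 + dd2 = 0")
 case False
 hence "dd1 + dd2 > 0" using assms by auto
 thus ?thesis
  using persp_eq[of "dd1+dd2" "x1+x2"]
   persp_ge[of dd1 x1 "dL ((x1 + x2) / (dd1 + dd2))"] persp_ge[of dd2 x2 "dL ((x1 + x2) / (dd1 + dd2))"] assms
  by (simp add: algebra_simps)
qed (use assms in \<open>auto simp: add_nonneg_eq_0_iff\<close>)

lemma persp_merge_strict:
 assumes "dd1 > 0" "dd2 > 0" "x1 / dd1 \<noteq> x2 / dd2"
 shows "(dd1 + dd2) * L ((x1 + x2) / (dd1 + dd2)) < dd1 * L (x1 / dd1) + dd2 * L (x2 / dd2)"
proof -
 have ne: "(x1 + x2) / (dd1 + dd2) \<noteq> x1 / dd1"
  using assms by (auto simp: field_simps)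
 have "dd1 + dd2 > 0" using assms by auto
 thus ?thesis
  using persp_eq[of "dd1+dd2" "x1+x2"] ne
   persp_gt[of dd1 "dL ((x1 + x2) / (dd1 + dd2))" x1] persp_ge[of dd2 x2 "dL ((x1 + x2) / (dd1 + dd2))"] assms
  by (simp add: algebra_simps)
qed

end


section \<open>Piecewise affine paths and their cost\<close>

text \<open>An affine function on \<open>{r..s}\<close>, given by its end values: this form needs no witnesses, and division by
zero makes it true on a single point.\<close>

definition affon :: "(real => real) => real => real => bool" where
 "affon c r s \<longleftrightarrow> (\<forall>u\<in>{r..s}. c u = c r + (c s - c r) / (s - r) * (u - r))"

definition same_side :: "real => real => bool" where
 "same_side a b \<longleftrightarrow> 0 \<le> a \<and> 0 \<le> b \<or> a \<le> 0 \<and> b \<le> 0"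

lemma affonI:
 assumes "\<And>u. u \<in> {r..s} ==> c u = k + m * u"
 shows "affon c r s"
proof (cases "r < s")
 case True
 hence "c r = k + m * r" "c s = k + m * s" using assms by auto
 hence m: "(c s - c r) / (s - r) = m" using True by (simp add: field_simps)
 have "c u = c r + m * (u - r)" if "u \<in> {r..s}" for u
  unfolding assms[OF that] \<open>c r = _\<close> by (simp add: algebra_simps)
 thus ?thesis unfolding affon_def m by blast
next
 case False
 have "c u = c r + (c s - c r) / (s - r) * (u - r)" if "u \<in> {r..s}" for u
 proof -
  have "u = r" using that False by simp
  thus ?thesis by simp
 qed
 thus ?thesis unfolding affon_def by blast
qed

lemma affonD:
 assumes "affon c r s"
 shows "\<exists>k m. (\<forall>u\<in>{r..s}. c u = k + m * u) \<and> (r < s --> m = (c s - c r) / (s - r))"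
proof (intro exI conjI ballI)
 show "c u = (c r - (c s - c r) / (s - r) * r) + (c s - c r) / (s - r) * u" if "u \<in> {r..s}" for u
 proof -
  have "c u = c r + (c s - c r) / (s - r) * (u - r)" using assms that unfolding affon_def by blast
  thus ?thesis by (simp only: right_diff_distrib)
 qed
qed auto

lemma affon_sub: "affon c r s ==> r \<le> r' ==> s' \<le> s ==> affon c r' s'"
proof -
 assume "affon c r s" "r \<le> r'" "s' \<le> s"
 from affonD[OF this(1)] obtain k m where "\<forall>u\<in>{r..s}. c u = k + m * u" by (elim exE conjE)
 thus ?thesis using \<open>r \<le> r'\<close> \<open>s' \<le> s\<close> by (intro affonI[of r' s' c k m]) auto
qed

lemma affon_slope:
 assumes "affon c r s" "r \<le> u" "u < v" "v \<le> s"
 shows "(c v - c u) / (v - u) = (c s - c r) / (s - r)"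
proof -
 from affonD[OF assms(1)] obtain k m where *: "\<forall>u\<in>{r..s}. c u = k + m * u" "r < s --> m = (c s - c r) / (s - r)"
  by (elim exE conjE)
 have "v \<in> {r..s}" "u \<in> {r..s}" "r < s" using assms(2-4) by auto
 hence "c v = k + m * v" "c u = k + m * u" and m: "m = (c s - c r) / (s - r)" using * by blast+
 hence "c v - c u = m * (v - u)" unfolding right_diff_distrib by linarith
 hence "(c v - c u) / (v - u) = m" using assms(3) by simp
 thus ?thesis using m by (simp only:)
qed

lemma affon_cong: "affon c r s ==> (\<And>u. u \<in> {r..s} ==> d u = c u) ==> affon d r s"
proof -
 assume "affon c r s" and eq: "\<And>u. u \<in> {r..s} ==> d u = c u"
 from affonD[OF this(1)] obtain k m where "\<forall>u\<in>{r..s}. c u = k + m * u" by (elim exE conjE)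
 thus ?thesis using eq by (intro affonI[of r s d k m]) auto
qed

lemma affon_cont: "affon c r s ==> continuous_on {r..s} c"
proof -
 assume "affon c r s"
 from affonD[OF this] obtain k m where *: "\<forall>u\<in>{r..s}. c u = k + m * u" by (elim exE conjE)
 have "continuous_on {r..s} (%u. k + m * u)" by (intro continuous_intros)
 thus ?thesis by (rule continuous_on_eq) (simp add: *)
qed

lemma affon_join:
 assumes "affon c r s" "affon c s t" "r < s" "s < t"
  "(c s - c r) / (s - r) = (c t - c s) / (t - s)"
 shows "affon c r t"
proof -
 from affonD[OF assms(1)] obtain k m where 1: "\<forall>u\<in>{r..s}. c u = k + m * u"
  "r < s --> m = (c s - c r) / (s - r)" by (elim exE conjE)
 from affonD[OF assms(2)] obtain k' m' where 2: "\<forall>u\<in>{s..t}. c u = k' + m' * u"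
  "s < t --> m' = (c t - c s) / (t - s)" by (elim exE conjE)
 have "m = m'" using 1(2) 2(2) assms(3-5) by metis
 have "c s = k + m * s" using 1(1) assms(3) by simp
 moreover have "c s = k' + m' * s" using 2(1) assms(4) by simp
 ultimately have "k = k'" using \<open>m = m'\<close> by simp
 show ?thesis
 proof (rule affonI)
  show "c u = k + m * u" if "u \<in> {r..t}" for u
   using that 1(1) 2(1) \<open>m = m'\<close> \<open>k = k'\<close> by (cases "u \<le> s") auto
 qed
qed

locale two_flux = F: conv_flux f + G: conv_flux g for f g :: "real => real" +
 assumes theta_le: "f (\<theta> f) \<le> g (\<theta> g)"
begin

text \<open>Cost of an affine piece. A piece that stays at \<open>0\<close> is charged \<open>g\<close>, whose rate \<open>K0 = - g (\<theta> g)\<close> is the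
smaller of the two resting rates.\<close>

definition seg :: "real => real => real => real" where
 "seg dd a b = (if a \<le> 0 \<and> b \<le> 0 then dd * G.L ((b - a) / dd) else dd * F.L ((b - a) / dd))"

abbreviation "K0 \<equiv> G.L 0"

lemma K0_le: "K0 \<le> F.L 0"
 using theta_le F.L_0 G.L_0 by simp

lemma seg_zero [simp]: "seg dd 0 0 = dd * K0" "seg 0 a b = 0"
 by (auto simp: seg_def)

text \<open>\<open>pc c a b cc\<close>: on \<open>{a..b}\<close> the path has finitely many affine pieces, none of which changes side, and \<open>cc\<close> is
its cost. Unlike control curves, these paths can be cut and glued freely.\<close>

inductive pc :: "(real => real) => real => real => real => bool" for c where
 pc_refl: "pc c a a 0"
| pc_step: "pc c a b cc ==> b < b' ==> affon c b b' ==> same_side (c b) (c b')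
  ==> pc c a b' (cc + seg (b' - b) (c b) (c b'))"

lemma pc_le: "pc c a b cc ==> a \<le> b"
 by (induction rule: pc.induct) auto

lemma pc_self: "pc c a a cc ==> cc = 0"
proof (erule pc.cases)
 fix c' a' b cc' b' assume "a = a'" "a = b'" "pc c a' b cc'" "b < b'"
 hence False using pc_le by fastforce
 thus "cc = 0" ..
qed simp

lemma pc_cong: "pc c a b cc ==> (\<And>s. s \<in> {a..b} ==> d s = c s) ==> pc d a b cc"
proof (induction rule: pc.induct)
 case (pc_step a b cc b')
 have ab: "a \<le> b" using pc_le pc_step by blast
 have "pc d a b cc" by (rule pc_step.IH) (rule pc_step.prems, use pc_step.hyps(2) in auto)
 moreover have "affon d b b'"
  by (rule affon_cong[OF pc_step.hyps(3)]) (rule pc_step.prems, use ab in auto)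
 moreover have "d b = c b" "d b' = c b'" by (rule pc_step.prems, use ab pc_step.hyps(2) in auto)+
 ultimately show ?case using pc.pc_step[of d a b cc b'] pc_step.hyps(2,4) by simp
qed (auto intro: pc.intros)

lemma pc_append: "pc c b dd cc2 ==> pc c a b cc1 ==> pc c a dd (cc1 + cc2)"
 by (induction rule: pc.induct) (auto simp: add.assoc[symmetric] intro: pc.intros)

lemma pc_glue:
 assumes "pc c a s cc1" "pc d s b cc2" "c s = d s"
 shows "pc (%r. if r \<le> s then c r else d r) a b (cc1 + cc2)"
proof (rule pc_append)
 show "pc (%r. if r \<le> s then c r else d r) s b cc2"
  by (rule pc_cong[OF assms(2)]) (use assms(3) in auto)
 show "pc (%r. if r \<le> s then c r else d r) a s cc1"
  by (rule pc_cong[OF assms(1)]) auto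
qed

lemma pc_affon: "a < b ==> affon c a b ==> same_side (c a) (c b) ==> pc c a b (seg (b - a) (c a) (c b))"
 using pc_step[OF pc_refl, of a b c] by simp

definition line :: "real => real => real => real => real => real" where
 "line a b z x s = z + (x - z) / (b - a) * (s - a)"

lemma line_simps [simp]: "line a b z x a = z" "a \<noteq> b ==> line a b z x b = x"
 by (auto simp: line_def)

lemma affon_line: "affon (line a b z x) r s"
 by (rule affonI[of _ _ _ "z - (x - z) / (b - a) * a" "(x - z) / (b - a)"])
  (simp add: line_def right_diff_distrib)

lemma pc_line: "a < b ==> same_side z x ==> pc (line a b z x) a b (seg (b - a) z x)"
 using pc_affon[of a b "line a b z x"] affon_line by simp

lemma seg_split:
 assumes "affon c b b'" "same_side (c b) (c b')" "b < s" "s < b'"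
 shows "seg (b' - b) (c b) (c b') = seg (s - b) (c b) (c s) + seg (b' - s) (c s) (c b')"
  and "same_side (c b) (c s)" "same_side (c s) (c b')"
proof -
 define mu where "mu = (s - b) / (b' - b)"
 have mu: "0 < mu" "mu < 1" using assms by (auto simp: mu_def)
 have gs: "c s = (1 - mu) * c b + mu * c b'"
 proof -
  have "s \<in> {b..b'}" using assms by simp
  hence "c s = c b + (c b' - c b) / (b' - b) * (s - b)"
   using assms(1) unfolding affon_def by blast
  moreover have "(c b' - c b) / (b' - b) * (s - b) = mu * (c b' - c b)" by (simp add: mu_def)
  ultimately show ?thesis by (simp add: algebra_simps)
 qed
 have s1: "(c s - c b) / (s - b) = (c b' - c b) / (b' - b)"
  and s2: "(c b' - c s) / (b' - s) = (c b' - c b) / (b' - b)"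
  using affon_slope[OF assms(1), of b s] affon_slope[OF assms(1), of s b'] assms(3,4) by linarith+
 have nonneg: "0 \<le> c b ==> 0 \<le> c b' ==> 0 \<le> c s" using gs mu by simp
 have nonpos: "c b \<le> 0 ==> c b' \<le> 0 ==> c s \<le> 0"
  using gs mu by (simp add: add_nonpos_nonpos mult_nonneg_nonpos)
 show ss: "same_side (c b) (c s)" "same_side (c s) (c b')"
  using assms(2) nonneg nonpos unfolding same_side_def by auto
 show "seg (b' - b) (c b) (c b') = seg (s - b) (c b) (c s) + seg (b' - s) (c s) (c b')"
 proof (cases "c b \<le> 0 \<and> c b' \<le> 0")
  case True
  thus ?thesis using nonpos unfolding seg_def s1 s2 by (simp add: algebra_simps)
 next
  case False
  hence "0 \<le> c b" "0 \<le> c b'" "c b > 0 \<or> c b' > 0" using assms(2) unfolding same_side_def by auto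
  hence "c s > 0" using gs mu by (auto simp: add_pos_nonneg add_nonneg_pos)
  thus ?thesis unfolding seg_def s1 s2 using False by (auto simp: algebra_simps)
 qed
qed

text \<open>Cutting inside a piece is harmless, as both parts have the slope of the whole.\<close>

lemma pc_split:
 "pc c a b cc ==> a \<le> s ==> s \<le> b ==> \<exists>cc1 cc2. pc c a s cc1 \<and> pc c s b cc2 \<and> cc = cc1 + cc2"
proof (induction rule: pc.induct)
 case (pc_refl a)
 hence "s = a" by simp
 thus ?case using pc.pc_refl[of c a] by (metis add_0_right)
next
 case (pc_step a b cc b')
 consider "s \<le> b" | "b < s" "s < b'" | "s = b'" using pc_step by linarith
 thus ?case
 proof cases
  case 1
  then obtain cc1 cc2 where *: "pc c a s cc1" "pc c s b cc2" "cc = cc1 + cc2"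
   using pc_step.IH[OF pc_step.prems(1)] by auto
  have "pc c s b' (cc2 + seg (b' - b) (c b) (c b'))"
   by (rule pc.pc_step[OF *(2) pc_step.hyps(2-4)])
  thus ?thesis using *(1,3) by (metis add.assoc)
 next
  case 2
  note sp = seg_split[OF pc_step.hyps(3,4) 2]
  have "pc c a s (cc + seg (s - b) (c b) (c s))"
   by (rule pc.pc_step[OF pc_step.hyps(1) 2(1) affon_sub[OF pc_step.hyps(3)] sp(2)]) (use 2 in auto)
  moreover have "pc c s b' (seg (b' - s) (c s) (c b'))"
   by (rule pc_affon[OF 2(2) affon_sub[OF pc_step.hyps(3)] sp(3)]) (use 2 in auto)
  ultimately show ?thesis using sp(1) by (metis add.assoc)
 next
  case 3
  have "pc c b' b' 0" by (rule pc.pc_refl)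
  thus ?thesis using pc.pc_step[OF pc_step.hyps(1-4)] 3 by (metis add_0_right)
 qed
qed

lemma pc_cont: "pc c a b cc ==> continuous_on {a..b} c"
proof (induction rule: pc.induct)
 case (pc_step a b cc b')
 have "a \<le> b" using pc_le pc_step by blast
 hence "{a..b'} = {a..b} \<union> {b..b'}" using pc_step by auto
 thus ?case
  using continuous_on_closed_Un[OF _ _ pc_step.IH affon_cont[OF pc_step.hyps(3)]] by simp
qed auto

subsection \<open>Straightening\<close>

text \<open>A path all of whose pieces are charged with the same Legendre transform costs at least as
 much as the straight path, and strictly more unless it is straight.\<close>

lemma pc_jensen_aux:
 assumes h: "conv_flux h"
 shows "pc c a b cc ==> a < b ==>
 (\<forall>r s. a \<le> r \<and> r < s \<and> s \<le> b \<and> affon c r s \<and> same_side (c r) (c s) -->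
   seg (s - r) (c r) (c s) = (s - r) * legendre h ((c s - c r) / (s - r))) ==>
 (b - a) * legendre h ((c b - c a) / (b - a)) \<le> cc \<and>
 (cc = (b - a) * legendre h ((c b - c a) / (b - a)) --> affon c a b)"
proof (induction rule: pc.induct)
 case (pc_step a b cc b')
 interpret H: conv_flux h by (rule h)
 have ab: "a \<le> b" using pc_le pc_step by blast
 have sg: "seg (b' - b) (c b) (c b') = (b' - b) * legendre h ((c b' - c b) / (b' - b))"
  using pc_step ab by blast
 show ?case
 proof (cases "a = b")
  case True
  hence "cc = 0" using pc_self pc_step by blast
  thus ?thesis using sg True pc_step by auto
 next
  case False
  hence ab: "a < b" using ab by simp
  have IH: "(b - a) * legendre h ((c b - c a) / (b - a)) \<le> cc"
    "cc = (b - a) * legendre h ((c b - c a) / (b - a)) ==> affon c a b"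
   using pc_step.IH[OF ab] pc_step.prems(2) pc_step.hyps(2) order.strict_trans1[of _ b b'] less_imp_le
   by (meson order_trans)+
  have e: "b - a + (b' - b) = b' - a" "c b - c a + (c b' - c b) = c b' - c a" by auto
  have m: "(b' - a) * legendre h ((c b' - c a) / (b' - a)) \<le>
   (b - a) * legendre h ((c b - c a) / (b - a)) + (b' - b) * legendre h ((c b' - c b) / (b' - b))"
   using H.persp_merge[of "b - a" "b' - b" "c b - c a" "c b' - c b"] ab pc_step(2) unfolding e by auto
  have ms: "(b' - a) * legendre h ((c b' - c a) / (b' - a)) <
   (b - a) * legendre h ((c b - c a) / (b - a)) + (b' - b) * legendre h ((c b' - c b) / (b' - b))"
   if "(c b - c a) / (b - a) \<noteq> (c b' - c b) / (b' - b)"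
   using H.persp_merge_strict[of "b - a" "b' - b" "c b - c a" "c b' - c b"] ab pc_step(2) that unfolding e by auto
  show ?thesis
  proof (intro conjI impI)
   show "(b' - a) * legendre h ((c b' - c a) / (b' - a)) \<le> cc + seg (b' - b) (c b) (c b')"
    using m IH(1) sg by linarith
   assume "cc + seg (b' - b) (c b) (c b') = (b' - a) * legendre h ((c b' - c a) / (b' - a))"
   hence "cc = (b - a) * legendre h ((c b - c a) / (b - a))"
    and "(c b - c a) / (b - a) = (c b' - c b) / (b' - b)"
    using m ms IH(1) sg by linarith+
   thus "affon c a b'" using affon_join IH(2) pc_step ab by blast
  qed
 qed
qed auto

lemma pc_nonpos:
 assumes "pc c a b cc" "a < b" "\<And>s. s \<in> {a..b} ==> c s \<le> 0"
 shows "seg (b - a) (c a) (c b) \<le> cc" "cc = seg (b - a) (c a) (c b) ==> affon c a b"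
proof -
 have *: "(b - a) * G.L ((c b - c a) / (b - a)) \<le> cc \<and>
 (cc = (b - a) * G.L ((c b - c a) / (b - a)) --> affon c a b)"
  by (rule pc_jensen_aux[OF G.conv_flux_axioms assms(1,2)]) (use assms(3) in \<open>auto simp: seg_def\<close>)
 have "seg (b - a) (c a) (c b) = (b - a) * G.L ((c b - c a) / (b - a))"
  using assms by (auto simp: seg_def)
 with * show "seg (b - a) (c a) (c b) \<le> cc" "cc = seg (b - a) (c a) (c b) ==> affon c a b" by auto
qed

lemma affon_mono_ends:
 assumes "affon c r s" "u \<in> {r..s}"
 shows "min (c r) (c s) \<le> c u" "c u \<le> max (c r) (c s)"
proof -
 from affonD[OF assms(1)] obtain k m where *: "\<forall>u\<in>{r..s}. c u = k + m * u" by (elim exE conjE)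
 have "m * r \<le> m * u \<and> m * u \<le> m * s \<or> m * s \<le> m * u \<and> m * u \<le> m * r"
  using assms(2) by (cases "m \<ge> 0") (auto simp: mult_left_mono mult_left_mono_neg)
 thus "min (c r) (c s) \<le> c u" "c u \<le> max (c r) (c s)"
  using * assms(2) by auto
qed

lemma pc_pos:
 assumes "pc c a b cc" "a < b" "\<And>s. s \<in> {a<..<b} ==> c s > 0"
 shows "(b - a) * F.L ((c b - c a) / (b - a)) \<le> cc"
  "cc = (b - a) * F.L ((c b - c a) / (b - a)) ==> affon c a b"
proof -
 have "(b - a) * F.L ((c b - c a) / (b - a)) \<le> cc \<and>
 (cc = (b - a) * F.L ((c b - c a) / (b - a)) --> affon c a b)"
 proof (rule pc_jensen_aux[OF F.conv_flux_axioms assms(1,2)], intro allI impI)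
  fix r s assume *: "a \<le> r \<and> r < s \<and> s \<le> b \<and> affon c r s \<and> same_side (c r) (c s)"
  hence "c ((r + s) / 2) > 0" using assms(3)[of "(r+s)/2"] by auto
  moreover have "c ((r + s) / 2) \<le> max (c r) (c s)" using affon_mono_ends(2)[of c r s "(r+s)/2"] * by auto
  ultimately show "seg (s - r) (c r) (c s) = (s - r) * F.L ((c s - c r) / (s - r))"
   by (auto simp: seg_def)
 qed
 thus "(b - a) * F.L ((c b - c a) / (b - a)) \<le> cc"
  "cc = (b - a) * F.L ((c b - c a) / (b - a)) ==> affon c a b" by auto
qed

subsection \<open>Reduction to paths that stay straight or pass through the interface\<close>

text \<open>Cost of going from \<open>z\<close> to the interface in time \<open>s1\<close>, resting there and going on to \<open>x\<close> in time \<open>s2\<close>.\<close>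

definition thr :: "real => real => real => real => real => real" where
 "thr dd s1 s2 z x = seg s1 z 0 + (dd - s1 - s2) * K0 + seg s2 0 x"

definition thr_ok :: "real => real => real => real => real => bool" where
 "thr_ok dd s1 s2 z x \<longleftrightarrow> 0 \<le> s1 \<and> 0 \<le> s2 \<and> s1 + s2 \<le> dd \<and> (s1 = 0 --> z = 0) \<and> (s2 = 0 --> x = 0)"

lemma seg_merge:
 assumes "dd1 \<ge> 0" "dd2 \<ge> 0" "dd1 = 0 --> a = b" "dd2 = 0 --> b = cc"
  and "0 \<le> a \<and> 0 < b \<and> 0 \<le> cc \<or> a \<le> 0 \<and> b \<le> 0 \<and> cc \<le> 0"
 shows "seg (dd1 + dd2) a cc \<le> seg dd1 a b + seg dd2 b cc"
proof -
 have G: "(dd1 + dd2) * G.L ((cc - a) / (dd1 + dd2)) \<le> dd1 * G.L ((b - a) / dd1) + dd2 * G.L ((cc - b) / dd2)"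
  using G.persp_merge[of dd1 dd2 "b - a" "cc - b"] assms by auto
 have F: "(dd1 + dd2) * F.L ((cc - a) / (dd1 + dd2)) \<le> dd1 * F.L ((b - a) / dd1) + dd2 * F.L ((cc - b) / dd2)"
  using F.persp_merge[of dd1 dd2 "b - a" "cc - b"] assms by auto
 show ?thesis
 proof (cases "a \<le> 0 \<and> b \<le> 0 \<and> cc \<le> 0")
  case True thus ?thesis using G by (simp add: seg_def)
 next
  case False
  hence nn: "0 \<le> a" "0 < b" "0 \<le> cc" using assms by auto
  have "(dd1 + dd2) * K0 \<le> (dd1 + dd2) * F.L 0" using K0_le assms by (intro mult_left_mono) auto
  thus ?thesis using F nn by (cases "a = 0 \<and> cc = 0") (auto simp: seg_def)
 qed
qed

text \<open>Induction on the pieces. A new piece either prolongs the last leg, which Jensen's inequality makes straight, or it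
returns to the interface, where the elapsed time is better spent resting, or it leaves the interface.\<close>

lemma pc_reduce:
 "pc c a b cc ==>
  (same_side (c a) (c b) \<and> (b = a --> c a = c b) \<and> seg (b - a) (c a) (c b) \<le> cc) \<or>
  (\<exists>s1 s2. thr_ok (b - a) s1 s2 (c a) (c b) \<and> thr (b - a) s1 s2 (c a) (c b) \<le> cc)"
proof (induction rule: pc.induct)
 case (pc_refl a)
 thus ?case by (auto simp: same_side_def)
next
 case (pc_step a b cc b')
 have ab: "a \<le> b" using pc_le pc_step by blast
 have e: "b - a + (b' - b) = b' - a" by simp
 note ss = pc_step.hyps(4)
 show ?case using pc_step.IH
 proof (elim disjE exE conjE)
  assume 1: "same_side (c a) (c b)" "seg (b - a) (c a) (c b) \<le> cc" "b = a --> c a = c b"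
  show ?thesis
  proof (cases "c b = 0")
   case True
   hence "thr_ok (b' - a) (b - a) (b' - b) (c a) (c b')"
    using ab pc_step.hyps 1 unfolding thr_ok_def by auto
   moreover have "thr (b' - a) (b - a) (b' - b) (c a) (c b') \<le> cc + seg (b' - b) (c b) (c b')"
    using True 1 unfolding thr_def by simp
   ultimately show ?thesis by blast
  next
   case False
   have "seg (b' - a) (c a) (c b') \<le> seg (b - a) (c a) (c b) + seg (b' - b) (c b) (c b')"
    unfolding e[symmetric]
    by (rule seg_merge) (use False 1(1,3) ss ab pc_step.hyps(2) in \<open>auto simp: same_side_def\<close>)
   moreover have "same_side (c a) (c b')"
    using False 1(1) ss unfolding same_side_def by auto
   ultimately show ?thesis using 1(2) ab pc_step.hyps(2) by auto
  qed
 next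
  fix s1 s2 assume 2: "thr_ok (b - a) s1 s2 (c a) (c b)" "thr (b - a) s1 s2 (c a) (c b) \<le> cc"
  show ?thesis
  proof (cases "c b = 0")
   case True
   have "thr_ok (b' - a) s1 (b' - b) (c a) (c b')"
    using 2(1) pc_step.hyps ab unfolding thr_ok_def by auto
   moreover have "thr (b' - a) s1 (b' - b) (c a) (c b') \<le> cc + seg (b' - b) (c b) (c b')"
    using True 2(2) unfolding thr_def by (simp add: algebra_simps)
   ultimately show ?thesis by blast
  next
   case False
   have "thr_ok (b' - a) s1 (s2 + (b' - b)) (c a) (c b')"
    using 2(1) pc_step.hyps ab unfolding thr_ok_def by auto
   moreover have "seg (s2 + (b' - b)) 0 (c b') \<le> seg s2 0 (c b) + seg (b' - b) (c b) (c b')"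
    by (rule seg_merge) (use 2(1) False ss pc_step.hyps(2) in \<open>auto simp: thr_ok_def same_side_def\<close>)
   hence "thr (b' - a) s1 (s2 + (b' - b)) (c a) (c b') \<le> cc + seg (b' - b) (c b) (c b')"
    using 2(2) unfolding thr_def by (simp add: algebra_simps)
   ultimately show ?thesis by blast
  qed
 qed
qed

end


section \<open>Control curves as paths\<close>

subsection \<open>The cost integral of a path\<close>

text \<open>The integral over the part of \<open>{a..b}\<close> where \<open>P\<close> holds, as a relation: additivity in the interval then
needs no integrability side conditions.\<close>

definition hh :: "real => real => (real => bool) => (real => real) => real => bool" where
 "hh a b P F cc \<longleftrightarrow> has_bochner_integral lebesgue (%s. indicator {s\<in>{a..b}. P s} s *\<^sub>R F s) cc"

lemma hh_join:
 assumes "hh a b P F cc" "hh b dd P F cc'" "a \<le> b" "b \<le> dd"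
 shows "hh a dd P F (cc + cc')"
proof -
 have "has_bochner_integral lebesgue (%s. indicator {s\<in>{a..b}. P s} s *\<^sub>R F s +
   indicator {s\<in>{b..dd}. P s} s *\<^sub>R F s) (cc + cc')"
  using assms(1,2) unfolding hh_def by (rule has_bochner_integral_add)
 moreover have "has_bochner_integral lebesgue (%s. indicator {s\<in>{a..b}. P s} s *\<^sub>R F s +
   indicator {s\<in>{b..dd}. P s} s *\<^sub>R F s) (cc + cc') \<longleftrightarrow>
  has_bochner_integral lebesgue (%s. indicator {s\<in>{a..dd}. P s} s *\<^sub>R F s) (cc + cc')"
  by (rule has_bochner_integral_discrete_difference[where X="{b}"])
   (use assms(3,4) in \<open>auto simp: indicator_def split: if_splits\<close>)
 ultimately show ?thesis unfolding hh_def by blast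
qed

lemma hh_const:
 assumes "a \<le> b" "\<And>s. a < s ==> s < b ==> P s \<and> F s = k"
 shows "hh a b P F ((b - a) * k)"
proof -
 have "has_bochner_integral lebesgue (%s. indicator {a..b} s *\<^sub>R k) (measure lebesgue {a..b} *\<^sub>R k)"
  by (rule has_bochner_integral_indicator) (use assms(1) in auto)
 moreover have "has_bochner_integral lebesgue (%s. indicator {a..b} s *\<^sub>R k) (measure lebesgue {a..b} *\<^sub>R k) \<longleftrightarrow>
  has_bochner_integral lebesgue (%s. indicator {s\<in>{a..b}. P s} s *\<^sub>R F s) (measure lebesgue {a..b} *\<^sub>R k)"
  by (rule has_bochner_integral_discrete_difference[where X="{a,b}"])
   (use assms(2) in \<open>auto simp: indicator_def\<close>)
 ultimately show ?thesis unfolding hh_def using assms(1) by simp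
qed

lemma hh_none:
 assumes "\<And>s. a < s ==> s < b ==> \<not> P s"
 shows "hh a b P F 0"
proof -
 have "has_bochner_integral lebesgue (%s::real. 0 :: real) 0" by (rule has_bochner_integral_zero)
 moreover have "has_bochner_integral lebesgue (%s::real. 0 :: real) 0 \<longleftrightarrow>
  has_bochner_integral lebesgue (%s. indicator {s\<in>{a..b}. P s} s *\<^sub>R F s) 0"
  by (rule has_bochner_integral_discrete_difference[where X="{a,b}"])
   (use assms in \<open>auto simp: indicator_def\<close>)
 ultimately show ?thesis unfolding hh_def by simp
qed

lemma affon_deriv:
 assumes "affon c a b" "a < s" "s < b"
 shows "deriv c s = (c b - c a) / (b - a)"
proof -
 from affonD[OF assms(1)] obtain k m where *: "\<forall>u\<in>{a..b}. c u = k + m * u" and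
  m: "a < b --> m = (c b - c a) / (b - a)" by (elim exE conjE)
 have "((%u. k + m * u) has_real_derivative m) (at s)"
  by (auto intro!: derivative_eq_intros)
 hence "(c has_real_derivative m) (at s)"
  by (rule has_field_derivative_transform_within_open[of _ _ _ "{a<..<b}"]) (use assms * in auto)
 hence "deriv c s = m" by (rule DERIV_imp_deriv)
 moreover have "a < b" using assms by simp
 ultimately show ?thesis using m by blast
qed

lemma affon_between:
 assumes "affon c a b" "a < s" "s < b"
 shows "c a \<ge> 0 ==> c b > 0 ==> c s > 0" "c a > 0 ==> c b \<ge> 0 ==> c s > 0"
  "c a \<le> 0 ==> c b < 0 ==> c s < 0" "c a < 0 ==> c b \<le> 0 ==> c s < 0"
  "c a = 0 ==> c b = 0 ==> c s = 0"
proof -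
 define mu where "mu = (s - a) / (b - a)"
 have mu: "0 < mu" "mu < 1" using assms by (auto simp: mu_def)
 have "s \<in> {a..b}" using assms by simp
 hence "c s = c a + (c b - c a) / (b - a) * (s - a)"
  using assms(1) unfolding affon_def by blast
 moreover have "(c b - c a) / (b - a) * (s - a) = mu * (c b - c a)" by (simp add: mu_def)
 ultimately have gs: "c s = (1 - mu) * c a + mu * c b" by (simp add: algebra_simps)
 show "c a \<ge> 0 ==> c b > 0 ==> c s > 0" "c a > 0 ==> c b \<ge> 0 ==> c s > 0"
  "c a = 0 ==> c b = 0 ==> c s = 0"
  using mu unfolding gs by (auto simp: add_pos_nonneg add_nonneg_pos)
 show "c a \<le> 0 ==> c b < 0 ==> c s < 0" "c a < 0 ==> c b \<le> 0 ==> c s < 0"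
  using mu mult_nonneg_nonpos[of "1 - mu" "c a"] mult_nonneg_nonpos[of mu "c b"]
   mult_pos_neg[of mu "c b"] mult_pos_neg[of "1 - mu" "c a"] unfolding gs by force+
qed

context two_flux begin

definition path_int :: "(real => real) => real => real => real => bool" where
 "path_int c a b cc \<longleftrightarrow> (\<exists>cc1 cc2 cc3. hh a b (%s. c s > 0) (%s. F.L (deriv c s)) cc1 \<and>
  hh a b (%s. c s < 0) (%s. G.L (deriv c s)) cc2 \<and> hh a b (%s. c s = 0) (%s. 1) cc3 \<and>
  cc = cc1 + cc2 + cc3 * K0)"

lemma path_int_join: "path_int c a b cc ==> path_int c b dd cc' ==> a \<le> b ==> b \<le> dd ==> path_int c a dd (cc + cc')"
 unfolding path_int_def
proof (elim exE conjE)
 fix cc1 cc2 cc3 dd1 dd2 dd3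
 assume le: "a \<le> b" "b \<le> dd"
 assume 1: "hh a b (%s. c s > 0) (%s. F.L (deriv c s)) cc1" "hh b dd (%s. c s > 0) (%s. F.L (deriv c s)) dd1"
  and 2: "hh a b (%s. c s < 0) (%s. G.L (deriv c s)) cc2" "hh b dd (%s. c s < 0) (%s. G.L (deriv c s)) dd2"
  and 3: "hh a b (%s. c s = 0) (%s. 1) cc3" "hh b dd (%s. c s = 0) (%s. 1) dd3"
  and cc: "cc = cc1 + cc2 + cc3 * K0" "cc' = dd1 + dd2 + dd3 * K0"
 have "cc + cc' = (cc1 + dd1) + (cc2 + dd2) + (cc3 + dd3) * K0" unfolding cc by (simp add: algebra_simps)
 thus "\<exists>cc1 cc2 cc3. hh a dd (%s. c s > 0) (%s. F.L (deriv c s)) cc1 \<and>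
  hh a dd (%s. c s < 0) (%s. G.L (deriv c s)) cc2 \<and> hh a dd (%s. c s = 0) (%s. 1) cc3 \<and>
  cc + cc' = cc1 + cc2 + cc3 * K0"
  using hh_join[OF 1 le] hh_join[OF 2 le] hh_join[OF 3 le] by blast
qed

lemma path_int_piece:
 assumes "a < b" "affon c a b" "same_side (c a) (c b)"
 shows "path_int c a b (seg (b - a) (c a) (c b))"
proof -
 note dd = affon_deriv[OF assms(2)] and bt = affon_between[OF assms(2)]
 consider "c a = 0" "c b = 0" | "c a \<ge> 0" "c b \<ge> 0" "c a > 0 \<or> c b > 0" | "c a \<le> 0" "c b \<le> 0" "c a < 0 \<or> c b < 0"
  using assms(3) unfolding same_side_def by linarith
 thus ?thesis
 proof cases
  case 1
  hence z: "\<And>s. a < s ==> s < b ==> c s = 0" using bt by blast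
  show ?thesis unfolding path_int_def
  proof (intro exI conjI)
   show "hh a b (%s. c s > 0) (%s. F.L (deriv c s)) 0" by (rule hh_none) (simp add: z)
   show "hh a b (%s. c s < 0) (%s. G.L (deriv c s)) 0" by (rule hh_none) (simp add: z)
   show "hh a b (%s. c s = 0) (%s. 1) ((b - a) * 1)" by (rule hh_const) (use assms z in auto)
  qed (use 1 in simp)
 next
  case 2
  hence z: "\<And>s. a < s ==> s < b ==> c s > 0" using bt by blast
  show ?thesis unfolding path_int_def
  proof (intro exI conjI)
   show "hh a b (%s. c s > 0) (%s. F.L (deriv c s)) ((b - a) * F.L ((c b - c a) / (b - a)))"
    by (rule hh_const) (use assms z dd in auto)
   show "hh a b (%s. c s < 0) (%s. G.L (deriv c s)) 0" by (rule hh_none) (use z in force)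
   show "hh a b (%s. c s = 0) (%s. 1) 0" by (rule hh_none) (use z in force)
  qed (use 2 in \<open>auto simp: seg_def\<close>)
 next
  case 3
  hence z: "\<And>s. a < s ==> s < b ==> c s < 0" using bt by blast
  show ?thesis unfolding path_int_def
  proof (intro exI conjI)
   show "hh a b (%s. c s > 0) (%s. F.L (deriv c s)) 0" by (rule hh_none) (use z in force)
   show "hh a b (%s. c s < 0) (%s. G.L (deriv c s)) ((b - a) * G.L ((c b - c a) / (b - a)))"
    by (rule hh_const) (use assms z dd in auto)
   show "hh a b (%s. c s = 0) (%s. 1) 0" by (rule hh_none) (use z in force)
  qed (use 3 in \<open>auto simp: seg_def\<close>)
 qed
qed

lemma path_int_pc: "pc c a b cc ==> path_int c a b cc"
proof (induction rule: pc.induct)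
 case (pc_refl a)
 show ?case unfolding path_int_def by (intro exI[of _ 0] conjI hh_none) auto
next
 case (pc_step a b cc b')
 show ?case
  by (rule path_int_join[OF pc_step.IH path_int_piece]) (use pc_step.hyps pc_le in auto)
qed

lemma curve_cost_pc:
 assumes "pc c 0 t cc"
 shows "curve_cost f g v0 t c = v0 (c 0) + cc"
proof -
 obtain cc1 cc2 cc3 where h: "hh 0 t (%s. c s > 0) (%s. F.L (deriv c s)) cc1"
  "hh 0 t (%s. c s < 0) (%s. G.L (deriv c s)) cc2" "hh 0 t (%s. c s = 0) (%s. 1) cc3"
  "cc = cc1 + cc2 + cc3 * K0"
  using path_int_pc[OF assms] unfolding path_int_def by blast
 have "(LINT s:{s\<in>{0..t}. c s > 0}|lebesgue. F.L (deriv c s)) = cc1"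
  "(LINT s:{s\<in>{0..t}. c s < 0}|lebesgue. G.L (deriv c s)) = cc2"
  using h(1,2) unfolding hh_def set_lebesgue_integral_def by (auto dest: has_bochner_integral_integral_eq)
 moreover have "measure lebesgue {s\<in>{0..t}. c s = 0} = cc3"
  using has_bochner_integral_integral_eq[OF h(3)[unfolded hh_def]] by simp
 moreover have "min (F.L 0) K0 = K0" using K0_le by simp
 ultimately show ?thesis unfolding curve_cost_def using h(4) by simp
qed

subsection \<open>Control curves are paths\<close>

lemma segment_iff:
 assumes "a \<le> b"
 shows "segment c a b \<longleftrightarrow> affon c a b \<and> same_side (c a) (c b)"
proof
 assume *: "segment c a b"
 then obtain m cc where mc: "\<forall>s\<in>{a..b}. c s = m * s + cc" unfolding segment_def by blast
 have "affon c a b" by (rule affonI[of _ _ _ cc m]) (use mc in auto)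
 moreover have "same_side (c a) (c b)"
  using * assms unfolding segment_def same_side_def by auto
 ultimately show "affon c a b \<and> same_side (c a) (c b)" ..
next
 assume *: "affon c a b \<and> same_side (c a) (c b)"
 hence "affon c a b" ..
 from affonD[OF this] obtain k m where "\<forall>u\<in>{a..b}. c u = k + m * u" by (elim exE conjE)
 hence "\<exists>m cc. \<forall>s\<in>{a..b}. c s = m * s + cc" by (intro exI[of _ m] exI[of _ k]) auto
 moreover have "(\<forall>s\<in>{a..b}. c s \<ge> 0) \<or> (\<forall>s\<in>{a..b}. c s \<le> 0)"
  using affon_mono_ends[of c a b] * unfolding same_side_def by fastforce
 ultimately show "segment c a b" unfolding segment_def by blast
qed

lemma pc_segment: "a \<le> b ==> segment c a b ==> pc c a b (seg (b - a) (c a) (c b))"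
 using pc_affon[of a b c] pc_refl[of c a] by (cases "a = b") (auto simp: segment_iff)

lemma control_curve_pc:
 assumes "c \<in> control_curves x t" "t \<ge> 0"
 shows "\<exists>cc. pc c 0 t cc"
proof -
 consider "segment c 0 t" | t1 where "t1 \<in> {0..t}" "segment c 0 t1" "segment c t1 t"
  | t1 t2 where "three_segments c t t1 t2"
  using assms unfolding control_curves_def by blast
 thus ?thesis
 proof cases
  case 1 thus ?thesis using pc_segment assms by blast
 next
  case 2 thus ?thesis using pc_append[OF pc_segment pc_segment] by fastforce
 next
  case 3
  hence o: "0 \<le> t1" "t1 \<le> t2" "t2 \<le> t" and s: "segment c 0 t1" "segment c t1 t2" "segment c t2 t"
   unfolding three_segments_def by auto
  show ?thesis
   using pc_append[OF pc_append[OF pc_segment[OF o(3) s(3)] pc_segment[OF o(2) s(2)]] pc_segment[OF o(1) s(1)]]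
   by blast
 qed
qed

text \<open>The path that reaches the interface after time \<open>s1\<close> and leaves it at time \<open>t - s2\<close>.\<close>

definition bent :: "real => real => real => real => real => real => real" where
 "bent t s1 s2 z x s = (if s < s1 then line 0 s1 z 0 s else if s \<le> t - s2 then 0 else line (t - s2) t 0 x s)"

lemma bent_affon:
 assumes "thr_ok t s1 s2 z x"
 shows "affon (bent t s1 s2 z x) 0 s1" "affon (bent t s1 s2 z x) s1 (t - s2)" "affon (bent t s1 s2 z x) (t - s2) t"
  "bent t s1 s2 z x 0 = z" "bent t s1 s2 z x s1 = 0" "bent t s1 s2 z x (t - s2) = 0" "bent t s1 s2 z x t = x"
proof -
 have ok: "0 \<le> s1" "0 \<le> s2" "s1 \<le> t - s2" "s1 = 0 ==> z = 0" "s2 = 0 ==> x = 0"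
  using assms unfolding thr_ok_def by auto
 show "bent t s1 s2 z x 0 = z" "bent t s1 s2 z x s1 = 0" "bent t s1 s2 z x (t - s2) = 0" "bent t s1 s2 z x t = x"
  using ok unfolding bent_def by (auto simp: line_simps)
 have l0: "line 0 s1 z 0 s1 = 0" using ok(4) by (cases "s1 = 0") auto
 show "affon (bent t s1 s2 z x) 0 s1"
  by (rule affon_cong[OF affon_line[of 0 s1 z 0]]) (use ok l0 in \<open>auto simp: bent_def\<close>)
 show "affon (bent t s1 s2 z x) s1 (t - s2)"
  by (rule affonI[of _ _ _ 0 0]) (use ok in \<open>auto simp: bent_def\<close>)
 show "affon (bent t s1 s2 z x) (t - s2) t"
  by (rule affon_cong[OF affon_line[of "t - s2" t 0 x]]) (use ok in \<open>auto simp: bent_def\<close>)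
qed

lemma bent_segments:
 assumes "thr_ok t s1 s2 z x"
 shows "segment (bent t s1 s2 z x) 0 s1" "segment (bent t s1 s2 z x) s1 (t - s2)"
  "segment (bent t s1 s2 z x) (t - s2) t"
 using bent_affon[OF assms] assms segment_iff by (auto simp: thr_ok_def same_side_def)

lemma bent_pc:
 assumes "thr_ok t s1 s2 z x"
 shows "pc (bent t s1 s2 z x) 0 t (thr t s1 s2 z x)"
proof -
 note b = bent_affon[OF assms] and sg = bent_segments[OF assms]
 have ok: "0 \<le> s1" "s1 \<le> t - s2" "t - s2 \<le> t" using assms unfolding thr_ok_def by auto
 have "pc (bent t s1 s2 z x) 0 t (seg (s1 - 0) z 0 + seg (t - s2 - s1) 0 0 + seg (t - (t - s2)) 0 x)"
  using pc_append[OF pc_segment[OF ok(3) sg(3)] pc_append[OF pc_segment[OF ok(2) sg(2)] pc_segment[OF ok(1) sg(1)]]]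
  unfolding b(4-7) .
 thus ?thesis unfolding thr_def by (simp add: algebra_simps)
qed

lemma bent_signs:
 assumes "thr_ok t s1 s2 z x"
 shows "s1 \<le> s ==> s \<le> t - s2 ==> bent t s1 s2 z x s = 0"
  "z > 0 ==> 0 \<le> s ==> s < s1 ==> bent t s1 s2 z x s > 0"
  "x > 0 ==> t - s2 < s ==> s \<le> t ==> bent t s1 s2 z x s > 0"
proof -
 note b = bent_affon[OF assms]
 show "s1 \<le> s ==> s \<le> t - s2 ==> bent t s1 s2 z x s = 0" by (simp add: bent_def)
 show "z > 0 ==> 0 \<le> s ==> s < s1 ==> bent t s1 s2 z x s > 0"
  using affon_between(2)[OF b(1), of s] b(4,5) by (cases "s = 0") auto
 show "x > 0 ==> t - s2 < s ==> s \<le> t ==> bent t s1 s2 z x s > 0"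
  using affon_between(1)[OF b(3), of s] b(6,7) by (cases "s = t") auto
qed

lemma control_straight:
 assumes "t > 0" "same_side z x"
 shows "line 0 t z x \<in> control_curves x t"
 using assms affon_line segment_iff[of 0 t] unfolding control_curves_def by simp

lemma control_bent2:
 assumes "thr_ok t s1 (t - s1) z x"
 shows "bent t s1 (t - s1) z x \<in> control_curves x t"
proof -
 have "s1 \<in> {0..t}" using assms unfolding thr_ok_def by auto
 thus ?thesis using bent_segments(1,3)[OF assms] bent_affon(7)[OF assms]
  unfolding control_curves_def by auto
qed

text \<open>Three segments form a control curve only if the outer ones lie strictly on the same side, here the right one.\<close>

lemma control_bent3:
 assumes "thr_ok t s1 s2 z x" "z > 0 \<or> z = 0 \<and> s1 = 0" "x > 0"
 shows "three_segments (bent t s1 s2 z x) t s1 (t - s2)" "bent t s1 s2 z x \<in> control_curves x t"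
proof -
 show "three_segments (bent t s1 s2 z x) t s1 (t - s2)"
  using bent_segments[OF assms(1)] bent_signs[OF assms(1)] assms
  unfolding three_segments_def thr_ok_def by auto
 thus "bent t s1 s2 z x \<in> control_curves x t"
  using bent_affon(7)[OF assms(1)] unfolding control_curves_def by blast
qed

text \<open>Waiting at the interface pays off only between two pieces on the right: on the left it can
 be absorbed into the adjacent moving piece, since the rate at the interface is the one of the
 left flux. This is why the three kinds of control curves suffice.\<close>

lemma control_of_reduced:
 assumes "t > 0" "same_side z x \<and> m = seg t z x \<or> (\<exists>s1 s2. thr_ok t s1 s2 z x \<and> m = thr t s1 s2 z x)"
 shows "\<exists>c\<in>control_curves x t. \<exists>cc. c 0 = z \<and> pc c 0 t cc \<and> cc \<le> m"
 using assms(2)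
proof (elim disjE exE conjE)
 assume "same_side z x" "m = seg t z x"
 thus ?thesis
  using control_straight[OF assms(1)] pc_line[of 0 t z x] assms(1) line_simps(1)[of 0 t z x] by fastforce
next
 fix s1 s2 assume ok: "thr_ok t s1 s2 z x" and m: "m = thr t s1 s2 z x"
 hence o: "0 \<le> s1" "0 \<le> s2" "s1 + s2 \<le> t" "s1 = 0 --> z = 0" "s2 = 0 --> x = 0" unfolding thr_ok_def by auto
 consider "z \<le> 0" "x \<le> 0" | "z \<le> 0" "x > 0" | "z > 0" "x \<le> 0" | "z > 0" "x > 0" by linarith
 thus ?thesis
 proof cases
  case 1
  have "seg (s1 + (t - s1)) z x \<le> seg s1 z 0 + seg (t - s1) 0 x"
   by (rule seg_merge) (use o 1 in auto)
  moreover have "seg ((t - s1 - s2) + s2) 0 x \<le> seg (t - s1 - s2) 0 0 + seg s2 0 x"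
   by (rule seg_merge) (use o 1 in auto)
  ultimately have "seg t z x \<le> m" unfolding m thr_def by simp
  moreover have "same_side z x" using 1 by (simp add: same_side_def)
  ultimately show ?thesis
   using control_straight[OF assms(1)] pc_line[of 0 t z x] assms(1) line_simps(1)[of 0 t z x] by fastforce
 next
  case 2
  have ok': "thr_ok t (t - s2) (t - (t - s2)) z x" using o 2 unfolding thr_ok_def by auto
  have "seg (s1 + (t - s1 - s2)) z 0 \<le> seg s1 z 0 + seg (t - s1 - s2) 0 0"
   by (rule seg_merge) (use o 2 in auto)
  hence "thr t (t - s2) (t - (t - s2)) z x \<le> m" unfolding m thr_def by simp
  thus ?thesis using control_bent2[OF ok'] bent_pc[OF ok'] bent_affon(4)[OF ok'] by blast
 next
  case 3
  have ok': "thr_ok t s1 (t - s1) z x" using o 3 unfolding thr_ok_def by auto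
  have "seg ((t - s1 - s2) + s2) 0 x \<le> seg (t - s1 - s2) 0 0 + seg s2 0 x"
   by (rule seg_merge) (use o 3 in auto)
  hence "thr t s1 (t - s1) z x \<le> m" unfolding m thr_def by simp
  thus ?thesis using control_bent2[OF ok'] bent_pc[OF ok'] bent_affon(4)[OF ok'] by blast
 next
  case 4
  thus ?thesis using control_bent3(2)[OF ok] bent_pc[OF ok] bent_affon(4)[OF ok] m by blast
 qed
qed

end


section \<open>Existence of minimisers\<close>

lemma same_side_iff: "same_side a b \<longleftrightarrow> 0 \<le> a * b"
 by (simp add: same_side_def zero_le_mult_iff)

context two_flux begin

text \<open>Slopes \<open>\<plusminus>k\<close> of the two Young inequalities give the linear lower bound \<open>k * \<bar>x\<bar> - dd * DD k\<close> for both costs.\<close>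

definition DD :: "real => real" where
 "DD k = max (max \<bar>f k\<bar> \<bar>f (-k)\<bar>) (max \<bar>g k\<bar> \<bar>g (-k)\<bar>)"

lemma DD_nonneg: "DD k \<ge> 0" by (auto simp: DD_def le_max_iff_disj)

lemma seg_lower:
 assumes "dd \<ge> 0" "dd = 0 --> a = b"
 shows "k * \<bar>b - a\<bar> - dd * DD k \<le> seg dd a b"
proof -
 have D: "dd * f k \<le> dd * DD k" "dd * f (-k) \<le> dd * DD k" "dd * g k \<le> dd * DD k" "dd * g (-k) \<le> dd * DD k"
  using assms(1) by (auto simp: DD_def intro!: mult_left_mono)
 have "k * (b - a) - dd * f k \<le> dd * F.L ((b - a) / dd)" "-k * (b - a) - dd * f (-k) \<le> dd * F.L ((b - a) / dd)"
  "k * (b - a) - dd * g k \<le> dd * G.L ((b - a) / dd)" "-k * (b - a) - dd * g (-k) \<le> dd * G.L ((b - a) / dd)"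
  by (rule F.persp_ge G.persp_ge; use assms in simp)+
 note P = this
 have e: "b - a \<ge> 0 ==> k * \<bar>b - a\<bar> = k * (b - a)" "\<not> b - a \<ge> 0 ==> k * \<bar>b - a\<bar> = - k * (b - a)"
  by (simp_all add: abs_if right_diff_distrib)
 have "k * \<bar>b - a\<bar> - dd * DD k \<le> dd * F.L ((b - a) / dd)"
  by (cases "b - a \<ge> 0") (use e D P in linarith)+
 moreover have "k * \<bar>b - a\<bar> - dd * DD k \<le> dd * G.L ((b - a) / dd)"
  by (cases "b - a \<ge> 0") (use e D P in linarith)+
 ultimately show ?thesis unfolding seg_def by simp
qed

lemma pc_lower: "pc c a b cc ==> k \<ge> 0 ==> k * \<bar>c b - c a\<bar> - (b - a) * DD k \<le> cc"
proof (induction rule: pc.induct)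
 case (pc_step a b cc b')
 have "k * \<bar>c b' - c b\<bar> - (b' - b) * DD k \<le> seg (b' - b) (c b) (c b')"
  by (rule seg_lower) (use pc_step.hyps(2) in auto)
 moreover have "k * \<bar>c b' - c a\<bar> \<le> k * (\<bar>c b' - c b\<bar> + \<bar>c b - c a\<bar>)"
  using pc_step.prems by (intro mult_left_mono) auto
 ultimately show ?case using pc_step.IH[OF pc_step.prems] by (simp add: algebra_simps)
qed simp

lemma seg_rest:
 assumes "dd \<ge> 0" "dd = 0 --> a = b"
 shows "dd * K0 - (\<bar>\<theta> f\<bar> + \<bar>\<theta> g\<bar>) * \<bar>b - a\<bar> \<le> seg dd a b"
proof -
 have G: "\<theta> g * (b - a) - dd * g (\<theta> g) \<le> dd * G.L ((b - a) / dd)" by (rule G.persp_ge) (use assms in auto)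
 have F: "\<theta> f * (b - a) - dd * f (\<theta> f) \<le> dd * F.L ((b - a) / dd)" by (rule F.persp_ge) (use assms in auto)
 have 1: "dd * K0 \<le> - (dd * f (\<theta> f))" and 2: "dd * K0 = - (dd * g (\<theta> g))"
  using mult_left_mono[OF theta_le assms(1)] G.L_0 by simp_all
 have 3: "- (\<bar>\<theta> f\<bar> * \<bar>b - a\<bar>) \<le> \<theta> f * (b - a)" "- (\<bar>\<theta> g\<bar> * \<bar>b - a\<bar>) \<le> \<theta> g * (b - a)"
  unfolding abs_mult[symmetric] by linarith+
 have 4: "\<bar>\<theta> f\<bar> * \<bar>b - a\<bar> \<ge> 0" "\<bar>\<theta> g\<bar> * \<bar>b - a\<bar> \<ge> 0" by auto
 have "dd * K0 - (\<bar>\<theta> f\<bar> + \<bar>\<theta> g\<bar>) * \<bar>b - a\<bar> \<le> dd * F.L ((b - a) / dd)"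
  unfolding distrib_right using F 1 3 4 by linarith
 moreover have "dd * K0 - (\<bar>\<theta> f\<bar> + \<bar>\<theta> g\<bar>) * \<bar>b - a\<bar> \<le> dd * G.L ((b - a) / dd)"
  unfolding distrib_right using G 2 3 4 by linarith
 ultimately show ?thesis unfolding seg_def by simp
qed

lemma eventually_lower:
 fixes X Y :: "nat => real"
 assumes "Y \<longlonglongrightarrow> l" "e > 0" "eventually (%n. Y n \<le> X n) sequentially"
 shows "eventually (%n. l - e \<le> X n) sequentially"
proof -
 have "eventually (%n. l - e < Y n) sequentially"
  using order_tendstoD(1)[OF assms(1)] assms(2) by simp
 with assms(3) show ?thesis by eventually_elim auto
qed

text \<open>Each cost is a supremum of functions that are affine in duration and displacement; the one that is active in
the limit bounds the sequence from below. If the limit lies on the interface, \<open>seg_rest\<close> does.\<close>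

lemma seg_lsc:
 assumes lim: "dd \<longlonglongrightarrow> D" "a \<longlonglongrightarrow> A" "b \<longlonglongrightarrow> B" and e: "e > 0"
  and ok: "\<And>n. dd n \<ge> 0" "\<And>n. same_side (a n) (b n)" "\<And>n. dd n = 0 ==> a n = b n" and deg: "D = 0 ==> A = B"
 shows "eventually (%n. seg D A B - e \<le> seg (dd n) (a n) (b n)) sequentially"
proof -
 have D0: "D \<ge> 0" by (rule LIMSEQ_le_const[OF lim(1)]) (use ok in auto)
 have rest: ?thesis if "A = B" "seg D A B \<le> D * K0"
 proof -
  have "(%n. dd n * K0 - (\<bar>\<theta> f\<bar> + \<bar>\<theta> g\<bar>) * \<bar>b n - a n\<bar>) \<longlonglongrightarrow> D * K0 - (\<bar>\<theta> f\<bar> + \<bar>\<theta> g\<bar>) * \<bar>B - A\<bar>"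
   by (intro tendsto_intros lim)
  hence "eventually (%n. D * K0 - (\<bar>\<theta> f\<bar> + \<bar>\<theta> g\<bar>) * \<bar>B - A\<bar> - e \<le> seg (dd n) (a n) (b n)) sequentially"
   by (rule eventually_lower[OF _ e]) (use seg_rest ok in auto)
  thus ?thesis by (rule eventually_mono) (use that in auto)
 qed
 have ssAB: "same_side A B"
  unfolding same_side_iff
  by (rule LIMSEQ_le_const[OF tendsto_mult[OF lim(2,3)]]) (use ok(2) in \<open>auto simp: same_side_iff\<close>)
 consider "D = 0" | "D > 0" "A > 0 \<or> B > 0" | "D > 0" "A < 0 \<or> B < 0" | "D > 0" "A = 0" "B = 0"
  using D0 by linarith
 thus ?thesis
 proof cases
  case 1 thus ?thesis using rest deg by simp
 next
  case 2
  let ?\<alpha> = "F.dL ((B - A) / D)"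
  have ev: "eventually (%n. a n > 0 \<or> b n > 0) sequentially"
  proof (cases "A > 0")
   case True show ?thesis by (rule eventually_mono[OF order_tendstoD(1)[OF lim(2) True]]) simp
  next
   case False
   hence "B > 0" using 2 by simp
   show ?thesis by (rule eventually_mono[OF order_tendstoD(1)[OF lim(3) \<open>B > 0\<close>]]) simp
  qed
  have l1: "(%n. ?\<alpha> * (b n - a n) - dd n * f ?\<alpha>) \<longlonglongrightarrow> ?\<alpha> * (B - A) - D * f ?\<alpha>"
   by (intro tendsto_intros lim)
  have l2: "seg D A B = ?\<alpha> * (B - A) - D * f ?\<alpha>"
   using 2 F.persp_eq[of D "B - A"] by (auto simp: seg_def)
  have l3: "eventually (%n. ?\<alpha> * (b n - a n) - dd n * f ?\<alpha> \<le> seg (dd n) (a n) (b n)) sequentially"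
   using ev
  proof eventually_elim
   case (elim n)
   hence "seg (dd n) (a n) (b n) = dd n * F.L ((b n - a n) / dd n)" by (auto simp: seg_def)
   thus ?case using F.persp_ge[of "dd n" "b n - a n" ?\<alpha>] ok(1,3)[of n] by auto
  qed
  show ?thesis unfolding l2 by (rule eventually_lower[OF l1 e l3])
 next
  case 3
  let ?\<alpha> = "G.dL ((B - A) / D)"
  have ev: "eventually (%n. a n < 0 \<or> b n < 0) sequentially"
  proof (cases "A < 0")
   case True show ?thesis by (rule eventually_mono[OF order_tendstoD(2)[OF lim(2) True]]) simp
  next
   case False
   hence "B < 0" using 3 by simp
   show ?thesis by (rule eventually_mono[OF order_tendstoD(2)[OF lim(3) \<open>B < 0\<close>]]) simp
  qed
  have l1: "(%n. ?\<alpha> * (b n - a n) - dd n * g ?\<alpha>) \<longlonglongrightarrow> ?\<alpha> * (B - A) - D * g ?\<alpha>"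
   by (intro tendsto_intros lim)
  have l2: "seg D A B = ?\<alpha> * (B - A) - D * g ?\<alpha>"
   using 3 ssAB G.persp_eq[of D "B - A"] by (auto simp: seg_def same_side_def)
  have l3: "eventually (%n. ?\<alpha> * (b n - a n) - dd n * g ?\<alpha> \<le> seg (dd n) (a n) (b n)) sequentially"
   using ev
  proof eventually_elim
   case (elim n)
   hence "seg (dd n) (a n) (b n) = dd n * G.L ((b n - a n) / dd n)"
    using ok(2)[of n] by (auto simp: seg_def same_side_def)
   thus ?case using G.persp_ge[of "dd n" "b n - a n" ?\<alpha>] ok(1,3)[of n] by auto
  qed
  show ?thesis unfolding l2 by (rule eventually_lower[OF l1 e l3])
 next
  case 4 thus ?thesis using rest by simp
 qed
qed

text \<open>Costs of the paths that remain after reduction.\<close>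

definition red :: "real => real => real => real => bool" where
 "red t z x m \<longleftrightarrow> same_side z x \<and> m = seg t z x \<or> (\<exists>s1 s2. thr_ok t s1 s2 z x \<and> m = thr t s1 s2 z x)"

lemma red_pc: "t > 0 ==> red t z x m ==> \<exists>c\<in>control_curves x t. \<exists>cc. c 0 = z \<and> pc c 0 t cc \<and> cc \<le> m"
 unfolding red_def by (rule control_of_reduced)

lemma pc_red: "pc c 0 t cc ==> \<exists>m\<le>cc. red t (c 0) (c t) m"
 using pc_reduce[of c 0 t cc] unfolding red_def by auto

lemma red_lower: "t > 0 ==> red t z x m ==> k \<ge> 0 ==> k * \<bar>x - z\<bar> - t * DD k \<le> m"
proof -
 assume "t > 0" "red t z x m" "k \<ge> 0"
 then obtain c cc where *: "c \<in> control_curves x t" "c 0 = z" "pc c 0 t cc" "cc \<le> m" using red_pc by blast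
 have "c t = x" using *(1) unfolding control_curves_def by blast
 thus ?thesis using pc_lower[OF *(3) \<open>k \<ge> 0\<close>] * by simp
qed

lemma red_ex: assumes "t > 0" shows "\<exists>m. red t z x m"
proof -
 have "thr_ok t (t/2) (t/2) z x" using assms by (simp add: thr_ok_def)
 thus ?thesis unfolding red_def by blast
qed

lemma le_all_multiples: "(\<And>k::real. k \<ge> 0 ==> k * a \<le> b) ==> a \<le> 0"
proof (rule ccontr)
 assume *: "\<And>k::real. k \<ge> 0 ==> k * a \<le> b" and "\<not> a \<le> 0"
 hence "(\<bar>b\<bar> + 1) / a * a \<le> b" by (intro *) auto
 thus False using \<open>\<not> a \<le> 0\<close> by simp
qed

text \<open>Durations are bounded, so a subsequence converges. A leg whose duration collapses must have collapsed length,
for otherwise superlinearity would make the costs unbounded.\<close>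

lemma red_closed:
 assumes t: "t > 0" and z: "z \<longlonglongrightarrow> Z" and m: "m \<longlonglongrightarrow> l" and r: "\<And>n. red t (z n) x (m n)"
 shows "\<exists>m'\<le>l. red t Z x m'"
proof (cases "infinite {n. same_side (z n) x \<and> m n = seg t (z n) x}")
 case True
 then obtain \<sigma> :: "nat => nat" where \<sigma>: "strict_mono \<sigma>" "\<And>n. \<sigma> n \<in> {n. same_side (z n) x \<and> m n = seg t (z n) x}"
  using infinite_enumerate by blast
 have zs: "(%n. z (\<sigma> n)) \<longlonglongrightarrow> Z" and ms: "(%n. m (\<sigma> n)) \<longlonglongrightarrow> l"
  using LIMSEQ_subseq_LIMSEQ[OF z \<sigma>(1)] LIMSEQ_subseq_LIMSEQ[OF m \<sigma>(1)] by (auto simp: o_def)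
 have "(%n. z (\<sigma> n) * x) \<longlonglongrightarrow> Z * x" by (intro tendsto_intros zs)
 hence "same_side Z x" unfolding same_side_iff
  by (rule LIMSEQ_le_const) (use \<sigma>(2) in \<open>auto simp: same_side_iff\<close>)
 moreover have "seg t Z x \<le> l"
 proof (rule field_le_epsilon)
  fix e :: real assume "e > 0"
  have "eventually (%n. seg t Z x - e \<le> seg t (z (\<sigma> n)) x) sequentially"
   using \<sigma>(2) t by (intro seg_lsc[OF tendsto_const zs tendsto_const \<open>e > 0\<close>]) auto
  moreover have "seg t (z (\<sigma> n)) x = m (\<sigma> n)" for n using \<sigma>(2)[of n] by simp
  ultimately have "seg t Z x - e \<le> l"
   by (intro tendsto_lowerbound[OF ms]) auto
  thus "seg t Z x \<le> l + e" by simp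
 qed
 ultimately show ?thesis unfolding red_def by blast
next
 case False
 hence "infinite (- {n. same_side (z n) x \<and> m n = seg t (z n) x})"
  using Diff_infinite_finite[of "{n. same_side (z n) x \<and> m n = seg t (z n) x}" UNIV]
  by (simp add: Compl_eq_Diff_UNIV)
 then obtain \<sigma> :: "nat => nat" where \<sigma>: "strict_mono \<sigma>" "\<And>n. \<sigma> n \<in> - {n. same_side (z n) x \<and> m n = seg t (z n) x}"
  using infinite_enumerate by blast
 have "\<forall>n. \<exists>s1 s2. thr_ok t s1 s2 (z (\<sigma> n)) x \<and> m (\<sigma> n) = thr t s1 s2 (z (\<sigma> n)) x"
  using r \<sigma>(2) unfolding red_def by auto
 then obtain S1 S2 where S: "\<And>n. thr_ok t (S1 n) (S2 n) (z (\<sigma> n)) x" "\<And>n. m (\<sigma> n) = thr t (S1 n) (S2 n) (z (\<sigma> n)) x"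
  by metis
 have mem: "\<forall>n. (S1 n, S2 n) \<in> {0..t} \<times> {0..t}"
 proof
  show "(S1 n, S2 n) \<in> {0..t} \<times> {0..t}" for n using S(1)[of n] unfolding thr_ok_def by auto
 qed
 have sc: "seq_compact ({0..t} \<times> {0..t} :: (real \<times> real) set)"
  by (intro compact_imp_seq_compact compact_Times compact_Icc)
 obtain p \<rho> where \<rho>: "strict_mono (\<rho> :: nat => nat)" "((%n. (S1 n, S2 n)) \<circ> \<rho>) \<longlonglongrightarrow> p"
  by (rule seq_compactE[OF sc mem])
 define a b where "a = fst p" "b = snd p"
 define \<tau> where "\<tau> = \<sigma> \<circ> \<rho>"
 have "strict_mono \<tau>" unfolding \<tau>_def using \<sigma>(1) \<rho>(1) strict_mono_o by blast
 hence zs: "(%n. z (\<tau> n)) \<longlonglongrightarrow> Z" and ms: "(%n. m (\<tau> n)) \<longlonglongrightarrow> l"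
  using LIMSEQ_subseq_LIMSEQ[OF z] LIMSEQ_subseq_LIMSEQ[OF m] by (auto simp: o_def)
 define U1 U2 where "U1 = S1 \<circ> \<rho>" "U2 = S2 \<circ> \<rho>"
 have U: "U1 \<longlonglongrightarrow> a" "U2 \<longlonglongrightarrow> b"
  using tendsto_fst[OF \<rho>(2)] tendsto_snd[OF \<rho>(2)] unfolding U1_U2_def a_b_def by (auto simp: o_def)
 have T: "thr_ok t (U1 n) (U2 n) (z (\<tau> n)) x" "m (\<tau> n) = thr t (U1 n) (U2 n) (z (\<tau> n)) x" for n
  using S unfolding U1_U2_def \<tau>_def by auto
 have T': "0 \<le> U1 n" "0 \<le> U2 n" "U1 n + U2 n \<le> t" "U1 n = 0 ==> z (\<tau> n) = 0" "U2 n = 0 ==> x = 0" for n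
  using T(1)[of n] unfolding thr_ok_def by auto
 have "0 \<le> a" by (rule LIMSEQ_le_const[OF U(1)]) (use T'(1) in blast)
 moreover have "0 \<le> b" by (rule LIMSEQ_le_const[OF U(2)]) (use T'(2) in blast)
 moreover have "a + b \<le> t" by (rule LIMSEQ_le_const2[OF tendsto_add[OF U]]) (use T'(3) in blast)
 ultimately have ab: "0 \<le> a" "0 \<le> b" "a + b \<le> t" by auto
 let ?M = "\<bar>\<theta> f\<bar> + \<bar>\<theta> g\<bar>"
 have a0: "Z = 0" if "a = 0"
 proof -
  have "k * \<bar>Z\<bar> \<le> l - (t - a - b) * K0 - b * K0 + ?M * \<bar>x\<bar>" if "k \<ge> 0" for k
  proof -
   have l: "(%n. k * \<bar>z (\<tau> n)\<bar> - U1 n * DD k + (t - U1 n - U2 n) * K0 + (U2 n * K0 - ?M * \<bar>x\<bar>)) \<longlonglongrightarrow>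
    k * \<bar>Z\<bar> - a * DD k + (t - a - b) * K0 + (b * K0 - ?M * \<bar>x\<bar>)"
    by (intro tendsto_intros U zs)
   have "k * \<bar>z (\<tau> n)\<bar> - U1 n * DD k + (t - U1 n - U2 n) * K0 + (U2 n * K0 - ?M * \<bar>x\<bar>) \<le> m (\<tau> n)" for n
    using seg_lower[of "U1 n" "z (\<tau> n)" 0 k] seg_rest[of "U2 n" 0 x] T'[of n] unfolding T(2) thr_def by auto
   hence "k * \<bar>Z\<bar> - a * DD k + (t - a - b) * K0 + (b * K0 - ?M * \<bar>x\<bar>) \<le> l"
    using LIMSEQ_le[OF l ms] by blast
   thus ?thesis using \<open>a = 0\<close> by simp
  qed
  hence "\<bar>Z\<bar> \<le> 0" by (rule le_all_multiples)
  thus ?thesis by simp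
 qed
 have b0: "x = 0" if "b = 0"
 proof -
  have "k * \<bar>x\<bar> \<le> l - (t - a - b) * K0 - a * K0 + ?M * \<bar>Z\<bar>" if "k \<ge> 0" for k
  proof -
   have l: "(%n. k * \<bar>x\<bar> - U2 n * DD k + (t - U1 n - U2 n) * K0 + (U1 n * K0 - ?M * \<bar>z (\<tau> n)\<bar>)) \<longlonglongrightarrow>
    k * \<bar>x\<bar> - b * DD k + (t - a - b) * K0 + (a * K0 - ?M * \<bar>Z\<bar>)"
    by (intro tendsto_intros U zs)
   have "k * \<bar>x\<bar> - U2 n * DD k + (t - U1 n - U2 n) * K0 + (U1 n * K0 - ?M * \<bar>z (\<tau> n)\<bar>) \<le> m (\<tau> n)" for n
    using seg_lower[of "U2 n" 0 x k] seg_rest[of "U1 n" "z (\<tau> n)" 0] T'[of n] unfolding T(2) thr_def by auto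
   hence "k * \<bar>x\<bar> - b * DD k + (t - a - b) * K0 + (a * K0 - ?M * \<bar>Z\<bar>) \<le> l"
    using LIMSEQ_le[OF l ms] by blast
   thus ?thesis using \<open>b = 0\<close> by simp
  qed
  hence "\<bar>x\<bar> \<le> 0" by (rule le_all_multiples)
  thus ?thesis by simp
 qed
 have "thr t a b Z x \<le> l"
 proof (rule field_le_epsilon)
  fix e :: real assume "e > 0"
  hence e3: "e / 3 > 0" by simp
  have "eventually (%n. seg a Z 0 - e/3 \<le> seg (U1 n) (z (\<tau> n)) 0) sequentially"
   by (rule seg_lsc[OF U(1) zs tendsto_const e3]) (use T' a0 in \<open>auto simp: same_side_def\<close>)
  moreover have "eventually (%n. seg b 0 x - e/3 \<le> seg (U2 n) 0 x) sequentially"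
   by (rule seg_lsc[OF U(2) tendsto_const tendsto_const e3]) (use T' b0 in \<open>auto simp: same_side_def\<close>)
  moreover have "eventually (%n. (t - a - b) * K0 - e/3 \<le> (t - U1 n - U2 n) * K0) sequentially"
   by (rule eventually_lower[OF _ e3, of "%n. (t - U1 n - U2 n) * K0"]) (auto intro!: tendsto_intros U)
  ultimately have "eventually (%n. thr t a b Z x - e \<le> m (\<tau> n)) sequentially"
   by eventually_elim (simp add: T(2) thr_def)
  hence "thr t a b Z x - e \<le> l" by (intro tendsto_lowerbound[OF ms]) auto
  thus "thr t a b Z x \<le> l + e" by simp
 qed
 moreover have "thr_ok t a b Z x" unfolding thr_ok_def using ab a0 b0 by auto
 ultimately show ?thesis unfolding red_def by blast
qed

text \<open>Superlinear cost against linearly bounded data confines a minimising sequence to a bounded set; closedness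
of the reduced costs does the rest.\<close>

lemma exists_min:
 assumes t: "t > 0" and Z: "closed Z" "z0 \<in> Z" and cont: "continuous_on UNIV (v0 :: real => real)"
  and C: "C \<ge> 0" "\<And>z. - C * \<bar>z\<bar> - C \<le> v0 z"
 shows "\<exists>z\<in>Z. \<exists>m. red t z x m \<and> (\<forall>z'\<in>Z. \<forall>m'. red t z' x m' --> v0 z + m \<le> v0 z' + m')"
proof -
 define S where "S = {v0 z + m | z m. z \<in> Z \<and> red t z x m}"
 define R where "R = (C + 1) * \<bar>x\<bar> + C + t * DD (C + 1)"
 have low: "\<bar>z\<bar> - R \<le> v0 z + m" if "red t z x m" for z m
 proof -
  have "(C + 1) * \<bar>z\<bar> \<le> (C + 1) * (\<bar>x\<bar> + \<bar>x - z\<bar>)" using C(1) by (intro mult_left_mono) auto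
  thus ?thesis using red_lower[OF t that, of "C + 1"] C(1) C(2)[of z] unfolding R_def
   by (simp add: algebra_simps)
 qed
 have ne: "S \<noteq> {}" using red_ex[OF t] Z(2) unfolding S_def by blast
 have bd: "bdd_below S"
 proof (rule bdd_belowI)
  fix w assume "w \<in> S"
  thus "- R \<le> w" unfolding S_def using low abs_ge_zero by (smt (verit) mem_Collect_eq)
 qed
 have "Inf S \<in> closure S" using closure_contains_Inf[OF ne bd] .
 then obtain w where w: "\<And>n. w n \<in> S" "w \<longlonglongrightarrow> Inf S" unfolding closure_sequential by blast
 have "\<forall>n. \<exists>z m. z \<in> Z \<and> red t z x m \<and> w n = v0 z + m" using w(1) unfolding S_def by blast
 then obtain z m where zm: "\<And>n. z n \<in> Z" "\<And>n. red t (z n) x (m n)" "\<And>n. w n = v0 (z n) + m n" by metis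
 obtain B where B: "\<And>n. \<bar>w n\<bar> \<le> B"
  using convergent_imp_Bseq[of w] w(2) unfolding convergent_def Bseq_def by auto
 have "\<forall>n. z n \<in> Z \<inter> cball 0 (B + R)"
 proof
  fix n
  have "\<bar>z n\<bar> \<le> B + R" using low[OF zm(2)[of n]] zm(3)[of n] B[of n] by linarith
  thus "z n \<in> Z \<inter> cball 0 (B + R)" using zm(1) by simp
 qed
 note mem = this
 have sc: "seq_compact (Z \<inter> cball 0 (B + R))"
  by (intro compact_imp_seq_compact closed_Int_compact Z(1) compact_cball)
 obtain z' \<rho> where "z' \<in> Z \<inter> cball 0 (B + R)" and \<rho>': "strict_mono (\<rho> :: nat => nat)" "(z \<circ> \<rho>) \<longlonglongrightarrow> z'"
  by (rule seq_compactE[OF sc mem])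
 hence \<rho>: "z' \<in> Z" "strict_mono \<rho>" "(z \<circ> \<rho>) \<longlonglongrightarrow> z'" by auto
 have "(%n. v0 ((z \<circ> \<rho>) n)) \<longlonglongrightarrow> v0 z'"
  using continuous_on_tendsto_compose[OF cont \<rho>(3)] by simp
 hence "(%n. w (\<rho> n) - v0 ((z \<circ> \<rho>) n)) \<longlonglongrightarrow> Inf S - v0 z'"
  using LIMSEQ_subseq_LIMSEQ[OF w(2) \<rho>(2)] by (intro tendsto_diff) (auto simp: o_def)
 hence ml: "(%n. m (\<rho> n)) \<longlonglongrightarrow> Inf S - v0 z'" by (simp add: zm(3))
 obtain m' where m': "m' \<le> Inf S - v0 z'" "red t z' x m'"
  using red_closed[OF t \<rho>(3) ml] zm(2) by auto
 show ?thesis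
 proof (intro bexI[OF _ \<rho>(1)] exI conjI ballI allI impI)
  show "red t z' x m'" by (rule m'(2))
  fix z'' m'' assume "z'' \<in> Z" "red t z'' x m''"
  hence "Inf S \<le> v0 z'' + m''" by (intro cInf_lower[OF _ bd]) (auto simp: S_def)
  thus "v0 z' + m' \<le> v0 z'' + m''" using m'(1) by simp
 qed
qed

end


section \<open>The value function\<close>

lemma last_zero:
 fixes c :: "real => real"
 assumes cc: "continuous_on {a..b} c" and ab: "a \<le> b" and s: "c a \<le> 0" "0 < c b"
 shows "\<exists>s. a \<le> s \<and> s < b \<and> c s = 0 \<and> (\<forall>r. s < r --> r \<le> b --> 0 < c r)"
proof -
 let ?S = "{r \<in> {a..b}. c r \<le> 0}"
 have "?S = {a..b} \<inter> c -` {..0}" by auto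
 hence "closed ?S" using continuous_closed_preimage[OF cc closed_atLeastAtMost closed_atMost[of 0]] by simp
 moreover have "bounded ?S" by (rule bounded_subset[OF compact_imp_bounded[OF compact_Icc[of a b]]]) auto
 ultimately have "compact ?S" by (simp add: compact_eq_bounded_closed)
 then obtain s where s': "s \<in> ?S" "\<And>r. r \<in> ?S ==> r \<le> s" using compact_attains_sup[of ?S] s ab by auto
 have pos: "0 < c r" if "s < r" "r \<le> b" for r using s'(2)[of r] s'(1) that by force
 have sb: "s < b" using s' s by (cases "s = b") auto
 have "c s = 0"
 proof (rule ccontr)
  assume "c s \<noteq> 0"
  hence "c s < 0" using s' by auto
  moreover have "continuous_on {s..b} c" by (rule continuous_on_subset[OF cc]) (use s' in auto)
  ultimately obtain r where "s \<le> r" "r \<le> b" "c r = 0" using IVT'[of c s 0 b] sb s by auto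
  thus False using pos[of r] \<open>c s \<noteq> 0\<close> by (cases "r = s") auto
 qed
 thus ?thesis using s' sb pos by auto
qed

lemma pos_interval:
 fixes c :: "real => real"
 assumes cont: "continuous_on {a..b} c" and s: "a < s" "s < b" and pos: "c s > 0"
 shows "\<exists>a' b'. a \<le> a' \<and> a' < s \<and> s < b' \<and> b' \<le> b \<and> (\<forall>u\<in>{a'<..<b'}. c u > 0) \<and>
  (a' = a \<or> c a' = 0) \<and> (b' = b \<or> c b' = 0)"
proof -
 have left: "\<exists>p'. p \<le> p' \<and> p' < r \<and> (\<forall>u\<in>{p'<..r}. h u > 0) \<and> (p' = p \<or> h p' = 0)"
  if cc: "continuous_on {p..r} h" and r: "p < r" "h r > 0" for p r and h :: "real => real"
 proof (cases "\<exists>u\<in>{p..r}. h u \<le> 0")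
  case True
  then obtain u where u: "p \<le> u" "u \<le> r" "h u \<le> 0" by auto
  obtain q where "u \<le> q" "q < r" "h q = 0" "\<forall>w. q < w --> w \<le> r --> 0 < h w"
   using last_zero[OF continuous_on_subset[OF cc] u(2,3) r(2)] u by auto
  thus ?thesis using u by (intro exI[of _ q]) auto
 next
  case False thus ?thesis using r by (intro exI[of _ p]) (auto simp: not_le)
 qed
 obtain a' where a': "a \<le> a'" "a' < s" "\<forall>u\<in>{a'<..s}. c u > 0" "a' = a \<or> c a' = 0"
  using left[OF continuous_on_subset[OF cont] s(1) pos] s by auto
 have "continuous_on {- b..- s} (%u. c (- u))"
  by (rule continuous_on_compose2[OF cont]) (use s in \<open>auto intro!: continuous_intros\<close>)
 from left[OF this] obtain q where q: "- b \<le> q" "q < - s" "\<forall>u\<in>{q<..- s}. c (- u) > 0" "q = - b \<or> c (- q) = 0"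
  using s pos by auto
 have "c u > 0" if "u \<in> {a'<..<- q}" for u
  using a'(3) q(3)[rule_format, of "- u"] that by (cases "u \<le> s") auto
 thus ?thesis using a' q by (intro exI[of _ a'] exI[of _ "- q"]) auto
qed

lemma affon_eq:
 assumes "affon c a b" "affon d a b" "a < b" "c u = d u" "c w = d w" "u < w" "u \<in> {a..b}" "w \<in> {a..b}" "r \<in> {a..b}"
 shows "c r = d r"
proof -
 from affonD[OF assms(1)] obtain k m where 1: "\<forall>u\<in>{a..b}. c u = k + m * u" by (elim exE conjE)
 from affonD[OF assms(2)] obtain k' m' where 2: "\<forall>u\<in>{a..b}. d u = k' + m' * u" by (elim exE conjE)
 have e: "k + m * u = k' + m' * u" "k + m * w = k' + m' * w"
  using 1 2 assms(4,5,7,8) by metis+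
 hence "(m - m') * (w - u) = 0" by (simp add: algebra_simps)
 hence mm: "m = m'" using assms(6) by simp
 hence "k = k'" using e by simp
 with mm show ?thesis using 1 2 assms(9) by metis
qed

locale value_function = two_flux +
 fixes v0 :: "real => real" and C :: real
 assumes v0_lip: "\<bar>v0 x - v0 y\<bar> \<le> C * \<bar>x - y\<bar>"
begin

definition v :: "real => real => real" where
 "v x t = (INF c\<in>control_curves x t. curve_cost f g v0 t c)"

text \<open>Optimality is stated for all piecewise affine paths, not just control curves, so that it is inherited
by pieces and by glued paths. For control curves it is membership in \<open>ch\<close>, see \<open>opt_iff\<close>.\<close>

definition isopt :: "(real => real) => real => bool" where
 "isopt c t \<longleftrightarrow> (\<exists>cc. pc c 0 t cc \<and> v (c t) t = v0 (c 0) + cc)"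

lemma C_nonneg: "C \<ge> 0"
 using v0_lip[of 1 0] by simp

lemma v0_cont: "continuous_on UNIV v0"
proof -
 have "C-lipschitz_on UNIV v0"
  by (rule lipschitz_onI) (use v0_lip C_nonneg in \<open>auto simp: dist_real_def\<close>)
 thus ?thesis by (rule lipschitz_on_continuous_on)
qed

definition C1 :: real where "C1 = C + \<bar>v0 0\<bar>"

lemma C1: "C1 \<ge> 0" "- C1 * \<bar>z\<bar> - C1 \<le> v0 z"
proof -
 show "C1 \<ge> 0" using C_nonneg by (simp add: C1_def)
 have "C * \<bar>z\<bar> \<le> C1 * \<bar>z\<bar>" by (intro mult_right_mono) (auto simp: C1_def)
 moreover have "\<bar>v0 z - v0 0\<bar> \<le> C * \<bar>z\<bar>" using v0_lip[of z 0] by simp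
 moreover have "\<bar>v0 0\<bar> \<le> C1" using C_nonneg by (simp add: C1_def)
 moreover have "- C1 * \<bar>z\<bar> = - (C1 * \<bar>z\<bar>)" by simp
 ultimately show "- C1 * \<bar>z\<bar> - C1 \<le> v0 z" by linarith
qed

lemma min_ex:
 assumes "t > 0"
 shows "\<exists>c\<in>control_curves x t. \<exists>cc. pc c 0 t cc \<and>
  (\<forall>d cc'. pc d 0 t cc' --> d t = x --> v0 (c 0) + cc \<le> v0 (d 0) + cc')"
proof -
 obtain z m where zm: "red t z x m" "\<And>z' m'. red t z' x m' ==> v0 z + m \<le> v0 z' + m'"
  using exists_min[OF assms closed_UNIV UNIV_I v0_cont C1(1) C1(2), where x = x] by auto
 obtain c cc where g: "c \<in> control_curves x t" "c 0 = z" "pc c 0 t cc" "cc \<le> m"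
  using red_pc[OF assms zm(1)] by blast
 show ?thesis
 proof (intro bexI[OF _ g(1)] exI conjI allI impI)
  show "pc c 0 t cc" by (rule g(3))
  fix d cc' assume dd: "pc d 0 t cc'" "d t = x"
  then obtain m' where "m' \<le> cc'" "red t (d 0) x m'" using pc_red by blast
  thus "v0 (c 0) + cc \<le> v0 (d 0) + cc'" using zm(2)[of "d 0" m'] g by simp
 qed
qed

lemma control_end: "c \<in> control_curves x t ==> c t = x"
 unfolding control_curves_def by blast

lemma v_min:
 assumes "t \<ge> 0"
 shows "\<exists>c\<in>control_curves x t. \<exists>cc. pc c 0 t cc \<and> v x t = v0 (c 0) + cc"
  and "pc d 0 t cc' ==> d t = x ==> v x t \<le> v0 (d 0) + cc'"
proof -
 have "\<exists>c\<in>control_curves x t. \<exists>cc. pc c 0 t cc \<and>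
  (\<forall>d cc'. pc d 0 t cc' --> d t = x --> v0 (c 0) + cc \<le> v0 (d 0) + cc')"
 proof (cases "t = 0")
  case True
  have "(%_. x) \<in> control_curves x 0"
   unfolding control_curves_def using segment_iff[of 0 0] by (auto simp: affon_def same_side_def zero_le_mult_iff)
  moreover have "cc' = 0" if "pc d 0 0 cc'" for d cc' using pc_self that .
  ultimately show ?thesis unfolding True using pc_refl[of "%_. x" 0] by (intro bexI[of _ "%_. x"] exI[of _ 0]) auto
 next
  case False thus ?thesis using min_ex assms by auto
 qed
 then obtain c cc where g: "c \<in> control_curves x t" "pc c 0 t cc"
  "\<And>d cc'. pc d 0 t cc' ==> d t = x ==> v0 (c 0) + cc \<le> v0 (d 0) + cc'" by blast
 have "v x t = v0 (c 0) + cc" unfolding v_def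
 proof (rule cInf_eq_minimum)
  show "v0 (c 0) + cc \<in> curve_cost f g v0 t ` control_curves x t"
   using g(1) curve_cost_pc[OF g(2)] by (metis imageI)
  fix w assume "w \<in> curve_cost f g v0 t ` control_curves x t"
  then obtain d where dd: "d \<in> control_curves x t" "w = curve_cost f g v0 t d" by blast
  obtain cc' where "pc d 0 t cc'" using control_curve_pc[OF dd(1) assms] by blast
  thus "v0 (c 0) + cc \<le> w" using g(3) control_end[OF dd(1)] curve_cost_pc dd(2) by metis
 qed
 thus "\<exists>c\<in>control_curves x t. \<exists>cc. pc c 0 t cc \<and> v x t = v0 (c 0) + cc"
  "pc d 0 t cc' ==> d t = x ==> v x t \<le> v0 (d 0) + cc'" using g by auto
qed

lemma v_0: "v x 0 = v0 x"
proof -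
 obtain c cc where "c \<in> control_curves x 0" "pc c 0 0 cc" "v x 0 = v0 (c 0) + cc" using v_min(1)[of 0 x] by auto
 thus ?thesis using pc_self control_end by fastforce
qed

lemma ex_opt: "t \<ge> 0 ==> \<exists>c\<in>control_curves x t. isopt c t \<and> c t = x"
 using v_min(1)[of t x] control_end unfolding isopt_def by metis

lemma opt_iff:
 assumes "c \<in> control_curves x t" "t \<ge> 0"
 shows "isopt c t \<longleftrightarrow> curve_cost f g v0 t c = v x t"
 using control_curve_pc[OF assms] control_end[OF assms(1)] curve_cost_pc unfolding isopt_def by metis

text \<open>Dynamic programming: continue an optimal path that ends at \<open>c s\<close> along \<open>c\<close>.\<close>

lemma v_le:
 assumes "pc c s t cc" "0 \<le> s"
 shows "v (c t) t \<le> v (c s) s + cc"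
proof -
 obtain d where dd: "isopt d s" "d s = c s" using ex_opt[OF assms(2), of "c s"] by blast
 then obtain cc' where cc': "pc d 0 s cc'" "v (c s) s = v0 (d 0) + cc'" unfolding isopt_def by auto
 have st: "s \<le> t" using pc_le assms by blast
 let ?h = "%r. if r \<le> s then d r else c r"
 have h: "pc ?h 0 t (cc' + cc)" by (rule pc_glue[OF cc'(1) assms(1) dd(2)])
 have ht: "?h t = c t" using dd(2) st by (cases "t = s") auto
 have "0 \<le> t" using st assms(2) by simp
 from v_min(2)[OF this h ht] have "v (c t) t \<le> v0 (?h 0) + (cc' + cc)" .
 thus ?thesis using cc'(2) assms(2) by simp
qed

lemma opt_mid:
 assumes "isopt c t" "0 \<le> s" "s \<le> t"
 shows "isopt c s" "\<exists>cc. pc c s t cc \<and> v (c t) t = v (c s) s + cc"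
proof -
 obtain cc where cc: "pc c 0 t cc" "v (c t) t = v0 (c 0) + cc" using assms(1) unfolding isopt_def by blast
 obtain cc1 cc2 where s: "pc c 0 s cc1" "pc c s t cc2" "cc = cc1 + cc2" using pc_split[OF cc(1) assms(2,3)] by blast
 have "v (c t) t \<le> v (c s) s + cc2" using v_le[OF s(2) assms(2)] .
 moreover have "v (c s) s \<le> v0 (c 0) + cc1" using v_min(2)[OF assms(2) s(1)] by simp
 ultimately have *: "v (c s) s = v0 (c 0) + cc1" "v (c t) t = v (c s) s + cc2" using cc(2) s(3) by auto
 show "isopt c s" unfolding isopt_def using s(1) *(1) by blast
 show "\<exists>cc. pc c s t cc \<and> v (c t) t = v (c s) s + cc" using s(2) *(2) by blast
qed

lemma opt_between:
 assumes "isopt c t" "0 \<le> r" "r \<le> s" "s \<le> t"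
 shows "\<exists>cc. pc c r s cc \<and> v (c s) s = v (c r) r + cc"
proof -
 have "0 \<le> s" using assms by simp
 thus ?thesis using opt_mid(2)[OF opt_mid(1)[OF assms(1) _ assms(4)] assms(2,3)] by simp
qed

lemma opt_ext:
 assumes "isopt c s" "pc c s t cc" "v (c t) t = v (c s) s + cc" "0 \<le> s"
 shows "isopt c t"
proof -
 obtain cc' where cc': "pc c 0 s cc'" "v (c s) s = v0 (c 0) + cc'" using assms(1) unfolding isopt_def by blast
 thus ?thesis unfolding isopt_def using pc_append[OF assms(2) cc'(1)] assms(3) by (intro exI[of _ "cc' + cc"]) simp
qed

lemma opt_cong: "isopt c t ==> (\<And>s. s \<in> {0..t} ==> d s = c s) ==> 0 \<le> t ==> isopt d t"
 unfolding isopt_def using pc_cong[of c 0 t _ d] by (metis atLeastAtMost_iff order_refl)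

text \<open>Both curves have paid \<open>v\<close> when they meet, so one may switch from one to the other.\<close>

lemma opt_glue:
 assumes "isopt d s" "isopt c t" "0 \<le> s" "s \<le> t" "d s = c s"
 shows "isopt (%r. if r \<le> s then d r else c r) t"
proof -
 let ?h = "%r. if r \<le> s then d r else c r"
 obtain cc where cc: "pc c s t cc" "v (c t) t = v (c s) s + cc" using opt_mid(2)[OF assms(2-4)] by blast
 have ht: "?h t = c t" using assms(4,5) by (cases "t = s") auto
 show ?thesis
 proof (rule opt_ext[of ?h s t cc])
  show "isopt ?h s" by (rule opt_cong[OF assms(1)]) (use assms in auto)
  show "pc ?h s t cc" by (rule pc_cong[OF cc(1)]) (use assms(5) in auto)
  show "v (?h t) t = v (?h s) s + cc" unfolding ht using cc(2) assms(5) by simp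
 qed (rule assms(3))
qed

lemma opt_cont: "isopt c t ==> continuous_on {0..t} c"
 unfolding isopt_def using pc_cont by blast

subsection \<open>Minimisers are straight away from the interface\<close>

lemma cont_nonneg_end:
 fixes c :: "real => real"
 assumes "continuous_on {a..b} c" "a < b" "\<And>s. s \<in> {a<..<b} ==> c s > 0"
 shows "c a \<ge> 0" "c b \<ge> 0"
proof -
 have cl: "closure {a<..<b} = {a..b}" using assms(2) by simp
 have "\<forall>x\<in>closure {a<..<b}. c x \<ge> 0"
  by (rule ballI, rule continuous_ge_on_closure[of "{a<..<b}" c _ 0]) (use assms cl in \<open>auto intro: less_imp_le\<close>)
 thus "c a \<ge> 0" "c b \<ge> 0" using assms(2) unfolding cl by auto
qed

lemma opt_pos:
 assumes "isopt c t" "0 \<le> a" "a < b" "b \<le> t" "\<And>s. s \<in> {a<..<b} ==> c s > 0"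
 shows "affon c a b" "v (c b) b = v (c a) a + (b - a) * F.L ((c b - c a) / (b - a))"
proof -
 have ab: "a \<le> b" using assms(3) by simp
 obtain cc where cc: "pc c a b cc" "v (c b) b = v (c a) a + cc" using opt_between[OF assms(1,2) ab assms(4)] by blast
 have nn: "c a \<ge> 0" "c b \<ge> 0" using cont_nonneg_end[OF pc_cont[OF cc(1)] assms(3,5)] by auto
 have "pc (line a b (c a) (c b)) a b (seg (b - a) (c a) (c b))"
  by (rule pc_line[OF assms(3)]) (use nn in \<open>auto simp: same_side_def\<close>)
 hence "v (c b) b \<le> v (c a) a + seg (b - a) (c a) (c b)"
  using v_le[OF _ assms(2)] assms(3) by fastforce
 also have "seg (b - a) (c a) (c b) \<le> (b - a) * F.L ((c b - c a) / (b - a))"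
 proof (cases "c a = 0 \<and> c b = 0")
  case True thus ?thesis using K0_le assms(3) by (simp add: mult_left_mono)
 next
  case False thus ?thesis using nn by (auto simp: seg_def)
 qed
 finally have "cc \<le> (b - a) * F.L ((c b - c a) / (b - a))" using cc(2) by simp
 hence eq: "cc = (b - a) * F.L ((c b - c a) / (b - a))" using pc_pos(1)[OF cc(1) assms(3,5)] by simp
 show "affon c a b" using pc_pos(2)[OF cc(1) assms(3,5) eq] .
 show "v (c b) b = v (c a) a + (b - a) * F.L ((c b - c a) / (b - a))" using cc(2) eq by simp
qed

lemma opt_nonpos:
 assumes "isopt c t" "0 \<le> a" "a < b" "b \<le> t" "\<And>s. s \<in> {a..b} ==> c s \<le> 0"
 shows "affon c a b" "v (c b) b = v (c a) a + (b - a) * G.L ((c b - c a) / (b - a))"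
proof -
 have ab: "a \<le> b" using assms(3) by simp
 obtain cc where cc: "pc c a b cc" "v (c b) b = v (c a) a + cc" using opt_between[OF assms(1,2) ab assms(4)] by blast
 have np: "c a \<le> 0" "c b \<le> 0" using assms(5) ab by auto
 have "pc (line a b (c a) (c b)) a b (seg (b - a) (c a) (c b))"
  by (rule pc_line[OF assms(3)]) (use np in \<open>auto simp: same_side_def\<close>)
 hence "v (c b) b \<le> v (c a) a + seg (b - a) (c a) (c b)"
  using v_le[OF _ assms(2)] assms(3) by fastforce
 hence eq: "cc = seg (b - a) (c a) (c b)" using pc_nonpos(1)[OF cc(1) assms(3,5)] cc(2) by simp
 show "affon c a b" using pc_nonpos(2)[OF cc(1) assms(3,5) eq] .
 show "v (c b) b = v (c a) a + (b - a) * G.L ((c b - c a) / (b - a))"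
  using cc(2) eq np by (simp add: seg_def)
qed

lemma cont_nonpos_end:
 fixes c :: "real => real"
 assumes "continuous_on {a..b} c" "a < b" "\<And>s. s \<in> {a<..<b} ==> c s < 0" "s \<in> {a..b}"
 shows "c s \<le> 0"
 using cont_nonneg_end[of a b "%s. - c s"] assms continuous_on_minus[OF assms(1)]
 by (cases "s = a \<or> s = b") (auto intro: less_imp_le)

text \<open>Gluing at the common point, in either order, gives minimisers that are affine again; an affine function is determined
by its values on either half.\<close>

lemma coincide_aux:
 assumes opt: "isopt c t" "isopt d t" and o: "0 \<le> a" "a < s" "s < b" "b \<le> t" and eq: "c s = d s"
  and aff: "\<And>\<eta>. isopt \<eta> t ==> (\<And>u. u \<in> {a..b} ==> \<eta> u = c u \<or> \<eta> u = d u) ==> affon \<eta> a b"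
  and u: "u \<in> {a..b}"
 shows "c u = d u"
proof -
 let ?h = "%r. if r \<le> s then d r else c r"
 have s0: "0 \<le> s" "s \<le> t" using o by auto
 have h: "isopt ?h t" using opt_glue[OF opt_mid(1)[OF opt(2) s0] opt(1) s0] eq by simp
 have A: "affon ?h a b" "affon c a b" "affon d a b"
  by (rule aff, rule h, simp) (rule aff, rule opt, simp, rule aff, rule opt, simp)
 have 1: "?h r = c r" if "r \<in> {a..b}" for r
  by (rule affon_eq[OF A(1,2), of s b]) (use o eq that in auto)
 have 2: "?h r = d r" if "r \<in> {a..b}" for r
  by (rule affon_eq[OF A(1,3), of a s]) (use o eq that in auto)
 show ?thesis using 1[OF u] 2[OF u] by simp
qed

lemma coincide_pos:
 assumes opt: "isopt c t" "isopt d t" and o: "0 \<le> a" "a < s" "s < b" "b \<le> t" and eq: "c s = d s"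
  and pos: "\<And>u. u \<in> {a..b} ==> d u > 0" and u: "u \<in> {a..b}"
 shows "c u = d u"
proof -
 have "continuous_on {a..b} c" by (rule continuous_on_subset[OF opt_cont[OF opt(1)]]) (use o in auto)
 moreover have "c s > 0" using pos[of s] eq o by auto
 ultimately obtain a' b' where ab: "a \<le> a'" "a' < s" "s < b'" "b' \<le> b" "\<forall>u\<in>{a'<..<b'}. c u > 0"
  "a' = a \<or> c a' = 0" "b' = b \<or> c b' = 0" using pos_interval o by blast
 have cc: "c r = d r" if r: "r \<in> {a'..b'}" for r
 proof (rule coincide_aux[OF opt, of a' s b'])
  fix \<eta> assume h: "isopt \<eta> t" "\<And>u. u \<in> {a'..b'} ==> \<eta> u = c u \<or> \<eta> u = d u"
  show "affon \<eta> a' b'"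
  proof (rule opt_pos(1)[OF h(1)])
   show "\<eta> u > 0" if "u \<in> {a'<..<b'}" for u
    using h(2)[of u] ab pos[of u] that by auto
  qed (use ab o in auto)
 qed (use ab o eq r in auto)
 have "a' = a" "b' = b" using ab(6,7) cc[of a'] cc[of b'] pos[of a'] pos[of b'] ab(1-4) by auto
 thus ?thesis using cc u by simp
qed

lemma coincide_neg:
 assumes opt: "isopt c t" "isopt d t" and o: "0 \<le> a" "a < s" "s < b" "b \<le> t" and eq: "c s = d s"
  and pos: "\<And>u. u \<in> {a..b} ==> d u < 0" and u: "u \<in> {a..b}"
 shows "c u = d u"
proof -
 have cg: "continuous_on {a..b} c" by (rule continuous_on_subset[OF opt_cont[OF opt(1)]]) (use o in auto)
 hence "continuous_on {a..b} (%u. - c u)" by (intro continuous_intros)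
 moreover have "- c s > 0" using pos[of s] eq o by auto
 ultimately obtain a' b' where ab: "a \<le> a'" "a' < s" "s < b'" "b' \<le> b" "\<forall>u\<in>{a'<..<b'}. - c u > 0"
  "a' = a \<or> - c a' = 0" "b' = b \<or> - c b' = 0" using pos_interval o by blast
 have cg': "continuous_on {a'..b'} c" by (rule continuous_on_subset[OF cg]) (use ab in auto)
 have np: "c u \<le> 0" if "u \<in> {a'..b'}" for u
  by (rule cont_nonpos_end[OF cg']) (use ab that in auto)
 have cc: "c r = d r" if r: "r \<in> {a'..b'}" for r
 proof (rule coincide_aux[OF opt, of a' s b'])
  fix \<eta> assume h: "isopt \<eta> t" "\<And>u. u \<in> {a'..b'} ==> \<eta> u = c u \<or> \<eta> u = d u"
  show "affon \<eta> a' b'"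
  proof (rule opt_nonpos(1)[OF h(1)])
   show "\<eta> u \<le> 0" if "u \<in> {a'..b'}" for u
    using h(2)[OF that] np[OF that] pos[of u] that ab by auto
  qed (use ab o in auto)
 qed (use ab o eq r in auto)
 have "a' = a" "b' = b" using ab(6,7) cc[of a'] cc[of b'] pos[of a'] pos[of b'] ab(1-4) by auto
 thus ?thesis using cc u by simp
qed

subsection \<open>Lipschitz continuity and bounded speed\<close>

lemma pc_shift: "pc c a b cc ==> pc (%s. c (s + h)) (a - h) (b - h) cc"
proof (induction rule: pc.induct)
 case (pc_refl a) show ?case by (rule pc.pc_refl)
next
 case (pc_step a b cc b')
 have "affon (%s. c (s + h)) (b - h) (b' - h)"
 proof -
  from affonD[OF pc_step.hyps(3)] obtain k m where "\<forall>u\<in>{b..b'}. c u = k + m * u" by (elim exE conjE)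
  thus ?thesis by (intro affonI[of _ _ _ "k + m * h" m]) (auto simp: algebra_simps)
 qed
 hence "pc (%s. c (s + h)) (a - h) (b' - h) (cc + seg ((b' - h) - (b - h)) (c (b - h + h)) (c (b' - h + h)))"
  using pc_step by (intro pc.pc_step) auto
 thus ?case by simp
qed

lemma v_time_up: "0 \<le> t ==> 0 \<le> h ==> v x (t + h) \<le> v x t + h * F.L 0"
proof -
 assume t: "0 \<le> t" "0 \<le> h"
 have "pc (%_. x) t (t + h) (seg h x x)"
  using pc_affon[of t "t + h" "%_. x"] pc_refl[of "%_. x" t] t
  by (cases "h = 0") (auto simp: affon_def same_side_iff)
 from v_le[OF this t(1)] have "v x (t + h) \<le> v x t + seg h x x" by simp
 moreover have "seg h x x \<le> h * F.L 0" using K0_le t(2) by (simp add: seg_def mult_left_mono)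
 ultimately show ?thesis by simp
qed

lemma v_low0: "0 \<le> h ==> v0 x - h * DD C \<le> v x h"
proof -
 assume h: "0 \<le> h"
 obtain c cc where g: "c \<in> control_curves x h" "pc c 0 h cc" "v x h = v0 (c 0) + cc" using v_min(1)[OF h, of x] by blast
 have "v0 x - C * \<bar>x - c 0\<bar> \<le> v0 (c 0)" using v0_lip[of x "c 0"] by linarith
 thus ?thesis using pc_lower[OF g(2) C_nonneg] control_end[OF g(1)] g(3) by simp
qed

lemma v_time_low: "0 \<le> t ==> 0 \<le> h ==> v x t - h * DD C \<le> v x (t + h)"
proof -
 assume t: "0 \<le> t" "0 \<le> h"
 obtain c where g: "isopt c (t + h)" "c (t + h) = x" using ex_opt[of "t + h" x] t by auto
 obtain cc where cc: "pc c h (t + h) cc" "v x (t + h) = v (c h) h + cc"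
  using opt_mid(2)[OF g(1) t(2)] t g(2) by auto
 have "pc (%s. c (s + h)) 0 t cc" using pc_shift[OF cc(1), of h] by simp
 hence "v x t \<le> v0 (c h) + cc" using v_min(2)[OF t(1)] g(2) by fastforce
 thus ?thesis using cc(2) v_low0[OF t(2), of "c h"] by simp
qed

definition M1 :: real where
 "M1 = \<bar>F.L 1\<bar> + \<bar>F.L (-1)\<bar> + \<bar>G.L 1\<bar> + \<bar>G.L (-1)\<bar> + \<bar>F.L 0\<bar> + \<bar>K0\<bar>"

lemma seg_unit:
 assumes "same_side a b" "dd = \<bar>b - a\<bar>"
 shows "seg dd a b \<le> dd * M1"
proof (cases "a = b")
 case False
 hence "dd > 0" "(b - a) / dd = 1 \<or> (b - a) / dd = -1" using assms(2)
  by (auto simp: abs_if divide_eq_minus_1_iff)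
 hence "G.L ((b - a) / dd) \<le> M1" "F.L ((b - a) / dd) \<le> M1" unfolding M1_def by auto
 thus ?thesis using \<open>dd > 0\<close> unfolding seg_def by (simp add: mult_left_mono)
qed (use assms in simp)

lemma move: "0 \<le> t ==> v x' (t + \<bar>x' - x\<bar>) \<le> v x t + \<bar>x' - x\<bar> * M1"
proof -
 have same: "v b (r + \<bar>b - a\<bar>) \<le> v a r + \<bar>b - a\<bar> * M1" if "same_side a b" "0 \<le> r" for a b r
 proof (cases "a = b")
  case False
  hence "pc (line r (r + \<bar>b - a\<bar>) a b) r (r + \<bar>b - a\<bar>) (seg (r + \<bar>b - a\<bar> - r) a b)"
   by (intro pc_line that(1)) auto
  from v_le[OF this that(2)] have "v b (r + \<bar>b - a\<bar>) \<le> v a r + seg \<bar>b - a\<bar> a b" using False by simp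
  thus ?thesis using seg_unit[OF that(1) refl] by simp
 qed simp
 assume t: "0 \<le> t"
 show ?thesis
 proof (cases "same_side x x'")
  case True thus ?thesis using same t by blast
 next
  case False
  hence *: "\<bar>x' - x\<bar> = \<bar>x'\<bar> + \<bar>x\<bar>" unfolding same_side_def by auto
  have ss: "same_side a 0" "same_side 0 a" for a by (auto simp: same_side_iff)
  have "v 0 (t + \<bar>x\<bar>) \<le> v x t + \<bar>x\<bar> * M1" using same[OF ss(1) t, of x] by simp
  moreover have "v x' (t + \<bar>x\<bar> + \<bar>x'\<bar>) \<le> v 0 (t + \<bar>x\<bar>) + \<bar>x'\<bar> * M1"
   using same[OF ss(2), of "t + \<bar>x\<bar>" x'] t by simp
  ultimately show ?thesis unfolding * by (simp add: algebra_simps)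
 qed
qed

definition CL :: real where "CL = C + \<bar>F.L 0\<bar> + DD C + M1"

lemma M1_nonneg: "M1 \<ge> 0" by (simp add: M1_def)
lemma CL_nonneg: "CL \<ge> 0" using C_nonneg DD_nonneg M1_nonneg by (simp add: CL_def)

lemma v_space: assumes t: "0 \<le> t" shows "v x' t - v x t \<le> CL * \<bar>x' - x\<bar>"
proof -
 let ?e = "\<bar>x' - x\<bar>"
 have M: "?e * M1 + ?e * DD C \<le> CL * ?e" "C * ?e + ?e * \<bar>F.L 0\<bar> + ?e * DD C \<le> CL * ?e"
  unfolding CL_def using C_nonneg DD_nonneg M1_nonneg by (auto simp: algebra_simps)
 show ?thesis
 proof (cases "?e \<le> t")
  case True
  have "v x' (t - ?e + ?e) \<le> v x (t - ?e) + ?e * M1" by (rule move) (use True in simp)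
  moreover have "v x (t - ?e) - ?e * DD C \<le> v x (t - ?e + ?e)" by (rule v_time_low) (use True in auto)
  ultimately show ?thesis using M(1) by simp
 next
  case False
  have "v x' t \<le> v0 x' + t * F.L 0" using v_time_up[of 0 t x'] t v_0 by simp
  moreover have "t * F.L 0 \<le> ?e * \<bar>F.L 0\<bar>" using False t
   by (meson abs_ge_self abs_ge_zero mult_mono mult_left_mono order_trans less_imp_le not_le)
  moreover have "t * DD C \<le> ?e * DD C" using False DD_nonneg by (intro mult_right_mono) auto
  ultimately show ?thesis using v_low0[OF t, of x] v0_lip[of x' x] M(2) by linarith
 qed
qed

lemma v_lip_x: "0 \<le> t ==> \<bar>v x' t - v x t\<bar> \<le> CL * \<bar>x' - x\<bar>"
 using v_space[of t x' x] v_space[of t x x'] by (simp add: abs_minus_commute)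

lemma v_lip_t: assumes "0 \<le> t" "0 \<le> t'" shows "\<bar>v x t' - v x t\<bar> \<le> CL * \<bar>t' - t\<bar>"
proof -
 have main: "\<bar>v x (r + h) - v x r\<bar> \<le> CL * h" if "0 \<le> r" "0 \<le> h" for r h
 proof -
  have "F.L 0 \<le> CL" "DD C \<le> CL"
   unfolding CL_def using C_nonneg DD_nonneg[of C] M1_nonneg abs_ge_self[of "F.L 0"] by linarith+
  hence "h * F.L 0 \<le> CL * h" "h * DD C \<le> CL * h"
   unfolding mult.commute[of h] using that(2) by (auto intro!: mult_right_mono)
  thus ?thesis using v_time_up[OF that, of x] v_time_low[OF that, of x] by linarith
 qed
 show ?thesis
 proof (cases "t \<le> t'")
  case True thus ?thesis using main[of t "t' - t"] assms by simp
 next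
  case False thus ?thesis using main[of t' "t - t'"] assms by (simp add: abs_minus_commute)
 qed
qed

lemma v_lip: "0 \<le> t ==> 0 \<le> t' ==> \<bar>v x' t' - v x t\<bar> \<le> CL * (\<bar>x' - x\<bar> + \<bar>t' - t\<bar>)"
 using v_lip_x[of t' x' x] v_lip_t[of t t' x] by (simp add: algebra_simps)

definition Q :: real where "Q = CL + DD (CL + 1)"

lemma Q_nonneg: "Q \<ge> 0" using CL_nonneg DD_nonneg by (simp add: Q_def)

text \<open>Going faster than \<open>Q\<close> would cost more than \<open>v\<close>, which has Lipschitz constant \<open>CL\<close>, can vary.\<close>

lemma opt_speed:
 assumes "isopt c t" "0 \<le> r" "r \<le> s" "s \<le> t"
 shows "\<bar>c s - c r\<bar> \<le> Q * (s - r)"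
proof -
 obtain cc where cc: "pc c r s cc" "v (c s) s = v (c r) r + cc" using opt_between[OF assms] by blast
 have "(CL + 1) * \<bar>c s - c r\<bar> - (s - r) * DD (CL + 1) \<le> cc" using pc_lower[OF cc(1)] CL_nonneg by simp
 moreover have "cc \<le> CL * (\<bar>c s - c r\<bar> + \<bar>s - r\<bar>)" using v_lip[of r s "c s" "c r"] assms cc(2) by simp
 ultimately show ?thesis using assms(3) unfolding Q_def by (simp add: algebra_simps)
qed

end


section \<open>One step of the Hopf-Lax operator\<close>

context conv_flux begin

lemma four_point:
 assumes "\<alpha> < c1" "\<alpha> < c2" "\<alpha> + \<beta> = c1 + c2"
 shows "L c1 + L c2 < L \<alpha> + L \<beta>"
proof -
 have *: "L cc + L dd < L \<alpha> + L \<beta>" if "\<alpha> < cc" "\<alpha> + \<beta> = cc + dd" "cc \<le> dd" for cc dd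
 proof -
  have "L cc + dL cc * (\<alpha> - cc) < L \<alpha>" using that by (intro L_tangent_strict) auto
  moreover have "L dd + dL dd * (\<beta> - dd) \<le> L \<beta>" by (rule L_tangent)
  moreover have "dL cc * (cc - \<alpha>) \<le> dL dd * (cc - \<alpha>)" using that by (intro mult_right_mono) auto
  moreover have "\<beta> - dd = cc - \<alpha>" using that by simp
  ultimately show ?thesis by (simp add: algebra_simps)
 qed
 show ?thesis using *[of c1 c2] *[of c2 c1] assms by linarith
qed

lemma four_point_le:
 assumes "\<alpha> \<le> c1" "\<alpha> \<le> c2" "\<alpha> + \<beta> = c1 + c2"
 shows "L c1 + L c2 \<le> L \<alpha> + L \<beta>"
proof (cases "\<alpha> < c1 \<and> \<alpha> < c2")
 case True thus ?thesis using four_point assms by (meson less_imp_le)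
next
 case False
 hence "c1 = \<alpha> \<and> c2 = \<beta> \<or> c2 = \<alpha> \<and> c1 = \<beta>" using assms by auto
 thus ?thesis by auto
qed

definition QL :: "real => real" where
 "QL M = \<bar>L 0\<bar> + max \<bar>f (M + 1)\<bar> \<bar>f (- (M + 1))\<bar>"

lemma QL_nonneg: "QL M \<ge> 0" by (auto simp: QL_def)

definition HL :: "real => (real => real) => real => real" where
 "HL h W x = (INF y. W y + h * L ((x - y) / h))"

definition lipc :: "real => (real => real) => bool" where
 "lipc M W \<longleftrightarrow> (\<forall>x y. \<bar>W x - W y\<bar> \<le> M * \<bar>x - y\<bar>)"

lemma lipc_nonneg: "lipc M W ==> M \<ge> 0"
 unfolding lipc_def by (drule spec[of _ 1], drule spec[of _ 0]) simp

lemma lipc_cont: assumes "lipc M W" shows "continuous_on A W"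
proof -
 have "M-lipschitz_on UNIV W"
  by (rule lipschitz_onI) (use assms lipc_nonneg[OF assms] in \<open>auto simp: dist_real_def lipc_def\<close>)
 thus ?thesis using lipschitz_on_continuous_on continuous_on_subset by blast
qed

lemma HL_far:
 assumes W: "lipc M W" and h: "h > 0" and y: "\<bar>x - y\<bar> > QL M * h"
 shows "W x + h * L 0 < W y + h * L ((x - y) / h)"
proof -
 have "(M + 1) * \<bar>(x - y) / h\<bar> - max (f (M + 1)) (f (- (M + 1))) \<le> L ((x - y) / h)" by (rule L_superlinear)
 moreover have "max (f (M + 1)) (f (- (M + 1))) \<le> max \<bar>f (M + 1)\<bar> \<bar>f (- (M + 1))\<bar>" by auto
 ultimately have "h * ((M + 1) * \<bar>(x - y) / h\<bar> - max \<bar>f (M + 1)\<bar> \<bar>f (- (M + 1))\<bar>) \<le> h * L ((x - y) / h)"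
  using h by (intro mult_left_mono) auto
 moreover have "h * ((M + 1) * \<bar>(x - y) / h\<bar> - X) = (M + 1) * \<bar>x - y\<bar> - h * X" for X
  using h by (simp add: right_diff_distrib)
 ultimately have "(M + 1) * \<bar>x - y\<bar> - h * max \<bar>f (M + 1)\<bar> \<bar>f (- (M + 1))\<bar> \<le> h * L ((x - y) / h)"
  by simp
 moreover have "W x - W y \<le> M * \<bar>x - y\<bar>" using W unfolding lipc_def by (meson abs_le_D1)
 moreover have "\<bar>x - y\<bar> > h * \<bar>L 0\<bar> + h * max \<bar>f (M + 1)\<bar> \<bar>f (- (M + 1))\<bar>" using y unfolding QL_def by (simp add: algebra_simps)
 moreover have "h * L 0 \<le> h * \<bar>L 0\<bar>" using h by (intro mult_left_mono) auto
 ultimately show ?thesis by (simp add: algebra_simps)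
qed

lemma HL_min:
 assumes W: "lipc M W" and h: "h > 0"
 shows "\<exists>y. \<bar>x - y\<bar> \<le> QL M * h \<and> HL h W x = W y + h * L ((x - y) / h)"
  and "HL h W x \<le> W y + h * L ((x - y) / h)"
proof -
 let ?S = "{x - QL M * h..x + QL M * h}"
 let ?F = "%y. W y + h * L ((x - y) / h)"
 have cc: "continuous_on ?S ?F"
  by (intro continuous_intros lipc_cont[OF W] continuous_on_compose2[OF continuous_L[of UNIV]]) (use h in auto)
 have ne: "?S \<noteq> {}" using QL_nonneg[of M] h by auto
 obtain y0 where y0: "y0 \<in> ?S" "\<And>y. y \<in> ?S ==> ?F y0 \<le> ?F y"
  using continuous_attains_inf[OF compact_Icc ne cc] by blast
 have xS: "x \<in> ?S" using QL_nonneg[of M] h by auto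
 have all: "?F y0 \<le> ?F y" for y
 proof (cases "y \<in> ?S")
  case True thus ?thesis using y0 by blast
 next
  case False
  hence "\<bar>x - y\<bar> > QL M * h" by auto
  thus ?thesis using HL_far[OF W h, of x y] y0(2)[OF xS] by simp
 qed
 have eq: "HL h W x = ?F y0" unfolding HL_def by (rule cInf_eq_minimum) (use all in auto)
 show "\<exists>y. \<bar>x - y\<bar> \<le> QL M * h \<and> HL h W x = W y + h * L ((x - y) / h)"
  using y0(1) eq by (intro exI[of _ y0]) auto
 show "HL h W x \<le> W y + h * L ((x - y) / h)" unfolding eq by (rule all)
qed

text \<open>If the minimisers \<open>z\<close> of \<open>W\<close> at \<open>x1\<close> and \<open>y\<close> of \<open>W'\<close> at \<open>x2\<close> are in order, compare the data between
them; otherwise exchange the two, which the convexity of \<open>L\<close> allows.\<close>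

lemma HL_compare:
 assumes W: "lipc M W" "lipc M' W'" and h: "h > 0" and mono: "\<And>y z. y \<le> z ==> W z - W y \<le> W' z - W' y"
  and x: "x1 \<le> x2"
 shows "HL h W x2 - HL h W x1 \<le> HL h W' x2 - HL h W' x1"
proof -
 obtain y where y: "HL h W' x2 = W' y + h * L ((x2 - y) / h)" using HL_min(1)[OF W(2) h] by blast
 obtain z where z: "HL h W x1 = W z + h * L ((x1 - z) / h)" using HL_min(1)[OF W(1) h] by blast
 show ?thesis
 proof (cases "z \<le> y")
  case True
  have "HL h W x2 \<le> W y + h * L ((x2 - y) / h)" "HL h W' x1 \<le> W' z + h * L ((x1 - z) / h)"
   using HL_min(2) W h by blast+
  thus ?thesis using y z mono[OF True] by simp
 next
  case False
  have "HL h W x2 \<le> W z + h * L ((x2 - z) / h)" "HL h W' x1 \<le> W' y + h * L ((x1 - y) / h)"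
   using HL_min(2) W h by blast+
  moreover have "L ((x2 - z) / h) + L ((x1 - y) / h) \<le> L ((x1 - z) / h) + L ((x2 - y) / h)"
   by (rule four_point_le) (use False x h in \<open>auto simp: divide_right_mono add_divide_distrib[symmetric]\<close>)
  hence "h * L ((x2 - z) / h) + h * L ((x1 - y) / h) \<le> h * L ((x1 - z) / h) + h * L ((x2 - y) / h)"
   unfolding distrib_left[symmetric] using h by simp
  ultimately show ?thesis using y z by simp
 qed
qed

lemma HL_affine: "h > 0 ==> HL h (%y. k * y + cc) x = k * x + cc - h * f k"
proof -
 assume h: "h > 0"
 show ?thesis unfolding HL_def
 proof (rule cInf_eq_minimum)
  let ?y = "x - h * deriv f k"
  have "L (deriv f k) = deriv f k * k - f k" using L_eq[of "deriv f k"] unfolding dL_deriv .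
  hence "h * L (deriv f k) = h * (deriv f k * k) - h * f k" by (simp only: right_diff_distrib)
  moreover have "(x - ?y) / h = deriv f k" using h by simp
  ultimately have eq: "k * ?y + cc + h * L ((x - ?y) / h) = k * x + cc - h * f k"
   by (simp only: right_diff_distrib) simp
  show "k * x + cc - h * f k \<in> range (%y. k * y + cc + h * L ((x - y) / h))"
   by (rule image_eqI[where x = "?y"], rule eq[symmetric], rule UNIV_I)
  fix w assume "w \<in> range (%y. k * y + cc + h * L ((x - y) / h))"
  then obtain y where "w = k * y + cc + h * L ((x - y) / h)" by blast
  thus "k * x + cc - h * f k \<le> w" using persp_ge[of h "x - y" k] h by (simp add: algebra_simps)
 qed
qed

definition HLy :: "real => (real => real) => real => real" where
 "HLy h W x = (SOME y. HL h W x = W y + h * L ((x - y) / h))"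

lemma HLy: "lipc M W ==> h > 0 ==> HL h W x = W (HLy h W x) + h * L ((x - HLy h W x) / h)"
 unfolding HLy_def by (rule someI_ex) (use HL_min(1) in blast)

lemma HLy_mono:
 assumes W: "lipc M W" and h: "h > 0"
 shows "mono (HLy h W)"
proof (rule monoI)
 fix z1 z2 :: real assume "z1 \<le> z2"
 show "HLy h W z1 \<le> HLy h W z2"
 proof (rule ccontr)
  assume n: "\<not> HLy h W z1 \<le> HLy h W z2"
  let ?y1 = "HLy h W z1" and ?y2 = "HLy h W z2"
  have lt: "z1 < z2" using \<open>z1 \<le> z2\<close> n by (cases "z1 = z2") auto
  have "HL h W z1 \<le> W ?y2 + h * L ((z1 - ?y2) / h)" "HL h W z2 \<le> W ?y1 + h * L ((z2 - ?y1) / h)"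
   using HL_min(2)[OF W h] by auto
  hence "h * L ((z1 - ?y1) / h) + h * L ((z2 - ?y2) / h) \<le> h * L ((z1 - ?y2) / h) + h * L ((z2 - ?y1) / h)"
   using HLy[OF W h, of z1] HLy[OF W h, of z2] by simp
  hence "L ((z1 - ?y1) / h) + L ((z2 - ?y2) / h) \<le> L ((z1 - ?y2) / h) + L ((z2 - ?y1) / h)"
   unfolding distrib_left[symmetric] using h by simp
  moreover have "L ((z1 - ?y2) / h) + L ((z2 - ?y1) / h) < L ((z1 - ?y1) / h) + L ((z2 - ?y2) / h)"
   by (rule four_point) (use lt n h in \<open>auto simp: divide_strict_right_mono add_divide_distrib[symmetric]\<close>)
  ultimately show False by simp
 qed
qed

text \<open>The state carried by the characteristic from \<open>HLy h W x\<close> to \<open>x\<close>.\<close>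

definition HLu :: "real => (real => real) => real => real" where
 "HLu h W x = dL ((x - HLy h W x) / h)"

lemma HL_slope:
 assumes W: "lipc M W" and h: "h > 0"
 shows "HL h W z - HL h W x \<le> dL ((z - HLy h W x) / h) * (z - x)"
proof -
 let ?y = "HLy h W x"
 have "HL h W z \<le> W ?y + h * L ((z - ?y) / h)" using HL_min(2)[OF W h] .
 moreover have "h * (L ((z - ?y) / h) + dL ((z - ?y) / h) * ((x - ?y) / h - (z - ?y) / h)) \<le> h * L ((x - ?y) / h)"
  using h by (intro mult_left_mono L_tangent) auto
 moreover have "h * (L ((z - ?y) / h) + dL ((z - ?y) / h) * ((x - ?y) / h - (z - ?y) / h)) =
  h * L ((z - ?y) / h) + dL ((z - ?y) / h) * (x - z)" using h by (simp add: field_simps)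
 ultimately show ?thesis using HLy[OF W h, of x] by (simp add: algebra_simps)
qed

lemma HL_DERIV:
 assumes W: "lipc M W" and h: "h > 0" and cc: "isCont (HLy h W) x"
 shows "(HL h W has_real_derivative HLu h W x) (at x)" "isCont (HLu h W) x"
proof -
 let ?a = "%z. dL ((z - HLy h W x) / h)" and ?b = "%z. dL ((x - HLy h W z) / h)"
 have dd: "isCont dL p" for p by (rule isCont_dL)
 have a: "(?a \<longlongrightarrow> HLu h W x) (at x)"
 proof -
  have "isCont ?a x" by (intro isCont_o2[OF _ dd] continuous_intros) (use h in auto)
  thus ?thesis unfolding isCont_def HLu_def .
 qed
 have b: "(?b \<longlongrightarrow> HLu h W x) (at x)"
 proof -
  have "isCont ?b x" by (intro isCont_o2[OF _ dd] continuous_intros cc) (use h in auto)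
  thus ?thesis unfolding isCont_def HLu_def .
 qed
 have s: "\<bar>(HL h W z - HL h W x) / (z - x) - HLu h W x\<bar> \<le> \<bar>?a z - HLu h W x\<bar> + \<bar>?b z - HLu h W x\<bar>" if "z \<noteq> x" for z
 proof -
  have 1: "HL h W z - HL h W x \<le> ?a z * (z - x)" "?b z * (z - x) \<le> HL h W z - HL h W x"
   using HL_slope[OF W h, of z x] HL_slope[OF W h, of x z] by (auto simp: algebra_simps)
  have "min (?a z) (?b z) \<le> (HL h W z - HL h W x) / (z - x)" "(HL h W z - HL h W x) / (z - x) \<le> max (?a z) (?b z)"
  proof -
   show "min (?a z) (?b z) \<le> (HL h W z - HL h W x) / (z - x)"
   proof (cases "x < z")
    case True hence "?b z \<le> (HL h W z - HL h W x) / (z - x)" using 1 by (simp add: pos_le_divide_eq)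
    thus ?thesis by simp
   next
    case False hence "?a z \<le> (HL h W z - HL h W x) / (z - x)" using 1 that by (simp add: neg_le_divide_eq)
    thus ?thesis by simp
   qed
   show "(HL h W z - HL h W x) / (z - x) \<le> max (?a z) (?b z)"
   proof (cases "x < z")
    case True hence "(HL h W z - HL h W x) / (z - x) \<le> ?a z" using 1 by (simp add: pos_divide_le_eq)
    thus ?thesis by simp
   next
    case False hence "(HL h W z - HL h W x) / (z - x) \<le> ?b z" using 1 that by (simp add: neg_divide_le_eq)
    thus ?thesis by simp
   qed
  qed
  thus ?thesis by (auto simp: min_def max_def split: if_splits)
 qed
 have "((%z. \<bar>?a z - HLu h W x\<bar> + \<bar>?b z - HLu h W x\<bar>) \<longlongrightarrow> \<bar>HLu h W x - HLu h W x\<bar> + \<bar>HLu h W x - HLu h W x\<bar>) (at x)"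
  by (intro tendsto_intros a b)
 hence lim0: "((%z. \<bar>?a z - HLu h W x\<bar> + \<bar>?b z - HLu h W x\<bar>) \<longlongrightarrow> 0) (at x)" by simp
 have "((%z. (HL h W z - HL h W x) / (z - x) - HLu h W x) \<longlongrightarrow> 0) (at x)"
  by (rule Lim_null_comparison[OF _ lim0]) (use s in \<open>auto simp: eventually_at_filter\<close>)
 thus "(HL h W has_real_derivative HLu h W x) (at x)"
  unfolding has_field_derivative_iff using LIM_zero_iff by blast
 show "isCont (HLu h W) x" unfolding HLu_def
  by (intro isCont_o2[OF _ dd] continuous_intros cc) (use h in auto)
qed

lemma HL_DERIV_unique:
 assumes W: "lipc M W" and h: "h > 0" and D: "(HL h W has_real_derivative p) (at x)"
 shows "p = HLu h W x"
proof -
 let ?y = "HLy h W x"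
 let ?F = "%z. W ?y + h * L ((z - ?y) / h) - HL h W z"
 have "((%z. L ((z - ?y) / h)) has_real_derivative (dL ((x - ?y) / h) * (1 / h))) (at x)"
  by (rule DERIV_chain2[OF DERIV_L]) (use h in \<open>auto intro!: derivative_eq_intros\<close>)
 hence "(?F has_real_derivative (h * (dL ((x - ?y) / h) * (1 / h)) - p)) (at x)"
  using D by (auto intro!: derivative_eq_intros)
 hence DF: "(?F has_real_derivative (HLu h W x - p)) (at x)" using h by (simp add: HLu_def)
 have "HLu h W x - p = 0"
  by (rule DERIV_local_min[OF DF zero_less_one]) (use HL_min(2)[OF W h] HLy[OF W h, of x] in auto)
 thus ?thesis by simp
qed

text \<open>The minimiser is monotone in \<open>x\<close>, hence continuous off a countable set, and there \<open>HL h W\<close> is differentiable.\<close>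

lemma HL_countable: "lipc M W ==> h > 0 ==> countable {x. \<not> isCont (HLy h W) x}"
 using mono_ctble_discont[OF HLy_mono] by blast

lemma HL_const_bound:
 assumes W: "lipc M W" and h: "h > 0"
 shows "\<bar>W x - HL h W x\<bar> \<le> h * (\<bar>L 0\<bar> + max \<bar>f M\<bar> \<bar>f (- M)\<bar>)"
proof -
 have "HL h W x \<le> W x + h * L 0" using HL_min(2)[OF W h, of x x] by simp
 moreover have "h * L 0 \<le> h * \<bar>L 0\<bar>" using h by (intro mult_left_mono) auto
 moreover obtain y where y: "HL h W x = W y + h * L ((x - y) / h)" using HL_min(1)[OF W h] by blast
 have "M * \<bar>(x - y) / h\<bar> - max (f M) (f (- M)) \<le> L ((x - y) / h)" by (rule L_superlinear)
 moreover have "max (f M) (f (- M)) \<le> max \<bar>f M\<bar> \<bar>f (- M)\<bar>" by auto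
 ultimately have "h * (M * \<bar>(x - y) / h\<bar> - max \<bar>f M\<bar> \<bar>f (- M)\<bar>) \<le> h * L ((x - y) / h)"
  using h by (intro mult_left_mono) auto
 hence "M * \<bar>x - y\<bar> - h * max \<bar>f M\<bar> \<bar>f (- M)\<bar> \<le> h * L ((x - y) / h)"
  using h by (simp add: algebra_simps)
 moreover have "W x - W y \<le> M * \<bar>x - y\<bar>" using W unfolding lipc_def by (meson abs_le_D1)
 moreover have "h * \<bar>L 0\<bar> \<ge> 0" "h * max \<bar>f M\<bar> \<bar>f (- M)\<bar> \<ge> 0" using h by (auto simp: le_max_iff_disj)
 ultimately have "W x - HL h W x \<le> h * (\<bar>L 0\<bar> + max \<bar>f M\<bar> \<bar>f (- M)\<bar>)"
  unfolding distrib_left using y by linarith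
 moreover have "- (W x - HL h W x) \<le> h * (\<bar>L 0\<bar> + max \<bar>f M\<bar> \<bar>f (- M)\<bar>)"
  unfolding distrib_left using \<open>HL h W x \<le> W x + h * L 0\<close> \<open>h * L 0 \<le> h * \<bar>L 0\<bar>\<close> \<open>h * max \<bar>f M\<bar> \<bar>f (- M)\<bar> \<ge> 0\<close> by linarith
 ultimately show ?thesis by linarith
qed

text \<open>Minimisers lie within distance \<open>QL M * h\<close> of \<open>x\<close>, where the data differ by \<open>o(h)\<close> from affine data of slope
\<open>p\<close>; for these the Young inequality gives the decrease \<open>h * f p\<close>.\<close>

lemma HL_time_deriv:
 assumes W: "lipc M W" and D: "(W has_real_derivative p) (at x)"
 shows "((%h. (W x - HL h W x) / h) \<longlongrightarrow> f p) (at_right 0)"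
proof (rule tendstoI)
 fix e :: real assume e: "e > 0"
 define q where "q = deriv f p"
 define B where "B = QL M + \<bar>q\<bar> + 1"
 have B: "B > 0" using QL_nonneg[of M] by (simp add: B_def)
 have "((%y. (W y - W x) / (y - x)) \<longlongrightarrow> p) (at x)" using D by (simp add: has_field_derivative_iff)
 hence "eventually (%y. dist ((W y - W x) / (y - x)) p < e / B / 2) (at x)"
  by (rule tendstoD) (use e B in auto)
 then obtain dd where dd: "dd > 0" "\<And>y. y \<noteq> x ==> \<bar>y - x\<bar> < dd ==> \<bar>(W y - W x) / (y - x) - p\<bar> < e / B / 2"
  unfolding eventually_at by (auto simp: dist_real_def)
 have near: "\<bar>W y - W x - p * (y - x)\<bar> \<le> e / B / 2 * \<bar>y - x\<bar>" if "\<bar>y - x\<bar> < dd" for y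
 proof (cases "y = x")
  case False
  have "W y - W x - p * (y - x) = ((W y - W x) / (y - x) - p) * (y - x)" using False by (simp add: field_simps)
  hence "\<bar>W y - W x - p * (y - x)\<bar> = \<bar>(W y - W x) / (y - x) - p\<bar> * \<bar>y - x\<bar>" by (simp add: abs_mult)
  also have "\<dots> \<le> e / B / 2 * \<bar>y - x\<bar>" using dd(2)[OF False that] by (intro mult_right_mono) auto
  finally show ?thesis .
 qed simp
 have main: "dist ((W x - HL h W x) / h) (f p) < e" if h: "0 < h" "h < dd / B" for h
 proof -
  have hB: "h * B < dd" using h B by (simp add: field_simps)
  have nb: "\<bar>W y - W x - p * (y - x)\<bar> \<le> h * (e / 2)" if "\<bar>y - x\<bar> \<le> h * B" for y
  proof -
   have "\<bar>W y - W x - p * (y - x)\<bar> \<le> e / B / 2 * \<bar>y - x\<bar>" by (rule near) (use that hB in simp)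
   also have "\<dots> \<le> e / B / 2 * (h * B)" using that e B by (intro mult_left_mono) auto
   also have "\<dots> = h * (e / 2)" using B by simp
   finally show ?thesis .
  qed
  have q: "L q = p * q - f p" using L_eq[of q] by (simp add: q_def mult.commute)
  have "HL h W x \<le> W (x - h * q) + h * L ((x - (x - h * q)) / h)" by (rule HL_min(2)[OF W h(1)])
  hence u1: "HL h W x \<le> W (x - h * q) + h * (p * q - f p)" using h q by simp
  have "\<bar>W (x - h * q) - W x - p * (x - h * q - x)\<bar> \<le> h * (e / 2)"
   by (rule nb) (use h QL_nonneg[of M] in \<open>auto simp: B_def abs_mult intro!: mult_left_mono\<close>)
  hence "W (x - h * q) - W x - p * (x - h * q - x) \<le> h * (e / 2)" by linarith
  moreover have "p * (x - h * q - x) = - (h * (p * q))" by simp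
  ultimately have up: "HL h W x \<le> W x - h * f p + h * (e / 2)" using u1 unfolding right_diff_distrib by linarith
  obtain y where y: "\<bar>x - y\<bar> \<le> QL M * h" "HL h W x = W y + h * L ((x - y) / h)" using HL_min(1)[OF W h(1)] by blast
  have "\<bar>y - x\<bar> \<le> h * B"
  proof -
   have "h * QL M \<le> h * B" using h by (intro mult_left_mono) (auto simp: B_def)
   thus ?thesis using y(1) by (simp add: mult.commute abs_minus_commute)
  qed
  from nb[OF this] have "W x + p * (y - x) - h * (e / 2) \<le> W y" by linarith
  moreover have "p * (x - y) - h * f p \<le> h * L ((x - y) / h)" by (rule persp_ge) (use h in auto)
  ultimately have lo: "W x - h * f p - h * (e / 2) \<le> HL h W x" using y(2) by (simp add: algebra_simps)
  have "\<bar>W x - HL h W x - h * f p\<bar> \<le> h * (e / 2)" using up lo by linarith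
  hence "\<bar>(W x - HL h W x) / h - f p\<bar> \<le> e / 2"
   using h(1) by (simp add: abs_le_iff field_simps)
  thus ?thesis using e by (simp add: dist_real_def)
 qed
 have "dd / B > 0" using dd(1) B by simp
 thus "eventually (%h. dist ((W x - HL h W x) / h) (f p) < e) (at_right 0)"
  unfolding eventually_at_right_field using main by blast
qed

end


section \<open>Integration by parts for Lipschitz functions\<close>

definition eps :: "nat => real" where "eps n = 1 / (real n + 1)"

lemma eps_pos: "0 < eps n" "eps n \<le> 1" by (auto simp: eps_def divide_le_eq)

lemma eps_mult: "eps n * (real n + 1) = 1" by (simp add: eps_def add.commute add_eq_0_iff)

lemma eps_lim: "eps \<longlonglongrightarrow> 0"
 using LIMSEQ_inverse_real_of_nat unfolding eps_def by (simp add: inverse_eq_divide add.commute)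

lemma right_quotient_seq:
 assumes "(P has_vector_derivative (w x :: real)) (at x within S)" "\<And>n. x + eps n \<in> S"
 shows "(%n. (P (x + eps n) - P x) * (real n + 1)) \<longlonglongrightarrow> w x"
proof -
 have "(P has_field_derivative w x) (at x within S)"
  using assms(1) by (simp add: has_real_derivative_iff_has_vector_derivative)
 hence l: "((%y. (P y - P x) / (y - x)) \<longlongrightarrow> w x) (at x within S)" by (simp add: has_field_derivative_iff)
 have "(%n. x + eps n) \<longlonglongrightarrow> x + 0" by (intro tendsto_intros eps_lim)
 hence "filterlim (%n. x + eps n) (at x within S) sequentially"
  using assms(2) eps_pos(1) by (auto simp: filterlim_at less_imp_neq[symmetric])
 from filterlim_compose[OF l this] show ?thesis by (simp add: eps_def field_simps)
qed

lemma DERIV_seq: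
 assumes "(w has_real_derivative u) (at x)"
 shows "(%n. (w (x + eps n) - w x) * (real n + 1)) \<longlonglongrightarrow> u"
 using right_quotient_seq[of w "%_. u" x UNIV] assms
 by (simp add: has_real_derivative_iff_has_vector_derivative)

lemma bounded_on_Icc:
 fixes w :: "real => real"
 assumes "continuous_on {a..b} w"
 shows "\<exists>B\<ge>0. \<forall>x\<in>{a..b}. \<bar>w x\<bar> \<le> B"
proof -
 have "bounded (w ` {a..b})" using compact_continuous_image[OF assms compact_Icc] compact_imp_bounded by blast
 then obtain B where "\<forall>x\<in>{a..b}. \<bar>w x\<bar> \<le> B" unfolding bounded_iff by auto
 thus ?thesis by (intro exI[of _ "max B 0"]) (auto simp: le_max_iff_disj)
qed

lemma compact_integrable:
 fixes w :: "'a::euclidean_space => real"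
 assumes m[measurable]: "w \<in> borel_measurable borel" and K: "compact K"
  and b: "\<And>x. x \<in> K ==> \<bar>w x\<bar> \<le> C" and z: "\<And>x. x \<notin> K ==> w x = 0"
 shows "integrable lborel w" "\<bar>integral\<^sup>L lborel w\<bar> \<le> measure lborel K * C"
proof -
 have Km[measurable]: "K \<in> sets borel" using K by (simp add: borel_compact)
 have fin: "emeasure lborel K < \<infinity>" using emeasure_bounded_finite compact_imp_bounded K by blast
 show i: "integrable lborel w"
  by (rule integrableI_bounded_set[where A = K and B = C]) (use b z fin in auto)
 have "\<bar>integral\<^sup>L lborel w\<bar> \<le> (LINT x|lborel. indicator K x * C)"
 proof (rule integral_abs_bound_integral[OF i])
  show "integrable lborel (%x. indicator K x * C)" using fin by (intro integrable_mult_left integrable_real_indicator) auto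
  show "\<bar>w x\<bar> \<le> indicator K x * C" for x using b z by (cases "x \<in> K") auto
 qed
 thus "\<bar>integral\<^sup>L lborel w\<bar> \<le> measure lborel K * C" by simp
qed

lemma compact_DCT:
 fixes w :: "nat => 'a::euclidean_space => real"
 assumes [measurable]: "\<And>n. w n \<in> borel_measurable borel" "w' \<in> borel_measurable borel" and K: "compact K"
  and b: "\<And>n x. x \<in> K ==> \<bar>w n x\<bar> \<le> C" and z: "\<And>n x. x \<notin> K ==> w n x = 0"
  and lim: "AE x in lborel. (%n. w n x) \<longlonglongrightarrow> w' x"
 shows "(%n. LINT x|lborel. w n x) \<longlonglongrightarrow> (LINT x|lborel. w' x)"
proof (rule integral_dominated_convergence[where w = "%x. indicator K x * C"])
 have [measurable]: "K \<in> sets borel" using K by (simp add: borel_compact)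
 show "integrable lborel (%x. indicator K x * C)"
  by (rule compact_integrable(1)[where K = K and C = "\<bar>C\<bar>"]) (use K in auto)
 show "AE x in lborel. norm (w n x) \<le> indicator K x * C" for n
  using b z by (intro AE_I2) (auto simp: indicator_def)
qed (use lim in measurable)

lemma integrable_cut:
 fixes w :: "real => real"
 assumes "w \<in> borel_measurable borel" and "\<And>x. x \<in> {a..b} ==> \<bar>w x\<bar> \<le> B" "\<And>x. x \<notin> {a..b} ==> w x = 0"
 shows "integrable lborel w"
 by (rule compact_integrable(1)[OF assms(1) compact_Icc assms(2,3)])

text \<open>An indefinite integral: for bounded \<open>u\<close> this determines a Lipschitz function up to a constant, without asking for a
derivative anywhere.\<close>

definition prim_of :: "(real => real) => (real => real) => bool" where
 "prim_of V u \<longleftrightarrow> (\<forall>a b. a \<le> b --> V b - V a = (LINT x|lborel. indicator {a..b} x * u x))"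

lemma lip_cont:
 fixes w :: "real => real"
 assumes "\<And>x y. \<bar>w x - w y\<bar> \<le> M * \<bar>x - y\<bar>"
 shows "continuous_on A w" "w \<in> borel_measurable borel"
proof -
 have "M-lipschitz_on UNIV w" by (rule lipschitz_onI) (use assms assms[of 1 0] in \<open>auto simp: dist_real_def\<close>)
 thus "continuous_on A w" "w \<in> borel_measurable borel"
  using lipschitz_on_continuous_on continuous_on_subset borel_measurable_continuous_onI by blast+
qed

text \<open>The fundamental theorem of calculus for Lipschitz functions: on an interval the integral of
 a difference quotient is a difference of two averages over short intervals.\<close>

lemma lip_prim:
 fixes w u :: "real => real"
 assumes lip: "\<And>x y. \<bar>w x - w y\<bar> \<le> M * \<bar>x - y\<bar>"
  and D: "AE x in lborel. (w has_real_derivative u x) (at x)" and u[measurable]: "u \<in> borel_measurable borel"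
 shows "prim_of w u"
 unfolding prim_of_def
proof (intro allI impI)
 fix a b :: real assume ab: "a \<le> b"
 note cw = lip_cont(1)[OF lip, where A = "{a..b+1}"] and [measurable] = lip_cont(2)[OF lip]
 obtain P where P: "\<And>x. x \<in> {a..b+1} ==> (P has_vector_derivative w x) (at x within {a..b+1})"
  using antiderivative_continuous[OF cw] by blast
 define F where "F n x = (w (x + eps n) - w x) * (real n + 1)" for n x
 define G where "G n x = (P (x + eps n) - P x) * (real n + 1)" for n x
 have Fm[measurable]: "F n \<in> borel_measurable borel" for n unfolding F_def by measurable
 have DG: "(G n has_vector_derivative F n x) (at x within {a..b})" if "a \<le> x" "x \<le> b" for n x
 proof -
  let ?s = "%x. x + eps n"
  have sub: "?s ` {a..b} \<subseteq> {a..b+1}" "{a..b} \<subseteq> {a..b+1}" using eps_pos[of n] by auto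
  have xm: "?s x \<in> {a..b+1}" "x \<in> {a..b+1}" using that eps_pos[of n] by auto
  have "(?s has_vector_derivative 1) (at x within {a..b})"
   by (auto intro!: derivative_eq_intros)
  moreover have "(P has_vector_derivative w (?s x)) (at (?s x) within ?s ` {a..b})"
   by (rule has_vector_derivative_within_subset[OF P[OF xm(1)] sub(1)])
  ultimately have "((P \<circ> ?s) has_vector_derivative (1 *\<^sub>R w (?s x))) (at x within {a..b})"
   by (rule vector_diff_chain_within)
  hence 1: "((%x. P (x + eps n)) has_vector_derivative w (x + eps n)) (at x within {a..b})" by (simp add: o_def)
  have 2: "(P has_vector_derivative w x) (at x within {a..b})"
   by (rule has_vector_derivative_within_subset[OF P[OF xm(2)] sub(2)])
  show ?thesis unfolding G_def F_def
   by (intro has_vector_derivative_mult_left has_vector_derivative_diff 1 2)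
 qed
 have cF: "continuous_on {a..b} (F n)" for n
  unfolding F_def
  by (intro continuous_intros continuous_on_compose2[OF cw] continuous_on_subset[OF cw])
   (use eps_pos[of n] in auto)
 have I: "(LINT x|lborel. indicator {a..b} x *\<^sub>R F n x) = G n b - G n a" for n
  by (rule integral_FTC_atLeastAtMost[OF ab DG cF])
 have bnd: "\<bar>F n x\<bar> \<le> M" if "x \<in> {a..b}" for n x
 proof -
  have "\<bar>w (x + eps n) - w x\<bar> \<le> M * \<bar>x + eps n - x\<bar>" by (rule lip)
  hence "\<bar>w (x + eps n) - w x\<bar> * (real n + 1) \<le> M * eps n * (real n + 1)" using eps_pos[of n] by (intro mult_right_mono) auto
  also have "M * eps n * (real n + 1) = M" using eps_mult[of n] by (simp add: mult.assoc)
  finally show ?thesis by (simp add: F_def abs_mult)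
 qed
 have "(%n. LINT x|lborel. indicator {a..b} x *\<^sub>R F n x) \<longlonglongrightarrow> (LINT x|lborel. indicator {a..b} x * u x)"
 proof (rule compact_DCT[where K = "{a..b}" and C = M])
  show "AE x in lborel. (%n. indicator {a..b} x *\<^sub>R F n x) \<longlonglongrightarrow> indicator {a..b} x * u x"
   using D by eventually_elim (use DERIV_seq in \<open>auto simp: F_def intro!: tendsto_mult\<close>)
 qed (use bnd in auto)
 moreover have "(%n. G n b - G n a) \<longlonglongrightarrow> w b - w a" unfolding G_def
 proof (rule tendsto_diff)
  have m: "b + eps n \<in> {a..b+1}" "a + eps n \<in> {a..b+1}" for n using eps_pos[of n] ab by auto
  show "(%n. (P (b + eps n) - P b) * (real n + 1)) \<longlonglongrightarrow> w b"
   by (rule right_quotient_seq[where S = "{a..b+1}"], rule P) (use ab m(1) in auto)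
  show "(%n. (P (a + eps n) - P a) * (real n + 1)) \<longlonglongrightarrow> w a"
   by (rule right_quotient_seq[where S = "{a..b+1}"], rule P) (use ab m(2) in auto)
 qed
 ultimately show "w b - w a = (LINT x|lborel. indicator {a..b} x * u x)" unfolding I using LIMSEQ_unique by blast
qed

lemma prim_lip:
 assumes P: "prim_of V u" and u[measurable]: "u \<in> borel_measurable borel" and ub: "\<And>x. \<bar>u x\<bar> \<le> B"
 shows "\<bar>V x - V y\<bar> \<le> B * \<bar>x - y\<bar>"
proof -
 have *: "\<bar>V b - V a\<bar> \<le> B * (b - a)" if "a \<le> b" for a b
 proof -
  have "\<bar>LINT x|lborel. indicator {a..b} x * u x\<bar> \<le> (LINT x|lborel. indicator {a..b} x * B)"
  proof (rule integral_abs_bound_integral)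
   show "integrable lborel (%x. indicator {a..b} x * u x)"
    by (rule integrable_cut[where a = a and b = b and B = B]) (use ub in \<open>auto simp: indicator_def\<close>)
   show "integrable lborel (%x. indicator {a..b} x * B)"
    by (rule integrable_cut[where a = a and b = b and B = "\<bar>B\<bar>"]) (auto simp: indicator_def)
  qed (use ub in \<open>auto simp: indicator_def\<close>)
  also have "\<dots> = B * (b - a)" using that by simp
  finally show ?thesis using P that unfolding prim_of_def by simp
 qed
 show ?thesis using *[of x y] *[of y x] by (cases "x \<le> y") (auto simp: abs_minus_commute)
qed

definition bump :: "real => (real => real) => (real => real) => bool" where
 "bump R \<psi> \<psi>' \<longleftrightarrow> R > 0 \<and> (\<forall>x. (\<psi> has_real_derivative \<psi>' x) (at x)) \<and> continuous_on UNIV \<psi>' \<and>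
  (\<forall>x. \<bar>x\<bar> \<ge> R --> \<psi> x = 0 \<and> \<psi>' x = 0)"

lemma bump_cont:
 assumes "bump R \<psi> \<psi>'"
 shows "continuous_on A \<psi>" "continuous_on A \<psi>'"
proof -
 have "(\<psi> has_real_derivative \<psi>' x) (at x)" for x using assms by (simp add: bump_def)
 thus "continuous_on A \<psi>" by (intro continuous_at_imp_continuous_on ballI) (rule DERIV_isCont)
 show "continuous_on A \<psi>'"
  by (rule continuous_on_subset[of UNIV]) (use assms in \<open>simp_all add: bump_def\<close>)
qed

lemma bump_meas:
 assumes "bump R \<psi> \<psi>'"
 shows "\<psi> \<in> borel_measurable borel" "\<psi>' \<in> borel_measurable borel"
 by (rule borel_measurable_continuous_onI, rule bump_cont[OF assms])+

lemma bump_bound: assumes "bump R \<psi> \<psi>'" shows "\<exists>B\<ge>0. \<forall>x. \<bar>\<psi> x\<bar> \<le> B \<and> \<bar>\<psi>' x\<bar> \<le> B"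
proof -
 obtain B1 where B1: "B1 \<ge> 0" "\<forall>x\<in>{-R..R}. \<bar>\<psi> x\<bar> \<le> B1" using bounded_on_Icc bump_cont(1)[OF assms] by blast
 obtain B2 where B2: "B2 \<ge> 0" "\<forall>x\<in>{-R..R}. \<bar>\<psi>' x\<bar> \<le> B2" using bounded_on_Icc bump_cont(2)[OF assms] by blast
 have "\<bar>\<psi> x\<bar> \<le> max B1 B2 \<and> \<bar>\<psi>' x\<bar> \<le> max B1 B2" for x
 proof (cases "x \<in> {-R..R}")
  case True thus ?thesis using B1 B2 by (auto simp: le_max_iff_disj)
 next
  case False
  hence "\<bar>x\<bar> \<ge> R" by auto
  thus ?thesis using assms B1 B2 unfolding bump_def by (auto simp: le_max_iff_disj)
 qed
 thus ?thesis using B1 by (intro exI[of _ "max B1 B2"]) auto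
qed

text \<open>Fubini on the triangle below the diagonal, since \<open>V\<close> need not be differentiable everywhere.\<close>

lemma prim_IBP:
 assumes P: "prim_of V u" and u[measurable]: "u \<in> borel_measurable borel" and ub: "\<And>x. \<bar>u x\<bar> \<le> B"
  and \<psi>: "bump R \<psi> \<psi>'"
 shows "(LINT x|lborel. u x * \<psi> x) = - (LINT x|lborel. V x * \<psi>' x)"
proof -
 note [measurable] = bump_meas[OF \<psi>]
 have R: "R > 0" and z: "\<And>x. \<bar>x\<bar> \<ge> R ==> \<psi> x = 0" "\<And>x. \<bar>x\<bar> \<ge> R ==> \<psi>' x = 0"
  and D\<psi>: "\<And>x. (\<psi> has_real_derivative \<psi>' x) (at x)" using \<psi> unfolding bump_def by auto
 have zo: "\<psi> x = 0 \<and> \<psi>' x = 0" if "\<not> (- R \<le> x \<and> x \<le> R)" for x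
 proof -
  have "\<bar>x\<bar> \<ge> R" using that by auto
  thus ?thesis using z by blast
 qed
 obtain B\<psi> where B\<psi>: "B\<psi> \<ge> 0" "\<And>x. \<bar>\<psi> x\<bar> \<le> B\<psi>" "\<And>x. \<bar>\<psi>' x\<bar> \<le> B\<psi>" using bump_bound[OF \<psi>] by blast
 have B: "B \<ge> 0" using order_trans[OF abs_ge_zero ub] .
 have int': "integral\<^sup>L lborel (%x. indicator {a..b} x *\<^sub>R \<psi>' x) = \<psi> b - \<psi> a" if "a \<le> b" for a b
  by (rule integral_FTC_atLeastAtMost[OF that])
   (use D\<psi> bump_cont[OF \<psi>] in \<open>auto simp: has_real_derivative_iff_has_vector_derivative[symmetric] intro: has_field_derivative_at_within\<close>)
 note cV = lip_cont(1)[OF prim_lip[OF P u ub]] and [measurable] = lip_cont(2)[OF prim_lip[OF P u ub]]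
 obtain BV where BV: "BV \<ge> 0" "\<forall>x\<in>{-R..R}. \<bar>V x\<bar> \<le> BV" using bounded_on_Icc cV by blast
 define H where "H x y = indicator {-R..R} x * indicator {-R..x} y * u y * \<psi>' x" for x y
 have Hm[measurable]: "(%(x, y). H x y) \<in> borel_measurable (lborel \<Otimes>\<^sub>M lborel)"
 proof -
  have "(%p. indicator {-R..R} (fst p) * (if -R \<le> snd p \<and> snd p \<le> fst p then 1 else 0) * u (snd p) * \<psi>' (fst p))
   \<in> borel_measurable (lborel \<Otimes>\<^sub>M lborel)" by measurable
  thus ?thesis by (rule measurable_cong[THEN iffD1, rotated]) (auto simp: H_def indicator_def)
 qed
 have inH: "integrable (lborel \<Otimes>\<^sub>M lborel) (%(x, y). H x y)"
 proof -
  have "\<bar>u y * \<psi>' x\<bar> \<le> B * B\<psi>" for x y unfolding abs_mult by (rule mult_mono) (use ub B\<psi> B in auto)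
  hence "integrable lborel (%(x, y). H x y)"
   using B B\<psi>(1) by (intro compact_integrable(1)[where K = "{-R..R} \<times> {-R..R}" and C = "B * B\<psi>"])
    (use Hm in \<open>auto simp: H_def indicator_def lborel_prod intro!: compact_Times\<close>)
  thus ?thesis by (simp add: lborel_prod)
 qed
 have Hy: "(LINT y|lborel. H x y) = (V x - V (-R)) * \<psi>' x" for x
 proof (cases "x \<in> {-R..R}")
  case True
  hence "(%y. H x y) = (%y. (indicator {-R..x} y * u y) * \<psi>' x)" by (auto simp: H_def fun_eq_iff)
  thus ?thesis using P True unfolding prim_of_def by simp
 next
  case False thus ?thesis using zo[of x] by (auto simp: H_def)
 qed
 have Hx: "(LINT x|lborel. H x y) = - (u y * \<psi> y)" for y
 proof (cases "y \<in> {-R..R}")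
  case True
  have "(%x. H x y) = (%x. u y * (indicator {y..R} x *\<^sub>R \<psi>' x))"
   using True by (auto simp: H_def fun_eq_iff indicator_def)
  hence "(LINT x|lborel. H x y) = u y * (\<psi> R - \<psi> y)" using int'[of y R] True by simp
  thus ?thesis using z(1)[of R] R by simp
 next
  case False
  hence "\<bar>y\<bar> \<ge> R" by auto
  moreover have "(%x. H x y) = (%x. 0)" using False by (auto simp: H_def fun_eq_iff indicator_def)
  ultimately show ?thesis using z(1)[of y] by simp
 qed
 have "(LINT y|lborel. LINT x|lborel. H x y) = (LINT x|lborel. LINT y|lborel. H x y)"
  by (rule lborel_pair.Fubini_integral[OF inH])
 hence "- (LINT y|lborel. u y * \<psi> y) = (LINT x|lborel. (V x - V (-R)) * \<psi>' x)" unfolding Hx Hy by simp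
 also have "\<dots> = (LINT x|lborel. V x * \<psi>' x) - V (-R) * (LINT x|lborel. \<psi>' x)"
 proof -
  have i1: "integrable lborel (%x. V x * \<psi>' x)"
  proof (rule integrable_cut[where a = "-R" and b = R and B = "BV * B\<psi>"])
   show "\<bar>V x * \<psi>' x\<bar> \<le> BV * B\<psi>" if "x \<in> {-R..R}" for x unfolding abs_mult
    by (rule mult_mono) (use BV B\<psi> that in auto)
  qed (use zo in auto)
  have i2: "integrable lborel \<psi>'" by (rule integrable_cut[where a = "-R" and b = R and B = B\<psi>]) (use zo B\<psi> in auto)
  show ?thesis unfolding left_diff_distrib using i1 i2 by simp
 qed
 also have "(LINT x|lborel. \<psi>' x) = 0"
 proof -
  have "(%x. indicator {-R..R} x *\<^sub>R \<psi>' x) = \<psi>'"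
  proof
   show "indicator {-R..R} x *\<^sub>R \<psi>' x = \<psi>' x" for x
    using zo[of x] by (cases "- R \<le> x \<and> x \<le> R") auto
  qed
  thus ?thesis using int'[of "-R" R] R z by simp
 qed
 finally show ?thesis by simp
qed


section \<open>The weak formulation\<close>

lemma test_facts:
 assumes "test_function \<Omega> \<phi> \<phi>x \<phi>t"
 shows "\<exists>R>0. \<exists>B\<ge>0. (\<forall>p. p \<notin> {-R..R} \<times> {-R..R} --> \<phi> p = 0 \<and> \<phi>x p = 0 \<and> \<phi>t p = 0) \<and>
  (\<forall>z. \<bar>\<phi> z\<bar> \<le> B \<and> \<bar>\<phi>x z\<bar> \<le> B \<and> \<bar>\<phi>t z\<bar> \<le> B)"
  and "((%x. \<phi> (x, t)) has_real_derivative \<phi>x (x, t)) (at x)"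
  and "((%t. \<phi> (x, t)) has_real_derivative \<phi>t (x, t)) (at t)"
  and "continuous_on UNIV \<phi>" "continuous_on UNIV \<phi>x" "continuous_on UNIV \<phi>t"
  and "\<exists>K. compact K \<and> K \<subseteq> \<Omega> \<and> (\<forall>z. z \<notin> K --> \<phi> z = 0 \<and> \<phi>x z = 0 \<and> \<phi>t z = 0)"
proof -
 have D: "(\<phi> has_derivative (%h. \<phi>x z * fst h + \<phi>t z * snd h)) (at z)" for z
  using assms unfolding test_function_def by blast
 show cx: "continuous_on UNIV \<phi>x" and ct: "continuous_on UNIV \<phi>t" using assms unfolding test_function_def by blast+
 show cc: "continuous_on UNIV \<phi>" using D has_derivative_continuous continuous_at_imp_continuous_on by blast
 obtain K where K: "compact K" "K \<subseteq> \<Omega>" "\<And>z. z \<notin> K ==> \<phi> z = 0" using assms unfolding test_function_def by blast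
 have dd0: "\<phi>x z = 0 \<and> \<phi>t z = 0" if "z \<notin> K" for z
 proof -
  have "open (- K)" using K(1) compact_imp_closed by blast
  have "((%_. 0) has_derivative (%h. 0)) (at z)" by simp
  hence "(\<phi> has_derivative (%h. 0)) (at z)"
   by (rule has_derivative_transform_within_open[OF _ \<open>open (- K)\<close>]) (use that K(3) in auto)
  hence "(%h. 0) = (%h. \<phi>x z * fst h + \<phi>t z * snd h)" using has_derivative_unique D by blast
  from fun_cong[OF this, of "(1, 0)"] fun_cong[OF this, of "(0, 1)"] show ?thesis by simp
 qed
 have K0: "\<forall>z. z \<notin> K --> \<phi> z = 0 \<and> \<phi>x z = 0 \<and> \<phi>t z = 0" using K(3) dd0 by blast
 show "\<exists>K. compact K \<and> K \<subseteq> \<Omega> \<and> (\<forall>z. z \<notin> K --> \<phi> z = 0 \<and> \<phi>x z = 0 \<and> \<phi>t z = 0)"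
  using K(1,2) K0 by blast
 have "((%x. (x, t)) has_derivative (%h. (h, 0))) (at x)" for x
  by (auto intro!: derivative_eq_intros)
 from diff_chain_at[OF this D, of x] show "((%x. \<phi> (x, t)) has_real_derivative \<phi>x (x, t)) (at x)"
  by (simp add: has_field_derivative_def o_def)
 have "((%t. (x, t)) has_derivative (%h. (0, h))) (at t)" for t
  by (auto intro!: derivative_eq_intros)
 from diff_chain_at[OF this D, of t] show "((%t. \<phi> (x, t)) has_real_derivative \<phi>t (x, t)) (at t)"
  by (simp add: has_field_derivative_def o_def)
 have bd: "\<exists>B. \<forall>z\<in>K. \<bar>\<psi> z\<bar> \<le> B" if "continuous_on UNIV \<psi>" for \<psi> :: "real \<times> real => real"
 proof -
  have "bounded (\<psi> ` K)"
   using compact_imp_bounded[OF compact_continuous_image[OF continuous_on_subset[OF that] K(1)]] by simp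
  thus ?thesis unfolding bounded_iff by auto
 qed
 obtain B1 B2 B3 where B: "\<forall>z\<in>K. \<bar>\<phi> z\<bar> \<le> B1" "\<forall>z\<in>K. \<bar>\<phi>x z\<bar> \<le> B2" "\<forall>z\<in>K. \<bar>\<phi>t z\<bar> \<le> B3"
  using bd[OF cc] bd[OF cx] bd[OF ct] by blast
 define B where "B = \<bar>B1\<bar> + \<bar>B2\<bar> + \<bar>B3\<bar>"
 have "\<bar>\<phi> z\<bar> \<le> B \<and> \<bar>\<phi>x z\<bar> \<le> B \<and> \<bar>\<phi>t z\<bar> \<le> B" for z
 proof (cases "z \<in> K")
  case True
  hence "\<bar>\<phi> z\<bar> \<le> B1" "\<bar>\<phi>x z\<bar> \<le> B2" "\<bar>\<phi>t z\<bar> \<le> B3" using B by auto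
  thus ?thesis unfolding B_def by linarith
 next
  case False
  hence "\<phi> z = 0" "\<phi>x z = 0" "\<phi>t z = 0" using K0 by blast+
  thus ?thesis by (simp add: B_def)
 qed
 note bound = this
 obtain r where r: "\<And>z. z \<in> K ==> norm z \<le> r" using compact_imp_bounded[OF K(1)] unfolding bounded_iff by blast
 let ?R = "\<bar>r\<bar> + 1"
 have box: "p \<in> {-?R..?R} \<times> {-?R..?R}" if "p \<in> K" for p
 proof -
  have "\<bar>fst p\<bar> \<le> r" "\<bar>snd p\<bar> \<le> r"
   using r[OF that] norm_fst_le[of "fst p" "snd p"] norm_snd_le[of "snd p" "fst p"] by simp_all
  thus ?thesis by (simp add: mem_Times_iff abs_le_iff)
 qed
 show "\<exists>R>0. \<exists>B\<ge>0. (\<forall>p. p \<notin> {-R..R} \<times> {-R..R} --> \<phi> p = 0 \<and> \<phi>x p = 0 \<and> \<phi>t p = 0) \<and>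
  (\<forall>z. \<bar>\<phi> z\<bar> \<le> B \<and> \<bar>\<phi>x z\<bar> \<le> B \<and> \<bar>\<phi>t z\<bar> \<le> B)"
 proof (rule exI[of _ ?R], intro conjI exI[of _ B] allI impI)
  fix p assume "p \<notin> {-?R..?R} \<times> {-?R..?R}"
  hence "p \<notin> K" using box by blast
  thus "\<phi> p = 0" "\<phi>x p = 0" "\<phi>t p = 0" using K0 by blast+
 qed (use bound in \<open>auto simp: B_def\<close>)
qed

lemma plane_Fubini:
 fixes H :: "real \<times> real => real"
 assumes H[measurable]: "H \<in> borel_measurable borel" and B: "\<And>p. \<bar>H p\<bar> \<le> B" and z: "\<And>p. p \<notin> {-R..R} \<times> {-R..R} ==> H p = 0"
 shows "integrable lborel H" "integral\<^sup>L lborel H = (LINT t|lborel. LINT x|lborel. H (x, t))"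
  "integral\<^sup>L lborel H = (LINT x|lborel. LINT t|lborel. H (x, t))"
  "(%t. LINT x|lborel. H (x, t)) \<in> borel_measurable borel"
proof -
 have [measurable]: "H \<in> borel_measurable (lborel \<Otimes>\<^sub>M lborel)" using H by (simp add: lborel_prod)
 show i: "integrable lborel H"
  by (rule compact_integrable(1)[OF H compact_Times[OF compact_Icc compact_Icc] B z])
 hence i': "integrable (lborel \<Otimes>\<^sub>M lborel) (%(x, t). H (x, t))" by (simp add: lborel_prod)
 show "integral\<^sup>L lborel H = (LINT t|lborel. LINT x|lborel. H (x, t))" "integral\<^sup>L lborel H = (LINT x|lborel. LINT t|lborel. H (x, t))"
  using lborel_pair.integral_snd[OF i'] lborel_pair.integral_fst[OF i'] by (simp_all add: lborel_prod)
 have "(%(t, x). H (x, t)) \<in> borel_measurable (borel \<Otimes>\<^sub>M lborel)" by measurable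
 thus "(%t. LINT x|lborel. H (x, t)) \<in> borel_measurable borel" by measurable
qed

lemma lborel_translate: "(LINT p|lborel. F (p + a)) = (LINT p|lborel. F p)"
 if "F \<in> borel_measurable borel" for F :: "'a::euclidean_space => real"
proof -
 have "(LINT p|lborel. F p) = integral\<^sup>L (distr lborel borel ((+) a)) F" by (simp add: lborel_distr_plus)
 also have "\<dots> = (LINT p|lborel. F (a + p))" by (rule integral_distr) (use that in auto)
 finally show ?thesis by (simp add: add.commute)
qed

lemma meas_comp2:
 assumes "(%p. W (fst p) (snd p)) \<in> borel_measurable (borel :: (real \<times> real) measure)"
  "a \<in> borel_measurable N" "b \<in> borel_measurable N"
 shows "(%q. W (a q) (b q) :: real) \<in> borel_measurable N"
proof -
 have "(%q. (a q, b q)) \<in> N \<rightarrow>\<^sub>M borel" using assms(2,3) by measurable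
 from measurable_compose[OF this assms(1)] show ?thesis by simp
qed

locale test_loc =
 fixes \<Omega> :: "(real \<times> real) set" and \<phi> \<phi>x \<phi>t :: "real \<times> real => real" and R B :: real
 assumes tf: "test_function \<Omega> \<phi> \<phi>x \<phi>t" and R: "R > 0" and B: "B \<ge> 0"
  and z: "\<And>p. p \<notin> {-R..R} \<times> {-R..R} ==> \<phi> p = 0 \<and> \<phi>x p = 0 \<and> \<phi>t p = 0"
  and b: "\<And>z. \<bar>\<phi> z\<bar> \<le> B \<and> \<bar>\<phi>x z\<bar> \<le> B \<and> \<bar>\<phi>t z\<bar> \<le> B"
begin

lemma m [measurable]: "\<phi> \<in> borel_measurable borel" "\<phi>x \<in> borel_measurable borel" "\<phi>t \<in> borel_measurable borel"
 using borel_measurable_continuous_onI test_facts(4-6)[OF tf] by blast+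

lemma zx: "x \<notin> {-R..R} ==> \<phi> (x, s) = 0 \<and> \<phi>x (x, s) = 0 \<and> \<phi>t (x, s) = 0"
 and zt: "s \<notin> {-R..R} ==> \<phi> (x, s) = 0 \<and> \<phi>x (x, s) = 0 \<and> \<phi>t (x, s) = 0"
 using z[of "(x, s)"] by (auto simp only: mem_Times_iff fst_conv snd_conv)

lemma bump_slice: "bump (R + 1) (%x. \<phi> (x, t)) (%x. \<phi>x (x, t))"
proof -
 have "continuous_on UNIV (%x. \<phi>x (x, t))"
  by (rule continuous_on_compose2[OF test_facts(5)[OF tf]]) (auto intro!: continuous_intros)
 thus ?thesis unfolding bump_def using R test_facts(2)[OF tf] zx by (auto simp: abs_if split: if_splits)
qed

lemma shift_bound: "\<bar>(\<phi> (x, t - eps n) - \<phi> (x, t)) * (real n + 1)\<bar> \<le> B"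
proof -
 have "norm (\<phi> (x, t - eps n) - \<phi> (x, t)) \<le> B * norm (t - eps n - t)"
  by (rule field_differentiable_bound[of UNIV "%t. \<phi> (x, t)" "%t. \<phi>t (x, t)"]) (use test_facts(3)[OF tf] b in auto)
 hence "\<bar>\<phi> (x, t - eps n) - \<phi> (x, t)\<bar> * (real n + 1) \<le> B * eps n * (real n + 1)"
  using eps_pos[of n] by (intro mult_right_mono) auto
 also have "\<dots> = B" using eps_mult[of n] by (simp add: mult.assoc)
 finally show ?thesis by (simp add: abs_mult)
qed

lemma shift_pointwise: "(%n. (\<phi> (x, t - eps n) - \<phi> (x, t)) * (real n + 1)) \<longlonglongrightarrow> - \<phi>t (x, t)"
proof -
 have "((%s. \<phi> (x, - s)) has_real_derivative (\<phi>t (x, - (- t)) * (- 1))) (at (- t))"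
  by (rule DERIV_chain2[OF test_facts(3)[OF tf]]) (auto intro!: derivative_eq_intros)
 from DERIV_seq[OF this] show ?thesis by (simp add: algebra_simps)
qed

lemma prod_facts:
 assumes h: "h \<in> borel_measurable borel" and hb: "\<And>p. \<bar>h p\<bar> \<le> C" and \<psi>: "\<psi> = \<phi> \<or> \<psi> = \<phi>x \<or> \<psi> = \<phi>t"
 shows "integrable lborel (%p. h p * \<psi> p)" "(LINT p|lborel. h p * \<psi> p) = (LINT t|lborel. LINT x|lborel. h (x, t) * \<psi> (x, t))"
  "(LINT p|lborel. h p * \<psi> p) = (LINT x|lborel. LINT t|lborel. h (x, t) * \<psi> (x, t))"
  "(%t. LINT x|lborel. h (x, t) * \<psi> (x, t)) \<in> borel_measurable borel"
  "integrable lborel (%x. h (x, t) * \<psi> (x, t))" "\<bar>LINT x|lborel. h (x, t) * \<psi> (x, t)\<bar> \<le> 2 * R * (C * B)"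
proof -
 have [measurable]: "\<psi> \<in> borel_measurable borel" "h \<in> borel_measurable borel" using h \<psi> m by auto
 have bb: "\<bar>h p * \<psi> p\<bar> \<le> C * B" for p
  unfolding abs_mult by (rule mult_mono) (use hb[of p] b[of p] \<psi> order_trans[OF abs_ge_zero hb] in auto)
 have zz: "h p * \<psi> p = 0" if "p \<notin> {-R..R} \<times> {-R..R}" for p using z[OF that] \<psi> by auto
 have "(%p. h p * \<psi> p) \<in> borel_measurable borel" by measurable
 note F = plane_Fubini[OF this bb zz]
 show "integrable lborel (%p. h p * \<psi> p)" "(LINT p|lborel. h p * \<psi> p) = (LINT t|lborel. LINT x|lborel. h (x, t) * \<psi> (x, t))"
  "(LINT p|lborel. h p * \<psi> p) = (LINT x|lborel. LINT t|lborel. h (x, t) * \<psi> (x, t))"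
  "(%t. LINT x|lborel. h (x, t) * \<psi> (x, t)) \<in> borel_measurable borel"
  by (rule F; assumption)+
 have hs: "(%x. h (x, t) * \<psi> (x, t)) \<in> borel_measurable borel" by measurable
 have zs: "h (x, t) * \<psi> (x, t) = 0" if "x \<notin> {-R..R}" for x using zx[OF that] \<psi> by auto
 note S = compact_integrable[OF hs compact_Icc[of "-R" R] bb]
 show "integrable lborel (%x. h (x, t) * \<psi> (x, t))" "\<bar>LINT x|lborel. h (x, t) * \<psi> (x, t)\<bar> \<le> 2 * R * (C * B)"
  using S[OF zs] R by simp_all
qed

lemma slice_DCT:
 fixes w :: "nat => real => real"
 assumes "\<And>n. w n \<in> borel_measurable borel" "w' \<in> borel_measurable borel" "\<And>n x. \<bar>w n x\<bar> \<le> C"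
  and \<psi>: "\<psi> = \<phi> \<or> \<psi> = \<phi>x \<or> \<psi> = \<phi>t" and lim: "AE x in lborel. \<psi> (x, t) = 0 \<or> (%n. w n x) \<longlonglongrightarrow> w' x"
 shows "(%n. LINT x|lborel. w n x * \<psi> (x, t)) \<longlonglongrightarrow> (LINT x|lborel. w' x * \<psi> (x, t))"
proof (rule compact_DCT[where K = "{-R..R}" and C = "C * B"])
 have [measurable]: "\<psi> \<in> borel_measurable borel" using \<psi> m by auto
 note [measurable] = assms(1,2)
 show "(%x. w n x * \<psi> (x, t)) \<in> borel_measurable borel" "(%x. w' x * \<psi> (x, t)) \<in> borel_measurable borel" for n by measurable
 show "\<bar>w n x * \<psi> (x, t)\<bar> \<le> C * B" for n x
  unfolding abs_mult by (rule mult_mono) (use assms(3) b \<psi> order_trans[OF abs_ge_zero assms(3)] in auto)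
 show "w n x * \<psi> (x, t) = 0" if "x \<notin> {-R..R}" for n x using zx[OF that] \<psi> by auto
 show "AE x in lborel. (%n. w n x * \<psi> (x, t)) \<longlonglongrightarrow> w' x * \<psi> (x, t)"
  using lim by eventually_elim (auto intro: tendsto_mult)
qed simp

text \<open>Translation in time moves a difference quotient of \<open>w\<close> onto the test function.\<close>

lemma plane_shift:
 assumes w[measurable]: "w \<in> borel_measurable borel" and wb: "\<And>p. \<bar>w p\<bar> \<le> C"
 shows "(%n. LINT p|lborel. (w (p + (0, eps n)) - w p) * (real n + 1) * \<phi> p) \<longlonglongrightarrow> - (LINT p|lborel. w p * \<phi>t p)"
proof -
 let ?K = "{-(R+1)..R+1} \<times> {-(R+1)..R+1}"
 let ?g = "%n p. w p * ((\<phi> (p - (0, eps n)) - \<phi> p) * (real n + 1))"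
 have C: "C \<ge> 0" using order_trans[OF abs_ge_zero wb] .
 have e: "(LINT p|lborel. (w (p + (0, eps n)) - w p) * (real n + 1) * \<phi> p) = (LINT p|lborel. ?g n p)" for n
 proof -
  have i: "integrable lborel (%p. w (p + a) * \<phi> (p - (0, dd)))" if dd: "0 \<le> dd" "dd \<le> 1" for a dd
  proof (rule compact_integrable(1)[where K = ?K and C = "C * B"])
   show "\<bar>w (p + a) * \<phi> (p - (0, dd))\<bar> \<le> C * B" for p
    unfolding abs_mult by (rule mult_mono) (use wb[of "p + a"] b[of "p - (0, dd)"] C in auto)
   show "w (p + a) * \<phi> (p - (0, dd)) = 0" if "p \<notin> ?K" for p
   proof -
    have "p - (0, dd) \<notin> {-R..R} \<times> {-R..R}" using that dd by (auto simp: mem_Times_iff)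
    thus ?thesis using z by simp
   qed
  qed (auto intro!: compact_Times)
  have "(LINT p|lborel. w (p + (0, eps n)) * \<phi> p) = (LINT p|lborel. w p * \<phi> (p - (0, eps n)))"
   using lborel_translate[of "%p. w p * \<phi> (p - (0, eps n))" "(0, eps n)"] by simp
  moreover have "(LINT p|lborel. (w (p + (0, eps n)) - w p) * (real n + 1) * \<phi> p) =
   ((LINT p|lborel. w (p + (0, eps n)) * \<phi> p) - (LINT p|lborel. w p * \<phi> p)) * (real n + 1)"
   using i[of 0 "(0, eps n)"] i[of 0 0] unfolding zero_prod_def[symmetric] by (simp add: algebra_simps flip: integral_diff integral_mult_left_zero)
  moreover have "(LINT p|lborel. ?g n p) = ((LINT p|lborel. w p * \<phi> (p - (0, eps n))) - (LINT p|lborel. w p * \<phi> p)) * (real n + 1)"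
   using i[of "eps n" 0] i[of 0 0] eps_pos[of n] unfolding zero_prod_def[symmetric] by (simp add: algebra_simps flip: integral_diff integral_mult_left_zero)
  ultimately show ?thesis by simp
 qed
 have "(%n. LINT p|lborel. ?g n p) \<longlonglongrightarrow> (LINT p|lborel. w p * (- \<phi>t p))"
 proof (rule compact_DCT[where K = ?K and C = "C * B"])
  show "\<bar>?g n p\<bar> \<le> C * B" for n p
   unfolding abs_mult[of "w p"] using shift_bound[of "fst p" "snd p" n] by (intro mult_mono wb C) (auto simp: minus_prod_def)
  show "?g n p = 0" if "p \<notin> ?K" for n p
  proof -
   have "p \<notin> {-R..R} \<times> {-R..R}" "p - (0, eps n) \<notin> {-R..R} \<times> {-R..R}" using that eps_pos[of n] by (auto simp: mem_Times_iff)
   thus ?thesis using z by simp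
  qed
  show "AE p in lborel. (%n. ?g n p) \<longlonglongrightarrow> w p * (- \<phi>t p)"
  proof (rule AE_I2)
   show "(%n. ?g n p) \<longlonglongrightarrow> w p * (- \<phi>t p)" for p
    using shift_pointwise[of "fst p" "snd p"] by (intro tendsto_mult tendsto_const) (simp add: minus_prod_def)
  qed
 qed (auto intro!: compact_Times)
 thus ?thesis unfolding e by simp
qed

lemma int_phix: "(LINT x|lborel. \<phi>x (x, t)) = 0"
proof -
 have "prim_of (%_. 1) (%_. 0)" by (rule lip_prim[where M = 0]) auto
 from prim_IBP[OF this _ _ bump_slice[of t], of 0] show ?thesis by simp
qed

end

text \<open>What the conservation law needs of a value function and its slope, which is a derivative only almost everywhere.\<close>

locale ulip =
 fixes v u :: "real => real => real" and M :: real
 assumes vlip: "\<And>x y t s. 0 \<le> t ==> 0 \<le> s ==> \<bar>v x t - v y s\<bar> \<le> M * (\<bar>x - y\<bar> + \<bar>t - s\<bar>)"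
  and um: "(%p. u (fst p) (snd p)) \<in> borel_measurable borel"
  and ub: "\<And>x t. \<bar>u x t\<bar> \<le> M"
  and uD: "\<And>t. t > 0 ==> AE x in lborel. ((%z. v z t) has_real_derivative u x t) (at x)"
begin

lemma M_nonneg: "M \<ge> 0" using order_trans[OF abs_ge_zero ub] .

lemma um_slice[measurable]: "(%x. u x t) \<in> borel_measurable borel"
proof -
 have "(%x. (x, t)) \<in> borel \<rightarrow>\<^sub>M (borel :: (real \<times> real) measure)" by measurable
 from measurable_compose[OF this um] show ?thesis by simp
qed

end


lemma meas_coord: "(%p::real \<times> real. fst p) \<in> borel_measurable borel" "(%p::real \<times> real. snd p) \<in> borel_measurable borel"
 by (intro borel_measurable_continuous_onI continuous_intros)+

lemma prim_diff:
 assumes "prim_of V u" "prim_of W w" and [measurable]: "u \<in> borel_measurable borel" "w \<in> borel_measurable borel"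
  and b: "\<And>x. \<bar>u x\<bar> \<le> B" "\<And>x. \<bar>w x\<bar> \<le> B"
 shows "prim_of (%x. (V x - W x) * cc) (%x. (u x - w x) * cc)"
 unfolding prim_of_def
proof (intro allI impI)
 fix a b :: real assume ab: "a \<le> b"
 have i: "integrable lborel (%x. indicator {a..b} x * u x)" "integrable lborel (%x. indicator {a..b} x * w x)"
  by (rule integrable_cut[where a = a and b = b and B = B]; use b in \<open>auto simp: indicator_def\<close>)+
 have "(LINT x|lborel. indicator {a..b} x * ((u x - w x) * cc)) =
   (LINT x|lborel. (indicator {a..b} x * u x - indicator {a..b} x * w x) * cc)" by (simp add: algebra_simps)
 thus "(V b - W b) * cc - (V a - W a) * cc = (LINT x|lborel. indicator {a..b} x * ((u x - w x) * cc))"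
  using i assms(1,2) ab unfolding prim_of_def by (simp add: algebra_simps)
qed

context test_loc begin

text \<open>Writing the time derivative of \<open>u\<close> as a difference quotient, integration by parts in space turns
 it into the difference quotient of the primitive \<open>V\<close>, whose limit is the flux.\<close>

lemma plane_weak:
 assumes Vlip: "\<And>x y t s. \<bar>V x t - V y s\<bar> \<le> M * (\<bar>x - y\<bar> + \<bar>t - s\<bar>)"
  and um: "(%p. u (fst p) (snd p)) \<in> borel_measurable borel" and ub: "\<And>x t. \<bar>u x t\<bar> \<le> C"
  and Fm: "(%p. F (fst p) (snd p)) \<in> borel_measurable borel"
  and P: "\<And>t. prim_of (%x. V x t) (%x. u x t)"
  and D: "\<And>t. t \<noteq> 0 ==> AE x in lborel. (%n. (V x t - V x (t + eps n)) * (real n + 1)) \<longlonglongrightarrow> F x t"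
  and Fb: "\<And>x t. \<bar>F x t\<bar> \<le> C'"
 shows "(LINT p|lborel. u (fst p) (snd p) * \<phi>t p) + (LINT p|lborel. F (fst p) (snd p) * \<phi>x p) = 0"
proof -
 note [measurable (raw)] = meas_comp2[OF um] meas_comp2[OF Fm] and [measurable] = meas_coord
 have us: "(%x. u x t) \<in> borel_measurable borel" and Fs: "(%x. F x t) \<in> borel_measurable borel" for t by measurable
 let ?q = "%n x t. (V x t - V x (t + eps n)) * (real n + 1)"
 let ?h = "%n p. (u (fst p) (snd p + eps n) - u (fst p) (snd p)) * (real n + 1)"
 have Vm[measurable]: "(%x. V x t) \<in> borel_measurable borel" for t
  by (rule lip_cont(2)[where M = M]) (use Vlip[of _ t _ t] in simp)
 have qm: "(%x. ?q n x t) \<in> borel_measurable borel" for n t by measurable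
 have qb: "\<bar>?q n x t\<bar> \<le> M" for n x t
 proof -
  have "\<bar>V x t - V x (t + eps n)\<bar> * (real n + 1) \<le> M * eps n * (real n + 1)"
   using Vlip[of x t x "t + eps n"] eps_pos[of n] by (intro mult_right_mono) auto
  thus ?thesis using eps_mult[of n] by (simp add: abs_mult mult.assoc)
 qed
 have hm: "?h n \<in> borel_measurable borel" for n by measurable
 have hb: "\<bar>?h n p\<bar> \<le> 2 * C * (real n + 1)" for n p
  using ub[of "fst p" "snd p"] ub[of "fst p" "snd p + eps n"] unfolding abs_mult by (intro mult_mono) auto
 have s: "(LINT x|lborel. ?h n (x, t) * \<phi> (x, t)) = (LINT x|lborel. ?q n x t * \<phi>x (x, t))" for n t
 proof -
  have 1: "(%x. (u x (t + eps n) - u x t) * (real n + 1)) \<in> borel_measurable borel" by measurable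
  have 2: "\<bar>(u x (t + eps n) - u x t) * (real n + 1)\<bar> \<le> 2 * C * (real n + 1)" for x using hb[of "(x, t)" n] by simp
  have "(LINT x|lborel. ?h n (x, t) * \<phi> (x, t)) = - (LINT x|lborel. (V x (t + eps n) - V x t) * (real n + 1) * \<phi>x (x, t))"
   using prim_IBP[OF prim_diff[OF P P us us ub ub] 1 2 bump_slice] by simp
  thus ?thesis by (simp add: algebra_simps flip: integral_minus)
 qed
 have "(%n. LINT t|lborel. LINT x|lborel. ?h n (x, t) * \<phi> (x, t)) \<longlonglongrightarrow> (LINT t|lborel. LINT x|lborel. F x t * \<phi>x (x, t))"
 proof (rule compact_DCT[where K = "{-R..R}" and C = "2 * R * (M * B)"])
  show "(%t. LINT x|lborel. ?h n (x, t) * \<phi> (x, t)) \<in> borel_measurable borel" for n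
   by (rule prod_facts(4)[OF hm hb]) simp
  show "(%t. LINT x|lborel. F x t * \<phi>x (x, t)) \<in> borel_measurable borel" using prod_facts(4)[OF Fm Fb, of \<phi>x] by simp
  show "\<bar>LINT x|lborel. ?h n (x, t) * \<phi> (x, t)\<bar> \<le> 2 * R * (M * B)" for n t
   unfolding s using prod_facts(6)[of "%p. ?q n (fst p) t" M \<phi>x t] qb by simp
  show "(LINT x|lborel. ?h n (x, t) * \<phi> (x, t)) = 0" if "t \<notin> {-R..R}" for n t using zt[OF that] by simp
  have "AE t in lborel. t \<noteq> (0::real)" by (rule AE_lborel_singleton)
  thus "AE t in lborel. (%n. LINT x|lborel. ?h n (x, t) * \<phi> (x, t)) \<longlonglongrightarrow> (LINT x|lborel. F x t * \<phi>x (x, t))"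
  proof eventually_elim
   case (elim t)
   show ?case unfolding s
   proof (rule slice_DCT[OF qm Fs qb])
    show "AE x in lborel. \<phi>x (x, t) = 0 \<or> (%n. ?q n x t) \<longlonglongrightarrow> F x t" using D[OF elim] by eventually_elim simp
   qed simp
  qed
 qed simp
 hence "(%n. LINT p|lborel. ?h n p * \<phi> p) \<longlonglongrightarrow> (LINT p|lborel. F (fst p) (snd p) * \<phi>x p)"
  using prod_facts(2)[OF hm hb, of \<phi>] prod_facts(2)[OF Fm Fb, of \<phi>x] by simp
 moreover have "(%n. LINT p|lborel. ?h n p * \<phi> p) \<longlonglongrightarrow> - (LINT p|lborel. u (fst p) (snd p) * \<phi>t p)"
  using plane_shift[OF um ub] by simp
 ultimately show ?thesis using LIMSEQ_unique by fastforce
qed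

end

text \<open>Extending the solution by its initial data to negative times produces the boundary term.\<close>

lemma weak_form:
 assumes "ulip v u M" "test_function UNIV \<phi> \<phi>x \<phi>t"
  and Flm: "(%p. Fl (fst p) (snd p)) \<in> borel_measurable borel"
  and Flb: "\<And>x t. \<bar>Fl x t\<bar> \<le> BF"
  and FlD: "\<And>t. t > 0 ==> AE x in lborel. (%n. (v x t - v x (t + eps n)) * (real n + 1)) \<longlonglongrightarrow> Fl x t"
  and P: "prim_of (%x. v x 0) w0" and w0[measurable]: "w0 \<in> borel_measurable borel" and w0b: "\<And>x. \<bar>w0 x\<bar> \<le> C"
 shows "(LINT z:UNIV \<times> {0<..}|lebesgue. u (fst z) (snd z) * \<phi>t z + Fl (fst z) (snd z) * \<phi>x z) + (LINT x|lborel. w0 x * \<phi> (x, 0)) = 0"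
proof -
 interpret ulip v u M by (rule assms(1))
 obtain R B where RB: "R > 0" "B \<ge> 0" "\<And>p. p \<notin> {-R..R} \<times> {-R..R} ==> \<phi> p = 0 \<and> \<phi>x p = 0 \<and> \<phi>t p = 0"
  "\<And>z. \<bar>\<phi> z\<bar> \<le> B \<and> \<bar>\<phi>x z\<bar> \<le> B \<and> \<bar>\<phi>t z\<bar> \<le> B"
  using test_facts(1)[OF assms(2)] by blast
 interpret test_loc UNIV \<phi> \<phi>x \<phi>t R B by unfold_locales (fact assms(2) RB)+
 note [measurable] = um Flm meas_coord measurable_compose[OF meas_coord(1) w0]
 let ?C = "max M C" and ?S = "UNIV \<times> {0<..} :: (real \<times> real) set"
 define V where "V x t = v x (max 0 t)" for x t
 define U where "U x t = (if t > 0 then u x t else w0 x)" for x t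
 define F where "F x t = (if t > 0 then Fl x t else 0)" for x t
 have Um: "(%p. U (fst p) (snd p)) \<in> borel_measurable borel" and Fm: "(%p. F (fst p) (snd p)) \<in> borel_measurable borel"
  unfolding U_def F_def by measurable
 have Ub: "\<bar>U x t\<bar> \<le> ?C" and Fb: "\<bar>F x t\<bar> \<le> BF" for x t
  using ub[of x t] w0b[of x] Flb[of x t] by (auto simp: U_def F_def)
 have Vlip: "\<bar>V x t - V y s\<bar> \<le> M * (\<bar>x - y\<bar> + \<bar>t - s\<bar>)" for x y t s
 proof -
  have "M * (\<bar>x - y\<bar> + \<bar>max 0 t - max 0 s\<bar>) \<le> M * (\<bar>x - y\<bar> + \<bar>t - s\<bar>)"
   by (intro mult_left_mono add_left_mono M_nonneg) linarith
  thus ?thesis using vlip[of "max 0 t" "max 0 s" x y] by (simp add: V_def)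
 qed
 have VU: "prim_of (%x. V x t) (%x. U x t)" for t
 proof (cases "t > 0")
  case True
  thus ?thesis using lip_prim[of "%x. v x t" M "%x. u x t"] vlip[of t t] uD by (simp add: V_def U_def)
 next
  case False thus ?thesis using P by (simp add: V_def U_def)
 qed
 have D: "AE x in lborel. (%n. (V x t - V x (t + eps n)) * (real n + 1)) \<longlonglongrightarrow> F x t" if "t \<noteq> 0" for t
 proof (cases "t > 0")
  case True
  hence "max 0 (t + eps n) = t + eps n" for n using eps_pos[of n] by simp
  thus ?thesis using FlD[OF True] True by (simp add: V_def F_def)
 next
  case False
  hence "eventually (%n. eps n < - t) sequentially" using order_tendstoD(2)[OF eps_lim, of "- t"] that by simp
  hence "eventually (%n. (V x t - V x (t + eps n)) * (real n + 1) = F x t) sequentially" for x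
   by eventually_elim (use False in \<open>simp add: V_def F_def max_def\<close>)
  thus ?thesis by (intro AE_I2 tendsto_eventually)
 qed
 define H where "H p = (if snd p > 0 then 0 else w0 (fst p))" for p :: "real \<times> real"
 have Hm: "H \<in> borel_measurable borel" and Hb: "\<bar>H p\<bar> \<le> C" for p
  unfolding H_def using w0b[of "fst p"] by (measurable, auto)
 have FTC: "(LINT t|lborel. H (x, t) * \<phi>t (x, t)) = w0 x * \<phi> (x, 0)" for x
 proof -
  have "(LINT t|lborel. indicator {-(R + 1)..0} t *\<^sub>R \<phi>t (x, t)) = \<phi> (x, 0) - \<phi> (x, -(R + 1))"
   by (rule integral_FTC_atLeastAtMost)
    (use R test_facts(3,6)[OF assms(2)] in \<open>auto simp: has_real_derivative_iff_has_vector_derivative[symmetric]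
     intro: has_field_derivative_at_within intro!: continuous_on_compose2[of UNIV \<phi>t] continuous_intros\<close>)
  also have "\<dots> = \<phi> (x, 0)" using zt[of "-(R + 1)" x] by simp
  finally have *: "(LINT t|lborel. w0 x * (indicator {-(R + 1)..0} t *\<^sub>R \<phi>t (x, t))) = w0 x * \<phi> (x, 0)" by simp
  have "(%t. H (x, t) * \<phi>t (x, t)) = (%t. w0 x * (indicator {-(R + 1)..0} t *\<^sub>R \<phi>t (x, t)))"
   using zt[of _ x] by (auto simp: fun_eq_iff H_def indicator_def)
  thus ?thesis using * by simp
 qed
 note iU = prod_facts(1)[OF Um Ub, of \<phi>t] and iF = prod_facts(1)[OF Fm Fb, of \<phi>x] and iH = prod_facts(1)[OF Hm Hb, of \<phi>t]
 let ?G = "%p. U (fst p) (snd p) * \<phi>t p + F (fst p) (snd p) * \<phi>x p - H p * \<phi>t p"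
 have "(%p. indicator ?S p *\<^sub>R (u (fst p) (snd p) * \<phi>t p + Fl (fst p) (snd p) * \<phi>x p)) = ?G"
  by (auto simp: fun_eq_iff U_def F_def H_def indicator_def)
 hence "(LINT z:?S|lebesgue. u (fst z) (snd z) * \<phi>t z + Fl (fst z) (snd z) * \<phi>x z) = (LINT p|lebesgue. ?G p)"
  unfolding set_lebesgue_integral_def by simp
 also have "\<dots> = (LINT p|lborel. ?G p)"
  by (rule integral_completion) (use iU iF iH in \<open>simp add: borel_measurable_integrable\<close>)
 also have "\<dots> = - (LINT p|lborel. H p * \<phi>t p)" using plane_weak[OF Vlip Um Ub Fm VU D Fb] iU iF iH by simp
 also have "\<dots> = - (LINT x|lborel. w0 x * \<phi> (x, 0))" unfolding prod_facts(3)[OF Hm Hb disjI2[OF disjI2[OF refl]]] FTC ..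
 finally show ?thesis by simp
qed


section \<open>The entropy inequality on one side of the interface\<close>

lemma exists_prim:
 assumes u[measurable]: "u \<in> borel_measurable borel" and ub: "\<And>x. \<bar>u x\<bar> \<le> B"
 shows "\<exists>V. prim_of V u \<and> V 0 = 0"
proof -
 define J where "J a b = (LINT x|lborel. indicator {a..b} x * u x)" for a b
 have i: "integrable lborel (%x. indicator {a..b} x * u x)" for a b
  by (rule integrable_cut[where a = a and b = b and B = B]) (use ub in \<open>auto simp: indicator_def\<close>)
 have add: "J a cc = J a b + J b cc" if "a \<le> b" "b \<le> cc" for a b cc
 proof -
  have "J a cc = (LINT x|lborel. indicator {a..b} x * u x + indicator {b..cc} x * u x)" unfolding J_def
  proof (rule integral_cong_AE)
   have "AE x in lborel. x \<noteq> b" by (rule AE_lborel_singleton)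
   thus "AE x in lborel. indicator {a..cc} x * u x = indicator {a..b} x * u x + indicator {b..cc} x * u x"
    by eventually_elim (use that in \<open>auto simp: indicator_def\<close>)
  qed measurable
  thus ?thesis unfolding J_def using i by simp
 qed
 define V where "V x = (if 0 \<le> x then J 0 x else - J x 0)" for x
 have J0: "J 0 0 = 0"
 proof -
  have "J 0 0 = (LINT x::real|lborel. (0::real))" unfolding J_def
  proof (rule integral_cong_AE)
   have "AE x in lborel. x \<noteq> (0::real)" by (rule AE_lborel_singleton)
   thus "AE x in lborel. indicator {0..0} x * u x = (0::real)" by eventually_elim auto
  qed measurable
  thus ?thesis by simp
 qed
 have "prim_of V u" unfolding prim_of_def
 proof (intro allI impI)
  fix a b :: real assume "a \<le> b"
  then consider "0 \<le> a" | "b < 0" | "a < 0" "0 \<le> b" by linarith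
  hence "V b - V a = J a b"
  proof cases
   case 1 thus ?thesis using add[of 0 a b] \<open>a \<le> b\<close> by (simp add: V_def)
  next
   case 2 thus ?thesis using add[of a b 0] \<open>a \<le> b\<close> by (simp add: V_def)
  next
   case 3 thus ?thesis using add[of a 0 b] by (simp add: V_def)
  qed
  thus "V b - V a = (LINT x|lborel. indicator {a..b} x * u x)" by (simp add: J_def)
 qed
 thus ?thesis using J0 by (intro exI[of _ V]) (simp add: V_def)
qed

lemma prim_mono:
 assumes "prim_of V u" "u \<in> borel_measurable borel" "\<And>x. \<bar>u x\<bar> \<le> B"
  "AE x in lborel. a \<le> x --> x \<le> b --> cc \<le> u x" "a \<le> b"
 shows "cc * (b - a) \<le> V b - V a"
proof -
 have "(LINT x|lborel. indicator {a..b} x * cc) \<le> (LINT x|lborel. indicator {a..b} x * u x)"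
 proof (rule integral_mono_AE)
  show "integrable lborel (%x. indicator {a..b} x * cc)"
   by (rule integrable_cut[where a = a and b = b and B = "\<bar>cc\<bar>"]) (auto simp: indicator_def)
  show "integrable lborel (%x. indicator {a..b} x * u x)"
   by (rule integrable_cut[where a = a and b = b and B = B]) (use assms(2,3) in \<open>auto simp: indicator_def\<close>)
  show "AE x in lborel. indicator {a..b} x * cc \<le> indicator {a..b} x * u x"
   using assms(4) by eventually_elim (auto simp: indicator_def)
 qed
 thus ?thesis using assms(1,5) unfolding prim_of_def by (simp add: mult.commute)
qed

lemma prim_uminus: "prim_of V u ==> prim_of (%x. - V x) (%x. - u x)"
 unfolding prim_of_def by (simp add: algebra_simps)

lemma abs_diff_le_from_bounds: "X - Y \<le> p ==> - X - Y \<le> - p ==> \<bar>p - X\<bar> \<le> (Y :: real)"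
 by linarith

text \<open>Lebesgue differentiation at a point where the density agrees almost everywhere with a continuous function.\<close>

lemma prim_DERIV:
 assumes P: "prim_of P w" and wm: "w \<in> borel_measurable borel" and wb: "\<And>x. \<bar>w x\<bar> \<le> B"
  and r: "r > 0" and eq: "AE z in lborel. \<bar>z - x\<bar> < r --> w z = cc z" and cont: "isCont cc x"
 shows "(P has_real_derivative cc x) (at x)"
 unfolding has_field_derivative_iff
proof (rule LIM_I)
 fix e :: real assume e: "e > 0"
 obtain dd where dd: "dd > 0" "\<And>z. \<bar>z - x\<bar> < dd ==> \<bar>cc z - cc x\<bar> < e / 2"
  using cont e unfolding continuous_at_eps_delta dist_real_def by (meson half_gt_zero)
 have main: "\<bar>P b - P a - cc x * (b - a)\<bar> \<le> e / 2 * (b - a)" if ab: "a \<le> b" "x - min dd r < a" "b < x + min dd r" for a b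
 proof -
  have "AE z in lborel. a \<le> z --> z \<le> b --> cc x - e / 2 \<le> w z" "AE z in lborel. a \<le> z --> z \<le> b --> - cc x - e / 2 \<le> - w z"
  proof -
   have *: "\<bar>w z - cc x\<bar> < e / 2" if "\<bar>z - x\<bar> < r --> w z = cc z" "a \<le> z" "z \<le> b" for z
    using that ab dd(2)[of z] by auto
   have **: "AE z in lborel. a \<le> z --> z \<le> b --> \<bar>w z - cc x\<bar> < e / 2"
    using eq
   proof eventually_elim
    case (elim z) thus ?case using *[OF elim] by blast
   qed
   show "AE z in lborel. a \<le> z --> z \<le> b --> cc x - e / 2 \<le> w z" using **
   proof eventually_elim
    case (elim z)
    show ?case
    proof (intro impI)
     assume "a \<le> z" "z \<le> b"
     hence "\<bar>w z - cc x\<bar> < e / 2" using elim by blast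
     thus "cc x - e / 2 \<le> w z" by linarith
    qed
   qed
   show "AE z in lborel. a \<le> z --> z \<le> b --> - cc x - e / 2 \<le> - w z" using **
   proof eventually_elim
    case (elim z)
    show ?case
    proof (intro impI)
     assume "a \<le> z" "z \<le> b"
     hence "\<bar>w z - cc x\<bar> < e / 2" using elim by blast
     thus "- cc x - e / 2 \<le> - w z" by linarith
    qed
   qed
  qed
  from prim_mono[OF P wm wb this(1) ab(1)] prim_mono[OF prim_uminus[OF P] _ _ this(2) ab(1), of B]
  have "(cc x - e / 2) * (b - a) \<le> P b - P a" "(- cc x - e / 2) * (b - a) \<le> - P b - - P a" using wm wb by auto
  hence "cc x * (b - a) - e / 2 * (b - a) \<le> P b - P a" "- (cc x * (b - a)) - e / 2 * (b - a) \<le> - (P b - P a)"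
   by (simp_all only: left_diff_distrib minus_mult_left)
  thus ?thesis by (rule abs_diff_le_from_bounds)
 qed
 show "\<exists>s>0. \<forall>z. z \<noteq> x \<and> norm (z - x) < s --> norm ((P z - P x) / (z - x) - cc x) < e"
 proof (intro exI[of _ "min dd r"] conjI allI impI)
  show "0 < min dd r" using dd r by simp
  fix z assume z: "z \<noteq> x \<and> norm (z - x) < min dd r"
  have "\<bar>P z - P x - cc x * (z - x)\<bar> \<le> e / 2 * \<bar>z - x\<bar>"
  proof (cases "x \<le> z")
   case True thus ?thesis using main[of x z] z dd r by auto
  next
   case False
   hence "\<bar>P x - P z - cc x * (x - z)\<bar> \<le> e / 2 * (x - z)" using z dd r by (intro main) auto
   moreover have "P z - P x - cc x * (z - x) = - (P x - P z - cc x * (x - z))" by (simp add: algebra_simps)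
   hence "\<bar>P z - P x - cc x * (z - x)\<bar> = \<bar>P x - P z - cc x * (x - z)\<bar>" by (simp only: abs_minus_cancel)
   moreover have "\<bar>z - x\<bar> = x - z" using False by simp
   ultimately show ?thesis by (simp only:)
  qed
  moreover have "(P z - P x) / (z - x) - cc x = (P z - P x - cc x * (z - x)) / (z - x)" using z by (simp add: field_simps)
  ultimately have "\<bar>(P z - P x) / (z - x) - cc x\<bar> \<le> e / 2"
   using z by (simp add: abs_divide divide_le_eq)
  thus "norm ((P z - P x) / (z - x) - cc x) < e" using e by simp
 qed
qed

lemma mono_deriv_nonneg:
 assumes "(F has_real_derivative l) (at x)" "r > 0" "\<And>z. x \<le> z ==> z < x + r ==> F x \<le> F z"
 shows "0 \<le> (l :: real)"
proof (rule LIMSEQ_le_const[OF DERIV_seq[OF assms(1)]])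
 have "eventually (%n. eps n < r) sequentially" using order_tendstoD(2)[OF eps_lim assms(2)] .
 then obtain N where N: "\<And>n. n \<ge> N ==> eps n < r" unfolding eventually_sequentially by blast
 show "\<exists>N. \<forall>n\<ge>N. 0 \<le> (F (x + eps n) - F x) * (real n + 1)"
 proof (intro exI[of _ N] allI impI)
  fix n assume "n \<ge> N"
  hence "F x \<le> F (x + eps n)" using N eps_pos[of n] by (intro assms(3)) auto
  thus "0 \<le> (F (x + eps n) - F x) * (real n + 1)" by simp
 qed
qed

context conv_flux begin

lemma HL_lip: assumes W: "lipc M W" and h: "h > 0" shows "lipc M (HL h W)"
proof -
 have *: "HL h W x - HL h W z \<le> M * \<bar>x - z\<bar>" for x z
 proof -
  obtain y where y: "HL h W z = W y + h * L ((z - y) / h)" using HL_min(1)[OF W h] by blast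
  have "HL h W x \<le> W (y + (x - z)) + h * L ((x - (y + (x - z))) / h)" by (rule HL_min(2)[OF W h])
  moreover have "x - (y + (x - z)) = z - y" by simp
  moreover have "\<bar>W (y + (x - z)) - W y\<bar> \<le> M * \<bar>y + (x - z) - y\<bar>" using W unfolding lipc_def by blast
  ultimately show ?thesis using y by simp
 qed
 show ?thesis unfolding lipc_def
 proof (intro allI)
  show "\<bar>HL h W x - HL h W z\<bar> \<le> M * \<bar>x - z\<bar>" for x z
   using *[of x z] *[of z x] by (simp add: abs_le_iff abs_minus_commute)
 qed
qed

lemma HLu_meas: "lipc M W ==> h > 0 ==> HLu h W \<in> borel_measurable borel"
proof -
 assume "lipc M W" "h > 0"
 hence [measurable]: "HLy h W \<in> borel_measurable borel" using borel_measurable_mono HLy_mono by blast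
 have [measurable]: "dL \<in> borel_measurable borel" using borel_measurable_continuous_onI continuous_dL by blast
 show ?thesis unfolding HLu_def[abs_def] by measurable
qed

lemma HLu_bound: "lipc M W ==> h > 0 ==> \<bar>HLu h W x\<bar> \<le> \<bar>dL (QL M)\<bar> + \<bar>dL (- QL M)\<bar>"
proof -
 assume W: "lipc M W" and h: "h > 0"
 have "\<not> \<bar>x - HLy h W x\<bar> > QL M * h"
  using HL_far[OF W h, of x "HLy h W x"] HLy[OF W h, of x] HL_min(2)[OF W h, of x x] by auto
 hence "- QL M \<le> (x - HLy h W x) / h" "(x - HLy h W x) / h \<le> QL M"
  using h by (auto simp: pos_le_divide_eq pos_divide_le_eq abs_le_iff not_less)
 hence "dL (- QL M) \<le> HLu h W x" "HLu h W x \<le> dL (QL M)" unfolding HLu_def by simp_all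
 thus ?thesis by linarith
qed

end

text \<open>On the open set \<open>I\<close> the value function evolves by the Hopf-Lax formula as long as the cone of speed \<open>Q\<close> stays in \<open>I\<close>.\<close>

locale kr_setup = ulip + conv_flux f for f +
 fixes I :: "real set" and Q :: real
 assumes I: "open I" and Q: "Q \<ge> 0"
  and HLeq: "\<And>x t h. t > 0 ==> h > 0 ==> cball x (Q * h) \<subseteq> I ==> v x (t + h) = HL h (%z. v z t) x"
begin

lemma vlipc: "0 \<le> t ==> lipc M (%z. v z t)"
 unfolding lipc_def using vlip[of t t] by simp

lemma time_deriv:
 assumes t: "t > 0"
 shows "AE x in lborel. x \<in> I --> (%n. (v x t - v x (t + eps n)) * (real n + 1)) \<longlonglongrightarrow> f (u x t)"
 using uD[OF t]
proof eventually_elim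
 case (elim x)
 show ?case
 proof
  assume "x \<in> I"
  then obtain r where r: "r > 0" "cball x r \<subseteq> I" using I open_contains_cball by blast
  have "(%n. Q * eps n) \<longlonglongrightarrow> Q * 0" by (intro tendsto_intros eps_lim)
  hence "eventually (%n. Q * eps n < r) sequentially" using r order_tendstoD(2) by fastforce
  hence ev: "eventually (%n. (v x t - HL (eps n) (%z. v z t) x) / eps n = (v x t - v x (t + eps n)) * (real n + 1)) sequentially"
  proof eventually_elim
   case (elim n)
   hence "cball x (Q * eps n) \<subseteq> I" using r by (meson less_imp_le order_trans subset_cball)
   hence "v x (t + eps n) = HL (eps n) (%z. v z t) x" using HLeq t eps_pos by blast
   thus ?case by (simp add: eps_def)
  qed
  have "filterlim eps (at_right 0) sequentially"
   using eps_lim eps_pos(1) by (auto simp: filterlim_at less_imp_neq[symmetric])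
  from filterlim_compose[OF HL_time_deriv[OF vlipc elim] this] t
  have "(%n. (v x t - HL (eps n) (%z. v z t) x) / eps n) \<longlonglongrightarrow> f (u x t)" by simp
  thus "(%n. (v x t - v x (t + eps n)) * (real n + 1)) \<longlonglongrightarrow> f (u x t)"
   using tendsto_cong[OF ev] by simp
 qed
qed

text \<open>A Hopf-Lax step started a little earlier shows that the slope is continuous off a countable set.\<close>

lemma u_cont:
 assumes t: "t > 0" and \<rho>: "\<rho> > 0"
 shows "\<exists>cc. (AE z in lborel. cball z \<rho> \<subseteq> I --> u z t = cc z) \<and> countable {x. \<not> isCont cc x}"
proof -
 define \<eta> where "\<eta> = min (t / 2) (\<rho> / (2 * (Q + 1)))"
 have \<eta>: "\<eta> > 0" "\<eta> < t" using t \<rho> Q by (auto simp: \<eta>_def)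
 have "\<eta> * (Q + 1) \<le> \<rho> / (2 * (Q + 1)) * (Q + 1)" using Q by (intro mult_right_mono) (auto simp: \<eta>_def)
 also have "\<dots> = \<rho> / 2" using Q by (simp add: field_simps add_nonneg_eq_0_iff)
 finally have Q\<eta>: "Q * \<eta> \<le> \<rho> / 2" using \<eta>(1) by (simp add: algebra_simps)
 let ?W = "%z. v z (t - \<eta>)"
 have W: "lipc M ?W" by (rule vlipc) (use \<eta> in simp)
 have loc: "v y t = HL \<eta> ?W y" if "cball z \<rho> \<subseteq> I" "y \<in> ball z (\<rho> / 2)" for z y
 proof -
  have "cball y (Q * \<eta>) \<subseteq> I"
  proof
   fix p assume "p \<in> cball y (Q * \<eta>)"
   hence "p \<in> cball z \<rho>" using that(2) Q\<eta> unfolding mem_cball mem_ball dist_real_def by linarith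
   thus "p \<in> I" using that(1) by blast
  qed
  thus ?thesis using HLeq[of "t - \<eta>" \<eta> y] \<eta> by simp
 qed
 have "AE z in lborel. cball z \<rho> \<subseteq> I --> u z t = HLu \<eta> ?W z"
  using uD[OF t]
 proof eventually_elim
  case (elim z)
  show ?case
  proof
   assume cc: "cball z \<rho> \<subseteq> I"
   have "(HL \<eta> ?W has_real_derivative u z t) (at z)"
    by (rule has_field_derivative_transform_within_open[OF elim open_ball[of z "\<rho>/2"]]) (use \<rho> loc[OF cc] in auto)
   thus "u z t = HLu \<eta> ?W z" using HL_DERIV_unique[OF W \<eta>(1)] by blast
  qed
 qed
 moreover have "countable {x. \<not> isCont (HLu \<eta> ?W) x}"
  by (rule countable_subset[OF _ HL_countable[OF W \<eta>(1)]]) (use HL_DERIV(2)[OF W \<eta>(1)] in blast)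
 ultimately show ?thesis by blast
qed

lemma P_DERIV:
 assumes t: "t > 0" and \<rho>: "\<rho> > 0" and P: "prim_of P (%x. max (u x t) k)"
 shows "AE x in lborel. cball x (2 * \<rho>) \<subseteq> I --> (P has_real_derivative max (u x t) k) (at x)"
proof -
 have wm: "(%x. max (u x t) k) \<in> borel_measurable borel" by measurable
 have wb: "\<bar>max (u x t) k\<bar> \<le> M + \<bar>k\<bar>" for x using ub[of x t] by linarith
 obtain cc where cc: "AE z in lborel. cball z \<rho> \<subseteq> I --> u z t = cc z" "countable {x. \<not> isCont cc x}"
  using u_cont[OF t \<rho>] by blast
 have "AE x in lborel. x \<notin> {x. \<not> isCont cc x}"
  by (rule AE_not_in) (rule countable_imp_null_set_lborel[OF cc(2)])
 thus ?thesis using cc(1)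
 proof eventually_elim
  case (elim x)
  show ?case
  proof
   assume x: "cball x (2 * \<rho>) \<subseteq> I"
   have sub: "cball z \<rho> \<subseteq> I" if "\<bar>z - x\<bar> < \<rho>" for z
   proof
    fix p assume "p \<in> cball z \<rho>"
    hence "p \<in> cball x (2 * \<rho>)" using that unfolding mem_cball dist_real_def by linarith
    thus "p \<in> I" using x by blast
   qed
   have "AE z in lborel. \<bar>z - x\<bar> < \<rho> --> max (u z t) k = max (cc z) k"
    using cc(1) by eventually_elim (use sub in auto)
   moreover have "isCont (%z. max (cc z) k) x" using elim(1) by (intro continuous_intros) auto
   ultimately have "(P has_real_derivative max (cc x) k) (at x)"
    by (rule prim_DERIV[OF P wm wb \<rho>])
   moreover have "u x t = cc x" using elim(2) sub[of x] \<rho> by simp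
   ultimately show "(P has_real_derivative max (u x t) k) (at x)" by simp
  qed
 qed
qed

text \<open>The primitive of \<open>max u k\<close> increases faster than both \<open>v\<close> and \<open>k * x\<close>. By the comparison principle the same holds after the Hopf-Lax
step, which turns the first into the next \<open>v\<close> and fixes the slope of the second.\<close>

lemma step_compare:
 assumes t: "t > 0" and \<rho>: "\<rho> > 0" and e: "e > 0" "Q * e \<le> \<rho>" and P: "prim_of P (%x. max (u x t) k)"
 shows "AE x in lborel. cball x (2 * \<rho>) \<subseteq> I --> max (u x (t + e)) k \<le> HLu e P x"
proof -
 have wm: "(%x. max (u x t) k) \<in> borel_measurable borel" by measurable
 have wb: "\<bar>max (u x t) k\<bar> \<le> M + \<bar>k\<bar>" for x using ub[of x t] by linarith
 have lP: "lipc (M + \<bar>k\<bar>) P" unfolding lipc_def using prim_lip[OF P wm wb] by blast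
 have lV: "lipc M (%z. v z t)" by (rule vlipc) (use t in simp)
 have lk: "lipc \<bar>k\<bar> (%y. k * y + 0)" unfolding lipc_def by (simp add: abs_mult flip: right_diff_distrib)
 have vu: "prim_of (%z. v z t) (%x. u x t)"
  by (rule lip_prim[where M = M, OF _ uD[OF t]]) (use vlip[of t t] t in auto)
 have m1: "v z t - v y t \<le> P z - P y" if "y \<le> z" for y z
 proof -
  have "(LINT x|lborel. indicator {y..z} x * u x t) \<le> (LINT x|lborel. indicator {y..z} x * max (u x t) k)"
  proof (rule integral_mono)
   show "integrable lborel (%x. indicator {y..z} x * u x t)"
    by (rule integrable_cut[where a = y and b = z and B = M]) (use ub in \<open>auto simp: indicator_def\<close>)
   show "integrable lborel (%x. indicator {y..z} x * max (u x t) k)"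
    by (rule integrable_cut[where a = y and b = z and B = "M + \<bar>k\<bar>"]) (use wb in \<open>auto simp: indicator_def\<close>)
  qed (auto simp: indicator_def)
  thus ?thesis using vu P that unfolding prim_of_def by simp
 qed
 have m2: "(k * z + 0) - (k * y + 0) \<le> P z - P y" if "y \<le> z" for y z
  using prim_mono[OF P wm wb _ that, of k] by (simp add: algebra_simps)
 have te: "t + e > 0" using t e by simp
 have "AE x in lborel. x \<notin> {x. \<not> isCont (HLy e P) x}"
  by (rule AE_not_in) (rule countable_imp_null_set_lborel[OF HL_countable[OF lP e(1)]])
 thus ?thesis using uD[OF te]
 proof eventually_elim
  case (elim x)
  show ?case
  proof
   assume x: "cball x (2 * \<rho>) \<subseteq> I"
   have D: "(HL e P has_real_derivative HLu e P x) (at x)" using HL_DERIV(1)[OF lP e(1)] elim(1) by blast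
   have loc: "v y (t + e) = HL e (%z. v z t) y" if "\<bar>y - x\<bar> < \<rho>" for y
   proof -
    have "cball y (Q * e) \<subseteq> I"
    proof
     fix p assume "p \<in> cball y (Q * e)"
     hence "p \<in> cball x (2 * \<rho>)" using that e(2) unfolding mem_cball dist_real_def by linarith
     thus "p \<in> I" using x by blast
    qed
    thus ?thesis using HLeq[OF t e(1)] by blast
   qed
   have "0 \<le> HLu e P x - u x (t + e)"
   proof (rule mono_deriv_nonneg[OF DERIV_diff[OF D elim(2)] \<rho>])
    fix z assume z: "x \<le> z" "z < x + \<rho>"
    show "HL e P x - v x (t + e) \<le> HL e P z - v z (t + e)"
     using HL_compare[OF lV lP e(1) m1 z(1)] loc[of x] loc[of z] z \<rho> by simp
   qed
   moreover have "0 \<le> HLu e P x - k"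
   proof (rule mono_deriv_nonneg[OF DERIV_diff[OF D DERIV_cmult_Id] \<rho>])
    fix z assume z: "x \<le> z" "z < x + \<rho>"
    show "HL e P x - k * x \<le> HL e P z - k * z"
     using HL_compare[OF lk lP e(1) m2 z(1)] HL_affine[OF e(1), of k 0] by simp
   qed
   ultimately show "max (u x (t + e)) k \<le> HLu e P x" by simp
  qed
 qed
qed

end


lemma compact_fst_gap:
 assumes "compact K" "K \<subseteq> A \<times> D" "open (A :: real set)" "open (D :: real set)"
 shows "\<exists>e>0. \<forall>x t. (x, t) \<in> K --> cball x e \<subseteq> A \<and> cball t e \<subseteq> D"
proof -
 have *: "\<exists>e>0. \<forall>x\<in>S. cball x e \<subseteq> U" if "compact S" "S \<subseteq> U" "open U" for S U :: "real set"
 proof -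
  note T = that
  obtain e where e: "e > 0" "(\<Union>x\<in>S. ball x e) \<subseteq> U"
   using compact_subset_open_imp_ball_epsilon_subset[OF T(1,3,2)] by auto
  hence "\<forall>x\<in>S. cball x (e / 2) \<subseteq> U" by (force simp: subset_iff)
  thus ?thesis using e(1) by (intro exI[of _ "e / 2"]) auto
 qed
 have "compact (fst ` K)" "compact (snd ` K)"
  by (intro compact_continuous_image[OF _ assms(1)] continuous_intros)+
 moreover have "fst ` K \<subseteq> A" "snd ` K \<subseteq> D" using assms(2) by auto
 ultimately obtain e1 e2 where e: "e1 > 0" "\<forall>x\<in>fst ` K. cball x e1 \<subseteq> A" "e2 > 0" "\<forall>t\<in>snd ` K. cball t e2 \<subseteq> D"
  using *[of "fst ` K" A] *[of "snd ` K" D] assms(3,4) by blast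
 show ?thesis
 proof (intro exI[of _ "min e1 e2"] conjI allI impI)
  fix x t assume "(x, t) \<in> K"
  hence "x \<in> fst ` K" "t \<in> snd ` K" by force+
  hence "cball x e1 \<subseteq> A" "cball t e2 \<subseteq> D" using e by auto
  thus "cball x (min e1 e2) \<subseteq> A" "cball t (min e1 e2) \<subseteq> D" by auto
 qed (use e in simp)
qed

locale kr_test = kr_setup v u M f I Q + test_loc \<Omega> \<phi> \<phi>x \<phi>t R B
 for v u M f I Q \<Omega> \<phi> \<phi>x \<phi>t R B +
 fixes K :: "(real \<times> real) set" and \<rho> k :: real
 assumes \<rho>: "\<rho> > 0" and nn: "\<And>p. \<phi> p \<ge> 0"
  and K: "\<And>p. p \<notin> K ==> \<phi> p = 0 \<and> \<phi>x p = 0 \<and> \<phi>t p = 0"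
  and gap: "\<And>x t. (x, t) \<in> K ==> cball x (2 * \<rho>) \<subseteq> I \<and> t > 0"
begin

definition w where "w x t = max (u x t) k"
definition Mk where "Mk = M + \<bar>k\<bar>"

lemma wb: "\<bar>w x t\<bar> \<le> Mk" unfolding w_def Mk_def using ub[of x t] by linarith
lemma wm: "(%p. w (fst p) (snd p)) \<in> borel_measurable borel" unfolding w_def using um by measurable
lemma fwm: "(%p. f (w (fst p) (snd p))) \<in> borel_measurable borel"
 by (rule measurable_compose[OF wm borel_measurable_continuous_onI[OF continuous_flux]])

lemma ws[measurable]: "(%x. w x t) \<in> borel_measurable borel" unfolding w_def by measurable

definition h where "h n p = (w (fst p) (snd p + eps n) - w (fst p) (snd p)) * (real n + 1)"

lemma hm: "h n \<in> borel_measurable borel"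
proof -
 note [measurable (raw)] = meas_comp2[OF wm] and [measurable] = meas_coord
 show ?thesis unfolding h_def[abs_def] by measurable
qed

lemma hb: "\<bar>h n p\<bar> \<le> 2 * Mk * (real n + 1)"
 unfolding h_def abs_mult by (intro mult_mono) (use wb[of "fst p" "snd p"] wb[of "fst p" "snd p + eps n"] in auto)

definition y where "y n t = (LINT x|lborel. h n (x, t) * \<phi> (x, t))"
definition gg where "gg t = (LINT x|lborel. f (w x t) * \<phi>x (x, t))"

text \<open>Let \<open>P\<close> be the primitive of \<open>max u k\<close>. By the comparison principle its Hopf-Lax evolution has
 slope at least \<open>max u k\<close> at the later time, and the difference quotient of that evolution converges
 to minus the flux.\<close>

lemma step_bound:
 "\<exists>G. (\<forall>n. Q * eps n \<le> \<rho> --> y n t \<le> G n) \<and> G \<longlonglongrightarrow> gg t \<and>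
  (\<forall>n. \<bar>G n\<bar> \<le> 2 * R * ((\<bar>L 0\<bar> + max \<bar>f Mk\<bar> \<bar>f (- Mk)\<bar>) * B))"
proof (cases "t > 0")
 case False
 hence "\<phi> (x, t) = 0 \<and> \<phi>x (x, t) = 0" for x using K[of "(x, t)"] gap[of x t] by blast
 thus ?thesis using R B by (intro exI[of _ "%_. 0"]) (simp add: y_def gg_def)
next
 case t: True
 let ?C1 = "\<bar>L 0\<bar> + max \<bar>f Mk\<bar> \<bar>f (- Mk)\<bar>"
 obtain P where P: "prim_of P (%x. w x t)" using exists_prim[OF ws wb] by blast
 have P': "prim_of P (%x. max (u x t) k)" using P by (simp add: w_def[abs_def])
 have lP: "lipc Mk P" unfolding lipc_def using prim_lip[OF P ws wb] by blast
 let ?H = "%n. HL (eps n) P" and ?U = "%n. HLu (eps n) P" and ?C2 = "max Mk (\<bar>dL (QL Mk)\<bar> + \<bar>dL (- QL Mk)\<bar>)"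
 let ?q = "%n x. (P x - ?H n x) * (real n + 1)" and ?dd = "%n x. (w x t - ?U n x) * (real n + 1)"
 have lH: "lipc Mk (?H n)" for n by (rule HL_lip[OF lP eps_pos(1)])
 have [measurable]: "P \<in> borel_measurable borel" "?H n \<in> borel_measurable borel" for n
  using borel_measurable_continuous_onI[OF lipc_cont[OF lP]] borel_measurable_continuous_onI[OF lipc_cont[OF lH]] by auto
 have Um[measurable]: "?U n \<in> borel_measurable borel" for n by (rule HLu_meas[OF lP eps_pos(1)])
 have Ub: "\<bar>?U n x\<bar> \<le> ?C2" and wb': "\<bar>w x t\<bar> \<le> ?C2" for n x
  using HLu_bound[OF lP eps_pos(1), of n x] wb[of x t] by linarith+
 have qm: "?q n \<in> borel_measurable borel" and dm: "?dd n \<in> borel_measurable borel" for n by measurable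
 have db: "\<bar>?dd n x\<bar> \<le> 2 * ?C2 * (real n + 1)" for n x
 proof -
  have "\<bar>a - b\<bar> \<le> 2 * cc" if "\<bar>a\<bar> \<le> cc" "\<bar>b\<bar> \<le> cc" for a b cc :: real using that by linarith
  from this[OF wb' Ub] have "\<bar>w x t - ?U n x\<bar> \<le> 2 * ?C2" .
  thus ?thesis unfolding abs_mult by (intro mult_mono) auto
 qed
 have qb: "\<bar>?q n x\<bar> \<le> ?C1" for n x
 proof -
  have "\<bar>P x - ?H n x\<bar> * (real n + 1) \<le> eps n * ?C1 * (real n + 1)"
   by (intro mult_right_mono HL_const_bound[OF lP eps_pos(1)]) auto
  also have "\<dots> = ?C1 * (eps n * (real n + 1))" by (simp only: mult_ac)
  finally show ?thesis unfolding eps_mult by (simp add: abs_mult)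
 qed
 define G where "G n = (LINT x|lborel. ?q n x * \<phi>x (x, t))" for n
 have "\<bar>G n\<bar> \<le> 2 * R * (?C1 * B)" for n
  unfolding G_def using prod_facts(6)[of "%p. ?q n (fst p)" ?C1 \<phi>x t] measurable_compose[OF meas_coord(1) qm] qb by simp
 moreover have "G \<longlonglongrightarrow> gg t" unfolding G_def[abs_def] gg_def
 proof (rule slice_DCT[OF qm _ qb])
  show "(%x. f (w x t)) \<in> borel_measurable borel"
   by (rule measurable_compose[OF ws borel_measurable_continuous_onI[OF continuous_flux]])
  show "AE x in lborel. \<phi>x (x, t) = 0 \<or> (%n. ?q n x) \<longlonglongrightarrow> f (w x t)"
   using P_DERIV[OF t \<rho> P']
  proof eventually_elim
   case (elim x)
   show ?case
   proof (cases "(x, t) \<in> K")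
    case True
    hence D: "(P has_real_derivative w x t) (at x)" using elim gap by (auto simp: w_def)
    have "filterlim eps (at_right 0) sequentially"
     using eps_lim eps_pos(1) by (auto simp: filterlim_at less_imp_neq[symmetric])
    from filterlim_compose[OF HL_time_deriv[OF lP D] this] show ?thesis by (simp add: eps_def)
   qed (use K in simp)
  qed
 qed simp
 moreover have "y n t \<le> G n" if n: "Q * eps n \<le> \<rho>" for n
 proof -
  have "AE x in lborel. x \<notin> {x. \<not> isCont (HLy (eps n) P) x}"
   by (rule AE_not_in) (rule countable_imp_null_set_lborel[OF HL_countable[OF lP eps_pos(1)]])
  hence "AE x in lborel. (?H n has_real_derivative ?U n x) (at x)"
   by eventually_elim (use HL_DERIV(1)[OF lP eps_pos(1)] in blast)
  hence "prim_of (?H n) (?U n)" using lip_prim[of "?H n" Mk "?U n"] lH Um by (simp add: lipc_def)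
  from prim_IBP[OF prim_diff[OF P this ws Um wb' Ub] dm db bump_slice]
  have G: "G n = - (LINT x|lborel. ?dd n x * \<phi> (x, t))" by (simp add: G_def)
  have "y n t \<le> (LINT x|lborel. - (?dd n x * \<phi> (x, t)))" unfolding y_def
  proof (rule integral_mono_AE)
   show "integrable lborel (%x. h n (x, t) * \<phi> (x, t))" by (rule prod_facts(5)[OF hm hb]) simp
   show "integrable lborel (%x. - (?dd n x * \<phi> (x, t)))"
    using prod_facts(5)[of "%p. ?dd n (fst p)" "2 * ?C2 * (real n + 1)" \<phi> t] measurable_compose[OF meas_coord(1) dm] db by simp
   show "AE x in lborel. h n (x, t) * \<phi> (x, t) \<le> - (?dd n x * \<phi> (x, t))"
    using step_compare[OF t \<rho> eps_pos(1) n P']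
   proof eventually_elim
    case (elim x)
    show ?case
    proof (cases "(x, t) \<in> K")
     case True
     hence "w x (t + eps n) \<le> ?U n x" using elim gap by (auto simp: w_def)
     hence "(w x (t + eps n) - w x t) * (real n + 1) * \<phi> (x, t) \<le> (?U n x - w x t) * (real n + 1) * \<phi> (x, t)"
      using nn by (intro mult_right_mono) auto
     thus ?thesis by (simp add: h_def algebra_simps)
    qed (use K in simp)
   qed
  qed
  thus ?thesis using G by simp
 qed
 ultimately show ?thesis by blast
qed

text \<open>The time difference quotients of \<open>max u k\<close> against the test function are bounded by \<open>G n\<close>, which tends
boundedly to the flux term; only the positive part of the excess has to be controlled.\<close>

lemma kr_core: "0 \<le> (LINT p|lborel. w (fst p) (snd p) * \<phi>t p) + (LINT p|lborel. f (w (fst p) (snd p)) * \<phi>x p)"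
proof -
 obtain Cf where "\<forall>p\<in>{-Mk..Mk}. \<bar>f p\<bar> \<le> Cf" using bounded_on_Icc[OF continuous_flux] by blast
 hence Cf: "\<bar>f (w x t)\<bar> \<le> Cf" for x t using wb[of x t] by (auto simp: abs_le_iff)
 let ?C = "2 * R * ((\<bar>L 0\<bar> + max \<bar>f Mk\<bar> \<bar>f (- Mk)\<bar>) * B)" and ?Cg = "2 * R * (Cf * B)"
 have ym[measurable]: "y n \<in> borel_measurable borel" for n unfolding y_def[abs_def] by (rule prod_facts(4)[OF hm hb]) simp
 have gm[measurable]: "gg \<in> borel_measurable borel" and gb: "\<bar>gg t\<bar> \<le> ?Cg" for t
  using prod_facts(4,6)[OF fwm Cf, of \<phi>x] unfolding gg_def[abs_def] by simp_all
 have yb: "\<bar>y n t\<bar> \<le> 2 * R * (2 * Mk * (real n + 1) * B)" for n t unfolding y_def by (rule prod_facts(6)[OF hm hb]) simp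
 have out: "y n t = 0" "gg t = 0" if "t \<notin> {-R..R}" for n t unfolding y_def gg_def using zt[OF that] by simp_all
 have iy: "integrable lborel (y n)" for n by (rule compact_integrable(1)[OF ym compact_Icc yb out(1)])
 have ig: "integrable lborel gg" by (rule compact_integrable(1)[OF gm compact_Icc gb out(2)])
 have "(%n. Q * eps n) \<longlonglongrightarrow> Q * 0" by (intro tendsto_intros eps_lim)
 hence "eventually (%n. Q * eps n < \<rho>) sequentially" using \<rho> order_tendstoD(2) by fastforce
 then obtain N where N: "\<And>n. n \<ge> N ==> Q * eps n \<le> \<rho>" unfolding eventually_sequentially by (meson less_imp_le)
 define D where "D n t = max 0 (y (n + N) t - gg t)" for n t
 have Dm: "D n \<in> borel_measurable borel" for n unfolding D_def[abs_def] by measurable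
 have D: "\<bar>D n t\<bar> \<le> ?C + ?Cg" "(%n. D n t) \<longlonglongrightarrow> 0" for n t
 proof -
  obtain G where G: "\<forall>n. Q * eps n \<le> \<rho> --> y n t \<le> G n" "G \<longlonglongrightarrow> gg t" "\<forall>n. \<bar>G n\<bar> \<le> ?C"
   using step_bound[of t] by (elim exE conjE)
  have le: "y (n + N) t \<le> G (n + N)" for n using G(1) N[of "n + N"] by simp
  show "\<bar>D n t\<bar> \<le> ?C + ?Cg"
   using le[of n] G(3)[rule_format, of "n + N"] gb[of t] unfolding D_def by linarith
  have "(%n. max 0 (G (n + N) - gg t)) \<longlonglongrightarrow> max 0 (gg t - gg t)"
   by (intro tendsto_intros LIMSEQ_ignore_initial_segment G(2))
  hence l: "(%n. max 0 (G (n + N) - gg t)) \<longlonglongrightarrow> 0" by simp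
  show "(%n. D n t) \<longlonglongrightarrow> 0"
  proof (rule tendsto_sandwich[OF _ _ tendsto_const l]; intro always_eventually allI)
   show "0 \<le> D n t" "D n t \<le> max 0 (G (n + N) - gg t)" for n using le[of n] unfolding D_def by linarith+
  qed
 qed
 have D0: "D n t = 0" if "t \<notin> {-R..R}" for n t using out[OF that] by (simp add: D_def)
 have iD: "integrable lborel (D n)" for n by (rule compact_integrable(1)[OF Dm compact_Icc D(1) D0])
 have "(%n. LINT t|lborel. D n t) \<longlonglongrightarrow> (LINT t::real|lborel. 0)"
  by (rule compact_DCT[where K = "{-R..R}", OF Dm _ _ D(1) D0]) (use D(2) in auto)
 hence "(%n. (LINT t|lborel. gg t) + (LINT t|lborel. D n t)) \<longlonglongrightarrow> (LINT t|lborel. gg t) + 0"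
  by (intro tendsto_add tendsto_const) simp
 moreover have "(LINT t|lborel. y (n + N) t) \<le> (LINT t|lborel. gg t) + (LINT t|lborel. D n t)" for n
 proof -
  have "(LINT t|lborel. y (n + N) t) \<le> (LINT t|lborel. gg t + D n t)"
   by (rule integral_mono[OF iy Bochner_Integration.integrable_add[OF ig iD]]) (simp add: D_def)
  thus ?thesis using ig iD by simp
 qed
 moreover have "(%n. LINT t|lborel. y (n + N) t) \<longlonglongrightarrow> - (LINT p|lborel. w (fst p) (snd p) * \<phi>t p)"
 proof (rule LIMSEQ_ignore_initial_segment[where f = "%n. LINT t|lborel. y n t"])
  have "(LINT t|lborel. y n t) = (LINT p|lborel. h n p * \<phi> p)" for n
   unfolding y_def using prod_facts(2)[OF hm hb, of \<phi>] by simp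
  thus "(%n. LINT t|lborel. y n t) \<longlonglongrightarrow> - (LINT p|lborel. w (fst p) (snd p) * \<phi>t p)"
   using plane_shift[OF wm wb] by (simp add: h_def)
 qed
 ultimately have "- (LINT p|lborel. w (fst p) (snd p) * \<phi>t p) \<le> (LINT t|lborel. gg t) + 0" by (intro LIMSEQ_le) auto
 thus ?thesis using prod_facts(2)[OF fwm Cf, of \<phi>x] by (simp add: gg_def)
qed

end

context kr_setup begin

text \<open>The entropy flux for \<open>\<bar>u - k\<bar>\<close> is twice the one for \<open>max u k\<close>, minus those for \<open>u\<close> and \<open>k\<close>,
 which contribute nothing.\<close>

lemma kruzkov_side:
 assumes weak: "\<And>\<phi> \<phi>x \<phi>t. test_function (I \<times> {0<..}) \<phi> \<phi>x \<phi>t ==>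
   (LINT z:UNIV \<times> {0<..}|lebesgue. u (fst z) (snd z) * \<phi>t z + f (u (fst z) (snd z)) * \<phi>x z) = 0"
 shows "kruzkov (I \<times> {0<..}) f u"
 unfolding kruzkov_def
proof (intro allI impI, elim conjE)
 fix k :: real and \<phi> \<phi>x \<phi>t
 assume tf: "test_function (I \<times> {0<..}) \<phi> \<phi>x \<phi>t" and nn: "\<forall>z. 0 \<le> \<phi> z"
 obtain R B where RB: "R > 0" "B \<ge> 0" "\<And>p. p \<notin> {-R..R} \<times> {-R..R} ==> \<phi> p = 0 \<and> \<phi>x p = 0 \<and> \<phi>t p = 0"
  "\<And>z. \<bar>\<phi> z\<bar> \<le> B \<and> \<bar>\<phi>x z\<bar> \<le> B \<and> \<bar>\<phi>t z\<bar> \<le> B"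
  using test_facts(1)[OF tf] by blast
 obtain K where KK: "compact K" "K \<subseteq> I \<times> {0<..}" "\<And>z. z \<notin> K ==> \<phi> z = 0 \<and> \<phi>x z = 0 \<and> \<phi>t z = 0"
  using test_facts(7)[OF tf] by blast
 obtain e where e: "e > 0" "\<And>x t. (x, t) \<in> K ==> cball x e \<subseteq> I"
  using compact_fst_gap[OF KK(1,2) I open_greaterThan] by blast
 interpret kr_test v u M f I Q "I \<times> {0<..}" \<phi> \<phi>x \<phi>t R B K "e / 2" k
 proof unfold_locales
  show "cball x (2 * (e / 2)) \<subseteq> I \<and> 0 < t" if "(x, t) \<in> K" for x t using e(2)[OF that] KK(2) that by auto
 qed (use tf RB KK(3) nn e(1) in auto)
 let ?u = "%p. u (fst p) (snd p)" and ?w = "%p. w (fst p) (snd p)"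
 have kM: "\<bar>k\<bar> \<le> Mk" and uM: "\<bar>u x t\<bar> \<le> Mk" for x t using ub[of x t] M_nonneg by (auto simp: Mk_def)
 obtain Cf where "\<forall>p\<in>{-Mk..Mk}. \<bar>f p\<bar> \<le> Cf" using bounded_on_Icc[OF continuous_flux] by blast
 hence Cf: "\<bar>f p\<bar> \<le> Cf" if "\<bar>p\<bar> \<le> Mk" for p using that by (auto simp: abs_le_iff)
 have fum: "(%p. f (?u p)) \<in> borel_measurable borel"
  by (rule measurable_compose[OF um borel_measurable_continuous_onI[OF continuous_flux]])
 have km: "(%p::real \<times> real. cc) \<in> borel_measurable borel" for cc :: real by simp
 note i = prod_facts(1)[OF wm wb, of \<phi>t] prod_facts(1)[OF fwm Cf[OF wb], of \<phi>x] prod_facts(1)[OF um uM, of \<phi>t]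
  prod_facts(1)[OF fum Cf[OF uM], of \<phi>x] prod_facts(1)[OF km kM, of \<phi>t] prod_facts(1)[OF km Cf[OF kM], of \<phi>x]
 have lb: "(LINT z:S|lebesgue. H z) = (LINT p|lborel. H p)" if "I \<times> {0<..} \<subseteq> S" "integrable lborel H" "\<And>p. p \<notin> K ==> H p = 0"
  for S and H :: "real \<times> real => real"
 proof -
  have "(%p. indicator S p *\<^sub>R H p) = H"
  proof
   have "p \<in> K ==> p \<in> S" for p using that(1) KK(2) by blast
   thus "indicator S p *\<^sub>R H p = H p" for p using that(3)[of p] by (cases "p \<in> K") simp_all
  qed
  thus ?thesis unfolding set_lebesgue_integral_def using integral_completion[OF borel_measurable_integrable[OF that(2)]] by simp
 qed
 have u0: "(LINT p|lborel. ?u p * \<phi>t p) + (LINT p|lborel. f (?u p) * \<phi>x p) = 0"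
  using weak[OF tf] lb[of "UNIV \<times> {0<..}" "%p. ?u p * \<phi>t p + f (?u p) * \<phi>x p"] i(3,4) KK(3) by auto
 have "(%n. 0) \<longlonglongrightarrow> - (LINT p|lborel. k * \<phi>t p)" using plane_shift[of "%_. k" "\<bar>k\<bar>"] by simp
 hence k1: "(LINT p|lborel. k * \<phi>t p) = 0" by (simp add: LIMSEQ_const_iff)
 have k2: "(LINT p|lborel. f k * \<phi>x p) = 0" using prod_facts(2)[OF km Cf[OF kM], of \<phi>x] int_phix by simp
 let ?T = "%z. \<bar>?u z - k\<bar> * \<phi>t z + sgn (?u z - k) * (f (?u z) - f k) * \<phi>x z"
 let ?E = "%p. 2 * (?w p * \<phi>t p + f (?w p) * \<phi>x p) - (?u p * \<phi>t p + f (?u p) * \<phi>x p) - (k * \<phi>t p + f k * \<phi>x p)"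
 have TE: "?T = ?E"
 proof
  show "?T p = ?E p" for p unfolding w_def
   by (cases "?u p" k rule: linorder_cases) (simp_all add: max_def algebra_simps)
 qed
 have "(LINT z:I \<times> {0<..}|lebesgue. ?T z) = (LINT p|lborel. ?E p)"
  unfolding TE by (rule lb) (use i KK(3) in auto)
 also have "\<dots> = 2 * ((LINT p|lborel. ?w p * \<phi>t p) + (LINT p|lborel. f (?w p) * \<phi>x p))" using i u0 k1 k2 by auto
 finally show "0 \<le> (LINT z:I \<times> {0<..}|lebesgue. ?T z)" using kr_core by simp
qed

end


section \<open>Optimal curves at the interface\<close>

lemma (in conv_flux) persp_DERIV:
 assumes "dd > 0"
 shows "((%dd. dd * L (x / dd)) has_real_derivative - f (dL (x / dd))) (at dd)"
proof -
 have D: "((%dd. x / dd) has_real_derivative - (x / dd\<^sup>2)) (at dd)"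
  using assms by (auto intro!: derivative_eq_intros simp: power2_eq_square)
 have "((%dd. dd * L (x / dd)) has_real_derivative 1 * L (x / dd) + dL (x / dd) * - (x / dd\<^sup>2) * dd) (at dd)"
  by (rule DERIV_mult[OF DERIV_ident DERIV_chain2[OF DERIV_L D]])
 moreover have "1 * L (x / dd) + dL (x / dd) * - (x / dd\<^sup>2) * dd = - f (dL (x / dd))"
  unfolding f_dL using assms by (simp add: power2_eq_square field_simps)
 ultimately show ?thesis by simp
qed

lemma (in conv_flux) flux_dL_less: "0 \<le> p ==> p < q ==> f (dL p) < f (dL q)" "p \<le> 0 ==> q < p ==> f (dL p) < f (dL q)"
proof -
 assume "0 \<le> p" "p < q"
 hence "0 \<le> deriv f (dL p) * (dL q - dL p)" "dL q \<noteq> dL p" by (auto intro!: mult_nonneg_nonneg)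
 thus "f (dL p) < f (dL q)" using tangent_strict[of "dL q" "dL p"] by linarith
next
 assume "p \<le> 0" "q < p"
 hence "0 \<le> deriv f (dL p) * (dL q - dL p)" "dL q \<noteq> dL p" by (auto intro!: mult_nonpos_nonpos)
 thus "f (dL p) < f (dL q)" using tangent_strict[of "dL q" "dL p"] by linarith
qed

lemma (in conv_flux) flux_dL_inj: "f (dL p) = f (dL q) ==> 0 \<le> p \<and> 0 \<le> q \<or> p \<le> 0 \<and> q \<le> 0 ==> p = q"
 using flux_dL_less[of p q] flux_dL_less[of q p] by (cases p q rule: linorder_cases) auto

context value_function begin

text \<open>The curve that stays off the interface pulls the other one along from the meeting point; the end points
follow by continuity.\<close>

lemma meet_pos:
 assumes opt: "isopt c t" "isopt d t" and o: "0 \<le> a" "a < s" "s < b" "b \<le> t" and eq: "c s = d s"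
  and pos: "(\<forall>u\<in>{a<..<b}. d u > 0) \<or> (\<forall>u\<in>{a<..<b}. d u < 0)" and u: "u \<in> {a..b}"
 shows "c u = d u"
proof -
 have inner: "c r - d r = 0" if r: "r \<in> {a<..<b}" for r
 proof -
  define a' where "a' = (a + min r s) / 2"
  define b' where "b' = (b + max r s) / 2"
  have o': "a < a'" "a' < s" "s < b'" "b' < b" "a' < r" "r < b'" using o r unfolding a'_def b'_def by auto
  from pos show ?thesis
  proof
   assume p: "\<forall>u\<in>{a<..<b}. d u > 0"
   have "c r = d r"
    by (rule coincide_pos[OF opt _ o'(2,3) _ eq, of r]) (use o o' p in auto)
   thus ?thesis by simp
  next
   assume p: "\<forall>u\<in>{a<..<b}. d u < 0"
   have "c r = d r"
    by (rule coincide_neg[OF opt _ o'(2,3) _ eq, of r]) (use o o' p in auto)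
   thus ?thesis by simp
  qed
 qed
 have "continuous_on {a..b} (%r. c r - d r)"
  using opt_cont[OF opt(1)] opt_cont[OF opt(2)] o
  by (intro continuous_intros) (auto elim: continuous_on_subset)
 hence "c u - d u = 0"
  using continuous_constant_on_closure[of "{a<..<b}" "%r. c r - d r" 0] inner u o by (auto simp: closure_greaterThanLessThan)
 thus ?thesis by simp
qed

text \<open>The intermediate value theorem yields a meeting point, and from there on the curves coincide.\<close>

lemma no_cross:
 assumes opt: "isopt c t" "isopt d t" and o: "0 \<le> a" "a < b" "b \<le> t"
  and pos: "(\<forall>u\<in>{a<..<b}. d u > 0) \<or> (\<forall>u\<in>{a<..<b}. d u < 0)"
  and x: "c a < d a \<and> c b > d b \<or> c a > d a \<and> c b < d b"
 shows False
proof -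
 have cc: "continuous_on {a..b} (%r. c r - d r)"
  using opt_cont[OF opt(1)] opt_cont[OF opt(2)] o
  by (intro continuous_intros) (auto elim: continuous_on_subset)
 have "\<exists>s\<ge>a. s \<le> b \<and> c s - d s = 0"
  using IVT'[OF _ _ _ cc, of 0] IVT2'[OF _ _ _ cc, of 0] x o by auto
 then obtain s where s: "a \<le> s" "s \<le> b" "c s = d s" by auto
 hence "s \<noteq> a" "s \<noteq> b" using x by auto
 hence "c a = d a" using meet_pos[OF opt o(1) _ _ o(3) s(3) pos, of a] s o by auto
 thus False using x by simp
qed

lemma opt_form:
 assumes "isopt c t" "t > 0"
 shows "\<exists>d. isopt d t \<and> d t = c t \<and> d 0 = c 0 \<and> (same_side (d 0) (d t) \<and> affon d 0 t \<or>
  (\<exists>s1 s2. thr_ok t s1 s2 (d 0) (d t) \<and> d = bent t s1 s2 (d 0) (d t)))"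
proof -
 obtain cc where cc: "pc c 0 t cc" "v (c t) t = v0 (c 0) + cc" using assms(1) unfolding isopt_def by blast
 have opt: "isopt d t" if dd: "pc d 0 t cc'" "cc' \<le> cc" "d t = c t" "d 0 = c 0" for d cc'
 proof -
  have "v (c t) t \<le> v0 (d 0) + cc'" using v_min(2)[OF _ dd(1,3)] assms(2) by simp
  hence "v (d t) t = v0 (d 0) + cc'" using cc(2) dd by simp
  thus ?thesis unfolding isopt_def using dd(1) by blast
 qed
 from pc_reduce[OF cc(1)] show ?thesis
 proof (elim disjE exE conjE)
  assume ss: "same_side (c 0) (c t)" and le: "seg (t - 0) (c 0) (c t) \<le> cc"
  have e: "line 0 t (c 0) (c t) 0 = c 0" "line 0 t (c 0) (c t) t = c t" using assms(2) by auto
  show ?thesis using opt[OF pc_line[OF assms(2) ss] le e(2,1)] e ss affon_line by metis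
 next
  fix s1 s2 assume ok: "thr_ok (t - 0) s1 s2 (c 0) (c t)" and le: "thr (t - 0) s1 s2 (c 0) (c t) \<le> cc"
  hence ok': "thr_ok t s1 s2 (c 0) (c t)" and le': "thr t s1 s2 (c 0) (c t) \<le> cc" by auto
  let ?d = "bent t s1 s2 (c 0) (c t)"
  note e = bent_affon(4,7)[OF ok']
  have "isopt ?d t" by (rule opt[OF bent_pc[OF ok'] le' e(2,1)])
  thus ?thesis using e ok' by (intro exI[of _ ?d]) auto
 qed
qed

lemma opt_seg:
 assumes "isopt c t" "0 \<le> a" "a < b" "b \<le> t" "affon c a b" "same_side (c a) (c b)"
 shows "v (c b) b = v (c a) a + seg (b - a) (c a) (c b)"
proof (cases "c a \<le> 0 \<and> c b \<le> 0")
 case True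
 hence "c s \<le> 0" if "s \<in> {a..b}" for s using affon_mono_ends(2)[OF assms(5) that] by auto
 thus ?thesis using opt_nonpos(2)[OF assms(1-4)] True by (simp add: seg_def)
next
 case False
 hence "0 \<le> c a" "0 \<le> c b" "0 < c a \<or> 0 < c b" using assms(6) unfolding same_side_def by auto
 hence "c s > 0" if "s \<in> {a<..<b}" for s
  using affon_between(1,2)[OF assms(5), of s] that by auto
 thus ?thesis using opt_pos(2)[OF assms(1-4)] False by (auto simp: seg_def)
qed

text \<open>Energy of a leg: minus the flux of the state carried by it. It is the derivative of the cost
of the leg with respect to its duration, so it is conserved at interior times on the interface.\<close>

definition eng :: "real => real => real" where
 "eng a p = (if a \<le> 0 then - g (G.dL p) else - f (F.dL p))"

lemma seg_DERIV:
 assumes "dd > 0"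
 shows "((%dd. seg dd a 0) has_real_derivative eng a (- a / dd)) (at dd)"
  and "((%dd. seg dd 0 a) has_real_derivative eng a (a / dd)) (at dd)"
 using F.persp_DERIV[OF assms, of a] F.persp_DERIV[OF assms, of "-a"] G.persp_DERIV[OF assms, of a] G.persp_DERIV[OF assms, of "-a"]
 by (auto simp: seg_def eng_def)

text \<open>Shifting the time of arrival at the interface by a small amount cannot lower the cost, and the two legs
exchange duration at the rates \<open>eng\<close>.\<close>

lemma corner:
 assumes opt: "isopt c t" and o: "0 \<le> a" "a < s" "s < b" "b \<le> t" and z: "c s = 0"
  and aff: "affon c a s" "affon c s b"
 shows "eng (c a) (- c a / (s - a)) = eng (c b) (c b / (b - s))"
proof -
 let ?\<phi> = "%r. seg (r - a) (c a) 0 + seg (b - r) 0 (c b)"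
 have ss: "same_side y 0" "same_side 0 y" for y by (auto simp: same_side_def)
 have e: "v (c b) b = v (c a) a + ?\<phi> s"
  using opt_seg[OF opt o(1,2) _ aff(1)] opt_seg[OF opt _ o(3,4) aff(2)] o z ss by simp
 have min: "?\<phi> s \<le> ?\<phi> r" if r: "a < r" "r < b" for r
 proof -
  have "v 0 r \<le> v (c a) a + seg (r - a) (c a) 0"
   using v_le[OF pc_line[OF r(1) ss(1)[of "c a"]] o(1)] r by simp
  moreover have "v (c b) b \<le> v 0 r + seg (b - r) 0 (c b)"
   using v_le[OF pc_line[OF r(2) ss(2)[of "c b"]]] r o by simp
  ultimately show ?thesis using e by simp
 qed
 have D1: "((%r. seg (r - a) (c a) 0) has_real_derivative eng (c a) (- c a / (s - a)) * 1) (at s)"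
  by (rule DERIV_chain2[OF seg_DERIV(1)]) (use o in \<open>auto intro!: derivative_eq_intros\<close>)
 have D2: "((%r. seg (b - r) 0 (c b)) has_real_derivative eng (c b) (c b / (b - s)) * -1) (at s)"
  by (rule DERIV_chain2[OF seg_DERIV(2)]) (use o in \<open>auto intro!: derivative_eq_intros\<close>)
 have "eng (c a) (- c a / (s - a)) * 1 + eng (c b) (c b / (b - s)) * -1 = 0"
 proof (rule DERIV_local_min[OF DERIV_add[OF D1 D2]])
  show "0 < min (s - a) (b - s)" using o by simp
  show "\<forall>y. \<bar>s - y\<bar> < min (s - a) (b - s) --> ?\<phi> s \<le> ?\<phi> y" using min by auto
 qed
 thus ?thesis by simp
qed

text \<open>The straight line between the end points stays on the same side, and it is strictly cheaper because the speed
changes at \<open>s\<close>.\<close>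

lemma no_touch:
 assumes opt: "isopt c t" and o: "0 \<le> a" "a < s" "s < b" "b \<le> t" and z: "c s = 0"
  and aff: "affon c a s" "affon c s b" and side: "c a > 0 \<and> c b > 0 \<or> c a < 0 \<and> c b < 0"
 shows False
proof -
 have e: "v (c b) b = v (c a) a + seg (s - a) (c a) 0 + seg (b - s) 0 (c b)"
  using opt_seg[OF opt o(1,2) _ aff(1)] opt_seg[OF opt _ o(3,4) aff(2)] o z
   linear[of 0 "c a"] linear[of 0 "c b"] by (simp add: same_side_def)
 have ab: "a < b" using o by simp
 have le: "v (c b) b \<le> v (c a) a + seg (b - a) (c a) (c b)"
  using v_le[OF pc_line[OF ab, of "c a" "c b"] o(1)] side ab by (auto simp: same_side_def)
 have sl: "- c a / (s - a) \<noteq> c b / (b - s)"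
 proof -
  have "- c a / (s - a) < 0 \<and> 0 < c b / (b - s) \<or> 0 < - c a / (s - a) \<and> c b / (b - s) < 0"
   using side o by (auto simp: divide_neg_pos divide_pos_pos)
  thus ?thesis by linarith
 qed
 have "seg (b - a) (c a) (c b) < seg (s - a) (c a) 0 + seg (b - s) 0 (c b)"
  using F.persp_merge_strict[OF _ _ sl] G.persp_merge_strict[OF _ _ sl] o side by (auto simp: seg_def)
 thus False using e le by linarith
qed

lemma eng_sit: "eng 0 0 = - g (\<theta> g)" by (simp add: eng_def G.dL_0)

lemma g_theta_less: "p \<noteq> 0 ==> g (\<theta> g) < g (G.dL p)"
 using G.flux_dL_less[of 0 p] by (cases "p < 0") (auto simp: G.dL_0)

text \<open>A leg on the left carries a flux above \<open>g (\<theta> g)\<close> unless its speed vanishes, so \<open>corner\<close> fails next to a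
rest.\<close>

lemma no_sit_left:
 assumes opt: "isopt c t" and o: "0 \<le> a" "a < s" "s < b" "b \<le> t" and z: "c s = 0"
  and aff: "affon c a s" "affon c s b" and side: "c a < 0 \<and> c b = 0 \<or> c a = 0 \<and> c b < 0"
 shows False
proof -
 have "- c a / (s - a) \<noteq> 0 \<and> c b = 0 \<or> c a = 0 \<and> c b / (b - s) \<noteq> 0" using side o by auto
 hence "g (\<theta> g) < g (G.dL (- c a / (s - a))) \<and> c b = 0 \<or> c a = 0 \<and> g (\<theta> g) < g (G.dL (c b / (b - s)))"
  using g_theta_less by blast
 thus False using corner[OF opt o z aff] side by (auto simp: eng_def G.dL_0)
qed

lemma bent_facts:
 assumes ok: "thr_ok t s1 s2 (d 0) (d t)" and e: "d = bent t s1 s2 (d 0) (d t)"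
 shows "affon d 0 s1" "affon d s1 (t - s2)" "affon d (t - s2) t" "d s1 = 0" "d (t - s2) = 0"
  "s1 \<le> s ==> s \<le> t - s2 ==> d s = 0"
 using bent_affon(1-3)[OF ok] bent_affon(5,6)[OF ok] bent_signs(1)[OF ok, of s] by (simp_all flip: e)

text \<open>Minimisers that end on the right after leaving the interface at time \<open>s\<close>: either they cross from the left, with
equal fluxes on both sides, or they rested before, and then leave with the flux \<open>g (\<theta> g)\<close> of the resting state.\<close>

definition crossR :: "(real => real) => real => real => bool" where
 "crossR c t s \<longleftrightarrow> isopt c t \<and> 0 < s \<and> s < t \<and> c s = 0 \<and> c t > 0 \<and> affon c s t \<and>
  (c 0 < 0 \<and> affon c 0 s \<and> f (F.dL (c t / (t - s))) = g (G.dL (- c 0 / s)) \<or>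
  0 \<le> c 0 \<and> (\<exists>s1\<ge>0. s1 < s \<and> affon c 0 s1 \<and> (\<forall>r\<in>{s1..s}. c r = 0)) \<and> f (F.dL (c t / (t - s))) = g (\<theta> g))"

text \<open>On the left only a transversal crossing is possible, by \<open>no_sit_left\<close>.\<close>

definition crossL :: "(real => real) => real => real => bool" where
 "crossL c t s \<longleftrightarrow> isopt c t \<and> 0 < s \<and> s < t \<and> c s = 0 \<and> c t < 0 \<and> affon c s t \<and>
  c 0 > 0 \<and> affon c 0 s \<and> g (G.dL (c t / (t - s))) = f (F.dL (- c 0 / s))"

lemma form_right:
 assumes "isopt c t" "t > 0" "c t > 0"
 shows "\<exists>d. isopt d t \<and> d t = c t \<and> d 0 = c 0 \<and> (0 \<le> d 0 \<and> affon d 0 t \<or> (\<exists>s. crossR d t s))"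
proof -
 obtain d where d: "isopt d t" "d t = c t" "d 0 = c 0"
  and form: "same_side (d 0) (d t) \<and> affon d 0 t \<or> (\<exists>s1 s2. thr_ok t s1 s2 (d 0) (d t) \<and> d = bent t s1 s2 (d 0) (d t))"
  using opt_form[OF assms(1,2)] by blast
 have "0 \<le> d 0 \<and> affon d 0 t \<or> (\<exists>s. crossR d t s)"
  using form
 proof (elim disjE exE conjE)
  assume "same_side (d 0) (d t)" "affon d 0 t"
  thus ?thesis using assms(3) d(2) by (auto simp: same_side_def)
 next
  fix s1 s2 assume ok: "thr_ok t s1 s2 (d 0) (d t)" and e: "d = bent t s1 s2 (d 0) (d t)"
  note B = bent_facts[OF ok e]
  define s where "s = t - s2"
  have s: "0 \<le> s1" "s1 \<le> s" "s < t" "s1 = 0 --> d 0 = 0"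
   using ok assms(3) d(2) unfolding thr_ok_def s_def by auto
  note B = B[folded s_def]
  have p: "d t > 0" using assms(3) d(2) by simp
  have co: "eng (d a) (- d a / (s - a)) = - f (F.dL (d t / (t - s)))" if "0 \<le> a" "a < s" "affon d a s" for a
   using corner[OF d(1) that(1,2) s(3) order_refl B(5) that(3) B(3)] p by (simp add: eng_def)
  show ?thesis
  proof (cases "d 0 < 0")
   case True
   hence s1: "0 < s1" using s by auto
   have "s1 = s"
   proof (rule ccontr)
    assume "s1 \<noteq> s"
    hence lt: "s1 < s" using s by simp
    show False using no_sit_left[OF d(1) order_refl s1 lt _ B(4) B(1,2)] True B(5) s by auto
   qed
   hence "crossR d t s" unfolding crossR_def using d(1) s s1 B p True co[of 0] by (simp add: eng_def)
   thus ?thesis by blast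
  next
   case z: False
   have sit: "crossR d t s" if "s1 < s"
    unfolding crossR_def using d(1) s B(1-5) p z that co[of s1] B(6) by (auto simp: eng_sit intro!: exI[of _ s1])
   have sit0: "crossR d t s" if "d 0 = 0" "s > 0"
   proof -
    have a0: "affon d 0 s1" by (rule B(1))
    have zero: "d r = 0" if r: "r \<in> {0..s}" for r
    proof (cases "r \<le> s1")
     case True
     hence "d r \<le> max (d 0) (d s1)" "min (d 0) (d s1) \<le> d r" using affon_mono_ends[OF a0, of r] r by auto
     thus ?thesis using that \<open>d 0 = 0\<close> B(4) by simp
    qed (use B(6) r in auto)
    have "affon d 0 s" by (rule affonI[where k = 0 and m = 0]) (use zero in simp)
    moreover have "affon d 0 0" by (rule affonI[where k = 0 and m = 0]) (use zero that in simp)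
    ultimately show ?thesis
     unfolding crossR_def using d(1) s B(1-5) p z that co[of 0] zero by (auto simp: eng_sit intro!: exI[of _ 0])
   qed
   show ?thesis
   proof (cases "s1 < s")
    case True thus ?thesis using sit by blast
   next
    case False
    hence e1: "s1 = s" using s by simp
    show ?thesis
    proof (cases "s = 0")
     case True
     hence "affon d 0 t" using B(3) by simp
     thus ?thesis using z by simp
    next
     case False
     have "d 0 = 0"
     proof (rule ccontr)
      assume "d 0 \<noteq> 0"
      thus False using no_touch[OF d(1) order_refl _ s(3) order_refl B(5) _ B(3)] B(1) e1 z p False s by auto
     qed
     thus ?thesis using sit0 False s e1 by auto
    qed
   qed
  qed
 qed
 thus ?thesis using d by blast
qed

lemma form_left:
 assumes "isopt c t" "t > 0" "c t < 0"
 shows "\<exists>d. isopt d t \<and> d t = c t \<and> d 0 = c 0 \<and> (d 0 \<le> 0 \<and> affon d 0 t \<or> (\<exists>s. crossL d t s))"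
proof -
 obtain d where d: "isopt d t" "d t = c t" "d 0 = c 0"
  and form: "same_side (d 0) (d t) \<and> affon d 0 t \<or> (\<exists>s1 s2. thr_ok t s1 s2 (d 0) (d t) \<and> d = bent t s1 s2 (d 0) (d t))"
  using opt_form[OF assms(1,2)] by blast
 have "d 0 \<le> 0 \<and> affon d 0 t \<or> (\<exists>s. crossL d t s)"
  using form
 proof (elim disjE exE conjE)
  assume "same_side (d 0) (d t)" "affon d 0 t"
  thus ?thesis using assms(3) d(2) by (auto simp: same_side_def)
 next
  fix s1 s2 assume ok: "thr_ok t s1 s2 (d 0) (d t)" and e: "d = bent t s1 s2 (d 0) (d t)"
  note B = bent_facts[OF ok e]
  define s where "s = t - s2"
  have s: "0 \<le> s1" "s1 \<le> s" "s < t" "s1 = 0 --> d 0 = 0"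
   using ok assms(3) d(2) unfolding thr_ok_def s_def by auto
  note B = B[folded s_def]
  have p: "d t < 0" using assms(3) d(2) by simp
  have e1: "s1 = s"
  proof (rule ccontr)
   assume "s1 \<noteq> s"
   hence lt: "s1 < s" using s by simp
   show False using no_sit_left[OF d(1) s(1) lt s(3) order_refl B(5) B(2,3)] B(4) p by auto
  qed
  show ?thesis
  proof (cases "s = 0")
   case True
   thus ?thesis using B(3) s e1 by auto
  next
   case False
   hence s0: "0 < s" using s by simp
   have co: "eng (d 0) (- d 0 / (s - 0)) = eng (d t) (d t / (t - s))"
    by (rule corner[OF d(1) order_refl s0 s(3) order_refl B(5) _ B(3)]) (use B(1) e1 in simp)
   have "\<not> d 0 < 0"
    using no_touch[OF d(1) order_refl s0 s(3) order_refl B(5) _ B(3)] B(1) e1 p by auto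
   moreover have "d 0 \<noteq> 0"
    using no_sit_left[OF d(1) order_refl s0 s(3) order_refl B(5) _ B(3)] B(1) e1 p by auto
   ultimately have "crossL d t s" unfolding crossL_def using d(1) s0 s B e1 p co by (simp add: eng_def)
   thus ?thesis by blast
  qed
 qed
 thus ?thesis using d by blast
qed

lemma crossR_sign:
 assumes "crossR c t s"
 shows "s < r ==> r \<le> t ==> c r > 0" "c 0 < 0 ==> 0 \<le> r ==> r < s ==> c r < 0"
  "0 \<le> c 0 ==> 0 \<le> r ==> r \<le> t ==> 0 \<le> c r"
proof -
 have cc: "0 < s" "s < t" "c s = 0" "c t > 0" "affon c s t" using assms unfolding crossR_def by auto
 show pos: "c r > 0" if "s < r" "r \<le> t" for r
  using affon_between(1)[OF cc(5), of r] cc that by (cases "r = t") auto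
 show "c r < 0" if z: "c 0 < 0" "0 \<le> r" "r < s"
 proof -
  have "affon c 0 s" using assms z unfolding crossR_def by auto
  thus ?thesis using affon_between(4)[of c 0 s r] cc z by (cases "r = 0") auto
 qed
 show "0 \<le> c r" if z: "0 \<le> c 0" "0 \<le> r" "r \<le> t"
 proof -
  obtain s1 where s1: "0 \<le> s1" "s1 < s" "affon c 0 s1" "\<forall>r\<in>{s1..s}. c r = 0" using assms z unfolding crossR_def by auto
  consider "r \<le> s1" | "s1 \<le> r" "r \<le> s" | "s < r" by linarith
  thus ?thesis
  proof cases
   case 1 thus ?thesis using affon_mono_ends(1)[OF s1(3), of r] s1 z by auto
  next
   case 2 thus ?thesis using s1 by auto
  next
   case 3 thus ?thesis using pos z by (auto intro: less_imp_le)
  qed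
 qed
qed

lemma crossL_sign:
 assumes "crossL c t s"
 shows "s < r ==> r \<le> t ==> c r < 0" "0 \<le> r ==> r < s ==> c r > 0"
proof -
 have cc: "0 < s" "s < t" "c s = 0" "c t < 0" "affon c s t" "affon c 0 s" "c 0 > 0" using assms unfolding crossL_def by auto
 show "c r < 0" if "s < r" "r \<le> t" for r
  using affon_between(3)[OF cc(5), of r] cc that by (cases "r = t") auto
 show "c r > 0" if "0 \<le> r" "r < s" for r
  using affon_between(2)[OF cc(6), of r] cc that by (cases "r = 0") auto
qed

end


section \<open>Traces at the interface\<close>

lemma mono_limit_right:
 fixes z :: "real => real"
 assumes "r > 0" and mono: "\<And>x y. 0 < x ==> x < y ==> y < r ==> z x \<le> z y" and B: "\<And>x. 0 < x ==> x < r ==> B \<le> z x"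
 shows "\<exists>l. (z \<longlongrightarrow> l) (at_right 0)"
proof
 let ?l = "Inf (z ` {0<..<r})"
 have bdd: "bdd_below (z ` {0<..<r})" using B by (intro bdd_belowI[of _ B]) auto
 show "(z \<longlongrightarrow> ?l) (at_right 0)"
 proof (rule order_tendstoI)
  fix a assume a: "a < ?l"
  have "a < z x" if "0 < x" "x < r" for x using cInf_lower[OF _ bdd, of "z x"] that a by force
  thus "eventually (%x. a < z x) (at_right 0)"
   unfolding eventually_at_right_field using assms(1) by blast
 next
  fix a assume "?l < a"
  then obtain y where y: "0 < y" "y < r" "z y < a" using cInf_lessD[of "z ` {0<..<r}" a] assms(1) by auto
  have "z x < a" if "0 < x" "x < y" for x using mono[of x y] that y by simp
  thus "eventually (%x. z x < a) (at_right 0)"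
   unfolding eventually_at_right_field using y by blast
 qed
qed

lemma (in conv_flux) flux_dL_limit:
 assumes S: "S = {0..Q} \<or> S = {-Q..0}" and lim: "((%x. f (dL (p x))) \<longlongrightarrow> E) F" and ev: "eventually (%x. p x \<in> S) F" and F: "F \<noteq> bot"
 shows "\<exists>l\<in>S. (p \<longlongrightarrow> l) F"
proof -
 let ?h = "%p. f (dL p)"
 let ?k = "inv_into S ?h"
 have S': "compact S" using S by auto
 have h: "continuous_on S ?h" by (rule continuous_on_compose2[OF continuous_flux[of UNIV] continuous_dL]) auto
 have inj: "inj_on ?h S"
 proof (rule inj_onI)
  fix x y assume "x \<in> S" "y \<in> S" and e: "f (dL x) = f (dL y)"
  hence "0 \<le> x \<and> 0 \<le> y \<or> x \<le> 0 \<and> y \<le> 0" using S by auto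
  thus "x = y" by (rule flux_dL_inj[OF e])
 qed
 hence k: "\<And>x. x \<in> S ==> ?k (?h x) = x" using inv_into_f_f[OF inj] by simp
 have kc: "continuous_on (?h ` S) ?k" by (rule continuous_on_inv[OF h S']) (use k in blast)
 have E: "E \<in> ?h ` S"
  by (rule Lim_in_closed_set[OF compact_imp_closed[OF compact_continuous_image[OF h S']] _ F lim])
   (use ev in eventually_elim, blast)
 have "((%x. ?k (?h (p x))) \<longlongrightarrow> ?k E) F"
  by (rule continuous_on_tendsto_compose[OF kc lim E]) (use ev in eventually_elim, blast)
 moreover have "eventually (%x. ?k (?h (p x)) = p x) F" using ev by eventually_elim (rule k)
 ultimately have "(p \<longlongrightarrow> ?k E) F" using tendsto_cong by fast
 thus ?thesis using inv_into_into[OF E] by blast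
qed

context value_function begin

text \<open>Moving the end point of a straight leg gives an upper bound for \<open>v\<close> that touches it at \<open>c t\<close>.\<close>

lemma slope_right:
 assumes opt: "isopt c t" and o: "0 \<le> a" "a < t" and aff: "affon c a t" and s: "0 \<le> c a" "0 < c t"
  and D: "((%z. v z t) has_real_derivative dd) (at (c t))"
 shows "dd = F.dL ((c t - c a) / (t - a))"
proof -
 let ?\<phi> = "%x. v (c a) a + (t - a) * F.L ((x - c a) / (t - a)) - v x t"
 have "((%x. (x - c a) / (t - a)) has_real_derivative 1 / (t - a)) (at (c t))"
  using o by (auto intro!: derivative_eq_intros)
 from DERIV_chain2[OF F.DERIV_L this]
 have "(?\<phi> has_real_derivative 0 + (t - a) * (F.dL ((c t - c a) / (t - a)) * (1 / (t - a))) - dd) (at (c t))"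
  by (intro DERIV_diff[OF DERIV_add[OF DERIV_const DERIV_cmult] D])
 hence "0 + (t - a) * (F.dL ((c t - c a) / (t - a)) * (1 / (t - a))) - dd = 0"
 proof (rule DERIV_local_min)
  show "\<forall>y. \<bar>c t - y\<bar> < c t --> ?\<phi> (c t) \<le> ?\<phi> y"
  proof (intro allI impI)
   fix y assume "\<bar>c t - y\<bar> < c t"
   hence y: "y > 0" by linarith
   have "v (c t) t = v (c a) a + seg (t - a) (c a) (c t)"
    using opt_seg[OF opt o order_refl aff] s by (simp add: same_side_def)
   moreover have "v y t \<le> v (c a) a + seg (t - a) (c a) y"
    using v_le[OF pc_line[OF o(2), of "c a" y] o(1)] s y o by (simp add: same_side_def)
   ultimately show "?\<phi> (c t) \<le> ?\<phi> y" using s y by (simp add: seg_def)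
  qed
 qed (use s in simp)
 thus ?thesis using o by simp
qed

lemma slope_left:
 assumes opt: "isopt c t" and o: "0 \<le> a" "a < t" and aff: "affon c a t" and s: "c a \<le> 0" "c t < 0"
  and D: "((%z. v z t) has_real_derivative dd) (at (c t))"
 shows "dd = G.dL ((c t - c a) / (t - a))"
proof -
 let ?\<phi> = "%x. v (c a) a + (t - a) * G.L ((x - c a) / (t - a)) - v x t"
 have "((%x. (x - c a) / (t - a)) has_real_derivative 1 / (t - a)) (at (c t))"
  using o by (auto intro!: derivative_eq_intros)
 from DERIV_chain2[OF G.DERIV_L this]
 have "(?\<phi> has_real_derivative 0 + (t - a) * (G.dL ((c t - c a) / (t - a)) * (1 / (t - a))) - dd) (at (c t))"
  by (intro DERIV_diff[OF DERIV_add[OF DERIV_const DERIV_cmult] D])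
 hence "0 + (t - a) * (G.dL ((c t - c a) / (t - a)) * (1 / (t - a))) - dd = 0"
 proof (rule DERIV_local_min)
  show "\<forall>y. \<bar>c t - y\<bar> < - c t --> ?\<phi> (c t) \<le> ?\<phi> y"
  proof (intro allI impI)
   fix y assume "\<bar>c t - y\<bar> < - c t"
   hence y: "y < 0" by linarith
   have "v (c t) t = v (c a) a + seg (t - a) (c a) (c t)"
    using opt_seg[OF opt o order_refl aff] s by (simp add: same_side_def)
   moreover have "v y t \<le> v (c a) a + seg (t - a) (c a) y"
    using v_le[OF pc_line[OF o(2), of "c a" y] o(1)] s y o by (simp add: same_side_def)
   ultimately show "?\<phi> (c t) \<le> ?\<phi> y" using s y by (simp add: seg_def)
  qed
 qed (use s in simp)
 thus ?thesis using o by simp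
qed

lemma straight_mono:
 assumes opt: "isopt c t" "isopt d t" and t: "t > 0" and aff: "affon d 0 t"
  and s: "0 \<le> d 0 \<and> 0 < d t \<or> d 0 \<le> 0 \<and> d t < 0" and x: "c t \<noteq> d t"
 shows "c t < d t ==> 0 \<le> u ==> u \<le> t ==> c u \<le> d u" "d t < c t ==> 0 \<le> u ==> u \<le> t ==> d u \<le> c u"
proof -
 have pos: "(\<forall>r\<in>{u<..<t}. d r > 0) \<or> (\<forall>r\<in>{u<..<t}. d r < 0)" if "0 \<le> u" for u
  using affon_between(1,3)[OF aff] s that by auto
 show "c u \<le> d u" if "c t < d t" "0 \<le> u" "u \<le> t"
 proof (rule ccontr)
  assume "\<not> c u \<le> d u"
  moreover have "u \<noteq> t" using that calculation by auto
  ultimately show False using no_cross[OF opt that(2) _ order_refl pos[OF that(2)]] that by auto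
 qed
 show "d u \<le> c u" if "d t < c t" "0 \<le> u" "u \<le> t"
 proof (rule ccontr)
  assume "\<not> d u \<le> c u"
  moreover have "u \<noteq> t" using that calculation by auto
  ultimately show False using no_cross[OF opt that(2) _ order_refl pos[OF that(2)]] that by auto
 qed
qed

lemma glue_facts:
 assumes "isopt c t" "isopt d t" "0 < s" "s < t" "c s = d s"
 shows "\<exists>\<eta>. isopt \<eta> t \<and> (\<forall>r\<le>s. \<eta> r = c r) \<and> (\<forall>r\<ge>s. \<eta> r = d r)"
 using opt_glue[OF opt_mid(1)[OF assms(1)] assms(2)] assms
 by (intro exI[of _ "%r. if r \<le> s then c r else d r"]) auto

text \<open>\<open>corner\<close> and its consequences for the curve glued from two minimisers that meet at the interface.\<close>

lemma meet_corner:
 assumes opt: "isopt c t" "isopt d t" and o: "0 < s" "s < b" "b \<le> t" and z: "c s = 0" "d s = 0"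
  and aff: "affon c 0 s" "affon d s b"
 shows "eng (c 0) (- c 0 / s) = eng (d b) (d b / (b - s))"
  and "c 0 > 0 \<and> d b > 0 \<or> c 0 < 0 \<and> d b < 0 ==> False" "c 0 < 0 \<and> d b = 0 \<or> c 0 = 0 \<and> d b < 0 ==> False"
proof -
 have st: "s < t" using o by simp
 obtain \<eta> where \<eta>: "isopt \<eta> t" "\<And>r. r \<le> s ==> \<eta> r = c r" "\<And>r. r \<ge> s ==> \<eta> r = d r"
  using glue_facts[OF opt o(1) st] z by metis
 have a: "affon \<eta> 0 s" "affon \<eta> s b" by (rule affon_cong[OF aff(1)] affon_cong[OF aff(2)]; use \<eta> in auto)+
 have z': "\<eta> s = 0" using \<eta>(2)[of s] z by simp
 have e: "\<eta> 0 = c 0" "\<eta> b = d b" using \<eta> o by auto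
 show "eng (c 0) (- c 0 / s) = eng (d b) (d b / (b - s))"
  using corner[OF \<eta>(1) order_refl o z' a] e by simp
 show "c 0 > 0 \<and> d b > 0 \<or> c 0 < 0 \<and> d b < 0 ==> False"
  using no_touch[OF \<eta>(1) order_refl o z' a] e by simp
 show "c 0 < 0 \<and> d b = 0 \<or> c 0 = 0 \<and> d b < 0 ==> False"
  using no_sit_left[OF \<eta>(1) order_refl o z' a] e by simp
qed

lemma crossR_zero:
 assumes cc: "crossR c t s" and r: "0 < r" "r \<le> s" "c r = 0"
 shows "\<forall>u\<in>{r..s}. c u = 0"
proof (cases "c 0 < 0")
 case True
 hence "r = s" using crossR_sign(2)[OF cc True, of r] r by force
 thus ?thesis using r by simp
next
 case False
 then obtain s1 where s1: "0 \<le> s1" "s1 < s" "affon c 0 s1" "\<forall>r\<in>{s1..s}. c r = 0" using cc unfolding crossR_def by auto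
 show ?thesis
 proof (cases "s1 \<le> r")
  case True thus ?thesis using s1 by auto
 next
  case False
  have "affon (%_. 0) 0 s1" by (rule affonI[where k = 0 and m = 0]) simp
  hence "c u = 0" if "u \<in> {r..s1}" for u
   by (rule affon_eq[where u = r and w = s1, OF s1(3)]) (use that r False s1 in simp_all)
  thus ?thesis using s1 by (metis atLeastAtMost_iff linear)
 qed
qed

text \<open>At time \<open>s\<close> the curve that ends closer to the interface is on the left of it: it is not on the right by
\<open>no_cross\<close>, and not at \<open>0\<close> by \<open>meet_corner\<close>.\<close>

lemma crossR_order:
 assumes a: "crossR c t s" "c 0 < 0" and b: "crossR d t r" and x: "d t < c t"
 shows "d 0 < 0 \<and> d 0 \<le> c 0 \<and> s < r"
proof -
 have A: "isopt c t" "0 < s" "s < t" "c s = 0" "c t > 0" "affon c s t" "affon c 0 s"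
   "f (F.dL (c t / (t - s))) = g (G.dL (- c 0 / s))" using a unfolding crossR_def by auto
 have B: "isopt d t" "0 < r" "r < t" "d r = 0" "d t > 0" "affon d r t" using b unfolding crossR_def by auto
 have "\<not> d s > 0"
  using no_cross[OF B(1) A(1) _ A(3)] crossR_sign(1)[OF a(1)] A x by auto
 moreover have "d s \<noteq> 0"
 proof
  assume z: "d s = 0"
  hence "s \<le> r" using crossR_sign(1)[OF b, of s] A by fastforce
  then consider "s = r" | "s < r" by linarith
  thus False
  proof cases
   case 1
   have "f (F.dL (c t / (t - s))) = f (F.dL (d t / (t - s)))"
    using meet_corner(1)[OF A(1) B(1) A(2,3) order_refl A(4) z A(7)] B(5,6) A(8) 1 a(2) by (simp add: eng_def)
   hence "c t / (t - s) = d t / (t - s)" by (rule F.flux_dL_inj) (use A(3,5) B(5) in simp)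
   thus False using x A(3) by simp
  next
   case 2
   have "affon d s r" by (rule affonI[where k = 0 and m = 0]) (use crossR_zero[OF b A(2) less_imp_le[OF 2] z] in simp)
   thus False using meet_corner(3)[OF A(1) B(1) A(2) 2 less_imp_le[OF B(3)] A(4) z A(7)] a(2) B(4) by simp
  qed
 qed
 ultimately have neg: "d s < 0" by simp
 have dd0: "d 0 < 0" using crossR_sign(3)[OF b, of s] neg A by force
 moreover have "s < r"
  using crossR_sign(1)[OF b, of s] neg A B(4) by (cases s r rule: linorder_cases) auto
 moreover have "\<not> c 0 < d 0"
  using no_cross[OF B(1) A(1) order_refl A(2)] crossR_sign(2)[OF a] A neg by auto
 ultimately show ?thesis by simp
qed

lemma crossL_order:
 assumes a: "crossL c t s" and b: "crossL d t r" and x: "c t < d t"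
 shows "c 0 \<le> d 0 \<and> s < r"
proof -
 have A: "isopt c t" "0 < s" "s < t" "c s = 0" "c t < 0" "affon c s t" "affon c 0 s" "c 0 > 0"
   "g (G.dL (c t / (t - s))) = f (F.dL (- c 0 / s))" using a unfolding crossL_def by auto
 have B: "isopt d t" "0 < r" "r < t" "d r = 0" "d t < 0" "affon d r t" using b unfolding crossL_def by auto
 have "\<not> d s < 0"
  using no_cross[OF B(1) A(1) _ A(3)] crossL_sign(1)[OF a(1)] A x by auto
 moreover have "d s \<noteq> 0"
 proof
  assume z: "d s = 0"
  hence 1: "s = r" using crossL_sign[OF b, of s] A by (cases s r rule: linorder_cases) auto
  have "g (G.dL (c t / (t - s))) = g (G.dL (d t / (t - s)))"
   using meet_corner(1)[OF A(1) B(1) A(2,3) order_refl A(4) z A(7)] B(5,6) A(8,9) 1 by (simp add: eng_def)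
  hence "c t / (t - s) = d t / (t - s)" by (rule G.flux_dL_inj) (use A(3,5) B(5) in \<open>simp add: divide_le_0_iff\<close>)
  thus False using x A(3) by simp
 qed
 ultimately have pos: "d s > 0" by simp
 hence "s < r" using crossL_sign(1)[OF b, of s] A B(4) by (cases s r rule: linorder_cases) auto
 moreover have "\<not> d 0 < c 0"
  using no_cross[OF B(1) A(1) order_refl A(2)] crossL_sign(2)[OF a] A pos by auto
 ultimately show ?thesis by simp
qed

end


context value_function begin

lemma near_crossR:
 assumes cc: "crossR c t s" and x: "0 < x" "x < c t"
 shows "\<exists>d r. crossR d t r \<and> d t = x"
proof -
 have A: "isopt c t" "0 < s" "s < t" "c s = 0" using cc unfolding crossR_def by auto
 obtain \<eta> where "isopt \<eta> t" "\<eta> t = x" using ex_opt[of t x] A by auto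
 then obtain d where d: "isopt d t" "d t = x" and f: "0 \<le> d 0 \<and> affon d 0 t \<or> (\<exists>s. crossR d t s)"
  using form_right[of \<eta> t] A x by auto
 have "\<not> (0 \<le> d 0 \<and> affon d 0 t)"
 proof
  assume "0 \<le> d 0 \<and> affon d 0 t"
  hence "d s > 0" using affon_between(1)[of d 0 t s] d(2) x A by auto
  thus False using no_cross[OF d(1) A(1) less_imp_le[OF A(2)] A(3) order_refl] crossR_sign(1)[OF cc] A(4) d(2) x by auto
 qed
 thus ?thesis using f d(2) by blast
qed

lemma near_crossL:
 assumes cc: "crossL c t s" and x: "x < 0" "c t < x"
 shows "\<exists>d r. crossL d t r \<and> d t = x"
proof -
 have A: "isopt c t" "0 < s" "s < t" "c s = 0" using cc unfolding crossL_def by auto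
 obtain \<eta> where "isopt \<eta> t" "\<eta> t = x" using ex_opt[of t x] A by auto
 then obtain d where d: "isopt d t" "d t = x" and f: "d 0 \<le> 0 \<and> affon d 0 t \<or> (\<exists>s. crossL d t s)"
  using form_left[of \<eta> t] A x by auto
 have "\<not> (d 0 \<le> 0 \<and> affon d 0 t)"
 proof
  assume "d 0 \<le> 0 \<and> affon d 0 t"
  hence "d s < 0" using affon_between(3)[of d 0 t s] d(2) x A by auto
  thus False using no_cross[OF d(1) A(1) less_imp_le[OF A(2)] A(3) order_refl] crossL_sign(1)[OF cc] A(4) d(2) x by auto
 qed
 thus ?thesis using f d(2) by blast
qed

definition has_slope :: "real => real => real => bool" where
 "has_slope t x dd \<longleftrightarrow> ((%z. v z t) has_real_derivative dd) (at x)"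

lemma speed_last:
 assumes "isopt c t" "0 \<le> s" "s < t" "c s = 0" shows "\<bar>c t / (t - s)\<bar> \<le> Q"
 using opt_speed[OF assms(1,2), of t] assms by (simp add: abs_divide divide_le_eq)

lemma at_rightI: "r > (0::real) ==> (\<And>x. 0 < x ==> x < r ==> R x) ==> eventually R (at_right 0)"
 unfolding eventually_at_right_field by auto

lemma ratio_limit:
 assumes r: "r > (0::real)" and ord: "\<And>x z. 0 < x ==> x < z ==> z < r ==> A x \<le> A z \<and> S z < S x"
  and b: "\<And>x. 0 < x ==> x < r ==> B \<le> A x \<and> 0 < S x \<and> S x < t"
 shows "\<exists>q::real. ((%x. A x / S x) \<longlongrightarrow> q) (at_right 0)"
proof -
 obtain l where l: "(A \<longlongrightarrow> l) (at_right 0)" using mono_limit_right[where r = r and B = B, of A] r ord b by blast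
 have "\<exists>l. ((%x. - S x) \<longlongrightarrow> l) (at_right 0)"
  by (rule mono_limit_right[where r = r and B = "- t"]) (use r ord b in \<open>auto intro: less_imp_le\<close>)
 then obtain l' where "((%x. - S x) \<longlongrightarrow> l') (at_right 0)" by blast
 from tendsto_minus[OF this] have S: "(S \<longlongrightarrow> - l') (at_right 0)" by simp
 have "S (r / 2) \<le> - l'"
  by (rule tendsto_lowerbound[OF S at_rightI[where r = "r / 2"]]) (use ord[of _ "r / 2"] r in \<open>auto intro: less_imp_le\<close>)
 hence "- l' \<noteq> 0" using b[of "r / 2"] r by auto
 from tendsto_divide[OF l S this] show ?thesis by blast
qed

lemma start_bound:
 assumes "isopt c t" "0 < s" "s < t" "c s = 0" shows "\<bar>c 0\<bar> \<le> Q * t"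
proof -
 have "\<bar>c s - c 0\<bar> \<le> Q * (s - 0)" by (rule opt_speed[OF assms(1)]) (use assms in auto)
 also have "\<dots> \<le> Q * t" using assms(3) Q_nonneg by (simp add: mult_left_mono)
 finally show ?thesis using assms(4) by simp
qed

text \<open>If a minimiser leaves the interface to the right, all end points closer to the interface are reached in this way.
Either they all leave with the flux \<open>g (\<theta> g)\<close>, or those close enough come from the left; then start points and
departure times are monotone, the incoming speeds converge, and equality of the fluxes carries the limit over to the
outgoing speeds. Otherwise minimisers near the interface are straight lines from the right.\<close>

lemma trace_right:
 assumes t: "t > 0"
 shows "\<exists>p P r. r > 0 \<and> (P \<longlongrightarrow> p) (at_right 0) \<and> (\<forall>x\<in>{0<..<r}. \<forall>dd. has_slope t x dd --> dd = F.dL (P x)) \<and>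
  (p > 0 --> (\<exists>c s. crossR c t s))"
proof (cases "\<exists>c s. crossR c t s")
 case False
 have "\<forall>x\<in>{0<..<1}. \<exists>d. isopt d t \<and> d t = x \<and> 0 \<le> d 0 \<and> affon d 0 t"
 proof
  fix x :: real assume x: "x \<in> {0<..<1}"
  obtain \<eta> where "isopt \<eta> t" "\<eta> t = x" using ex_opt[of t x] t by auto
  thus "\<exists>d. isopt d t \<and> d t = x \<and> 0 \<le> d 0 \<and> affon d 0 t"
   using form_right[of \<eta> t] False x t by auto
 qed
 from bchoice[OF this] obtain \<Delta> where \<Delta>: "\<And>x. x \<in> {0<..<1} ==> isopt (\<Delta> x) t \<and> \<Delta> x t = x \<and> 0 \<le> \<Delta> x 0 \<and> affon (\<Delta> x) 0 t"
  by blast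
 have "\<exists>l. ((%x. \<Delta> x 0) \<longlongrightarrow> l) (at_right 0)"
 proof (rule mono_limit_right[where r = 1 and B = 0])
  fix x y :: real assume o: "0 < x" "x < y" "y < 1"
  have X: "isopt (\<Delta> x) t" "\<Delta> x t = x" and Y: "isopt (\<Delta> y) t" "\<Delta> y t = y" "0 \<le> \<Delta> y 0" "affon (\<Delta> y) 0 t"
   using \<Delta>[of x] \<Delta>[of y] o by auto
  show "\<Delta> x 0 \<le> \<Delta> y 0" using straight_mono(1)[OF X(1) Y(1) t Y(4), of 0] X Y o t by auto
 qed (use \<Delta> in auto)
 then obtain l where l: "((%x. \<Delta> x 0) \<longlongrightarrow> l) (at_right 0)" by blast
 have l0: "0 \<le> l"
  by (rule tendsto_lowerbound[OF l at_rightI[where r = 1]]) (use \<Delta> in auto)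
 have P: "((%x. (x - \<Delta> x 0) / t) \<longlongrightarrow> (0 - l) / t) (at_right 0)"
  using t by (intro tendsto_intros l) auto
 have "dd = F.dL ((x - \<Delta> x 0) / t)" if "x \<in> {0<..<1}" "has_slope t x dd" for x dd
  using slope_right[of "\<Delta> x" t 0 dd] \<Delta>[OF that(1)] that t unfolding has_slope_def by auto
 moreover have "\<not> 0 < (0 - l) / t" using l0 t by (simp add: field_simps)
 ultimately show ?thesis using P
  by (intro exI[of _ "(0 - l) / t"] exI[of _ "%x. (x - \<Delta> x 0) / t"] exI[of _ 1]) auto
next
 case True
 then obtain c1 s1 where cc1: "crossR c1 t s1" by blast
 define x1 where "x1 = c1 t"
 have x1: "x1 > 0" using cc1 unfolding crossR_def x1_def by auto
 have "\<forall>x\<in>{0<..<x1}. \<exists>p. crossR (fst p) t (snd p) \<and> fst p t = x"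
  using near_crossR[OF cc1] unfolding x1_def by auto
 from bchoice[OF this] obtain p where p: "\<And>x. x \<in> {0<..<x1} ==> crossR (fst (p x)) t (snd (p x)) \<and> fst (p x) t = x" by blast
 define \<Gamma> S where "\<Gamma> x = fst (p x)" and "S x = snd (p x)" for x
 have G: "crossR (\<Gamma> x) t (S x)" "\<Gamma> x t = x" if "x \<in> {0<..<x1}" for x using p[OF that] by (auto simp: \<Gamma>_def S_def)
 have G': "isopt (\<Gamma> x) t" "0 < S x" "S x < t" "\<Gamma> x (S x) = 0" "affon (\<Gamma> x) (S x) t" if "x \<in> {0<..<x1}" for x
  using G(1)[OF that] unfolding crossR_def by auto
 define P where "P x = x / (t - S x)" for x
 have PQ: "P x \<in> {0..Q}" if "x \<in> {0<..<x1}" for x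
  using speed_last[OF G'(1)[OF that] _ G'(3)[OF that] G'(4)[OF that]] G(2)[OF that] G'(2,3)[OF that] that unfolding P_def by auto
 have sl: "dd = F.dL (P x)" if "x \<in> {0<..<x1}" "has_slope t x dd" for x dd
  using slope_right[of "\<Gamma> x" t "S x" dd] G(2)[OF that(1)] G'[OF that(1)] that unfolding has_slope_def P_def by auto
 have "\<exists>E. ((%x. f (F.dL (P x))) \<longlongrightarrow> E) (at_right 0)"
 proof (cases "\<exists>y\<in>{0<..<x1}. \<Gamma> y 0 < 0")
  case False
  have "f (F.dL (P x)) = g (\<theta> g)" if "x \<in> {0<..<x1}" for x
   using G[OF that] False that unfolding crossR_def P_def by auto
  hence "eventually (%x. f (F.dL (P x)) = g (\<theta> g)) (at_right 0)"
   by (intro at_rightI[OF x1]) auto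
  thus ?thesis by (intro exI[of _ "g (\<theta> g)"] tendsto_eventually)
 next
  case True
  then obtain y where y: "y \<in> {0<..<x1}" "\<Gamma> y 0 < 0" by blast
  have ord: "\<Gamma> x 0 < 0 \<and> \<Gamma> x 0 \<le> \<Gamma> z 0 \<and> S z < S x" if "x < z" "x \<in> {0<..<x1}" "z \<in> {0<..<x1}" "\<Gamma> z 0 < 0" for x z
   using crossR_order[OF G(1)[OF that(3)] that(4) G(1)[OF that(2)]] G(2)[OF that(2)] G(2)[OF that(3)] that(1) by auto
  have ne: "\<Gamma> x 0 < 0" "S y < S x" if "0 < x" "x < y" for x using ord[of x y] that y by auto
  have "\<exists>q. ((%x. \<Gamma> x 0 / S x) \<longlongrightarrow> q) (at_right 0)"
  proof (rule ratio_limit[where r = y and B = "- (Q * t)" and t = t])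
   show "- (Q * t) \<le> \<Gamma> x 0 \<and> 0 < S x \<and> S x < t" if o: "0 < x" "x < y" for x
    using G'[of x] start_bound[of "\<Gamma> x" t "S x"] o y by (auto simp: abs_le_iff)
  qed (use ord y ne in auto)
  then obtain q where "((%x. \<Gamma> x 0 / S x) \<longlongrightarrow> q) (at_right 0)" by blast
  from tendsto_minus[OF this] have q: "((%x. - \<Gamma> x 0 / S x) \<longlongrightarrow> - q) (at_right 0)" by simp
  have cc: "isCont (%p. g (G.dL p)) p" for p
   using G.isCont_dL DERIV_isCont[OF G.DERIV_flux] by (rule isCont_o2)
  from isCont_tendsto_compose[OF cc q]
  have "((%x. g (G.dL (- \<Gamma> x 0 / S x))) \<longlongrightarrow> g (G.dL (- q))) (at_right 0)" .
  moreover have "f (F.dL (P x)) = g (G.dL (- \<Gamma> x 0 / S x))" if o: "0 < x" "x < y" for x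
   using G[of x] ne[OF o] o y unfolding crossR_def P_def by auto
  hence "eventually (%x. g (G.dL (- \<Gamma> x 0 / S x)) = f (F.dL (P x))) (at_right 0)"
   using y by (intro at_rightI[where r = y]) auto
  ultimately show ?thesis using tendsto_cong[THEN iffD1] by (intro exI[of _ "g (G.dL (- q))"]) fast
 qed
 then obtain E where "((%x. f (F.dL (P x))) \<longlongrightarrow> E) (at_right 0)" by blast
 moreover have "eventually (%x. P x \<in> {0..Q}) (at_right 0)" by (rule at_rightI[OF x1]) (use PQ in auto)
 ultimately have "\<exists>l\<in>{0..Q}. (P \<longlongrightarrow> l) (at_right 0)"
  by (rule F.flux_dL_limit[where Q = Q, rotated]) simp_all
 thus ?thesis using sl x1 True by blast
qed

text \<open>As for \<open>trace_right\<close>; in addition, if the limiting speed is negative, departure times come arbitrarily close to \<open>t\<close>, since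
the legs get short.\<close>

lemma trace_left:
 assumes t: "t > 0"
 shows "\<exists>p P r. r > 0 \<and> (P \<longlongrightarrow> p) (at_right 0) \<and> (\<forall>x\<in>{0<..<r}. \<forall>dd. has_slope t (- x) dd --> dd = G.dL (P x)) \<and>
  (p < 0 --> (\<forall>s0<t. \<exists>c s. crossL c t s \<and> s0 \<le> s))"
proof (cases "\<exists>c s. crossL c t s")
 case False
 have "\<forall>x\<in>{0<..<1}. \<exists>d. isopt d t \<and> d t = - x \<and> d 0 \<le> 0 \<and> affon d 0 t"
 proof
  fix x :: real assume x: "x \<in> {0<..<1}"
  obtain \<eta> where "isopt \<eta> t" "\<eta> t = - x" using ex_opt[of t "- x"] t by auto
  thus "\<exists>d. isopt d t \<and> d t = - x \<and> d 0 \<le> 0 \<and> affon d 0 t"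
   using form_left[of \<eta> t] False x t by auto
 qed
 from bchoice[OF this] obtain \<Delta> where \<Delta>: "\<And>x. x \<in> {0<..<1} ==> isopt (\<Delta> x) t \<and> \<Delta> x t = - x \<and> \<Delta> x 0 \<le> 0 \<and> affon (\<Delta> x) 0 t"
  by blast
 have "\<exists>l. ((%x. - \<Delta> x 0) \<longlongrightarrow> l) (at_right 0)"
 proof (rule mono_limit_right[where r = 1 and B = 0])
  fix x y :: real assume o: "0 < x" "x < y" "y < 1"
  have X: "isopt (\<Delta> x) t" "\<Delta> x t = - x" and Y: "isopt (\<Delta> y) t" "\<Delta> y t = - y" "\<Delta> y 0 \<le> 0" "affon (\<Delta> y) 0 t"
   using \<Delta>[of x] \<Delta>[of y] o by auto
  show "- \<Delta> x 0 \<le> - \<Delta> y 0" using straight_mono(2)[OF X(1) Y(1) t Y(4), of 0] X Y o t by auto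
 qed (use \<Delta> in auto)
 then obtain l where l: "((%x. - \<Delta> x 0) \<longlongrightarrow> l) (at_right 0)" by blast
 have l0: "0 \<le> l"
  by (rule tendsto_lowerbound[OF l at_rightI[where r = 1]]) (use \<Delta> in auto)
 have P: "((%x. (- x + - \<Delta> x 0) / t) \<longlongrightarrow> (- 0 + l) / t) (at_right 0)"
  using t by (intro tendsto_intros l) auto
 have "dd = G.dL ((- x + - \<Delta> x 0) / t)" if "x \<in> {0<..<1}" "has_slope t (- x) dd" for x dd
  using slope_left[of "\<Delta> x" t 0 dd] \<Delta>[OF that(1)] that t unfolding has_slope_def by auto
 moreover have "\<not> (- 0 + l) / t < 0" using l0 t by (simp add: field_simps)
 ultimately show ?thesis using P
  by (intro exI[of _ "(- 0 + l) / t"] exI[of _ "%x. (- x + - \<Delta> x 0) / t"] exI[of _ 1]) auto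
next
 case True
 then obtain c1 s1 where cc1: "crossL c1 t s1" by blast
 define x1 where "x1 = - c1 t"
 have x1: "x1 > 0" using cc1 unfolding crossL_def x1_def by auto
 have "\<forall>x\<in>{0<..<x1}. \<exists>p. crossL (fst p) t (snd p) \<and> fst p t = - x"
  using near_crossL[OF cc1] unfolding x1_def by auto
 from bchoice[OF this] obtain p where p: "\<And>x. x \<in> {0<..<x1} ==> crossL (fst (p x)) t (snd (p x)) \<and> fst (p x) t = - x" by blast
 define \<Gamma> S where "\<Gamma> x = fst (p x)" and "S x = snd (p x)" for x
 have G: "crossL (\<Gamma> x) t (S x)" "\<Gamma> x t = - x" if "x \<in> {0<..<x1}" for x using p[OF that] by (auto simp: \<Gamma>_def S_def)
 have G': "isopt (\<Gamma> x) t" "0 < S x" "S x < t" "\<Gamma> x (S x) = 0" "affon (\<Gamma> x) (S x) t" "0 < \<Gamma> x 0"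
  "g (G.dL (- x / (t - S x))) = f (F.dL (- \<Gamma> x 0 / S x))" if "x \<in> {0<..<x1}" for x
  using G[OF that] unfolding crossL_def by auto
 define P where "P x = - x / (t - S x)" for x
 have PQ: "P x \<in> {-Q..0}" if "x \<in> {0<..<x1}" for x
 proof -
  have "\<bar>P x\<bar> \<le> Q"
   using speed_last[OF G'(1)[OF that] _ G'(3)[OF that] G'(4)[OF that]] G(2)[OF that] G'(2)[OF that] unfolding P_def by simp
  moreover have "P x \<le> 0" unfolding P_def using G'(3)[OF that] that by (simp add: divide_le_0_iff)
  ultimately show ?thesis by auto
 qed
 have sl: "dd = G.dL (P x)" if "x \<in> {0<..<x1}" "has_slope t (- x) dd" for x dd
  using slope_left[of "\<Gamma> x" t "S x" dd] G(2)[OF that(1)] G'(1-5)[OF that(1)] that unfolding has_slope_def P_def by auto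
 have ord: "\<Gamma> z 0 \<le> \<Gamma> x 0 \<and> S z < S x" if "x < z" "x \<in> {0<..<x1}" "z \<in> {0<..<x1}" for x z
  using crossL_order[OF G(1)[OF that(3)] G(1)[OF that(2)]] G(2)[OF that(2)] G(2)[OF that(3)] that(1) by auto
 have "\<exists>l. ((%x. - \<Gamma> x 0 / S x) \<longlongrightarrow> l) (at_right 0)"
 proof (rule ratio_limit[where r = x1 and B = "- (Q * t)" and t = t])
  show "- (Q * t) \<le> - \<Gamma> x 0 \<and> 0 < S x \<and> S x < t" if o: "0 < x" "x < x1" for x
   using G'[of x] start_bound[of "\<Gamma> x" t "S x"] o by (auto simp: abs_le_iff)
 qed (use ord x1 in auto)
 then obtain l where l: "((%x. - \<Gamma> x 0 / S x) \<longlongrightarrow> l) (at_right 0)" by blast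
 have cc: "isCont (%p. f (F.dL p)) p" for p
  using F.isCont_dL DERIV_isCont[OF F.DERIV_flux] by (rule isCont_o2)
 from isCont_tendsto_compose[OF cc l]
 have E: "((%x. f (F.dL (- \<Gamma> x 0 / S x))) \<longlongrightarrow> f (F.dL l)) (at_right 0)" .
 have "eventually (%x. f (F.dL (- \<Gamma> x 0 / S x)) = g (G.dL (P x))) (at_right 0)"
  by (rule at_rightI[OF x1]) (use G'(7) in \<open>simp add: P_def\<close>)
 hence "((%x. g (G.dL (P x))) \<longlongrightarrow> f (F.dL l)) (at_right 0)"
  using E by (rule tendsto_cong[THEN iffD1])
 moreover have "eventually (%x. P x \<in> {-Q..0}) (at_right 0)" by (rule at_rightI[OF x1]) (use PQ in auto)
 ultimately have "\<exists>l\<in>{-Q..0}. (P \<longlongrightarrow> l) (at_right 0)"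
  by (rule G.flux_dL_limit[where Q = Q, rotated]) simp_all
 then obtain q where q: "(P \<longlongrightarrow> q) (at_right 0)" by blast
 have "\<exists>c s. crossL c t s \<and> s0 \<le> s" if "q < 0" "s0 < t" for s0
 proof (rule ccontr)
  assume n: "\<nexists>c s. crossL c t s \<and> s0 \<le> s"
  have "((%x. - x / (t - s0)) \<longlongrightarrow> - 0 / (t - s0)) (at_right 0)"
   using that by (intro tendsto_intros) auto
  moreover have "eventually (%x. - x / (t - s0) \<le> P x) (at_right 0)"
  proof (rule at_rightI[OF x1])
   fix x assume "0 < x" "x < x1"
   hence x: "x \<in> {0<..<x1}" by simp
   have "S x < s0" using n G(1)[OF x] by (meson not_le)
   hence "x / (t - S x) \<le> x / (t - s0)" using x that by (intro divide_left_mono) auto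
   thus "- x / (t - s0) \<le> P x" by (simp add: P_def)
  qed
  ultimately have "- 0 / (t - s0) \<le> q" by (intro tendsto_le[OF _ q]) auto
  thus False using that by simp
 qed
 thus ?thesis using q sl x1 by blast
qed

text \<open>The second curve is on the right of the interface until it comes down to it at \<open>r\<close>, while the first one has left
it to the right at \<open>s\<close>; so they cross.\<close>

lemma crossR_crossL:
 assumes cc: "crossR c t s" and dd: "crossL d t r" and le: "s \<le> r"
 shows False
proof -
 have A: "isopt c t" "0 < s" "s < t" "c s = 0" "c t > 0" "affon c s t" using cc unfolding crossR_def by auto
 have B: "isopt d t" "0 < r" "r < t" "d r = 0" "d 0 > 0" "affon d 0 r" using dd unfolding crossL_def by auto
 show False
 proof (cases "s = r")
  case True
  have "d s = 0" "affon d 0 s" using B True by auto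
  thus False using meet_corner(2)[OF B(1) A(1) A(2,3) order_refl _ A(4) _ A(6)] A(5) B(5) by simp
 next
  case False
  hence lt: "s < r" using le by simp
  show False
   using no_cross[OF A(1) B(1) less_imp_le[OF A(2)] lt less_imp_le[OF B(3)]] crossL_sign(2)[OF dd] crossR_sign(1)[OF cc lt] A B lt by auto
 qed
qed

end


section \<open>The entropy solution\<close>

context value_function begin

text \<open>Domain of dependence: within this speed a Hopf-Lax minimiser and an optimal curve both stay on their side.\<close>

definition QQ :: real where "QQ = Q + F.QL CL + G.QL CL"

lemma QQ: "QQ \<ge> 0" "Q \<le> QQ" "F.QL CL \<le> QQ" "G.QL CL \<le> QQ"
 using Q_nonneg F.QL_nonneg[of CL] G.QL_nonneg[of CL] unfolding QQ_def by linarith+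

lemma lipv: "0 \<le> t ==> F.lipc CL (%z. v z t)"
 unfolding F.lipc_def using v_lip_x by (simp add: abs_minus_commute)

text \<open>Optimal curves have speed at most \<open>Q\<close>, so they do not meet the interface during the step; conversely a Hopf-Lax
segment is an admissible continuation.\<close>

lemma step_right:
 assumes t: "0 \<le> t" "0 < h" and x: "0 < x - QQ * h"
 shows "v x (t + h) = F.HL h (%z. v z t) x"
proof (rule antisym)
 have far: "0 < y" if "\<bar>x - y\<bar> \<le> q * h" "q \<le> QQ" for y q
 proof -
  have "q * h \<le> QQ * h" using that(2) t(2) by (intro mult_right_mono) auto
  thus ?thesis using that(1) x by linarith
 qed
 obtain y where y: "\<bar>x - y\<bar> \<le> F.QL CL * h" "F.HL h (%z. v z t) x = v y t + h * F.L ((x - y) / h)"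
  using F.HL_min(1)[OF lipv[OF t(1)] t(2)] by blast
 have "0 < y" "0 < x" using far[OF y(1) QQ(3)] far[of x 0] QQ(1) by auto
 thus "v x (t + h) \<le> F.HL h (%z. v z t) x"
  using v_le[OF pc_line[of t "t + h" y x] t(1)] t y(2) by (simp add: same_side_def seg_def)
 obtain c where c: "isopt c (t + h)" "c (t + h) = x" using ex_opt[of "t + h" x] t by auto
 have pos: "c s > 0" if s: "t \<le> s" "s \<le> t + h" for s
 proof -
  have "\<bar>c (t + h) - c s\<bar> \<le> Q * (t + h - s)" by (rule opt_speed[OF c(1)]) (use s t in auto)
  also have "\<dots> \<le> Q * h" using s Q_nonneg by (intro mult_left_mono) auto
  finally show ?thesis using far[OF _ QQ(2)] c(2) by simp
 qed
 have "v (c (t + h)) (t + h) = v (c t) t + (t + h - t) * F.L ((c (t + h) - c t) / (t + h - t))"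
  by (rule opt_pos(2)[OF c(1)]) (use t pos in auto)
 thus "F.HL h (%z. v z t) x \<le> v x (t + h)"
  using F.HL_min(2)[OF lipv[OF t(1)] t(2), of x "c t"] c(2) by simp
qed

lemma step_left:
 assumes t: "0 \<le> t" "0 < h" and x: "x + QQ * h < 0"
 shows "v x (t + h) = G.HL h (%z. v z t) x"
proof (rule antisym)
 have far: "y < 0" if "\<bar>x - y\<bar> \<le> q * h" "q \<le> QQ" for y q
 proof -
  have "q * h \<le> QQ * h" using that(2) t(2) by (intro mult_right_mono) auto
  thus ?thesis using that(1) x by linarith
 qed
 obtain y where y: "\<bar>x - y\<bar> \<le> G.QL CL * h" "G.HL h (%z. v z t) x = v y t + h * G.L ((x - y) / h)"
  using G.HL_min(1)[OF lipv[OF t(1)] t(2)] by blast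
 have "y < 0" "x < 0" using far[OF y(1) QQ(4)] far[of x 0] QQ(1) by auto
 thus "v x (t + h) \<le> G.HL h (%z. v z t) x"
  using v_le[OF pc_line[of t "t + h" y x] t(1)] t y(2) by (simp add: same_side_def seg_def)
 obtain c where c: "isopt c (t + h)" "c (t + h) = x" using ex_opt[of "t + h" x] t by auto
 have pos: "c s \<le> 0" if s: "t \<le> s" "s \<le> t + h" for s
 proof -
  have "\<bar>c (t + h) - c s\<bar> \<le> Q * (t + h - s)" by (rule opt_speed[OF c(1)]) (use s t in auto)
  also have "\<dots> \<le> Q * h" using s Q_nonneg by (intro mult_left_mono) auto
  finally show ?thesis using far[OF _ QQ(2)] c(2) by (simp add: less_imp_le)
 qed
 have "v (c (t + h)) (t + h) = v (c t) t + (t + h - t) * G.L ((c (t + h) - c t) / (t + h - t))"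
  by (rule opt_nonpos(2)[OF c(1)]) (use t pos in auto)
 thus "G.HL h (%z. v z t) x \<le> v x (t + h)"
  using G.HL_min(2)[OF lipv[OF t(1)] t(2), of x "c t"] c(2) by simp
qed

text \<open>Every \<open>x \<noteq> 0\<close> is within reach of a Hopf-Lax step that is short enough, and each of the countably many
steps fails to provide a slope at countably many points only.\<close>

lemma slope_countable:
 assumes t: "t > 0"
 shows "countable {x. \<nexists>dd. has_slope t x dd}"
proof -
 define h where "h n = t / 2 * eps n" for n
 have h: "0 < h n" "h n < t" for n
 proof -
  have "t / 2 * eps n \<le> t / 2 * 1" using t eps_pos[of n] by (intro mult_left_mono) auto
  thus "0 < h n" "h n < t" using t eps_pos[of n] unfolding h_def by auto
 qed
 have hlim: "(%n. QQ * h n) \<longlonglongrightarrow> 0"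
  unfolding h_def using tendsto_mult_left[OF eps_lim, of "QQ * (t / 2)"] by (simp add: mult.assoc)
 define A where "A n = {x. \<not> isCont (F.HLy (h n) (%z. v z (t - h n))) x} \<union> {x. \<not> isCont (G.HLy (h n) (%z. v z (t - h n))) x}" for n
 have l: "F.lipc CL (%z. v z (t - h n))" for n using lipv[of "t - h n"] h[of n] by simp
 have cc: "countable (insert 0 (\<Union>n. A n))"
  using F.HL_countable[OF l h(1)] G.HL_countable[OF l h(1)] unfolding A_def by blast
 have m: "x \<in> insert 0 (\<Union>n. A n)" if nd: "\<nexists>dd. has_slope t x dd" for x
 proof (rule ccontr)
  assume "x \<notin> insert 0 (\<Union>n. A n)"
  hence x: "x \<noteq> 0" "\<And>n. x \<notin> A n" by auto
  have "eventually (%n. QQ * h n < \<bar>x\<bar> / 2) sequentially" using order_tendstoD(2)[OF hlim, of "\<bar>x\<bar> / 2"] x by simp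
  then obtain n where n: "QQ * h n < \<bar>x\<bar> / 2" using eventually_happens sequentially_bot by blast
  let ?W = "%z. v z (t - h n)"
  have op: "open (ball x (\<bar>x\<bar> / 2))" "x \<in> ball x (\<bar>x\<bar> / 2)" using x by auto
  show False
  proof (cases "x > 0")
   case True
   have eq: "F.HL (h n) ?W z = v z t" if "z \<in> ball x (\<bar>x\<bar> / 2)" for z
   proof -
    have "0 < z - QQ * h n" using n that True unfolding mem_ball dist_real_def by linarith
    thus ?thesis using step_right[of "t - h n" "h n" z] h[of n] by simp
   qed
   have "isCont (F.HLy (h n) ?W) x" using x(2)[of n] by (auto simp: A_def)
   from has_field_derivative_transform_within_open[OF F.HL_DERIV(1)[OF l h(1) this] op eq]
   show False using nd unfolding has_slope_def by blast
  next
   case False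
   have eq: "G.HL (h n) ?W z = v z t" if "z \<in> ball x (\<bar>x\<bar> / 2)" for z
   proof -
    have "z + QQ * h n < 0" using n that False x(1) unfolding mem_ball dist_real_def by linarith
    thus ?thesis using step_left[of "t - h n" "h n" z] h[of n] by simp
   qed
   have "isCont (G.HLy (h n) ?W) x" using x(2)[of n] by (auto simp: A_def)
   from has_field_derivative_transform_within_open[OF G.HL_DERIV(1)[OF l h(1) this] op eq]
   show False using nd unfolding has_slope_def by blast
  qed
 qed
 show ?thesis
 proof (rule countable_subset[OF subsetI cc])
  fix x assume "x \<in> {x. \<nexists>dd. has_slope t x dd}"
  thus "x \<in> insert 0 (\<Union>n. A n)" using m by blast
 qed
qed

text \<open>A Borel representative of the slope, defined everywhere: it is the limit of the difference quotients where that
exists, clipped to the Lipschitz bound, and uses the initial data for negative times.\<close>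

definition sol :: "real => real => real" where
 "sol x t = max (- CL) (min CL (lim (%n. (v (x + eps n) (max 0 t) - v x (max 0 t)) * (real n + 1))))"

lemma sol_slope:
 assumes t: "t > 0" and dd: "has_slope t x dd"
 shows "sol x t = dd"
proof -
 have l: "(%n. (v (x + eps n) t - v x t) * (real n + 1)) \<longlonglongrightarrow> dd"
  using DERIV_seq dd unfolding has_slope_def by blast
 have "\<bar>(v (x + eps n) t - v x t) * (real n + 1)\<bar> \<le> CL" for n
 proof -
  have "\<bar>v (x + eps n) t - v x t\<bar> * (real n + 1) \<le> CL * eps n * (real n + 1)"
   using v_lip_x[of t "x + eps n" x] t eps_pos[of n] by (intro mult_right_mono) auto
  thus ?thesis using eps_mult[of n] by (simp add: abs_mult mult.assoc)
 qed
 hence "\<bar>dd\<bar> \<le> CL" by (intro LIMSEQ_le_const2[OF tendsto_rabs[OF l]]) auto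
 thus ?thesis using limI[OF l] t unfolding sol_def by auto
qed

lemma sol_AE: assumes t: "t > 0" shows "AE x in lborel. ((%z. v z t) has_real_derivative sol x t) (at x)"
proof -
 have "AE x in lborel. x \<notin> {x. \<nexists>dd. has_slope t x dd}"
  by (rule AE_not_in) (rule countable_imp_null_set_lborel[OF slope_countable[OF t]])
 thus ?thesis
 proof eventually_elim
  case (elim x)
  then obtain dd where "has_slope t x dd" by blast
  thus ?case using sol_slope[OF t] unfolding has_slope_def by blast
 qed
qed

lemma v_pair_cont: "continuous_on UNIV (%p. v (fst p) (max 0 (snd p)))"
proof (rule lipschitz_on_continuous_on)
 show "(2 * CL)-lipschitz_on UNIV (%p. v (fst p) (max 0 (snd p)))"
 proof (rule lipschitz_onI)
  fix p q :: "real \<times> real"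
  have "\<bar>v (fst p) (max 0 (snd p)) - v (fst q) (max 0 (snd q))\<bar> \<le> CL * (\<bar>fst p - fst q\<bar> + \<bar>max 0 (snd p) - max 0 (snd q)\<bar>)"
   by (rule v_lip) auto
  also have "\<dots> \<le> CL * (dist p q + dist p q)"
  proof (rule mult_left_mono[OF add_mono CL_nonneg])
   show "\<bar>fst p - fst q\<bar> \<le> dist p q" using dist_fst_le[of p q] by (simp add: dist_real_def)
   have "\<bar>snd p - snd q\<bar> \<le> dist p q" using dist_snd_le[of p q] by (simp add: dist_real_def)
   thus "\<bar>max 0 (snd p) - max 0 (snd q)\<bar> \<le> dist p q" by linarith
  qed
  finally show "dist (v (fst p) (max 0 (snd p))) (v (fst q) (max 0 (snd q))) \<le> 2 * CL * dist p q"
   by (simp add: dist_real_def)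
 qed (use CL_nonneg in simp)
qed

lemma ulip_sol: "ulip v sol CL"
proof
 show "\<bar>v x t - v y s\<bar> \<le> CL * (\<bar>x - y\<bar> + \<bar>t - s\<bar>)" if "0 \<le> t" "0 \<le> s" for x y t s by (rule v_lip[OF that(2,1)])
 show "\<bar>sol x t\<bar> \<le> CL" for x t using CL_nonneg unfolding sol_def by auto
 show "AE x in lborel. ((%z. v z t) has_real_derivative sol x t) (at x)" if "t > 0" for t by (rule sol_AE[OF that])
 have cc: "continuous_on UNIV (%p. v (fst p + e) (max 0 (snd p)))" for e
 proof -
  have "continuous_on UNIV (%p :: real \<times> real. (fst p + e, snd p))" by (intro continuous_intros)
  from continuous_on_compose2[OF v_pair_cont this] show ?thesis by simp
 qed
 have "(%p. (v (fst p + eps n) (max 0 (snd p)) - v (fst p) (max 0 (snd p))) * (real n + 1)) \<in> borel_measurable borel" for n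
  using cc[of "eps n"] cc[of 0] by (intro borel_measurable_continuous_onI continuous_intros) auto
 hence "(%p. lim (%n. (v (fst p + eps n) (max 0 (snd p)) - v (fst p) (max 0 (snd p))) * (real n + 1))) \<in> borel_measurable borel"
  by (rule borel_measurable_lim_metric)
 thus "(%p. sol (fst p) (snd p)) \<in> borel_measurable borel" unfolding sol_def by measurable
qed

lemma kr_right: "kr_setup v sol CL f {0<..} QQ"
proof (intro kr_setup.intro ulip_sol kr_setup_axioms.intro)
 show "conv_flux f" by unfold_locales
 show "v x (t + h) = F.HL h (%z. v z t) x" if "0 < t" "0 < h" "cball x (QQ * h) \<subseteq> {0<..}" for x t h
 proof -
  have "x - QQ * h \<in> cball x (QQ * h)" using QQ(1) that by (simp add: dist_real_def)
  hence "0 < x - QQ * h" using that(3) by blast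
  thus ?thesis using step_right[of t h x] that by simp
 qed
qed (use QQ in auto)

lemma kr_left: "kr_setup v sol CL g {..<0} QQ"
proof (intro kr_setup.intro ulip_sol kr_setup_axioms.intro)
 show "conv_flux g" by unfold_locales
 show "v x (t + h) = G.HL h (%z. v z t) x" if "0 < t" "0 < h" "cball x (QQ * h) \<subseteq> {..<0}" for x t h
 proof -
  have "x + QQ * h \<in> cball x (QQ * h)" using QQ(1) that by (simp add: dist_real_def)
  hence "x + QQ * h < 0" using that(3) by blast
  thus ?thesis using step_left[of t h x] that by simp
 qed
qed (use QQ in auto)

text \<open>The exceptional set is empty at positive times: positive speed on the right needs a minimiser that leaves to the right at some \<open>s\<close>, and negative
speed on the left one that leaves to the left after \<open>s\<close>.\<close>

lemma sol_interface: "interface_entropy f g sol"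
proof -
 have "\<exists>a b. trace_at_0 {0<..} (%x. sol x t) a \<and> trace_at_0 {..<0} (%x. sol x t) b \<and> \<not> (deriv f a > 0 \<and> deriv g b < 0)"
  if t: "t > 0" for t
 proof -
  obtain p P r where p: "r > 0" "(P \<longlongrightarrow> p) (at_right 0)" "\<forall>x\<in>{0<..<r}. \<forall>dd. has_slope t x dd --> dd = F.dL (P x)"
   "p > 0 --> (\<exists>c s. crossR c t s)" using trace_right[OF t] by metis
  obtain q P' r' where q: "r' > 0" "(P' \<longlongrightarrow> q) (at_right 0)" "\<forall>x\<in>{0<..<r'}. \<forall>dd. has_slope t (- x) dd --> dd = G.dL (P' x)"
   "q < 0 --> (\<forall>s0<t. \<exists>c s. crossL c t s \<and> s0 \<le> s)" using trace_left[OF t] by metis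
  let ?N = "{x. \<nexists>dd. has_slope t x dd}"
  have N: "negligible ?N" unfolding negligible_iff_null_sets
   by (rule null_sets_completionI[OF countable_imp_null_set_lborel[OF slope_countable[OF t]]])
  have "trace_at_0 {0<..} (%x. sol x t) (F.dL p)" unfolding trace_at_0_def
  proof (rule exI[of _ ?N], rule conjI[OF N])
   have "((%x. F.dL (P x)) \<longlongrightarrow> F.dL p) (at_right 0)" by (rule isCont_tendsto_compose[OF F.isCont_dL p(2)])
   hence l: "((%x. F.dL (P x)) \<longlongrightarrow> F.dL p) (at 0 within ({0<..} - ?N))" by (rule tendsto_within_subset) auto
   have e: "F.dL (P x) = sol x t" if "x \<in> {0<..} - ?N" "0 < dist x 0" "dist x 0 < r" for x
    using that p(3) sol_slope[OF t] by (auto simp: dist_real_def)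
   show "((%x. sol x t) \<longlongrightarrow> F.dL p) (at 0 within ({0<..} - ?N))"
    by (rule Lim_transform_within[OF l p(1)]) (use e in blast)
  qed
  moreover have "trace_at_0 {..<0} (%x. sol x t) (G.dL q)" unfolding trace_at_0_def
  proof (rule exI[of _ ?N], rule conjI[OF N])
   have "((%x. P' (- x)) \<longlongrightarrow> q) (at_left 0)" using q(2) by (simp add: filterlim_at_left_to_right)
   hence "((%x. G.dL (P' (- x))) \<longlongrightarrow> G.dL q) (at_left 0)" by (rule isCont_tendsto_compose[OF G.isCont_dL])
   hence l: "((%x. G.dL (P' (- x))) \<longlongrightarrow> G.dL q) (at 0 within ({..<0} - ?N))" by (rule tendsto_within_subset) auto
   have e: "G.dL (P' (- x)) = sol x t" if "x \<in> {..<0} - ?N" "0 < dist x 0" "dist x 0 < r'" for x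
   proof -
    note T = that
    obtain dd where dd: "has_slope t x dd" using T(1) by blast
    have "- x \<in> {0<..<r'}" using T by (auto simp: dist_real_def)
    hence "dd = G.dL (P' (- x))" using q(3) dd by force
    thus ?thesis using sol_slope[OF t dd] by simp
   qed
   show "((%x. sol x t) \<longlongrightarrow> G.dL q) (at 0 within ({..<0} - ?N))"
    by (rule Lim_transform_within[OF l q(1)]) (use e in blast)
  qed
  moreover have "\<not> (deriv f (F.dL p) > 0 \<and> deriv g (G.dL q) < 0)"
  proof
   assume "deriv f (F.dL p) > 0 \<and> deriv g (G.dL q) < 0"
   hence s: "p > 0" "q < 0" by auto
   then obtain c s where cc: "crossR c t s" using p(4) by blast
   hence "s < t" unfolding crossR_def by blast
   then obtain d r where "crossL d t r" "s \<le> r" using q(4) s by blast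
   thus False using crossR_crossL[OF cc] by blast
  qed
  ultimately show ?thesis by blast
 qed
 thus ?thesis unfolding interface_entropy_def by (intro AE_I2) blast
qed

lemma sol_weak:
 assumes P: "prim_of v0 w0" "w0 \<in> borel_measurable borel" "\<And>x. \<bar>w0 x\<bar> \<le> B" and tf: "test_function UNIV \<phi> \<phi>x \<phi>t"
 shows "(LINT z:UNIV \<times> {0<..}|lebesgue. sol (fst z) (snd z) * \<phi>t z + flux f g (fst z) (sol (fst z) (snd z)) * \<phi>x z)
  + (LINT x|lborel. w0 x * \<phi> (x, 0)) = 0"
proof -
 interpret U: ulip v sol CL by (rule ulip_sol)
 obtain b1 where "\<forall>p\<in>{-CL..CL}. \<bar>f p\<bar> \<le> b1" using bounded_on_Icc[OF F.continuous_flux[of "{-CL..CL}"]] by blast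
 hence b1: "\<And>p. \<bar>p\<bar> \<le> CL ==> \<bar>f p\<bar> \<le> b1" by (simp add: abs_le_iff)
 obtain b2 where "\<forall>p\<in>{-CL..CL}. \<bar>g p\<bar> \<le> b2" using bounded_on_Icc[OF G.continuous_flux[of "{-CL..CL}"]] by blast
 hence b2: "\<And>p. \<bar>p\<bar> \<le> CL ==> \<bar>g p\<bar> \<le> b2" by (simp add: abs_le_iff)
 have [measurable]: "f \<in> borel_measurable borel" "g \<in> borel_measurable borel"
  using borel_measurable_continuous_onI F.continuous_flux G.continuous_flux by blast+
 have bound: "\<bar>flux f g x (sol x t)\<bar> \<le> \<bar>b1\<bar> + \<bar>b2\<bar>" for x t
  using b1[OF U.ub[of x t]] b2[OF U.ub[of x t]] by (auto simp: flux_def)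
 have AE: "AE x in lborel. (%n. (v x t - v x (t + eps n)) * (real n + 1)) \<longlonglongrightarrow> flux f g x (sol x t)" if t: "t > 0" for t
 proof -
  have "AE x in lborel. x \<notin> {0::real}" by (rule AE_not_in[OF countable_imp_null_set_lborel]) simp
  with kr_setup.time_deriv[OF kr_right t] kr_setup.time_deriv[OF kr_left t]
  show ?thesis by eventually_elim (auto simp: flux_def)
 qed
 show ?thesis
 proof (rule weak_form[OF ulip_sol tf _ bound AE _ P(2,3)])
  show "(%p. flux f g (fst p) (sol (fst p) (snd p))) \<in> borel_measurable borel" unfolding flux_def
  proof (rule measurable_If)
   show "(%p. f (sol (fst p) (snd p))) \<in> borel_measurable borel" "(%p. g (sol (fst p) (snd p))) \<in> borel_measurable borel"
    by (rule measurable_compose[OF U.um]; measurable)+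
   have "closed {p :: real \<times> real. 0 \<le> fst p}" by (intro closed_Collect_le continuous_intros)
   thus "{p \<in> space borel. 0 \<le> fst (p :: real \<times> real)} \<in> sets borel" using borel_closed by simp
  qed
  show "prim_of (%x. v x 0) w0" using P(1) by (simp add: v_0)
 qed
qed

lemma sol_kruzkov:
 assumes P: "prim_of v0 w0" "w0 \<in> borel_measurable borel" "\<And>x. \<bar>w0 x\<bar> \<le> B"
 shows "kruzkov ({0<..} \<times> {0<..}) f sol" "kruzkov ({..<0} \<times> {0<..}) g sol"
proof -
 have gen: "(LINT z:UNIV \<times> {0<..}|lebesgue. sol (fst z) (snd z) * \<phi>t z + h (sol (fst z) (snd z)) * \<phi>x z) = 0"
  if tf: "test_function (I \<times> {0<..}) \<phi> \<phi>x \<phi>t" and h: "\<And>x p. x \<in> I ==> flux f g x p = h p" for I h \<phi> \<phi>x \<phi>t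
 proof -
  obtain K where K: "K \<subseteq> I \<times> {0<..}" "\<And>z. z \<notin> K ==> \<phi> z = 0 \<and> \<phi>x z = 0 \<and> \<phi>t z = 0" using test_facts(7)[OF tf] by blast
  have tf': "test_function UNIV \<phi> \<phi>x \<phi>t" using tf unfolding test_function_def by blast
  have "\<phi> (x, 0) = 0" for x using K(2)[of "(x, 0)"] K(1) by fastforce
  hence "(LINT z:UNIV \<times> {0<..}|lebesgue. sol (fst z) (snd z) * \<phi>t z + flux f g (fst z) (sol (fst z) (snd z)) * \<phi>x z) = 0"
   using sol_weak[OF P tf'] by simp
  moreover have "flux f g (fst z) (sol (fst z) (snd z)) * \<phi>x z = h (sol (fst z) (snd z)) * \<phi>x z" for z
  proof (cases "z \<in> K")
   case True
   hence "fst z \<in> I" using K(1) by auto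
   thus ?thesis using h by simp
  qed (use K(2) in simp)
  ultimately show ?thesis by (simp only:)
 qed
 show "kruzkov ({0<..} \<times> {0<..}) f sol" by (rule kr_setup.kruzkov_side[OF kr_right gen]) (auto simp: flux_def)
 show "kruzkov ({..<0} \<times> {0<..}) g sol" by (rule kr_setup.kruzkov_side[OF kr_left gen]) (auto simp: flux_def)
qed

end

lemma Linf_borel:
 assumes "Linf UNIV (u0 :: real => real)"
 shows "\<exists>w0 B. w0 \<in> borel_measurable borel \<and> (\<forall>x. \<bar>w0 x\<bar> \<le> B) \<and> (AE x in lebesgue. u0 x = w0 x)"
proof -
 obtain B where um: "u0 \<in> borel_measurable lebesgue" and B: "AE x in lebesgue. \<bar>u0 x\<bar> \<le> B"
  using assms unfolding Linf_def set_borel_measurable_def by auto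
 obtain w where w: "w \<in> borel_measurable lborel" "AE x in lborel. u0 x = w x"
  using completion_ex_borel_measurable_real[OF um] by blast
 have "AE x in lebesgue. u0 x = max (- \<bar>B\<bar>) (min \<bar>B\<bar> (w x))"
  using B AE_completion[OF w(2)] by eventually_elim auto
 thus ?thesis using w(1)
  by (intro exI[of _ "%x. max (- \<bar>B\<bar>) (min \<bar>B\<bar> (w x))"] exI[of _ "\<bar>B\<bar>"]) auto
qed

lemma lebesgue_to_lborel:
 fixes F G :: "'a::euclidean_space => real"
 assumes "F \<in> borel_measurable lebesgue" "G \<in> borel_measurable borel" "AE x in lebesgue. F x = G x"
 shows "integral\<^sup>L lebesgue F = integral\<^sup>L lborel G"
proof -
 have "integral\<^sup>L lebesgue F = integral\<^sup>L lebesgue G"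
  using assms by (intro integral_cong_AE) (auto intro: measurable_completion)
 also have "\<dots> = integral\<^sup>L lborel G" by (rule integral_completion) (use assms in simp)
 finally show ?thesis .
qed

lemma primitive_prim_of:
 assumes um: "u0 \<in> borel_measurable lebesgue" and wm: "w0 \<in> borel_measurable borel" and ub: "\<And>x. \<bar>w0 x\<bar> \<le> B"
  and AE: "AE x in lebesgue. u0 x = w0 x"
 shows "prim_of (primitive u0) w0"
proof -
 obtain P where P: "prim_of P w0" using exists_prim[OF wm ub] by blast
 have I: "(LINT z:{a<..<b}|lebesgue. u0 z) = P b - P a" if "a \<le> b" for a b
 proof -
  have "(LINT z:{a<..<b}|lebesgue. u0 z) = (LINT z|lborel. indicator {a..b} z * w0 z)"
   unfolding set_lebesgue_integral_def
  proof (rule lebesgue_to_lborel)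
   show "(%z. indicator {a<..<b} z *\<^sub>R u0 z) \<in> borel_measurable lebesgue"
    by (rule borel_measurable_scaleR[OF borel_measurable_indicator um]) simp
   show "(%z. indicator {a..b} z * w0 z) \<in> borel_measurable borel" using wm by measurable
   have "AE x in lborel. x \<notin> {a, b}" by (rule AE_not_in[OF countable_imp_null_set_lborel]) simp
   from AE_completion[OF this] AE show "AE z in lebesgue. indicator {a<..<b} z *\<^sub>R u0 z = indicator {a..b} z * w0 z"
    by eventually_elim (auto simp: indicator_def)
  qed
  thus ?thesis using P that unfolding prim_of_def by simp
 qed
 have "primitive u0 x = P x - P 0" for x
  unfolding primitive_def interval_lebesgue_integral_def
  using I[of 0 x] I[of x 0] by auto
 thus ?thesis using P unfolding prim_of_def by simp
qed


lemma (in two_flux) solution_exists: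
 assumes u0: "Linf UNIV u0"
 shows "\<exists>B u. value_function f g (primitive u0) B \<and> is_solution f g u0 u"
proof -
 obtain w0 B where w0: "w0 \<in> borel_measurable borel" "\<And>x. \<bar>w0 x\<bar> \<le> B" "AE x in lebesgue. u0 x = w0 x"
  using Linf_borel[OF u0] by blast
 have um: "u0 \<in> borel_measurable lebesgue" using u0 unfolding Linf_def set_borel_measurable_def by simp
 have P: "prim_of (primitive u0) w0" by (rule primitive_prim_of[OF um w0])
 interpret V: value_function f g "primitive u0" B
  by unfold_locales (rule prim_lip[OF P w0(1,2)])
 have v: "V.v x t = value_fun f g u0 x t" for x t by (simp add: V.v_def value_fun_def)
 interpret U: ulip V.v V.sol V.CL by (rule V.ulip_sol)
 have "is_solution f g u0 V.sol" unfolding is_solution_def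
 proof (intro conjI)
  show "\<forall>t>0. AE x in lebesgue. ((%z. value_fun f g u0 z t) has_real_derivative V.sol x t) (at x)"
   using AE_completion[OF V.sol_AE] by (simp add: v)
  show "kruzkov ({0<..} \<times> {0<..}) f V.sol" "kruzkov ({..<0} \<times> {0<..}) g V.sol"
   by (rule V.sol_kruzkov[OF P w0(1,2)])+
  show "interface_entropy f g V.sol" by (rule V.sol_interface)
  show "weak_solution f g u0 V.sol" unfolding weak_solution_def
  proof (intro conjI allI impI)
   have eq: "(%(x, t). V.sol x t) = (%p. V.sol (fst p) (snd p))" by auto
   have "closed (UNIV \<times> {..0} :: (real \<times> real) set)" by (intro closed_Times) auto
   moreover have "- (UNIV \<times> {..0}) = (UNIV \<times> {0<..} :: (real \<times> real) set)" by auto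
   ultimately have S: "(UNIV \<times> {0<..} :: (real \<times> real) set) \<in> sets borel" by (metis borel_comp borel_closed)
   have "(%p. indicator (UNIV \<times> {0<..}) p *\<^sub>R V.sol (fst p) (snd p)) \<in> borel_measurable borel"
    by (rule borel_measurable_scaleR[OF borel_measurable_indicator[OF S] U.um])
   hence "(%p. indicator (UNIV \<times> {0<..}) p *\<^sub>R V.sol (fst p) (snd p)) \<in> borel_measurable lebesgue"
    by (intro measurable_completion) simp
   thus "Linf (UNIV \<times> {0<..}) (%(x, t). V.sol x t)"
    unfolding Linf_def set_borel_measurable_def eq using U.ub by (intro conjI exI[of _ V.CL] AE_I2) auto
   fix \<phi> \<phi>x \<phi>t assume tf: "test_function UNIV \<phi> \<phi>x \<phi>t"
   have cc: "continuous_on UNIV (%x. \<phi> (x, 0))"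
    by (rule continuous_on_compose2[OF test_facts(4)[OF tf]]) (auto intro!: continuous_intros)
   hence pm: "(%x. \<phi> (x, 0)) \<in> borel_measurable borel" by (rule borel_measurable_continuous_onI)
   have "(LINT x|lebesgue. u0 x * \<phi> (x, 0)) = (LINT x|lborel. w0 x * \<phi> (x, 0))"
   proof (rule lebesgue_to_lborel)
    have "(%x. \<phi> (x, 0)) \<in> borel_measurable lebesgue" using pm by (intro measurable_completion) simp
    thus "(%x. u0 x * \<phi> (x, 0)) \<in> borel_measurable lebesgue" by (rule borel_measurable_times[OF um])
    show "(%x. w0 x * \<phi> (x, 0)) \<in> borel_measurable borel" by (rule borel_measurable_times[OF w0(1) pm])
    show "AE x in lebesgue. u0 x * \<phi> (x, 0) = w0 x * \<phi> (x, 0)" using w0(3) by eventually_elim simp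
   qed
   thus "(LINT z:UNIV \<times> {0<..}|lebesgue. V.sol (fst z) (snd z) * \<phi>t z + flux f g (fst z) (V.sol (fst z) (snd z)) * \<phi>x z)
    + (LINT x|lebesgue. u0 x * \<phi> (x, 0)) = 0" using V.sol_weak[OF P w0(1,2) tf] by simp
  qed
 qed
 thus ?thesis using V.value_function_axioms by blast
qed

section \<open>Lipschitz functions as primitives\<close>

text \<open>The Stieltjes measures of \<open>F\<close> and \<open>G\<close> add up to Lebesgue measure, so both have densities, with sum \<open>1\<close>.\<close>

lemma complementary_densities:
 fixes F G :: "real => real"
 assumes mono: "\<And>x y. x \<le> y ==> F x \<le> F y" "\<And>x y. x \<le> y ==> G x \<le> G y"
  and cont: "continuous_on UNIV F" "continuous_on UNIV G" and FG: "\<And>x. F x + G x = x"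
 shows "\<exists>p. p \<in> borel_measurable borel \<and> (\<forall>x. 0 \<le> p x \<and> p x \<le> 1) \<and> prim_of F p"
proof -
 let ?\<mu> = "interval_measure F" and ?\<nu> = "interval_measure G"
 have rc: "continuous (at_right a) F" "continuous (at_right a) G" for a
  using cont by (auto simp: continuous_on_eq_continuous_within intro: continuous_within_subset)
 let ?\<sigma> = "measure_of UNIV (sets borel) (%S. emeasure ?\<mu> S + emeasure ?\<nu> S)"
 have ca: "countably_additive (sets borel) (%S. emeasure ?\<mu> S + emeasure ?\<nu> S)"
 proof (rule countably_additiveI)
  fix A :: "nat => real set" assume A: "range A \<subseteq> sets borel" "disjoint_family A" "\<Union> (range A) \<in> sets borel"
  have "(\<Sum>i. emeasure ?\<mu> (A i) + emeasure ?\<nu> (A i)) = (\<Sum>i. emeasure ?\<mu> (A i)) + (\<Sum>i. emeasure ?\<nu> (A i))"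
   by (rule suminf_add[symmetric]) auto
  thus "(\<Sum>i. emeasure ?\<mu> (A i) + emeasure ?\<nu> (A i)) = emeasure ?\<mu> (\<Union> (range A)) + emeasure ?\<nu> (\<Union> (range A))"
   using suminf_emeasure[of A ?\<mu>] suminf_emeasure[of A ?\<nu>] A by simp
 qed
 have em: "emeasure ?\<sigma> S = emeasure ?\<mu> S + emeasure ?\<nu> S" if "S \<in> sets borel" for S
  by (rule emeasure_measure_of_sigma[OF _ _ ca that]) (use sets.sigma_algebra_axioms[of borel] in \<open>auto simp: positive_def\<close>)
 have "lborel = ?\<sigma>"
 proof (rule lborel_eqI)
  show "sets ?\<sigma> = sets borel" by (simp add: sets.sigma_sets_eq[of borel, simplified])
  fix l u :: real assume "\<And>b. b \<in> Basis ==> l \<bullet> b \<le> u \<bullet> b"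
  hence lu: "l \<le> u" by simp
  have pt: "emeasure ?\<mu> {u} = 0" "emeasure ?\<nu> {u} = 0"
   using emeasure_interval_measure_Icc[OF order_refl mono(1) cont(1), of u] emeasure_interval_measure_Icc[OF order_refl mono(2) cont(2), of u] by auto
  have Ioo: "emeasure M {l<..<u} = emeasure M {l<..u}" if "emeasure M {u} = 0" "sets M = sets borel" for M
  proof (cases "l < u")
   case True
   have "emeasure M ({l<..<u} \<union> {u}) = emeasure M {l<..<u}"
    by (rule emeasure_Un_null_set) (use that in \<open>auto simp: null_sets_def\<close>)
   moreover have "{l<..<u} \<union> {u} = {l<..u}" using True by auto
   ultimately show ?thesis by simp
  qed auto
  have nn: "0 \<le> F u - F l" "0 \<le> G u - G l" using mono lu by auto
  have "emeasure ?\<sigma> (box l u) = ennreal (F u - F l) + ennreal (G u - G l)"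
   using em[of "{l<..<u}"] Ioo[OF pt(1)] Ioo[OF pt(2)] emeasure_interval_measure_Ioc[OF lu mono(1) rc(1)]
    emeasure_interval_measure_Ioc[OF lu mono(2) rc(2)] by (simp add: box_real)
  also have "\<dots> = ennreal ((F u - F l) + (G u - G l))" by (rule ennreal_plus[OF nn, symmetric])
  also have "(F u - F l) + (G u - G l) = u - l" using FG[of u] FG[of l] by linarith
  finally show "emeasure ?\<sigma> (box l u) = (\<Prod>b\<in>Basis. (u - l) \<bullet> b)" by simp
 qed
 hence sum: "emeasure lborel S = emeasure ?\<mu> S + emeasure ?\<nu> S" if "S \<in> sets borel" for S using em[OF that] by simp
 have ac: "absolutely_continuous lborel ?\<mu>" "absolutely_continuous lborel ?\<nu>"
  unfolding absolutely_continuous_def null_sets_def using sum by auto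
 obtain p where p: "p \<in> borel_measurable lborel" "density lborel p = ?\<mu>"
  using sigma_finite_measure.Radon_Nikodym[OF sigma_finite_lborel ac(1)] by auto
 obtain q where q: "q \<in> borel_measurable lborel" "density lborel q = ?\<nu>"
  using sigma_finite_measure.Radon_Nikodym[OF sigma_finite_lborel ac(2)] by auto
 have "density lborel (%x. p x + q x) = density lborel (%_. 1)"
 proof (rule measure_eqI)
  fix S assume "S \<in> sets (density lborel (%x. p x + q x))"
  hence S: "S \<in> sets lborel" by simp
  have "emeasure (density lborel (%x. p x + q x)) S = emeasure ?\<mu> S + emeasure ?\<nu> S"
   using emeasure_density_add[OF S p(1) q(1)] p(2) q(2) by simp
  thus "emeasure (density lborel (%x. p x + q x)) S = emeasure (density lborel (%_. 1)) S"
   using sum S by (simp add: density_1)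
 qed simp
 hence "AE x in lborel. p x + q x = 1"
  using p(1) q(1) by (subst (asm) sigma_finite_measure.density_unique_iff[OF sigma_finite_lborel]) auto
 hence le: "AE x in lborel. p x \<le> 1" by eventually_elim (metis le_iff_add)
 define P where "P x = enn2real (min 1 (p x))" for x
 have Pm: "P \<in> borel_measurable borel" unfolding P_def[abs_def] using p(1) by measurable
 have Pb: "0 \<le> P x \<and> P x \<le> 1" for x
  using enn2real_mono[of "min 1 (p x)" 1] unfolding P_def by auto
 have "prim_of F P" unfolding prim_of_def
 proof (intro allI impI)
  fix a b :: real assume ab: "a \<le> b"
  have "(LINT x|lborel. indicator {a..b} x * P x) = enn2real (\<integral>\<^sup>+x. ennreal (indicator {a..b} x * P x) \<partial>lborel)"
   by (rule integral_eq_nn_integral) (use Pm Pb in auto)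
  also have "(\<integral>\<^sup>+x. ennreal (indicator {a..b} x * P x) \<partial>lborel) = (\<integral>\<^sup>+x. p x * indicator {a..b} x \<partial>lborel)"
  proof (rule nn_integral_cong_AE)
   show "AE x in lborel. ennreal (indicator {a..b} x * P x) = p x * indicator {a..b} x"
    using le by eventually_elim (auto simp: P_def indicator_def min_def le_less_trans[OF _ ennreal_one_less_top])
  qed
  also have "\<dots> = emeasure ?\<mu> {a..b}" using emeasure_density[OF p(1), of "{a..b}"] p(2) by simp
  also have "\<dots> = ennreal (F b - F a)" by (rule emeasure_interval_measure_Icc[OF ab mono(1) cont(1)])
  finally show "F b - F a = (LINT x|lborel. indicator {a..b} x * P x)" using mono(1)[OF ab] by simp
 qed
 thus ?thesis using Pm Pb by blast
qed

text \<open>Apply the previous lemma to the nondecreasing functions \<open>x / 2 \<plusminus> w x / (2 * N)\<close>.\<close>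

lemma lipschitz_prim_of:
 fixes w :: "real => real"
 assumes lip: "\<And>x y. \<bar>w x - w y\<bar> \<le> N * \<bar>x - y\<bar>" and N: "N > 0"
 shows "\<exists>u. u \<in> borel_measurable borel \<and> (\<forall>x. \<bar>u x\<bar> \<le> N) \<and> prim_of w u"
proof -
 define F where "F x = x / 2 + w x / (2 * N)" for x
 define G where "G x = x / 2 - w x / (2 * N)" for x
 have q: "\<bar>w y / (2 * N) - w x / (2 * N)\<bar> \<le> \<bar>y - x\<bar> / 2" for x y
 proof -
  have "\<bar>w y - w x\<bar> / (2 * N) \<le> N * \<bar>y - x\<bar> / (2 * N)" using lip N by (intro divide_right_mono) auto
  thus ?thesis using N by (simp add: abs_divide flip: diff_divide_distrib)
 qed
 have mono: "F x \<le> F y" "G x \<le> G y" if "x \<le> y" for x y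
 proof -
  have *: "x / 2 + b \<le> y / 2 + a \<and> x / 2 - b \<le> y / 2 - a" if "\<bar>a - b\<bar> \<le> \<bar>y - x\<bar> / 2" for a b
  proof -
   have "\<bar>a - b\<bar> \<le> (y - x) / 2" using that \<open>x \<le> y\<close> by simp
   hence "a - b \<le> (y - x) / 2" "b - a \<le> (y - x) / 2" by (simp_all only: abs_le_iff minus_diff_eq)
   thus ?thesis by (simp add: field_simps)
  qed
  show "F x \<le> F y" "G x \<le> G y" using *[OF q[of y x]] unfolding F_def G_def by simp_all
 qed
 have wc: "continuous_on UNIV w"
  by (rule lipschitz_on_continuous_on[of N]) (use lip N in \<open>auto intro!: lipschitz_onI simp: dist_real_def\<close>)
 have cont: "continuous_on UNIV F" "continuous_on UNIV G"
  unfolding F_def[abs_def] G_def[abs_def] using wc N by (auto intro!: continuous_intros)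
 obtain p where p: "p \<in> borel_measurable borel" "\<And>x. 0 \<le> p x \<and> p x \<le> 1" "prim_of F p"
  using complementary_densities[OF mono cont] by (auto simp: F_def G_def)
 define u where "u x = 2 * N * p x - N" for x
 have "\<bar>u x\<bar> \<le> N" for x
  using p(2)[of x] N mult_left_mono[of "p x" 1 "2 * N"] unfolding u_def by (auto simp: abs_le_iff)
 moreover have "prim_of w u" unfolding prim_of_def
 proof (intro allI impI)
  fix a b :: real assume ab: "a \<le> b"
  have i: "integrable lborel (%x. indicator {a..b} x * p x)"
   by (rule integrable_cut[where a = a and b = b and B = 1]) (use p in auto)
  have i1: "integrable lborel (%x. indicator {a..b} x :: real)" using ab by simp
  have "(LINT x|lborel. indicator {a..b} x * u x) = (LINT x|lborel. 2 * N * (indicator {a..b} x * p x) - N * indicator {a..b} x)"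
   by (rule Bochner_Integration.integral_cong[OF refl]) (simp add: u_def algebra_simps)
  also have "\<dots> = 2 * N * (LINT x|lborel. indicator {a..b} x * p x) - N * (LINT x|lborel. indicator {a..b} x)"
   using i i1 by simp
  also have "\<dots> = 2 * N * (F b - F a) - N * (b - a)" using p(3) ab unfolding prim_of_def by simp
  also have "\<dots> = w b - w a" unfolding F_def using N by (simp add: field_simps)
  finally show "w b - w a = (LINT x|lborel. indicator {a..b} x * u x)" by simp
 qed
 moreover have "u \<in> borel_measurable borel" unfolding u_def[abs_def] using p(1) by measurable
 ultimately show ?thesis by blast
qed

section \<open>A potential for a monotone coupling\<close>

text \<open>Match the largest \<open>x\<close> with \<open>Y x\<close> by exchanging partners, and use induction: the monotone coupling is optimal.\<close>

lemma monge_sum: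
 fixes A :: "real => real => real"
 assumes monge: "\<And>z z' x x'. z \<le> z' ==> x \<le> x' ==> A z x + A z' x' \<le> A z x' + A z' x"
  and Y: "mono_on J Y"
 shows "set_mset N \<subseteq> J ==> image_mset fst M = image_mset Y N ==> image_mset snd M = N ==>
  (\<Sum>x\<in>#N. A (Y x) x) \<le> (\<Sum>p\<in>#M. A (fst p) (snd p))"
proof (induction "size N" arbitrary: N M)
 case 0
 thus ?case by simp
next
 case (Suc n)
 define x where "x = Max_mset N"
 have xN: "x \<in># N" using Suc(2) Max_in[of "set_mset N"] unfolding x_def by (cases "N = {#}") auto
 have xm: "b \<le> x" if "b \<in># N" for b using that unfolding x_def by simp
 obtain N' where N': "N = add_mset x N'" using xN by (metis insert_DiffM)
 have "x \<in># image_mset snd M" using Suc.prems(3) xN by simp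
 then obtain a M1 where M1: "M = add_mset (a, x) M1" by (metis (no_types, lifting) imageE insert_DiffM prod.collapse set_image_mset)
 have s1: "image_mset snd M1 = N'" using Suc.prems(3) N' M1 by simp
 have f1: "add_mset a (image_mset fst M1) = add_mset (Y x) (image_mset Y N')" using Suc.prems(2) N' M1 by simp
 have sub: "set_mset N' \<subseteq> J" "n = size N'" using Suc.prems(1) Suc(2) N' by auto
 show ?case
 proof (cases "a = Y x")
  case True
  thus ?thesis using Suc(1)[OF sub(2,1) _ s1] f1 N' M1 by simp
 next
  case False
  have "Y x \<in># add_mset a (image_mset fst M1)" unfolding f1 by simp
  hence "Y x \<in># image_mset fst M1" using False by auto
  then obtain b M2 where M2: "M1 = add_mset (Y x, b) M2" by (metis (no_types, lifting) imageE insert_DiffM prod.collapse set_image_mset)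
  have b: "b \<in># N'" using s1 M2 by auto
  have "a \<in># add_mset (Y x) (image_mset Y N')" using f1 by (metis union_single_eq_member)
  then obtain cc where cc: "cc \<in># N" "a = Y cc" using N' by auto
  have "Y cc \<le> Y x" using Y xm[OF cc(1)] cc(1) xN Suc.prems(1) unfolding mono_on_def by blast
  hence m: "A a b + A (Y x) x \<le> A a x + A (Y x) b" using monge[of a "Y x" b x] xm[of b] b N' cc by simp
  let ?M3 = "add_mset (a, b) M2"
  have "image_mset fst ?M3 = image_mset Y N'" using f1 M2 by simp
  moreover have "image_mset snd ?M3 = N'" using s1 M2 by simp
  ultimately have "(\<Sum>x\<in>#N'. A (Y x) x) \<le> (\<Sum>p\<in>#?M3. A (fst p) (snd p))" using Suc(1)[OF sub(2,1)] by blast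
  thus ?thesis using m N' M1 M2 by simp
 qed
qed

text \<open>Rockafellar's chains: the change of cost when \<open>z\<close> is passed on along a list of points.\<close>

fun chain :: "(real => real => real) => (real => real) => real list => real => real" where
 "chain A Y [] z = 0"
| "chain A Y (x # xs) z = A z x - A (Y x) x + chain A Y xs (Y x)"

text \<open>Up to one closing term a chain is the difference of the costs of two couplings.\<close>

lemma chain_mset:
 "xs \<noteq> [] ==> \<exists>M. add_mset (Y (last xs)) (image_mset fst M) = add_mset z (image_mset Y (mset xs)) \<and> image_mset snd M = mset xs \<and>
  chain A Y xs z = (\<Sum>p\<in>#M. A (fst p) (snd p)) - (\<Sum>x\<in>#mset xs. A (Y x) x)"
proof (induction xs arbitrary: z)
 case (Cons x xs)
 show ?case
 proof (cases "xs = []")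
  case True
  thus ?thesis by (intro exI[of _ "{#(z, x)#}"]) auto
 next
  case False
  from Cons.IH[OF this, of "Y x"] obtain M where
   M: "add_mset (Y (last xs)) (image_mset fst M) = add_mset (Y x) (image_mset Y (mset xs))" "image_mset snd M = mset xs"
    "chain A Y xs (Y x) = (\<Sum>p\<in>#M. A (fst p) (snd p)) - (\<Sum>x\<in>#mset xs. A (Y x) x)" by blast
  have "add_mset (Y (last xs)) (add_mset z (image_mset fst M)) = add_mset z (add_mset (Y x) (image_mset Y (mset xs)))"
   using M(1) by (simp add: add_mset_commute)
  thus ?thesis using M False by (intro exI[of _ "add_mset (z, x) M"]) auto
 qed
qed simp

text \<open>The potential at \<open>z\<close> is the infimum of the chains that start at \<open>z\<close>. It is finite because closed chains are
nonnegative by \<open>monge_sum\<close> and a change of the start point costs at most \<open>N * \<bar>z - z'\<bar>\<close>.\<close>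

lemma monotone_potential:
 fixes A :: "real => real => real"
 assumes monge: "\<And>z z' x x'. z \<le> z' ==> x \<le> x' ==> A z x + A z' x' \<le> A z x' + A z' x"
  and Y: "mono_on J Y" "\<And>x. x \<in> J ==> Y x \<in> {a..b}" and ab: "a \<le> b"
  and lip: "\<And>x z z'. x \<in> J ==> z \<in> {a..b} ==> z' \<in> {a..b} ==> A z x - A z' x \<le> N * \<bar>z - z'\<bar>" and N: "N \<ge> 0"
 shows "\<exists>w. (\<forall>z\<in>{a..b}. \<forall>z'\<in>{a..b}. \<bar>w z - w z'\<bar> \<le> N * \<bar>z - z'\<bar>) \<and>
  (\<forall>x\<in>J. \<forall>z\<in>{a..b}. w (Y x) + A (Y x) x \<le> w z + A z x)"
proof -
 let ?C = "%z. {chain A Y xs z |xs. set xs \<subseteq> J}"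
 have cl: "chain A Y xs z - chain A Y xs z' \<le> N * \<bar>z - z'\<bar>" if "set xs \<subseteq> J" "z \<in> {a..b}" "z' \<in> {a..b}" for xs z z'
  using that lip N by (cases xs) auto
 have low: "- N * (b - a) \<le> chain A Y xs z" if xs: "set xs \<subseteq> J" and z: "z \<in> {a..b}" for xs z
 proof (cases "xs = []")
  case True thus ?thesis using N ab by simp
 next
  case False
  have l: "last xs \<in> J" using False xs by auto
  obtain M where M: "add_mset (Y (last xs)) (image_mset fst M) = add_mset (Y (last xs)) (image_mset Y (mset xs))" "image_mset snd M = mset xs"
    "chain A Y xs (Y (last xs)) = (\<Sum>p\<in>#M. A (fst p) (snd p)) - (\<Sum>x\<in>#mset xs. A (Y x) x)"
   using chain_mset[OF False, of Y "Y (last xs)" A] by blast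
  have "0 \<le> chain A Y xs (Y (last xs))"
   using monge_sum[of A J Y "mset xs" M, OF monge Y(1)] M xs by simp
  moreover have "chain A Y xs (Y (last xs)) - chain A Y xs z \<le> N * \<bar>Y (last xs) - z\<bar>" by (rule cl[OF xs Y(2)[OF l] z])
  moreover have "N * \<bar>Y (last xs) - z\<bar> \<le> N * (b - a)" using Y(2)[OF l] z N by (intro mult_left_mono) auto
  ultimately show ?thesis by simp
 qed
 have bdd: "bdd_below (?C z)" if "z \<in> {a..b}" for z using low that by (intro bdd_belowI[of _ "- N * (b - a)"]) auto
 have ne: "?C z \<noteq> {}" for z by (auto intro!: exI[of _ "[]"])
 define \<phi> where "\<phi> z = Inf (?C z)" for z
 have half: "\<phi> z \<le> \<phi> z' + N * \<bar>z - z'\<bar>" if z: "z \<in> {a..b}" "z' \<in> {a..b}" for z z'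
 proof -
  have "\<phi> z - N * \<bar>z - z'\<bar> \<le> \<phi> z'" unfolding \<phi>_def[of z']
  proof (rule cInf_greatest[OF ne])
   fix y assume "y \<in> ?C z'"
   then obtain xs where xs: "set xs \<subseteq> J" "y = chain A Y xs z'" by blast
   have "\<phi> z \<le> chain A Y xs z" unfolding \<phi>_def by (rule cInf_lower[OF _ bdd[OF z(1)]]) (use xs in blast)
   thus "\<phi> z - N * \<bar>z - z'\<bar> \<le> y" using cl[OF xs(1) z] xs(2) by linarith
  qed
  thus ?thesis by linarith
 qed
 have ext: "\<phi> z \<le> A z x - A (Y x) x + \<phi> (Y x)" if x: "x \<in> J" and z: "z \<in> {a..b}" for x z
 proof -
  have "\<phi> z - (A z x - A (Y x) x) \<le> \<phi> (Y x)" unfolding \<phi>_def[of "Y x"]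
  proof (rule cInf_greatest[OF ne])
   fix y assume "y \<in> ?C (Y x)"
   then obtain xs where xs: "set xs \<subseteq> J" "y = chain A Y xs (Y x)" by blast
   have "\<phi> z \<le> chain A Y (x # xs) z" unfolding \<phi>_def by (rule cInf_lower[OF _ bdd[OF z]]) (use xs x in \<open>auto intro!: exI[of _ "x # xs"]\<close>)
   thus "\<phi> z - (A z x - A (Y x) x) \<le> y" using xs(2) by simp
  qed
  thus ?thesis by linarith
 qed
 show ?thesis
 proof (intro exI[of _ "%z. - \<phi> z"] conjI ballI)
  show "\<bar>- \<phi> z - - \<phi> z'\<bar> \<le> N * \<bar>z - z'\<bar>" if "z \<in> {a..b}" "z' \<in> {a..b}" for z z'
   using half[OF that] half[OF that(2,1)] by (simp add: abs_le_iff abs_minus_commute)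
  show "- \<phi> (Y x) + A (Y x) x \<le> - \<phi> z + A z x" if "x \<in> J" "z \<in> {a..b}" for x z using ext[OF that] by linarith
 qed
qed


section \<open>Least action between two points\<close>

lemma (in conv_flux) persp_compress:
 assumes "0 \<le> \<tau>" "\<tau> < dd"
 shows "(dd - \<tau>) * L (x / (dd - \<tau>)) \<le> dd * L (x / dd) + \<tau> * f (dL (x / (dd - \<tau>)))"
proof -
 let ?a = "dL (x / (dd - \<tau>))"
 have "?a * x - dd * f ?a \<le> dd * L (x / dd)" by (rule persp_ge) (use assms in auto)
 moreover have "(dd - \<tau>) * L (x / (dd - \<tau>)) = ?a * x - (dd - \<tau>) * f ?a" by (rule persp_eq) (use assms in auto)
 ultimately show ?thesis by (simp add: algebra_simps)
qed

lemma (in conv_flux) bounded_speed: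
 "\<exists>B\<ge>0. \<forall>q. \<bar>q\<bar> \<le> p --> \<bar>f (dL q)\<bar> \<le> B \<and> \<bar>L q\<bar> \<le> B"
proof -
 have "continuous_on {-p..p} (%q. f (dL q))"
  by (rule continuous_on_compose2[OF continuous_flux[of UNIV] continuous_dL]) auto
 then obtain B1 where B1: "B1 \<ge> 0" "\<forall>q\<in>{-p..p}. \<bar>f (dL q)\<bar> \<le> B1" using bounded_on_Icc by blast
 obtain B2 where B2: "B2 \<ge> 0" "\<forall>q\<in>{-p..p}. \<bar>L q\<bar> \<le> B2" using bounded_on_Icc[OF continuous_L] by blast
 show ?thesis
 proof (intro exI[of _ "B1 + B2"] conjI allI impI)
  fix q assume "\<bar>q\<bar> \<le> p"
  hence "q \<in> {-p..p}" by auto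
  hence "\<bar>f (dL q)\<bar> \<le> B1" "\<bar>L q\<bar> \<le> B2" using B1 B2 by auto
  thus "\<bar>f (dL q)\<bar> \<le> B1 + B2" "\<bar>L q\<bar> \<le> B1 + B2" using B1(1) B2(1) by linarith+
 qed (use B1 B2 in simp)
qed

context two_flux begin

text \<open>Least cost of a path from \<open>z\<close> to \<open>x\<close> in time \<open>t\<close>.\<close>

definition act :: "real => real => real => real" where
 "act t z x = (SOME m. red t z x m \<and> (\<forall>m'. red t z x m' --> m \<le> m'))"

lemma act:
 assumes "t > 0"
 shows "red t z x (act t z x)" "red t z x m' ==> act t z x \<le> m'"
proof -
 have "\<exists>z'\<in>{z}. \<exists>m. red t z' x m \<and> (\<forall>z''\<in>{z}. \<forall>m'. red t z'' x m' --> 0 + m \<le> 0 + m')"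
  by (rule exists_min[OF assms, where C = 0]) auto
 hence "\<exists>m. red t z x m \<and> (\<forall>m'. red t z x m' --> m \<le> m')" by auto
 from someI_ex[OF this] show "red t z x (act t z x)" "red t z x m' ==> act t z x \<le> m'" unfolding act_def by blast+
qed

lemma act_le: "t > 0 ==> pc c 0 t cc ==> act t (c 0) (c t) \<le> cc"
 using pc_red[of c t cc] act(2) by (meson order_trans)

lemma act_path:
 assumes "t > 0"
 shows "\<exists>c. c 0 = z \<and> c t = x \<and> pc c 0 t (act t z x)"
proof -
 obtain c cc where c: "c \<in> control_curves x t" "c 0 = z" "pc c 0 t cc" "cc \<le> act t z x"
  using red_pc[OF assms act(1)[OF assms]] by blast
 have x: "c t = x" using c(1) unfolding control_curves_def by auto
 have "cc = act t z x" using act_le[OF assms c(3)] c(2,4) x by simp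
 thus ?thesis using c x by blast
qed

text \<open>The two paths on the right-hand side have end points in opposite order, so they meet; exchange their tails.\<close>

lemma act_monge:
 assumes t: "t > 0" and z: "z \<le> z'" and x: "x \<le> x'"
 shows "act t z x + act t z' x' \<le> act t z x' + act t z' x"
proof -
 obtain c where c: "c 0 = z" "c t = x'" "pc c 0 t (act t z x')" using act_path[OF t] by blast
 obtain d where d: "d 0 = z'" "d t = x" "pc d 0 t (act t z' x)" using act_path[OF t] by blast
 have "continuous_on {0..t} (%r. c r - d r)" using pc_cont[OF c(3)] pc_cont[OF d(3)] by (intro continuous_intros)
 hence "\<exists>s\<ge>0. s \<le> t \<and> c s - d s = 0" using IVT'[of "%r. c r - d r" 0 0 t] z x c d t by auto
 then obtain s where s: "0 \<le> s" "s \<le> t" "c s = d s" by auto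
 obtain cc1 cc2 where cc: "pc c 0 s cc1" "pc c s t cc2" "act t z x' = cc1 + cc2" using pc_split[OF c(3) s(1,2)] by blast
 obtain dd1 dd2 where dd: "pc d 0 s dd1" "pc d s t dd2" "act t z' x = dd1 + dd2" using pc_split[OF d(3) s(1,2)] by blast
 have 1: "act t z x \<le> cc1 + dd2"
  using act_le[OF t pc_glue[OF cc(1) dd(2) s(3)]] s c d by (auto split: if_splits)
 have 2: "act t z' x' \<le> dd1 + cc2"
  using act_le[OF t pc_glue[OF dd(1) cc(2) s(3)[symmetric]]] s c d by (auto split: if_splits)
 show ?thesis using 1 2 cc dd by simp
qed

lemma seg_bound: "\<exists>B\<ge>0. \<forall>dd a b. dd > 0 \<and> \<bar>b - a\<bar> \<le> p * dd --> \<bar>seg dd a b\<bar> \<le> dd * B"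
proof -
 obtain B1 where B1: "B1 \<ge> 0" "\<forall>q. \<bar>q\<bar> \<le> p --> \<bar>F.L q\<bar> \<le> B1" using F.bounded_speed by blast
 obtain B2 where B2: "B2 \<ge> 0" "\<forall>q. \<bar>q\<bar> \<le> p --> \<bar>G.L q\<bar> \<le> B2" using G.bounded_speed by blast
 show ?thesis
 proof (intro exI[of _ "B1 + B2"] conjI allI impI)
  fix dd a b :: real assume dd: "dd > 0 \<and> \<bar>b - a\<bar> \<le> p * dd"
  hence "\<bar>(b - a) / dd\<bar> \<le> p" by (simp add: abs_divide pos_divide_le_eq)
  hence "\<bar>F.L ((b - a) / dd)\<bar> \<le> B1" "\<bar>G.L ((b - a) / dd)\<bar> \<le> B2" using B1(2) B2(2) by blast+
  hence "\<bar>F.L ((b - a) / dd)\<bar> \<le> B1 + B2" "\<bar>G.L ((b - a) / dd)\<bar> \<le> B1 + B2" using B1(1) B2(1) by linarith+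
  thus "\<bar>seg dd a b\<bar> \<le> dd * (B1 + B2)" using dd by (auto simp: seg_def abs_mult mult_left_mono)
 qed (use B1 B2 in simp)
qed

lemma seg_compress:
 assumes T: "T > 0"
 shows "\<exists>B\<ge>0. \<forall>dd \<tau> a b. T / 3 \<le> dd \<and> 0 \<le> \<tau> \<and> \<tau> \<le> T / 6 \<and> \<bar>a\<bar> \<le> R \<and> \<bar>b\<bar> \<le> R --> seg (dd - \<tau>) a b \<le> seg dd a b + \<tau> * B"
proof -
 let ?p = "2 * R / (T / 6)"
 obtain B1 where B1: "B1 \<ge> 0" "\<forall>q. \<bar>q\<bar> \<le> ?p --> \<bar>f (F.dL q)\<bar> \<le> B1" using F.bounded_speed[of ?p] by blast
 obtain B2 where B2: "B2 \<ge> 0" "\<forall>q. \<bar>q\<bar> \<le> ?p --> \<bar>g (G.dL q)\<bar> \<le> B2" using G.bounded_speed[of ?p] by blast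
 show ?thesis
 proof (intro exI[of _ "B1 + B2"] conjI allI impI)
  fix dd \<tau> a b :: real assume H: "T / 3 \<le> dd \<and> 0 \<le> \<tau> \<and> \<tau> \<le> T / 6 \<and> \<bar>a\<bar> \<le> R \<and> \<bar>b\<bar> \<le> R"
  hence dd: "T / 6 \<le> dd - \<tau>" "\<bar>b - a\<bar> \<le> 2 * R" "0 \<le> \<tau>" "\<tau> < dd" using T by auto
  have "\<bar>b - a\<bar> / (dd - \<tau>) \<le> ?p" by (rule frac_le) (use dd T in auto)
  hence q: "\<bar>(b - a) / (dd - \<tau>)\<bar> \<le> ?p" using dd by (simp add: abs_divide)
  have "\<bar>f (F.dL ((b - a) / (dd - \<tau>)))\<bar> \<le> B1" "\<bar>g (G.dL ((b - a) / (dd - \<tau>)))\<bar> \<le> B2"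
   using B1(2) B2(2) q by blast+
  hence "f (F.dL ((b - a) / (dd - \<tau>))) \<le> B1 + B2" "g (G.dL ((b - a) / (dd - \<tau>))) \<le> B1 + B2"
   using B1(1) B2(1) by linarith+
  hence "\<tau> * f (F.dL ((b - a) / (dd - \<tau>))) \<le> \<tau> * (B1 + B2)" "\<tau> * g (G.dL ((b - a) / (dd - \<tau>))) \<le> \<tau> * (B1 + B2)"
   using dd by (auto intro: mult_left_mono)
  thus "seg (dd - \<tau>) a b \<le> seg dd a b + \<tau> * (B1 + B2)"
   using F.persp_compress[OF dd(3,4), of "b - a"] G.persp_compress[OF dd(3,4), of "b - a"] by (auto simp: seg_def)
 qed (use B1 B2 in simp)
qed

text \<open>The rest or one of the legs of a minimal path lasts at least \<open>T / 3\<close>; shortening that part changes the cost at a bounded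
rate.\<close>

lemma act_compress:
 assumes T: "T > 0" and R: "R \<ge> 0"
 shows "\<exists>B\<ge>0. \<forall>z x \<tau>. \<bar>z\<bar> \<le> R \<and> \<bar>x\<bar> \<le> R \<and> 0 \<le> \<tau> \<and> \<tau> \<le> T / 6 --> act (T - \<tau>) z x \<le> act T z x + \<tau> * B"
proof -
 obtain B where B: "B \<ge> 0" "\<And>dd \<tau> a b. T / 3 \<le> dd \<and> 0 \<le> \<tau> \<and> \<tau> \<le> T / 6 \<and> \<bar>a\<bar> \<le> R \<and> \<bar>b\<bar> \<le> R ==> seg (dd - \<tau>) a b \<le> seg dd a b + \<tau> * B"
  using seg_compress[OF T, of R] by blast
 show ?thesis
 proof (intro exI[of _ "B + \<bar>K0\<bar>"] conjI allI impI)
  fix z x \<tau> :: real assume H: "\<bar>z\<bar> \<le> R \<and> \<bar>x\<bar> \<le> R \<and> 0 \<le> \<tau> \<and> \<tau> \<le> T / 6"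
  have t: "T - \<tau> > 0" using H T by auto
  have le: "\<tau> * B \<le> \<tau> * (B + \<bar>K0\<bar>)" "- (\<tau> * K0) \<le> \<tau> * (B + \<bar>K0\<bar>)"
  proof -
   show "\<tau> * B \<le> \<tau> * (B + \<bar>K0\<bar>)" using H by (intro mult_left_mono) auto
   have "\<tau> * (- K0) \<le> \<tau> * (B + \<bar>K0\<bar>)" using H B(1) by (intro mult_left_mono) auto
   thus "- (\<tau> * K0) \<le> \<tau> * (B + \<bar>K0\<bar>)" by simp
  qed
  have "\<exists>m. red (T - \<tau>) z x m \<and> m \<le> act T z x + \<tau> * (B + \<bar>K0\<bar>)"
   using act(1)[OF T, of z x] unfolding red_def[of T]
  proof (elim disjE exE conjE)
   assume "same_side z x" "act T z x = seg T z x"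
   thus ?thesis using B(2)[of T \<tau> z x] H T le(1) by (intro exI[of _ "seg (T - \<tau>) z x"]) (auto simp: red_def)
  next
   fix s1 s2 assume ok: "thr_ok T s1 s2 z x" and e: "act T z x = thr T s1 s2 z x"
   have red: "red (T - \<tau>) z x (thr (T - \<tau>) r1 r2 z x)" if "thr_ok (T - \<tau>) r1 r2 z x" for r1 r2
    using that unfolding red_def by blast
   consider "T / 3 \<le> s1" | "T / 3 \<le> s2" | "T / 3 \<le> T - s1 - s2" by linarith
   thus ?thesis
   proof cases
    case 1
    hence "thr_ok (T - \<tau>) (s1 - \<tau>) s2 z x" using ok H T unfolding thr_ok_def by auto
    moreover have "thr (T - \<tau>) (s1 - \<tau>) s2 z x \<le> thr T s1 s2 z x + \<tau> * B"
     using B(2)[of s1 \<tau> z 0] 1 H R by (simp add: thr_def)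
    ultimately show ?thesis using red[of "s1 - \<tau>" s2] e le(1) by (intro exI[of _ "thr (T - \<tau>) (s1 - \<tau>) s2 z x"]) simp
   next
    case 2
    hence "thr_ok (T - \<tau>) s1 (s2 - \<tau>) z x" using ok H T unfolding thr_ok_def by auto
    moreover have "thr (T - \<tau>) s1 (s2 - \<tau>) z x \<le> thr T s1 s2 z x + \<tau> * B"
    proof -
     have e2: "T - \<tau> - s1 - (s2 - \<tau>) = T - s1 - s2" by simp
     have "seg (s2 - \<tau>) 0 x \<le> seg s2 0 x + \<tau> * B" by (rule B(2)) (use 2 H R in simp)
     thus ?thesis unfolding thr_def e2 by simp
    qed
    ultimately show ?thesis using red[of s1 "s2 - \<tau>"] e le(1) by (intro exI[of _ "thr (T - \<tau>) s1 (s2 - \<tau>) z x"]) simp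
   next
    case 3
    hence "thr_ok (T - \<tau>) s1 s2 z x" using ok H T unfolding thr_ok_def by auto
    moreover have "thr (T - \<tau>) s1 s2 z x = thr T s1 s2 z x + - (\<tau> * K0)" by (simp add: thr_def algebra_simps)
    ultimately show ?thesis using red[of s1 s2] e le(2) by (intro exI[of _ "thr (T - \<tau>) s1 s2 z x"]) simp
   qed
  qed
  then obtain m where "red (T - \<tau>) z x m" "m \<le> act T z x + \<tau> * (B + \<bar>K0\<bar>)" by (elim exE conjE)
  thus "act (T - \<tau>) z x \<le> act T z x + \<tau> * (B + \<bar>K0\<bar>)" using act(2)[OF t, of z x m] by simp
 qed (use B in simp)
qed

lemma act_move:
 assumes t: "0 < \<tau>" "\<tau> < t" and z: "\<tau> = \<bar>z' - z\<bar>" "same_side z z'"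
 shows "act t z x \<le> seg \<tau> z z' + act (t - \<tau>) z' x"
proof -
 interpret V: value_function f g "%_. 0" 0 by unfold_locales simp
 have t': "0 < t - \<tau>" using t by simp
 obtain c where c: "c 0 = z'" "c (t - \<tau>) = x" "pc c 0 (t - \<tau>) (act (t - \<tau>) z' x)" using act_path[OF t'] by blast
 have p: "pc (%s. c (s + - \<tau>)) \<tau> t (act (t - \<tau>) z' x)" using V.pc_shift[OF c(3), of "- \<tau>"] by simp
 have l: "pc (line 0 \<tau> z z') 0 \<tau> (seg \<tau> z z')" using pc_line[OF t(1) z(2)] by simp
 have e: "line 0 \<tau> z z' \<tau> = c (\<tau> + - \<tau>)" using t c(1) by simp
 show ?thesis using act_le[OF _ pc_glue[OF l p e]] t c by simp
qed

lemma act_bound: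
 assumes T: "T > 0"
 shows "\<exists>B\<ge>0. \<forall>z x. \<bar>z\<bar> \<le> R \<and> \<bar>x\<bar> \<le> R --> \<bar>act T z x\<bar> \<le> B"
proof -
 obtain B where B: "B \<ge> 0" "\<And>dd a b. dd > 0 \<and> \<bar>b - a\<bar> \<le> 2 * R / T * dd ==> \<bar>seg dd a b\<bar> \<le> dd * B" using seg_bound[of "2 * R / T"] by blast
 have D: "DD 0 \<ge> 0" by (rule DD_nonneg)
 show ?thesis
 proof (intro exI[of _ "T * B + T * DD 0"] conjI allI impI)
  fix z x assume H: "\<bar>z\<bar> \<le> R \<and> \<bar>x\<bar> \<le> R"
  have "thr_ok T (T / 2) (T / 2) z x" using T by (auto simp: thr_ok_def)
  hence "act T z x \<le> thr T (T / 2) (T / 2) z x" using act(2)[OF T] unfolding red_def by blast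
  moreover have "\<bar>seg (T / 2) z 0\<bar> \<le> T / 2 * B" "\<bar>seg (T / 2) 0 x\<bar> \<le> T / 2 * B"
   by (rule B(2); use H T in simp)+
  moreover have "0 \<le> T * DD 0" using T D by simp
  ultimately have u: "act T z x \<le> T * B + T * DD 0" unfolding thr_def by (simp add: field_simps)
  have "- (T * DD 0) \<le> act T z x" using red_lower[OF T act(1)[OF T], of 0 x z] by simp
  moreover have "0 \<le> T * B" using T B by simp
  ultimately show "\<bar>act T z x\<bar> \<le> T * B + T * DD 0" using u by linarith
 qed (use B T D in simp)
qed

text \<open>To start at \<open>z\<close> instead of \<open>z'\<close>, first go to \<open>z'\<close> at unit speed and then follow a minimal path, compressed by the
time spent. If the points lie on different sides, pass through \<open>0\<close>; for distant points the bound on \<open>act\<close> suffices.\<close>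

lemma act_lip:
 assumes T: "T > 0" and R: "R \<ge> 0"
 shows "\<exists>N>0. \<forall>z z' x. \<bar>z\<bar> \<le> R \<and> \<bar>z'\<bar> \<le> R \<and> \<bar>x\<bar> \<le> R --> act T z x - act T z' x \<le> N * \<bar>z - z'\<bar>"
proof -
 interpret V: value_function f g "%_. 0" 0 by unfold_locales simp
 obtain B where B: "B \<ge> 0" "\<And>z x \<tau>. \<bar>z\<bar> \<le> R \<and> \<bar>x\<bar> \<le> R \<and> 0 \<le> \<tau> \<and> \<tau> \<le> T / 6 ==> act (T - \<tau>) z x \<le> act T z x + \<tau> * B"
  using act_compress[OF assms] by blast
 obtain D where D: "D \<ge> 0" "\<And>z x. \<bar>z\<bar> \<le> R \<and> \<bar>x\<bar> \<le> R ==> \<bar>act T z x\<bar> \<le> D" using act_bound[OF T] by blast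
 define N where "N = V.M1 + B + 2 * D / (T / 6) + 1"
 have N: "N > 0" "V.M1 + B \<le> N" "2 * D / (T / 6) \<le> N" using B D T V.M1_nonneg unfolding N_def by (simp_all add: add_nonneg_pos)
 have same: "act T z x - act T z' x \<le> N * \<bar>z - z'\<bar>" if H: "\<bar>z\<bar> \<le> R" "\<bar>z'\<bar> \<le> R" "\<bar>x\<bar> \<le> R" "same_side z z'" for z z' x
 proof -
  consider "z = z'" | "0 < \<bar>z - z'\<bar>" "\<bar>z - z'\<bar> \<le> T / 6" | "T / 6 \<le> \<bar>z - z'\<bar>" by linarith
  thus ?thesis
  proof cases
   case 2
   let ?\<tau> = "\<bar>z' - z\<bar>"
   have \<tau>: "0 < ?\<tau>" "?\<tau> \<le> T / 6" "?\<tau> < T" using 2 T by (auto simp: abs_minus_commute)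
   have "act T z x \<le> seg ?\<tau> z z' + act (T - ?\<tau>) z' x" by (rule act_move[OF \<tau>(1,3) refl H(4)])
   also have "\<dots> \<le> ?\<tau> * V.M1 + (act T z' x + ?\<tau> * B)"
    using V.seg_unit[OF H(4) refl] B(2)[of z' x ?\<tau>] H \<tau> by (intro add_mono) auto
   also have "?\<tau> * V.M1 + (act T z' x + ?\<tau> * B) = act T z' x + ?\<tau> * (V.M1 + B)" by (simp add: algebra_simps)
   finally have "act T z x - act T z' x \<le> ?\<tau> * (V.M1 + B)" by simp
   also have "\<dots> \<le> ?\<tau> * N" using N by (intro mult_left_mono) auto
   finally show ?thesis by (simp add: mult.commute abs_minus_commute)
  next
   case 3
   have "act T z x - act T z' x \<le> 2 * D" using D(2)[of z x] D(2)[of z' x] H by linarith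
   also have "\<dots> = 2 * D / (T / 6) * (T / 6)" using T by simp
   also have "\<dots> \<le> N * \<bar>z - z'\<bar>" using N 3 T D by (intro mult_mono) auto
   finally show ?thesis .
  qed simp
 qed
 show ?thesis
 proof (intro exI[of _ N] conjI allI impI N)
  fix z z' x assume H: "\<bar>z\<bar> \<le> R \<and> \<bar>z'\<bar> \<le> R \<and> \<bar>x\<bar> \<le> R"
  show "act T z x - act T z' x \<le> N * \<bar>z - z'\<bar>"
  proof (cases "same_side z z'")
   case True thus ?thesis using same H by blast
  next
   case False
   have "act T z x - act T 0 x \<le> N * \<bar>z - 0\<bar>" "act T 0 x - act T z' x \<le> N * \<bar>0 - z'\<bar>"
    by (rule same; use H R in \<open>auto simp: same_side_def\<close>)+
   moreover have "\<bar>z - z'\<bar> = \<bar>z - 0\<bar> + \<bar>0 - z'\<bar>" using False by (auto simp: same_side_def abs_if)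
   ultimately show ?thesis by (simp add: algebra_simps)
  qed
 qed
qed

end


section \<open>Initial data with prescribed minimisers\<close>

context two_flux begin

text \<open>On \<open>{b1..b2}\<close> the primitive of the datum is the potential of the coupling; from there to \<open>B1\<close> and \<open>B2\<close> it rises
with slope \<open>N\<close>. This slope exceeds the Lipschitz constant of the action, and lifts the end points so high that
neither the prescribed data, bounded by \<open>C0\<close>, nor the action, which grows faster than \<open>C0 * \<bar>x - z\<bar>\<close>,
can make up for it further out.\<close>

lemma initial_datum:
 assumes T: "T > 0" and B: "B1 < b1" "b1 < 0" "0 < b2" "b2 < B2" and u1: "Linf (- {B1<..<B2}) u1"
  and Y: "mono_on {C1<..<C2} Y" "\<And>x. x \<in> {C1<..<C2} ==> Y x \<in> {b1..b2}"
 defines "u0 \<equiv> %ut x. if x \<in> {B1<..<B2} then ut x else u1 x"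
 shows "\<exists>ut. Linf {B1<..<B2} ut \<and> Linf UNIV (u0 ut) \<and>
  (\<forall>x\<in>{C1<..<C2}. \<forall>z. primitive (u0 ut) (Y x) + act T (Y x) x \<le> primitive (u0 ut) z + act T z x)"
proof -
 define R where "R = \<bar>B1\<bar> + \<bar>B2\<bar> + \<bar>C1\<bar> + \<bar>C2\<bar>"
 have R: "R \<ge> 0" "\<bar>z\<bar> \<le> R" if "B1 \<le> z" "z \<le> B2" for z using that unfolding R_def by auto
 have R0: "R \<ge> 0" unfolding R_def by simp
 have RJ: "\<bar>x\<bar> \<le> R" if "x \<in> {C1<..<C2}" for x using that unfolding R_def by auto
 obtain N1 where N1: "N1 > 0" "\<And>z z' x. \<bar>z\<bar> \<le> R \<and> \<bar>z'\<bar> \<le> R \<and> \<bar>x\<bar> \<le> R ==> act T z x - act T z' x \<le> N1 * \<bar>z - z'\<bar>"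
  using act_lip[OF T R0] by blast
 obtain D where D: "D \<ge> 0" "\<And>z x. \<bar>z\<bar> \<le> R \<and> \<bar>x\<bar> \<le> R ==> \<bar>act T z x\<bar> \<le> D" using act_bound[OF T] by blast
 have "\<exists>w. (\<forall>z\<in>{b1..b2}. \<forall>z'\<in>{b1..b2}. \<bar>w z - w z'\<bar> \<le> N1 * \<bar>z - z'\<bar>) \<and>
  (\<forall>x\<in>{C1<..<C2}. \<forall>z\<in>{b1..b2}. w (Y x) + act T (Y x) x \<le> w z + act T z x)"
 proof (rule monotone_potential[OF act_monge[OF T] Y])
  show "act T z x - act T z' x \<le> N1 * \<bar>z - z'\<bar>" if "x \<in> {C1<..<C2}" "z \<in> {b1..b2}" "z' \<in> {b1..b2}" for x z z'
   using N1(2)[of z z' x] R(2)[of z] R(2)[of z'] RJ[OF that(1)] that B by auto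
 qed (use B N1 in auto)
 then obtain w where w: "\<And>z z'. z \<in> {b1..b2} ==> z' \<in> {b1..b2} ==> \<bar>w z - w z'\<bar> \<le> N1 * \<bar>z - z'\<bar>"
  "\<And>x z. x \<in> {C1<..<C2} ==> z \<in> {b1..b2} ==> w (Y x) + act T (Y x) x \<le> w z + act T z x" by blast
 obtain C where u1m: "set_borel_measurable lebesgue (- {B1<..<B2}) u1" and C': "AE x in lebesgue. x \<in> - {B1<..<B2} --> \<bar>u1 x\<bar> \<le> C"
  using u1 unfolding Linf_def by blast
 define C0 where "C0 = max 0 C"
 have C0: "C0 \<ge> 0" "AE x in lebesgue. x \<notin> {B1<..<B2} --> \<bar>u1 x\<bar> \<le> C0"
  using C' by (auto simp: C0_def elim: eventually_mono)
 \<comment> \<open>What a start point outside can gain: \<open>D\<close> by the action from inside, \<open>T * DD C0\<close> in the lower bound of its own action,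
 \<open>2 * R * C0\<close> since that bound counts the distance from \<open>x\<close> instead of the one from the free interval.\<close>
 define H where "H = D + 2 * R * C0 + T * DD C0"
 have H: "H \<ge> 0" using D R0 C0 T DD_nonneg[of C0] by (simp add: H_def)
 define N where "N = N1 + H / (b1 - B1) + H / (B2 - b2)"
 have q: "0 \<le> H / (b1 - B1)" "0 \<le> H / (B2 - b2)" using H B by auto
 have N: "N1 \<le> N" "H \<le> N * (b1 - B1)" "H \<le> N * (B2 - b2)"
 proof -
  show "N1 \<le> N" using q unfolding N_def by linarith
  have "H = H / (b1 - B1) * (b1 - B1)" using B by simp
  also have "\<dots> \<le> N * (b1 - B1)" using q N1(1) B unfolding N_def by (intro mult_right_mono) auto
  finally show "H \<le> N * (b1 - B1)" .
  have "H = H / (B2 - b2) * (B2 - b2)" using B by simp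
  also have "\<dots> \<le> N * (B2 - b2)" using q N1(1) B unfolding N_def by (intro mult_right_mono) auto
  finally show "H \<le> N * (B2 - b2)" .
 qed
 define cl where "cl z = max b1 (min b2 z)" for z
 have cl: "cl z \<in> {b1..b2}" "\<bar>cl z - cl z'\<bar> \<le> \<bar>z - z'\<bar>" "\<bar>\<bar>z - cl z\<bar> - \<bar>z' - cl z'\<bar>\<bar> \<le> \<bar>z - z'\<bar>" for z z'
  using B unfolding cl_def by (auto simp: max_def min_def)
 define W where "W z = w (cl z) + N * \<bar>z - cl z\<bar>" for z
 have "\<bar>W z - W z'\<bar> \<le> (N1 + N) * \<bar>z - z'\<bar>" for z z'
 proof -
  have "\<bar>w (cl z) - w (cl z')\<bar> \<le> N1 * \<bar>z - z'\<bar>"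
   using w(1)[OF cl(1) cl(1), of z z'] mult_left_mono[OF cl(2)[of z z'], of N1] N1(1) by linarith
  moreover have "\<bar>N * \<bar>z - cl z\<bar> - N * \<bar>z' - cl z'\<bar>\<bar> \<le> N * \<bar>z - z'\<bar>"
  proof -
   have "\<bar>N * \<bar>z - cl z\<bar> - N * \<bar>z' - cl z'\<bar>\<bar> = N * \<bar>\<bar>z - cl z\<bar> - \<bar>z' - cl z'\<bar>\<bar>"
    using N(1) N1(1) by (simp add: abs_mult flip: right_diff_distrib)
   thus ?thesis using cl(3)[of z z'] N(1) N1(1) by (simp add: mult_left_mono)
  qed
  ultimately show ?thesis unfolding W_def distrib_right by linarith
 qed
 from lipschitz_prim_of[OF this] obtain ut where
  ut: "ut \<in> borel_measurable borel" "\<And>x. \<bar>ut x\<bar> \<le> N1 + N" "prim_of W ut" using N(1) N1(1) by auto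
 let ?u = "u0 ut"
 have utm: "ut \<in> borel_measurable lebesgue" using ut(1) by (intro measurable_completion) simp
 have i: "(%x. indicator {B1<..<B2} x *\<^sub>R ut x) \<in> borel_measurable lebesgue"
  by (rule borel_measurable_scaleR[OF borel_measurable_indicator utm]) simp
 have "(%x. indicator {B1<..<B2} x *\<^sub>R ut x + indicator (- {B1<..<B2}) x *\<^sub>R u1 x) \<in> borel_measurable lebesgue"
  using borel_measurable_add[OF i] u1m unfolding set_borel_measurable_def by blast
 moreover have "?u = (%x. indicator {B1<..<B2} x *\<^sub>R ut x + indicator (- {B1<..<B2}) x *\<^sub>R u1 x)"
  unfolding u0_def by (auto simp: indicator_def)
 ultimately have um: "?u \<in> borel_measurable lebesgue" by simp
 have "AE x in lebesgue. \<bar>?u x\<bar> \<le> max (N1 + N) C0"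
  using C0(2) by eventually_elim (use ut(2) in \<open>auto simp: u0_def le_max_iff_disj\<close>)
 hence Lu: "Linf UNIV ?u" using um unfolding Linf_def set_borel_measurable_def by auto
 have Lut: "Linf {B1<..<B2} ut" unfolding Linf_def set_borel_measurable_def using i ut(2) by auto
 obtain w0 M where w0: "w0 \<in> borel_measurable borel" "\<And>x. \<bar>w0 x\<bar> \<le> M" "AE x in lebesgue. ?u x = w0 x"
  using Linf_borel[OF Lu] by blast
 define P where "P = primitive ?u"
 have P: "prim_of P w0" unfolding P_def by (rule primitive_prim_of[OF um w0])
 have AE0: "AE x in lborel. ?u x = w0 x \<and> (x \<notin> {B1<..<B2} --> \<bar>u1 x\<bar> \<le> C0)"
  using w0(3) C0(2) unfolding AE_completion_iff by eventually_elim simp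
 have inside: "P b - P a = W b - W a" if ab: "B1 \<le> a" "a \<le> b" "b \<le> B2" for a b
 proof -
  have "AE x in lborel. x \<notin> {B1, B2}" by (rule AE_not_in[OF countable_imp_null_set_lborel]) simp
  with AE0 have "AE x in lborel. indicator {a..b} x * w0 x = indicator {a..b} x * ut x"
   by eventually_elim (use ab in \<open>auto simp: u0_def indicator_def split: if_splits\<close>)
  hence "(LINT x|lborel. indicator {a..b} x * w0 x) = (LINT x|lborel. indicator {a..b} x * ut x)"
   using w0(1) ut(1) by (intro integral_cong_AE) auto
  thus ?thesis using P ut(3) ab(2) unfolding prim_of_def by simp
 qed
 have left: "P B1 - C0 * (B1 - z) \<le> P z" if z: "z \<le> B1" for z
 proof -
  have "AE x in lborel. z \<le> x --> x \<le> B1 --> - C0 \<le> - w0 x"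
   using AE0 by eventually_elim (auto simp: u0_def)
  from prim_mono[OF prim_uminus[OF P] _ _ this z, of M] have "- C0 * (B1 - z) \<le> - P B1 - - P z" using w0(1,2) by simp
  thus ?thesis by simp
 qed
 have right: "P B2 - C0 * (z - B2) \<le> P z" if z: "B2 \<le> z" for z
 proof -
  have "AE x in lborel. B2 \<le> x --> x \<le> z --> - C0 \<le> w0 x"
   using AE0 by eventually_elim (auto simp: u0_def)
  from prim_mono[OF P w0(1,2) this z] show ?thesis by simp
 qed
 have far: "C0 * \<bar>x - z\<bar> - T * DD C0 \<le> act T z x" for z x by (rule red_lower[OF T act(1)[OF T] C0(1)])
 have grow: "P z - P (cl z) = N * \<bar>z - cl z\<bar>" if z: "B1 \<le> z" "z \<le> B2" for z
 proof -
  have "cl (cl z) = cl z" unfolding cl_def by auto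
  thus ?thesis using inside[of z "cl z"] inside[of "cl z" z] cl(1)[of z] z B by (cases "z \<le> cl z") (auto simp: W_def)
 qed
 have "P (Y x) + act T (Y x) x \<le> P z + act T z x" if x: "x \<in> {C1<..<C2}" for x z
 proof -
  note Yx = Y(2)[OF x]
  have xR: "\<bar>x\<bar> \<le> R" by (rule RJ[OF x])
  have mid: "P (Y x) + act T (Y x) x \<le> P (cl z) + act T (cl z) x" for z
  proof -
   have Wb: "W y = w y" if "y \<in> {b1..b2}" for y using that unfolding W_def cl_def by auto
   have "P (cl z) - P (Y x) = W (cl z) - W (Y x)"
    using inside[of "Y x" "cl z"] inside[of "cl z" "Y x"] Yx cl(1)[of z] B by (cases "Y x \<le> cl z") auto
   thus ?thesis using w(2)[OF x cl(1), of z] Wb[OF cl(1), of z] Wb[OF Yx] by linarith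
  qed
  have clR: "\<bar>cl z\<bar> \<le> R" for z using cl(1)[of z] B by (intro R(2)) auto
  show ?thesis
  proof (cases "B1 \<le> z \<and> z \<le> B2")
   case True
   hence "act T (cl z) x - act T z x \<le> N1 * \<bar>cl z - z\<bar>" using N1(2)[of "cl z" z x] clR[of z] R(2)[of z] xR by blast
   moreover have "N1 * \<bar>cl z - z\<bar> \<le> N * \<bar>z - cl z\<bar>" using N(1) by (simp add: mult_right_mono abs_minus_commute)
   ultimately show ?thesis using mid[of z] grow[of z] True by linarith
  next
   case False
   define e where "e = (if z \<le> B1 then B1 else B2)"
   have e: "B1 \<le> e" "e \<le> B2" using B by (auto simp: e_def)
   have "H \<le> N * \<bar>e - cl e\<bar>" using N(2,3) B by (auto simp: e_def cl_def)
   moreover have "P e - C0 * \<bar>z - e\<bar> \<le> P z" using left[of z] right[of z] False by (auto simp: e_def)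
   moreover have "C0 * (\<bar>z - e\<bar> - 2 * R) \<le> C0 * \<bar>x - z\<bar>" using xR R(2)[OF e] C0 by (intro mult_left_mono) linarith+
   hence "C0 * \<bar>z - e\<bar> - 2 * R * C0 \<le> C0 * \<bar>x - z\<bar>" by (simp add: algebra_simps)
   moreover have "act T (cl e) x \<le> D" using D(2)[of "cl e" x] clR[of e] xR by (auto simp: abs_le_iff)
   ultimately show ?thesis using mid[of e] grow[OF e] far[of x z] unfolding H_def by linarith
  qed
 qed
 thus ?thesis using Lut Lu unfolding P_def by blast
qed

end


section \<open>The pair attached to a reachable state\<close>

context two_flux begin

text \<open>The two states of level \<open>g (\<theta> g)\<close> and their speeds: a curve on the right runs into the interface with speed
\<open>Mm\<close> before a rest, and leaves it with speed \<open>Mp\<close> afterwards.\<close>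

abbreviation "tb \<equiv> \<theta>bar f g"
abbreviation "tbb \<equiv> \<theta>barbar f g"
abbreviation "Mp \<equiv> deriv f tb"
abbreviation "Mm \<equiv> deriv f tbb"

lemma flux_mono_right: "\<theta> f \<le> p ==> p < q ==> f p < f q" and flux_mono_left: "p \<le> \<theta> f ==> q < p ==> f p < f q"
proof -
 have e: "0 = deriv f (\<theta> f)" using F.deriv_theta by simp
 show "f p < f q" if "\<theta> f \<le> p" "p < q"
 proof -
  have "0 \<le> deriv f p" "deriv f p < deriv f q" unfolding e
   using that F.deriv_strict_mono by (auto simp: strict_mono_less_eq strict_mono_less)
  thus ?thesis using F.flux_dL_less(1)[of "deriv f p" "deriv f q"] by simp
 qed
 show "f p < f q" if "p \<le> \<theta> f" "q < p"
 proof -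
  have "deriv f p \<le> 0" "deriv f q < deriv f p" unfolding e
   using that F.deriv_strict_mono by (auto simp: strict_mono_less_eq strict_mono_less)
  thus ?thesis using F.flux_dL_less(2)[of "deriv f p" "deriv f q"] by simp
 qed
qed

lemma tb: "\<theta> f \<le> tb" "f tb = g (\<theta> g)" and tbb: "tbb \<le> \<theta> f" "f tbb = g (\<theta> g)"
proof -
 let ?E = "g (\<theta> g)"
 obtain R where R: "R > 0" "\<And>p. \<bar>p\<bar> \<ge> R ==> 1 * \<bar>p\<bar> \<le> f p" using F.superlinear[of 1] by blast
 define r where "r = R + \<bar>?E\<bar> + \<bar>\<theta> f\<bar>"
 have r: "?E \<le> f r" "?E \<le> f (- r)" "\<theta> f \<le> r" "- r \<le> \<theta> f"
 proof -
  have rr: "0 \<le> r" "R \<le> r" "?E \<le> r" "\<bar>\<theta> f\<bar> \<le> r" using R(1) unfolding r_def by linarith+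
  thus "?E \<le> f r" "?E \<le> f (- r)" using R(2)[of r] R(2)[of "- r"] by auto
  show "\<theta> f \<le> r" "- r \<le> \<theta> f" using rr(4) by linarith+
 qed
 obtain p where p: "\<theta> f \<le> p" "f p = ?E"
  using IVT'[of f "\<theta> f" ?E r] theta_le r F.continuous_flux by blast
 have "tb = p" unfolding \<theta>bar_def
 proof (rule the_equality)
  show "q = p" if "\<theta> f \<le> q \<and> f q = ?E" for q
   using flux_mono_right[of p q] flux_mono_right[of q p] p that by (cases p q rule: linorder_cases) auto
 qed (use p in simp)
 thus "\<theta> f \<le> tb" "f tb = ?E" using p by auto
 obtain q where q: "q \<le> \<theta> f" "f q = ?E"
  using IVT2'[of f "\<theta> f" ?E "- r"] theta_le r F.continuous_flux by blast
 have "tbb = q" unfolding \<theta>barbar_def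
 proof (rule the_equality)
  show "p = q" if "p \<le> \<theta> f \<and> f p = ?E" for p
   using flux_mono_left[of p q] flux_mono_left[of q p] q that by (cases p q rule: linorder_cases) auto
 qed (use q in simp)
 thus "tbb \<le> \<theta> f" "f tbb = ?E" using q by auto
qed

lemma Mp_nonneg: "0 \<le> Mp" and Mm_nonpos: "Mm \<le> 0" and Mm_neg: "0 < Mp ==> Mm < 0"
proof -
 have e: "0 = deriv f (\<theta> f)" using F.deriv_theta by simp
 show "0 \<le> Mp" unfolding e using tb F.deriv_strict_mono by (simp add: strict_mono_less_eq)
 show "Mm \<le> 0" unfolding e using tbb F.deriv_strict_mono by (simp add: strict_mono_less_eq)
 assume "0 < Mp"
 hence "\<theta> f < tb" using e tb(1) by (cases "tb = \<theta> f") auto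
 hence "f (\<theta> f) < f tb" by (rule flux_mono_right[OF order_refl])
 hence "tbb \<noteq> \<theta> f" using tb(2) tbb(2) by auto
 hence "tbb < \<theta> f" using tbb(1) by simp
 thus "Mm < 0" unfolding e using F.deriv_strict_mono by (simp add: strict_mono_less)
qed

lemma L_Mp: "F.L Mp = Mp * tb - f tb" and L_Mm: "F.L Mm = Mm * tbb - f tb"
 using F.L_eq[of Mp] F.L_eq[of Mm] tb tbb by simp_all

lemma K0_eq: "K0 = - f tb" using tb(2) G.L_0 by simp

text \<open>The right-hand side is the cost of arriving at the interface with speed \<open>Mm\<close>, during \<open>s1\<close>, resting, and leaving with speed
\<open>Mp\<close>, during \<open>s2\<close>; without rest the straight line is cheaper by convexity.\<close>

lemma merge_speeds:
 assumes "0 \<le> s1" "0 \<le> s2" "s1 + s2 = T" "T > 0"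
 shows "T * F.L ((Mp * s2 + Mm * s1) / T) \<le> tbb * (Mm * s1) + tb * (Mp * s2) - T * f tb"
proof -
 have "(s1 + s2) * F.L ((Mm * s1 + Mp * s2) / (s1 + s2)) \<le> s1 * F.L (Mm * s1 / s1) + s2 * F.L (Mp * s2 / s2)"
  by (rule F.persp_merge) (use assms in auto)
 also have "\<dots> = s1 * F.L Mm + s2 * F.L Mp" by (cases "s1 = 0"; cases "s2 = 0") auto
 also have "\<dots> = tbb * (Mm * s1) + tb * (Mp * s2) - (s1 + s2) * f tb" unfolding L_Mp L_Mm by (simp add: algebra_simps)
 finally show ?thesis using assms(3) by (simp add: add.commute)
qed

lemma L_chord:
 assumes "0 \<le> \<kappa>" "\<kappa> \<le> 1"
 shows "F.L ((1 - \<kappa>) * p + \<kappa> * q) \<le> (1 - \<kappa>) * F.L p + \<kappa> * F.L q"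
proof -
 let ?r = "(1 - \<kappa>) * p + \<kappa> * q"
 have "(1 - \<kappa>) * (F.L ?r + F.dL ?r * (p - ?r)) + \<kappa> * (F.L ?r + F.dL ?r * (q - ?r)) \<le> (1 - \<kappa>) * F.L p + \<kappa> * F.L q"
  using assms by (intro add_mono mult_left_mono F.L_tangent) auto
 moreover have "(1 - \<kappa>) * (F.L ?r + F.dL ?r * (p - ?r)) + \<kappa> * (F.L ?r + F.dL ?r * (q - ?r)) = F.L ?r"
  by (simp add: algebra_simps)
 ultimately show ?thesis by simp
qed

text \<open>Write \<open>(s1, s2)\<close> as a convex combination of \<open>(r1, r2)\<close> and a pair with sum \<open>T\<close>, at which
\<open>merge_speeds\<close> applies: the cost of the line is convex, that of the resting path affine.\<close>

lemma triangle:
 assumes T: "T > 0" and r: "0 \<le> r1" "0 \<le> r2" "r1 \<le> s1" "r2 \<le> s2" "s1 + s2 \<le> T"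
  and r0: "T * F.L ((Mp * r2 + Mm * r1) / T) \<le> tbb * (Mm * r1) + tb * (Mp * r2) - T * f tb"
 shows "T * F.L ((Mp * s2 + Mm * s1) / T) \<le> tbb * (Mm * s1) + tb * (Mp * s2) - T * f tb"
proof (cases "s1 + s2 = r1 + r2")
 case True
 hence "s1 = r1" "s2 = r2" using r by auto
 thus ?thesis using r0 by simp
next
 case False
 define \<kappa> where "\<kappa> = (s1 + s2 - (r1 + r2)) / (T - (r1 + r2))"
 have pos: "0 < s1 + s2 - (r1 + r2)" "0 < T - (r1 + r2)" using False r by auto
 have l: "0 < \<kappa>" "\<kappa> \<le> 1" using pos r by (auto simp: \<kappa>_def divide_le_eq)
 define h1 h2 where "h1 = r1 + (s1 - r1) / \<kappa>" and "h2 = r2 + (s2 - r2) / \<kappa>"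
 have s: "s1 = (1 - \<kappa>) * r1 + \<kappa> * h1" "s2 = (1 - \<kappa>) * r2 + \<kappa> * h2"
  using l unfolding h1_def h2_def by (simp_all add: field_simps)
 have "(s1 - r1) / \<kappa> + (s2 - r2) / \<kappa> = (s1 + s2 - (r1 + r2)) / \<kappa>" by (simp add: add_divide_distrib diff_divide_distrib)
 also have "\<dots> = T - (r1 + r2)" using pos unfolding \<kappa>_def by simp
 finally have "h1 + h2 = T" unfolding h1_def h2_def by simp
 hence h: "T * F.L ((Mp * h2 + Mm * h1) / T) \<le> tbb * (Mm * h1) + tb * (Mp * h2) - T * f tb"
  using r l T by (intro merge_speeds) (auto simp: h1_def h2_def)
 have e: "(Mp * s2 + Mm * s1) / T = (1 - \<kappa>) * ((Mp * r2 + Mm * r1) / T) + \<kappa> * ((Mp * h2 + Mm * h1) / T)"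
  unfolding s using T by (simp add: field_simps)
 have "T * F.L ((Mp * s2 + Mm * s1) / T) \<le> T * ((1 - \<kappa>) * F.L ((Mp * r2 + Mm * r1) / T) + \<kappa> * F.L ((Mp * h2 + Mm * h1) / T))"
  unfolding e by (intro mult_left_mono L_chord) (use l T in auto)
 also have "\<dots> = (1 - \<kappa>) * (T * F.L ((Mp * r2 + Mm * r1) / T)) + \<kappa> * (T * F.L ((Mp * h2 + Mm * h1) / T))"
  by (simp add: algebra_simps)
 also have "\<dots> \<le> (1 - \<kappa>) * (tbb * (Mm * r1) + tb * (Mp * r2) - T * f tb) + \<kappa> * (tbb * (Mm * h1) + tb * (Mp * h2) - T * f tb)"
  using r0 h l by (intro add_mono mult_left_mono) auto
 also have "\<dots> = tbb * (Mm * s1) + tb * (Mp * s2) - T * f tb" unfolding s by (simp add: algebra_simps)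
 finally show ?thesis .
qed

text \<open>\<open>\<Phi> t x\<close> is the cost of the straight line from \<open>\<xi>\<close> to \<open>x\<close> minus that of the path that runs into the
interface with speed \<open>Mm\<close>, rests, and leaves with speed \<open>Mp\<close>. The shock consists of zeros of \<open>\<Phi>\<close>. Since \<open>\<Phi>\<close> is convex, its tangents bound \<open>s\<close>
from below by lines with the slope required by the differential equation, which gives convexity and the derivative at once.\<close>

lemma shock_curve:
 assumes \<tau>: "0 < \<tau>" "\<tau> < T" and R1: "0 \<le> R1" "R1 < - (Mm * \<tau>) + Mp * T" and Mp: "0 < Mp"
  and eq: "T * F.L ((R1 - - (Mm * \<tau>)) / T) = tbb * (Mm * \<tau>) + tb * R1 - T * f tb"
 shows "\<exists>s. (\<exists>L. L-lipschitz_on {\<tau>..T} s) \<and> mono_on {\<tau>..T} s \<and> convex_on {\<tau>..T} s \<and> (\<forall>t\<in>{\<tau>..T}. s t \<ge> 0) \<and>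
  s T = R1 \<and> s \<tau> = 0 \<and> (\<forall>t\<in>{\<tau><..<T}. let w = inv (deriv f) ((s t - - (Mm * \<tau>)) / t) in
   (s has_real_derivative (f tb - f w) / (tb - w)) (at t))"
proof -
 define \<xi> where "\<xi> = - (Mm * \<tau>)"
 have Mm: "Mm < 0" by (rule Mm_neg[OF Mp])
 have \<xi>: "\<xi> > 0" unfolding \<xi>_def using Mm \<tau> by (simp add: mult_neg_pos)
 have tt: "tbb < tb" using tb(1) tbb(1) Mp Mm by (cases "tbb = tb") auto
 define \<Phi> where "\<Phi> t x = t * F.L ((x - \<xi>) / t) + tbb * \<xi> - tb * x + t * f tb" for t x
 define w where "w t x = F.dL ((x - \<xi>) / t)" for t x
 have tangent: "\<Phi> t x + (f tb - f (w t x)) * (t' - t) + (w t x - tb) * (x' - x) \<le> \<Phi> t' x'" if "t > 0" "t' > 0" for t t' x x'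
 proof -
  have "w t x * (x' - \<xi>) - t' * f (w t x) \<le> t' * F.L ((x' - \<xi>) / t')" by (rule F.persp_ge) (use that in auto)
  moreover have "t * F.L ((x - \<xi>) / t) = w t x * (x - \<xi>) - t * f (w t x)" unfolding w_def by (rule F.persp_eq[OF that(1)])
  ultimately show ?thesis unfolding \<Phi>_def by (simp add: algebra_simps)
 qed
 have wlt: "w t x < tb" if "t > 0" "x < \<xi> + Mp * t" for t x
 proof -
  have "(x - \<xi>) / t < Mp" using that by (simp add: pos_divide_less_eq algebra_simps)
  hence "w t x < F.dL Mp" unfolding w_def by (simp only: F.dL_less_iff)
  thus ?thesis by simp
 qed
 have \<Phi>0: "0 \<le> \<Phi> t 0" if "t > 0" for t
  using F.persp_ge[of t "- \<xi>" tbb] that tb tbb unfolding \<Phi>_def by (simp add: algebra_simps)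
 have \<Phi>M: "\<Phi> t (\<xi> + Mp * t) < 0" if "t > 0" for t
 proof -
  have "\<Phi> t (\<xi> + Mp * t) = t * F.L Mp + tbb * \<xi> - tb * (\<xi> + Mp * t) + t * f tb" unfolding \<Phi>_def using that by simp
  also have "\<dots> = \<xi> * (tbb - tb)" unfolding L_Mp by (simp add: algebra_simps)
  finally have "\<Phi> t (\<xi> + Mp * t) = \<xi> * (tbb - tb)" .
  thus ?thesis using \<xi> tt by (simp add: mult_pos_neg)
 qed
 have "\<exists>x. t > 0 --> 0 \<le> x \<and> x < \<xi> + Mp * t \<and> \<Phi> t x = 0" for t
 proof (cases "t > 0")
  case True
  have cc: "continuous_on {0..\<xi> + Mp * t} (\<Phi> t)" unfolding \<Phi>_def[abs_def]
   by (intro continuous_intros continuous_on_compose2[OF F.continuous_L[of UNIV]]) (use True in auto)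
  have "0 \<le> \<xi> + Mp * t" using \<xi> Mp True by (simp add: add_nonneg_nonneg)
  then obtain x where x: "0 \<le> x" "x \<le> \<xi> + Mp * t" "\<Phi> t x = 0"
   using IVT2'[OF _ _ _ cc, of 0] \<Phi>0[OF True] \<Phi>M[OF True] by auto
  hence "x \<noteq> \<xi> + Mp * t" using \<Phi>M[OF True] by auto
  thus ?thesis using x by (intro exI[of _ x]) auto
 qed simp
 then obtain s where s: "\<And>t. t > 0 ==> 0 \<le> s t \<and> s t < \<xi> + Mp * t \<and> \<Phi> t (s t) = 0" by metis
 have uniq: "x = s t" if t: "t > 0" and x: "x < \<xi> + Mp * t" "\<Phi> t x = 0" for t x
 proof (rule ccontr)
  assume ne: "x \<noteq> s t"
  have "(w t x - tb) * (s t - x) \<le> 0" "(w t (s t) - tb) * (x - s t) \<le> 0"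
   using tangent[OF t t, of x "s t"] tangent[OF t t, of "s t" x] s[OF t] x by auto
  moreover have "w t x - tb < 0" "w t (s t) - tb < 0" using wlt[OF t] x s[OF t] by auto
  ultimately have "0 \<le> s t - x" "0 \<le> x - s t" by (auto simp: mult_le_0_iff)
  thus False using ne by simp
 qed
 define r where "r t = (f tb - f (w t (s t))) / (tb - w t (s t))" for t
 have supp: "s t + r t * (t' - t) \<le> s t'" if t: "t > 0" "t' > 0" for t t'
 proof -
  have dd: "0 < tb - w t (s t)" using wlt[OF t(1)] s[OF t(1)] by simp
  have "(f tb - f (w t (s t))) * (t' - t) \<le> (tb - w t (s t)) * (s t' - s t)"
   using tangent[OF t, of "s t" "s t'"] s[OF t(1)] s[OF t(2)] by (simp add: algebra_simps)
  hence "(f tb - f (w t (s t))) * (t' - t) / (tb - w t (s t)) \<le> s t' - s t"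
   using dd by (simp add: pos_divide_le_eq mult.commute)
  thus ?thesis unfolding r_def by simp
 qed
 have r0: "0 \<le> r t" if t: "\<tau> \<le> t" for t
 proof -
  have t0: "t > 0" using t \<tau> by simp
  have "Mm * t \<le> Mm * \<tau>" using Mm t by simp
  hence "Mm * t \<le> s t - \<xi>" using s[OF t0] by (simp add: \<xi>_def)
  hence "Mm \<le> (s t - \<xi>) / t" using t0 by (simp add: pos_le_divide_eq)
  hence "F.dL Mm \<le> w t (s t)" unfolding w_def by (simp only: F.dL_le_iff)
  hence ge: "tbb \<le> w t (s t)" by simp
  have lt: "w t (s t) < tb" using wlt[OF t0] s[OF t0] by simp
  have "f (w t (s t)) \<le> f tb"
  proof (cases "\<theta> f \<le> w t (s t)")
   case True thus ?thesis using flux_mono_right[OF _ lt] by simp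
  next
   case False
   thus ?thesis using flux_mono_left[of "w t (s t)" tbb] ge tb(2) tbb(2) by (cases "tbb = w t (s t)") auto
  qed
  thus ?thesis unfolding r_def using lt by simp
 qed
 have rM: "r t \<le> Mp" if t: "t > 0" for t
 proof -
  have "f tb - f (w t (s t)) \<le> Mp * (tb - w t (s t))"
   using F.persp_ge[of 1 Mp "w t (s t)"] L_Mp by (simp add: algebra_simps)
  moreover have "w t (s t) < tb" using wlt[OF t] s[OF t] by simp
  ultimately show ?thesis unfolding r_def by (simp add: pos_divide_le_eq)
 qed
 have lip: "\<bar>s t' - s t\<bar> \<le> Mp * \<bar>t' - t\<bar>" if "\<tau> \<le> t" "\<tau> \<le> t'" for t t'
 proof -
  have main: "\<bar>s t' - s t\<bar> \<le> Mp * \<bar>t' - t\<bar>" if "\<tau> \<le> t" "t \<le> t'" for t t'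
  proof -
   have "0 \<le> r t * (t' - t)" using r0[OF that(1)] that(2) by simp
   hence "0 \<le> s t' - s t" using supp[of t t'] that \<tau> by linarith
   moreover have "r t' * (t' - t) \<le> Mp * (t' - t)" using rM[of t'] that \<tau> by (intro mult_right_mono) auto
   hence "s t' - s t \<le> Mp * (t' - t)" using supp[of t' t] that \<tau> by (simp add: algebra_simps)
   ultimately show ?thesis using that by simp
  qed
  show ?thesis using main[of t t'] main[of t' t] that by (cases "t \<le> t'") (auto simp: abs_minus_commute)
 qed
 have "continuous_on {\<tau>..} s"
  by (rule lipschitz_on_continuous_on[of Mp]) (use lip Mp in \<open>auto intro!: lipschitz_onI simp: dist_real_def\<close>)
 hence sc: "isCont s t" if "\<tau> < t" for t
  using that by (intro continuous_on_interior[of "{\<tau>..}"]) auto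
 have D: "(s has_real_derivative r t) (at t)" if t: "\<tau> < t" for t
 proof -
  have t0: "t > 0" using t \<tau> by simp
  have wc: "isCont (%t. w t (s t)) t" unfolding w_def
   by (rule isCont_o2[OF _ F.isCont_dL]) (use sc[OF t] t0 in \<open>auto intro!: continuous_intros\<close>)
  have fc: "isCont (%t. f (w t (s t))) t" by (rule isCont_o2[OF wc DERIV_isCont[OF F.DERIV_flux]])
  have "tb - w t (s t) \<noteq> 0" using wlt[OF t0, of "s t"] s[OF t0] by simp
  hence rc: "isCont r t" unfolding r_def[abs_def] using wc fc by (intro continuous_intros)
  have "((%u. (s u - s t) / (u - t)) \<longlongrightarrow> r t) (at t)"
  proof (rule LIM_I)
   fix e :: real assume e: "0 < e"
   obtain dd where dd: "dd > 0" "\<And>u. \<bar>u - t\<bar> < dd ==> \<bar>r u - r t\<bar> < e"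
    using rc e unfolding continuous_at_eps_delta dist_real_def by metis
   show "\<exists>dd>0. \<forall>u. u \<noteq> t \<and> norm (u - t) < dd --> norm ((s u - s t) / (u - t) - r t) < e"
   proof (intro exI[of _ "min dd t"] conjI allI impI)
    fix u assume u: "u \<noteq> t \<and> norm (u - t) < min dd t"
    hence u0: "u > 0" "\<bar>u - t\<bar> < dd" by auto
    have 1: "r t * (u - t) \<le> s u - s t" using supp[OF t0 u0(1)] by simp
    have 2: "s u - s t \<le> r u * (u - t)" using supp[OF u0(1) t0] by (simp add: algebra_simps)
    have "\<bar>(s u - s t) / (u - t) - r t\<bar> \<le> \<bar>r u - r t\<bar>"
    proof (cases "t < u")
     case True
     hence "r t \<le> (s u - s t) / (u - t)" "(s u - s t) / (u - t) \<le> r u"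
      using 1 2 by (simp_all add: pos_le_divide_eq pos_divide_le_eq)
     thus ?thesis by linarith
    next
     case False
     hence "u - t < 0" using u by simp
     hence "(s u - s t) / (u - t) \<le> r t" "r u \<le> (s u - s t) / (u - t)"
      using 1 2 by (simp_all add: neg_le_divide_eq neg_divide_le_eq)
     thus ?thesis by linarith
    qed
    thus "norm ((s u - s t) / (u - t) - r t) < e" using dd(2)[OF u0(2)] by simp
   qed (use dd t0 in simp)
  qed
  thus ?thesis by (simp add: has_field_derivative_iff)
 qed
 have "T > 0" using \<tau> by simp
 have sT: "s T = R1"
 proof (rule uniq[symmetric, OF \<open>T > 0\<close>])
  show "R1 < \<xi> + Mp * T" using R1 by (simp add: \<xi>_def)
  show "\<Phi> T R1 = 0" unfolding \<Phi>_def using eq by (simp add: \<xi>_def algebra_simps)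
 qed
 have s\<tau>: "s \<tau> = 0"
 proof (rule uniq[symmetric, OF \<tau>(1)])
  show "0 < \<xi> + Mp * \<tau>" using \<xi> Mp \<tau> by (simp add: add_pos_pos)
  have "(0 - \<xi>) / \<tau> = Mm" using \<tau> by (simp add: \<xi>_def)
  hence "\<Phi> \<tau> 0 = \<tau> * F.L Mm + tbb * \<xi> - tb * 0 + \<tau> * f tb" unfolding \<Phi>_def by (simp only:)
  thus "\<Phi> \<tau> 0 = 0" unfolding L_Mm \<xi>_def by (simp add: algebra_simps)
 qed
 show ?thesis
 proof (intro exI[of _ s] conjI)
  show "\<exists>L. L-lipschitz_on {\<tau>..T} s"
   by (intro exI[of _ Mp] lipschitz_onI) (use lip Mp in \<open>auto simp: dist_real_def\<close>)
  show "mono_on {\<tau>..T} s"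
  proof (rule mono_onI)
   fix t t' assume "t \<in> {\<tau>..T}" "t' \<in> {\<tau>..T}" and le: "t \<le> t'"
   hence "0 \<le> r t * (t' - t)" "s t + r t * (t' - t) \<le> s t'" using r0[of t] supp[of t t'] \<tau> by auto
   thus "s t \<le> s t'" by linarith
  qed
  show "convex_on {\<tau>..T} s"
  proof (rule convex_onI)
   fix l a b :: real assume l: "0 < l" "l < 1" and ab: "a \<in> {\<tau>..T}" "b \<in> {\<tau>..T}"
   let ?cc = "(1 - l) *\<^sub>R a + l *\<^sub>R b"
   have p: "0 < a" "0 < b" using ab \<tau> by auto
   hence cc: "0 < ?cc" using l by (simp add: add_pos_pos)
   have "(1 - l) * (s ?cc + r ?cc * (a - ?cc)) + l * (s ?cc + r ?cc * (b - ?cc)) \<le> (1 - l) * s a + l * s b"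
    using l supp[OF cc p(1)] supp[OF cc p(2)] by (intro add_mono mult_left_mono) auto
   moreover have "(1 - l) * (s ?cc + r ?cc * (a - ?cc)) + l * (s ?cc + r ?cc * (b - ?cc)) = s ?cc" by (simp add: algebra_simps)
   ultimately show "s ?cc \<le> (1 - l) * s a + l * s b" by simp
  qed simp
  show "\<forall>t\<in>{\<tau>..T}. s t \<ge> 0" using s \<tau> by auto
  show "\<forall>t\<in>{\<tau><..<T}. let w = inv (deriv f) ((s t - - (Mm * \<tau>)) / t) in (s has_real_derivative (f tb - f w) / (tb - w)) (at t)"
   using D unfolding r_def w_def F.dL_def \<xi>_def Let_def by auto
 qed (fact sT s\<tau>)+
qed

text \<open>If \<open>T1 > 0\<close>, the intermediate value theorem in the duration of the first leg gives a \<open>\<tau>\<close> at which line and resting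
path cost the same; \<open>triangle\<close> extends the comparison to all longer legs.\<close>

lemma shock_pair_exists:
 assumes T: "T > 0" and R1: "R1 > 0" and ax: "axis_time f g T R1 T1"
 shows "\<exists>\<tau> \<xi>. shock_pair f g T T1 \<tau> \<xi> \<and> (\<forall>s1 s2. 0 \<le> s1 --> 0 \<le> s2 --> s1 + s2 \<le> T --> \<xi> \<le> - (Mm * s1) --> R1 \<le> Mp * s2 -->
  T * F.L ((Mp * s2 + Mm * s1) / T) \<le> tbb * (Mm * s1) + tb * (Mp * s2) - T * f tb)"
proof -
 have T1: "0 \<le> T1" "T1 \<le> T" "R1 = Mp * (T - T1)" using ax unfolding axis_time_def by (auto simp: algebra_simps)
 have Mp: "0 < Mp" using T1 R1 Mp_nonneg by (cases "Mp = 0") auto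
 hence lt: "T1 < T" using T1 R1 by (cases "T1 = T") auto
 have Mm: "Mm < 0" by (rule Mm_neg[OF Mp])
 have conv: "r1 \<le> s1" if "- (Mm * r1) \<le> - (Mm * s1)" for r1 s1 using that Mm by (simp add: mult_le_cancel_left)
 have conv': "T - T1 \<le> s2" if "R1 \<le> Mp * s2" for s2 using that Mp T1 by (simp add: mult_le_cancel_left)
 show ?thesis
 proof (cases "T1 = 0")
  case True
  have "shock_pair f g T T1 0 0" using True R1 T1 unfolding shock_pair_def Let_def by auto
  moreover have "T * F.L ((Mp * s2 + Mm * s1) / T) \<le> tbb * (Mm * s1) + tb * (Mp * s2) - T * f tb"
   if "0 \<le> s1" "0 \<le> s2" "s1 + s2 \<le> T" "0 \<le> - (Mm * s1)" "R1 \<le> Mp * s2" for s1 s2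
   using that conv'[OF that(5)] True T by (intro merge_speeds) auto
  ultimately show ?thesis by blast
 next
  case False
  hence T1p: "0 < T1" using T1 by simp
  let ?\<psi> = "%r. T * F.L ((R1 + Mm * r) / T) - (tbb * (Mm * r) + tb * R1 - T * f tb)"
  have cc: "continuous_on {0..T1} ?\<psi>"
   by (intro continuous_intros continuous_on_compose2[OF F.continuous_L[of UNIV]]) (use T in auto)
  have "0 \<le> ?\<psi> 0" using F.persp_ge[of T R1 tb] T by (simp add: algebra_simps)
  moreover have "?\<psi> T1 \<le> 0" using merge_speeds[of T1 "T - T1" T] T1 T by simp
  ultimately obtain \<tau> where \<tau>: "0 \<le> \<tau>" "\<tau> \<le> T1" "?\<psi> \<tau> = 0" using IVT2'[OF _ _ _ cc, of 0] T1 by auto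
  have "\<tau> \<noteq> 0"
  proof
   assume "\<tau> = 0"
   hence e: "T * F.L (R1 / T) = tb * R1 - T * f tb" using \<tau>(3) by simp
   have "tb = F.dL (R1 / T)"
    using F.persp_gt[OF T, of tb R1] e by fastforce
   hence "Mp = R1 / T" by simp
   hence "Mp * T = Mp * (T - T1)" using T T1(3) by (simp add: field_simps)
   thus False using Mp T1p by simp
  qed
  hence \<tau>0: "0 < \<tau>" using \<tau> by simp
  have "\<exists>s. (\<exists>L. L-lipschitz_on {\<tau>..T} s) \<and> mono_on {\<tau>..T} s \<and> convex_on {\<tau>..T} s \<and> (\<forall>t\<in>{\<tau>..T}. s t \<ge> 0) \<and>
   s T = R1 \<and> s \<tau> = 0 \<and> (\<forall>t\<in>{\<tau><..<T}. let w = inv (deriv f) ((s t - - (Mm * \<tau>)) / t) in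
   (s has_real_derivative (f tb - f w) / (tb - w)) (at t))"
  proof (rule shock_curve[OF \<tau>0 _ _ _ Mp])
   show "\<tau> < T" using \<tau> lt by simp
   have "Mp * (T - T1) \<le> Mp * T" using Mp T1 by (intro mult_left_mono) auto
   moreover have "0 < - (Mm * \<tau>)" using Mm \<tau>0 by (simp add: mult_neg_pos)
   ultimately show "R1 < - (Mm * \<tau>) + Mp * T" using T1(3) by linarith
   show "T * F.L ((R1 - - (Mm * \<tau>)) / T) = tbb * (Mm * \<tau>) + tb * R1 - T * f tb" using \<tau>(3) by simp
  qed (use R1 in simp)
  moreover have "0 \<le> - (Mm * \<tau>)" "- (Mm * \<tau>) \<le> - (Mm * T1)"
  proof -
   show "0 \<le> - (Mm * \<tau>)" using Mm \<tau>0 by (simp add: mult_le_0_iff)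
   show "- (Mm * \<tau>) \<le> - (Mm * T1)" using Mm \<tau> by (simp add: mult_le_cancel_left)
  qed
  ultimately have "shock_pair f g T T1 \<tau> (- (Mm * \<tau>))"
   unfolding shock_pair_def Let_def using R1 T1 False \<tau> lt Mp by (simp add: mult.commute)
  moreover have "T * F.L ((Mp * s2 + Mm * s1) / T) \<le> tbb * (Mm * s1) + tb * (Mp * s2) - T * f tb"
   if "0 \<le> s1" "0 \<le> s2" "s1 + s2 \<le> T" "- (Mm * \<tau>) \<le> - (Mm * s1)" "R1 \<le> Mp * s2" for s1 s2
  proof (rule triangle[OF T \<tau>(1) _ conv[OF that(4)] conv'[OF that(5)] that(3)])
   show "0 \<le> T - T1" using T1 by simp
   show "T * F.L ((Mp * (T - T1) + Mm * \<tau>) / T) \<le> tbb * (Mm * \<tau>) + tb * (Mp * (T - T1)) - T * f tb"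
    using \<tau>(3) T1(3) by simp
  qed
  ultimately show ?thesis by blast
 qed
qed

end


section \<open>Characteristics at the final time\<close>

context value_function begin

text \<open>Following \<open>d\<close> after \<open>s\<close> gives a minimiser, and \<open>corner\<close> determines the flux before \<open>s\<close>. It is above that
of a rest, so the first leg is straight, and its speed is known.\<close>

lemma start_unique:
 assumes cc: "crossR d t s" "d 0 < 0" and c: "isopt c t" "c s = 0"
 shows "c 0 = d 0"
proof -
 have D: "isopt d t" "0 < s" "s < t" "d s = 0" "d t > 0" "affon d s t" "affon d 0 s"
  "f (F.dL (d t / (t - s))) = g (G.dL (- d 0 / s))" using cc unfolding crossR_def by auto
 have "isopt c s" by (rule opt_mid(1)[OF c(1)]) (use D in auto)
 then obtain \<eta> where \<eta>: "isopt \<eta> s" "\<eta> s = c s" "\<eta> 0 = c 0"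
  and form: "same_side (\<eta> 0) (\<eta> s) \<and> affon \<eta> 0 s \<or> (\<exists>s1 s2. thr_ok s s1 s2 (\<eta> 0) (\<eta> s) \<and> \<eta> = bent s s1 s2 (\<eta> 0) (\<eta> s))"
  using opt_form D by blast
 have z: "\<eta> s = 0" using \<eta> c by simp
 have "isopt (%r. if r \<le> s then \<eta> r else d r) t" by (rule opt_glue[OF \<eta>(1) D(1)]) (use D z in auto)
 then obtain \<zeta> where \<zeta>: "isopt \<zeta> t" "\<And>r. r \<le> s ==> \<zeta> r = \<eta> r" by fastforce
 have \<zeta>s: "\<zeta> s = 0" using \<zeta>(2)[of s] z by simp
 have cong: "affon \<zeta> p q" if "affon \<eta> p q" "q \<le> s" for p q by (rule affon_cong[OF that(1)]) (use \<zeta>(2) that in auto)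
 have direct: ?thesis if aff: "affon \<eta> 0 s"
 proof -
  note co = meet_corner[OF \<zeta>(1) D(1) D(2,3) order_refl \<zeta>s D(4) cong[OF aff order_refl] D(6)]
  have e0: "\<zeta> 0 = c 0" using \<zeta>(2)[of 0] \<eta>(3) D(2) by simp
  have "\<not> c 0 > 0" using co(2) D(5) e0 by auto
  hence e: "g (G.dL (- c 0 / s)) = g (G.dL (- d 0 / s))" using co(1) e0 D(5,8) by (simp add: eng_def)
  have "- c 0 / s = - d 0 / s"
   by (rule G.flux_dL_inj[OF e]) (use \<open>\<not> c 0 > 0\<close> cc(2) D(2) in \<open>simp add: divide_nonpos_pos divide_le_0_iff\<close>)
  thus ?thesis using D(2) by simp
 qed
 from form show ?thesis
 proof (elim disjE exE conjE)
  assume "affon \<eta> 0 s" thus ?thesis by (rule direct)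
 next
  fix s1 s2 assume ok: "thr_ok s s1 s2 (\<eta> 0) (\<eta> s)" and e: "\<eta> = bent s s1 s2 (\<eta> 0) (\<eta> s)"
  note B = bent_facts[OF ok e]
  have s12: "0 \<le> s1" "0 \<le> s2" "s1 + s2 \<le> s" "s1 = 0 --> \<eta> 0 = 0" using ok unfolding thr_ok_def by auto
  have zero: "\<eta> r = 0" if r: "s1 \<le> r" "r \<le> s" for r
  proof (cases "r \<le> s - s2")
   case False
   hence "r \<in> {s - s2..s}" using r by auto
   hence "\<eta> r \<le> max (\<eta> (s - s2)) (\<eta> s)" "min (\<eta> (s - s2)) (\<eta> s) \<le> \<eta> r" using affon_mono_ends[OF B(3)] by auto
   thus ?thesis using B(5) z by simp
  qed (use B(6) r in auto)
  show ?thesis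
  proof (cases "s1 = s")
   case True thus ?thesis using B(1) direct by simp
  next
   case False
   hence lt: "s1 < s" using s12 by simp
   have aff: "affon \<zeta> s1 s" by (rule affonI[where k = 0 and m = 0]) (use zero \<zeta>(2) in simp)
   have "\<zeta> s1 = 0" using zero[of s1] \<zeta>(2)[of s1] lt by simp
   moreover have "isopt (%r. if r \<le> s then \<zeta> r else d r) t"
    by (rule opt_glue[OF opt_mid(1)[OF \<zeta>(1)] D(1)]) (use D \<zeta>s in auto)
   then obtain \<zeta>' where \<zeta>': "isopt \<zeta>' t" "\<And>r. r \<le> s ==> \<zeta>' r = \<zeta> r" "\<And>r. s < r ==> \<zeta>' r = d r" by fastforce
   have a': "affon \<zeta>' s1 s" by (rule affon_cong[OF aff]) (use \<zeta>'(2) in auto)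
   have z': "\<zeta>' s = 0" using \<zeta>'(2)[of s] \<zeta>s by simp
   have b': "affon \<zeta>' s t" by (rule affon_cong[OF D(6)]) (metis D(4) \<zeta>'(3) atLeastAtMost_iff order_le_less z')
   have "\<zeta>' t = d t" using \<zeta>'(3) D(3) by simp
   ultimately have "g (\<theta> g) = f (F.dL (d t / (t - s)))"
    using corner[OF \<zeta>'(1) s12(1) lt D(3) order_refl z' a' b'] \<zeta>'(2)[of s1] lt D(5) by (simp add: eng_def G.dL_0)
   moreover have "g (\<theta> g) < g (G.dL (- d 0 / s))" by (rule g_theta_less) (use cc(2) D(2) in simp)
   ultimately show ?thesis using D(8) by simp
  qed
 qed
qed

lemma line_opt:
 assumes c: "isopt c s" and s: "0 \<le> s" "s < t" and e: "v x t = v (c s) s + seg (t - s) (c s) x" and ss: "same_side (c s) x"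
 shows "\<exists>\<eta>. isopt \<eta> t \<and> \<eta> t = x \<and> \<eta> 0 = c 0"
proof -
 let ?\<eta> = "%r. if r \<le> s then c r else line s t (c s) x r"
 have 1: "isopt ?\<eta> s" by (rule opt_cong[OF c]) (use s in auto)
 have 2: "pc ?\<eta> s t (seg (t - s) (c s) x)" by (rule pc_cong[OF pc_line[OF s(2) ss]]) auto
 have "isopt ?\<eta> t" by (rule opt_ext[OF 1 2 _ s(1)]) (use s e in auto)
 thus ?thesis using s by (intro exI[of _ ?\<eta>]) auto
qed

end

text \<open>Start points \<open>Y\<close> of minimisers are known on \<open>{a<..<b}\<close>; the conditions on them are those of a reachable state, with
\<open>0\<close> between \<open>R2\<close> and \<open>R1\<close>.\<close>

locale target = value_function f g "primitive u0" C for f g u0 C +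
 fixes T R1 R2 a b :: real and Y :: "real => real"
 assumes T: "T > 0" and R: "0 \<le> R2" "R2 \<le> R1" "0 < R1" and ab: "a < 0" "R1 < b"
  and Yopt: "\<And>x. a < x ==> x < b ==> \<exists>c. isopt c T \<and> c T = x \<and> c 0 = Y x"
  and Yneg: "\<And>x. a < x ==> x < 0 ==> Y x \<le> 0" and Ymid: "\<And>x. 0 < x ==> x < R2 ==> Y x < 0"
  and Yzero: "\<And>x. R2 \<le> x ==> x < R1 ==> Y x = 0" and Ypos: "\<And>x. R1 < x ==> x < b ==> 0 \<le> Y x"
  and axis: "R2 < R1 ==> \<exists>T1. axis_time f g T R1 T1"
  and shock: "\<And>T1 \<tau> \<xi> x. axis_time f g T R1 T1 ==> shock_pair f g T T1 \<tau> \<xi> ==> R1 < x ==> x < b ==> \<xi> \<le> Y x"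
begin

lemma v_value_fun: "v x t = value_fun f g u0 x t"
 by (simp add: v_def value_fun_def)

lemma ch_iff: "0 \<le> t ==> c \<in> ch f g u0 x t \<longleftrightarrow> c \<in> control_curves x t \<and> isopt c t"
 using opt_iff[of c x t] by (auto simp: ch_def v_value_fun)

lemma ch_opt: "0 \<le> t ==> c \<in> ch f g u0 x t ==> isopt c t \<and> c t = x"
 using ch_iff control_end by blast

lemma ch_ex: "0 \<le> t ==> \<exists>c. c \<in> ch f g u0 x t"
 using ex_opt[of t x] ch_iff by blast

definition starts :: "real => real set" where
 "starts x = {c 0 |c. isopt c T \<and> c T = x}"

lemma straight_left:
 assumes "a < x" "x < 0"
 shows "\<exists>d. isopt d T \<and> d T = x \<and> d 0 = Y x \<and> affon d 0 T \<and> d 0 \<le> 0"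
proof -
 obtain c where c: "isopt c T" "c T = x" "c 0 = Y x" using Yopt[of x] assms R ab by auto
 obtain d where d: "isopt d T" "d T = x" "d 0 = Y x" "d 0 \<le> 0 \<and> affon d 0 T \<or> (\<exists>s. crossL d T s)"
  using form_left[OF c(1) T] c assms by auto
 have "\<not> (\<exists>s. crossL d T s)" using Yneg[OF assms] d(3) unfolding crossL_def by auto
 thus ?thesis using d by blast
qed

lemma left_opt:
 assumes "isopt c T" "c T < 0"
 shows "affon c 0 T" "c 0 \<le> 0" "0 < s ==> s \<le> T ==> c s < 0"
proof -
 define x where "x = max a (c T) / 2"
 have x: "a < x" "x < 0" "c T < x" using ab assms(2) by (auto simp: x_def max_def)
 obtain d where d: "isopt d T" "d T = x" "affon d 0 T" "d 0 \<le> 0" using straight_left[OF x(1,2)] by auto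
 have le: "c u \<le> d u" if "0 \<le> u" "u \<le> T" for u
  by (rule straight_mono(1)[OF assms(1) d(1) T d(3)]) (use d x that in auto)
 have neg: "c s < 0" if "0 < s" "s \<le> T" for s
  using le[of s] affon_between(3)[OF d(3), of s] d x that by (cases "s = T") auto
 thus "0 < s ==> s \<le> T ==> c s < 0" by blast
 show z: "c 0 \<le> 0" using le[of 0] d(4) T by simp
 have "c s \<le> 0" if "s \<in> {0..T}" for s using neg[of s] z that by (cases "s = 0") auto
 thus "affon c 0 T" using opt_nonpos(1)[OF assms(1) order_refl T order_refl] by blast
qed

lemma Mp_slope: "0 < p ==> f (F.dL p) = g (\<theta> g) ==> p = Mp"
 using F.flux_dL_inj[of p Mp] tb(2) Mp_nonneg by simp

lemma Mm_slope: "p < 0 ==> f (F.dL p) = g (\<theta> g) ==> p = Mm"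
 using F.flux_dL_inj[of p Mm] tbb(2) Mm_nonpos by simp

text \<open>A minimiser that rests on the interface has the speeds of the two fluxes of level \<open>g (\<theta> g)\<close>; the shock
 condition says that the straight line between its end points is not more expensive.\<close>

lemma straight_right:
 assumes x: "R1 < x" "x < b"
 shows "\<exists>d. isopt d T \<and> d T = x \<and> d 0 = Y x \<and> affon d 0 T \<and> 0 \<le> d 0"
proof -
 obtain c where c: "isopt c T" "c T = x" "c 0 = Y x" using Yopt[of x] assms R ab by auto
 have x0: "0 < x" using x R by simp
 obtain d where d: "isopt d T" "d T = x" "d 0 = Y x" "0 \<le> d 0 \<and> affon d 0 T \<or> (\<exists>s. crossR d T s)"
  using form_right[OF c(1) T] c x0 by auto
 from d(4) show ?thesis
 proof (elim disjE exE)
  assume "0 \<le> d 0 \<and> affon d 0 T" thus ?thesis using d by blast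
 next
  fix s assume cc: "crossR d T s"
  have z: "0 \<le> d 0" using Ypos[OF x] d by simp
  have S: "0 < s" "s < T" "d s = 0" "affon d s T" "f (F.dL (x / (T - s))) = g (\<theta> g)"
   using cc z d(2) unfolding crossR_def by auto
  have "x / (T - s) = Mp" by (rule Mp_slope[OF _ S(5)]) (use x0 S in simp)
  hence xs: "x = Mp * (T - s)" using S by (simp add: field_simps)
  hence Mp: "0 < Mp" using x0 S by (auto simp: zero_less_mult_iff)
  define T1 where "T1 = T - R1 / Mp"
  have "R1 / Mp < T - s" using x(1) xs Mp by (simp add: pos_divide_less_eq mult.commute)
  moreover have "0 \<le> R1 / Mp" "Mp * (R1 / Mp) = R1" using R Mp by auto
  moreover have "Mp * (T1 - T) = - (Mp * (R1 / Mp))" unfolding T1_def by (simp add: algebra_simps)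
  ultimately have ax: "axis_time f g T R1 T1" unfolding axis_time_def using S unfolding T1_def by simp
  obtain \<tau> \<xi> where sp: "shock_pair f g T T1 \<tau> \<xi>" and tri: "\<And>s1 s2. 0 \<le> s1 ==> 0 \<le> s2 ==> s1 + s2 \<le> T ==> \<xi> \<le> - (Mm * s1) ==> R1 \<le> Mp * s2 ==>
   T * F.L ((Mp * s2 + Mm * s1) / T) \<le> tbb * (Mm * s1) + tb * (Mp * s2) - T * f tb"
   using shock_pair_exists[OF T R(3) ax] by blast
  have \<xi>: "\<xi> \<le> d 0" using shock[OF ax sp x] d(3) by simp
  have "\<exists>s1\<ge>0. s1 < s \<and> (d 0 = 0 --> s1 = 0) \<and> affon d 0 s1 \<and> affon d s1 s \<and> d s1 = 0"
  proof -
   obtain s1 where s1: "0 \<le> s1" "s1 < s" "affon d 0 s1" "\<forall>r\<in>{s1..s}. d r = 0" using cc z unfolding crossR_def by auto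
   show ?thesis
   proof (cases "d 0 = 0")
    case False
    have "affon d s1 s" by (rule affonI[where k = 0 and m = 0]) (use s1 in simp)
    thus ?thesis using False s1 by auto
   next
    case True
    have zero: "d r = 0" if r: "r \<in> {0..s}" for r
    proof (cases "r \<le> s1")
     case le: True
     hence "d r \<le> max (d 0) (d s1)" "min (d 0) (d s1) \<le> d r" using affon_mono_ends[OF s1(3), of r] r by auto
     thus ?thesis using True s1 by simp
    qed (use s1 r in auto)
    have "affon d 0 s" by (rule affonI[where k = 0 and m = 0]) (use zero in simp)
    moreover have "affon d 0 0" by (rule affonI[where k = 0 and m = 0]) (use True in simp)
    ultimately show ?thesis using True S by (intro exI[of _ 0]) auto
   qed
  qed
  then obtain s1 where s1: "0 \<le> s1" "s1 < s" "d 0 = 0 --> s1 = 0" "affon d 0 s1" "affon d s1 s" "d s1 = 0" by blast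
  have zs: "d 0 = - (Mm * s1)"
  proof (cases "d 0 = 0")
   case False
   hence z0: "0 < d 0" "0 < s1" using z s1 by (auto simp: order_le_less)
   have "f (F.dL (- d 0 / s1)) = g (\<theta> g)"
    using corner[OF d(1) order_refl z0(2) s1(2) _ s1(6,4,5)] z0 S(2,3) by (simp add: eng_def G.dL_0)
   hence "- d 0 / s1 = Mm" by (intro Mm_slope) (use z0 in auto)
   thus ?thesis using z0 by (simp add: field_simps)
  qed (use s1 in simp)
  have e1: "v 0 s1 = v (d 0) 0 + s1 * F.L Mm"
  proof (cases "s1 = 0")
   case False
   hence p: "0 < s1" using s1 by simp
   have dd0: "0 < d 0" using False s1(3) z by (auto simp: order_le_less)
   have "v (d s1) s1 = v (d 0) 0 + seg (s1 - 0) (d 0) (d s1)"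
    by (rule opt_seg[OF d(1) order_refl p _ s1(4)]) (use s1 S dd0 in \<open>auto simp: same_side_def\<close>)
   thus ?thesis using s1(6) dd0 zs p by (simp add: seg_def)
  qed (use s1 in auto)
  have e2: "v 0 s = v 0 s1 + (s - s1) * K0"
   using opt_seg[OF d(1) s1(1,2) _ s1(5)] s1 S by (simp add: same_side_def)
  have e3: "v x T = v 0 s + (T - s) * F.L Mp"
   using opt_seg[OF d(1) _ S(2) order_refl S(4)] S(1,3) d(2) x0 \<open>x / (T - s) = Mp\<close> by (simp add: same_side_def seg_def)
  have "v x T = v (d 0) 0 + (tbb * (Mm * s1) + tb * (Mp * (T - s)) - T * f tb)"
   using e1 e2 e3 unfolding L_Mp L_Mm K0_eq by (simp add: algebra_simps)
  moreover have "T * F.L ((x - d 0) / T) \<le> tbb * (Mm * s1) + tb * (Mp * (T - s)) - T * f tb"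
   using tri[of s1 "T - s"] s1 S \<xi> zs xs x by simp
  moreover have sg: "seg T (d 0) x = T * F.L ((x - d 0) / T)" using x0 by (simp add: seg_def)
  moreover have ss: "same_side (d 0) x" using z x0 by (simp add: same_side_def)
  moreover have "v x T \<le> v (d 0) 0 + seg T (d 0) x" using v_le[OF pc_line[OF T ss] order_refl] T by simp
  ultimately have "v x T = v (d 0) 0 + seg T (d 0) x" by linarith
  hence "isopt (line 0 T (d 0) x) T" unfolding isopt_def using pc_line[OF T ss] T by (auto simp: v_0)
  thus ?thesis using d(3) z T by (intro exI[of _ "line 0 T (d 0) x"]) (auto simp: affon_line)
 qed
qed

lemma right_opt:
 assumes "isopt c T" "R1 < c T"
 shows "affon c 0 T" "0 \<le> c 0" "0 < s ==> s \<le> T ==> 0 < c s"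
proof -
 define x where "x = (R1 + min b (c T)) / 2"
 have x: "R1 < x" "x < b" "x < c T" "0 < x" using ab R assms(2) by (auto simp: x_def min_def)
 obtain d where d: "isopt d T" "d T = x" "affon d 0 T" "0 \<le> d 0" using straight_right[OF x(1,2)] by auto
 have le: "d u \<le> c u" if "0 \<le> u" "u \<le> T" for u
  by (rule straight_mono(2)[OF assms(1) d(1) T d(3)]) (use d x that in auto)
 have pos: "0 < c s" if "0 < s" "s \<le> T" for s
  using le[of s] affon_between(1)[OF d(3), of s] d x that by (cases "s = T") auto
 thus "0 < s ==> s \<le> T ==> 0 < c s" by blast
 show "0 \<le> c 0" using le[of 0] d(4) T by simp
 show "affon c 0 T" using opt_pos(1)[OF assms(1) order_refl T order_refl] pos by auto
qed

lemma mid_form: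
 assumes "0 < x" "x < R2"
 shows "\<exists>d s. crossR d T s \<and> d T = x \<and> d 0 = Y x"
proof -
 obtain c where c: "isopt c T" "c T = x" "c 0 = Y x" using Yopt[of x] assms R ab by auto
 obtain d where d: "isopt d T" "d T = x" "d 0 = Y x" "0 \<le> d 0 \<and> affon d 0 T \<or> (\<exists>s. crossR d T s)"
  using form_right[OF c(1) T] c assms by auto
 thus ?thesis using Ymid[OF assms] by auto
qed

lemma mid_opt:
 assumes c: "isopt c T" "0 < c T" "c T < R2"
 shows "\<exists>d s. crossR d T s \<and> d T = c T \<and> d 0 = c 0 \<and> d 0 < 0" "\<exists>s>0. s < T \<and> c s \<le> 0"
proof -
 define x where "x = (c T + R2) / 2"
 have x: "0 < x" "x < R2" "c T < x" using c by (auto simp: x_def)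
 obtain \<eta> r where \<eta>: "crossR \<eta> T r" "\<eta> T = x" "\<eta> 0 = Y x" using mid_form[OF x(1,2)] by blast
 have E: "isopt \<eta> T" "0 < r" "r < T" "\<eta> r = 0" "\<eta> 0 < 0" using \<eta> Ymid[OF x(1,2)] unfolding crossR_def by auto
 have below: "d r \<le> 0" if "isopt d T" "d T = c T" for d
 proof (rule ccontr)
  assume "\<not> d r \<le> 0"
  thus False using no_cross[OF that(1) E(1) less_imp_le[OF E(2)] E(3) order_refl] crossR_sign(1)[OF \<eta>(1)] E \<eta>(2) x that(2) by auto
 qed
 show "\<exists>s>0. s < T \<and> c s \<le> 0" using below[OF c(1) refl] E by blast
 obtain d where d: "isopt d T" "d T = c T" "d 0 = c 0" "0 \<le> d 0 \<and> affon d 0 T \<or> (\<exists>s. crossR d T s)"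
  using form_right[OF c(1) T c(2)] by auto
 have "\<not> (0 \<le> d 0 \<and> affon d 0 T)"
  using below[OF d(1,2)] affon_between(1)[of d 0 T r] E d(2) c(2) by fastforce
 then obtain s where cc: "crossR d T s" using d(4) by blast
 hence "d 0 < 0" using crossR_order[OF \<eta>(1) E(5) cc] d(2) \<eta>(2) x by simp
 thus "\<exists>d s. crossR d T s \<and> d T = c T \<and> d 0 = c 0 \<and> d 0 < 0" using cc d by blast
qed

text \<open>Minimisers do not cross, so the start point at \<open>x\<close> lies between those prescribed on either side of \<open>x\<close>, even if \<open>x\<close> itself is
outside the prescribed interval.\<close>

lemma start_bounds:
 assumes z: "z \<in> starts x" and x: "x < R2 \<or> R1 < x" and w: "a < w" "w < b" "w < R2 \<and> w \<noteq> 0 \<or> R1 < w"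
 shows "x < w ==> z \<le> Y w" "w < x ==> Y w \<le> z"
proof -
 obtain c where c: "isopt c T" "c T = x" "c 0 = z" using z unfolding starts_def by auto
 have "(x < w --> z \<le> Y w) \<and> (w < x --> Y w \<le> z)"
 proof (cases "0 < w \<and> w < R2")
  case False
  hence "w < 0 \<or> R1 < w" using w(3) by auto
  then obtain d where d: "isopt d T" "d T = w" "d 0 = Y w" "affon d 0 T" "0 \<le> d 0 \<and> 0 < d T \<or> d 0 \<le> 0 \<and> d T < 0"
   using straight_left[of w] straight_right[of w] w R by auto
  show ?thesis
   using straight_mono[OF c(1) d(1) T d(4,5), of 0] c d T by auto
 next
  case True
  obtain d s where d: "crossR d T s" "d T = w" "d 0 = Y w" using mid_form True by blast
  have neg: "Y w < 0" using Ymid True by blast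
  have D: "isopt d T" "0 < s" "s < T" "d s = 0" using d(1) unfolding crossR_def by auto
  consider "0 < x" "x < R2" | "x \<le> 0" | "R1 < x" using x by linarith
  thus ?thesis
  proof cases
   case 1
   obtain \<eta> r where \<eta>: "crossR \<eta> T r" "\<eta> T = x" "\<eta> 0 = z" "\<eta> 0 < 0" using mid_opt(1)[OF c(1)] c 1 by auto
   show ?thesis using crossR_order[OF d(1) _ \<eta>(1)] crossR_order[OF \<eta>(1,4) d(1)] d \<eta> neg by auto
  next
   case 2
   have "\<not> 0 < c s"
   proof
    assume "0 < c s"
    thus False using no_cross[OF c(1) D(1) less_imp_le[OF D(2)] D(3) order_refl] crossR_sign(1)[OF d(1)] D(4) d(2) c(2) 2 True by auto
   qed
   then consider "c s = 0" | "c s < 0" by linarith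
   hence "z \<le> Y w"
   proof cases
    case 1
    thus ?thesis using start_unique[OF d(1) _ c(1)] c(3) d(3) neg by simp
   next
    case 2
    show ?thesis
    proof (rule ccontr)
     assume "\<not> ?thesis"
     thus False using no_cross[OF c(1) D(1) order_refl D(2)] crossR_sign(2)[OF d(1)] D d(3) c(3) 2 neg by auto
    qed
   qed
   thus ?thesis using 2 True by simp
  next
   case 3
   thus ?thesis using right_opt(2)[OF c(1)] c neg True R by auto
  qed
 qed
 thus "x < w ==> z \<le> Y w" "w < x ==> Y w \<le> z" by blast+
qed

lemma start_signs:
 assumes "z \<in> starts x"
 shows "x < R2 ==> z \<le> 0" "R1 < x ==> 0 \<le> z" "\<bar>x - z\<bar> \<le> Q * T"
proof -
 obtain c where c: "isopt c T" "c T = x" "c 0 = z" using assms unfolding starts_def by auto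
 show "\<bar>x - z\<bar> \<le> Q * T" using opt_speed[OF c(1) order_refl, of T] T c by simp
 show "R1 < x ==> 0 \<le> z" using right_opt(2)[OF c(1)] c by simp
 assume x: "x < R2"
 consider "x < 0" | "x = 0" | "0 < x" by linarith
 thus "z \<le> 0"
 proof cases
  case 1 thus ?thesis using left_opt(2)[OF c(1)] c by simp
 next
  case 2
  hence w: "0 < R2 / 2" "R2 / 2 < R2" using x by auto
  have "z \<le> Y (R2 / 2)" by (rule start_bounds(1)[OF assms]) (use x 2 w R ab in auto)
  thus ?thesis using Ymid[OF w] by simp
 next
  case 3
  thus ?thesis using mid_opt(1)[OF c(1)] c x by auto
 qed
qed

end


section \<open>Identification of the final state\<close>

lemma Inf_eqI:
 fixes r :: real
 assumes "\<And>x. x \<in> A ==> r \<le> x" "\<And>e. e > 0 ==> \<exists>x\<in>A. x < r + e"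
 shows "Inf A = r"
proof (rule antisym)
 have ne: "A \<noteq> {}" using assms(2)[of 1] by auto
 show "r \<le> Inf A" by (rule cInf_greatest[OF ne assms(1)])
 have bdd: "bdd_below A" using assms(1) by (rule bdd_belowI)
 show "Inf A \<le> r"
 proof (rule field_le_epsilon)
  fix e :: real assume "e > 0"
  then obtain x where "x \<in> A" "x < r + e" using assms(2) by blast
  thus "Inf A \<le> r + e" using cInf_lower[OF _ bdd] by force
 qed
qed

context two_flux begin

text \<open>Lower bound for the action by the time-independent subsolution with slope \<open>\<theta> g\<close> on the left and
 \<open>\<theta>bar f g\<close> on the right.\<close>

lemma pc_calibrate:
 assumes "pc c p q cc"
 defines "\<psi> \<equiv> %x. if x \<le> 0 then \<theta> g * x else tb * x"
 shows "\<psi> (c q) - \<psi> (c p) - (q - p) * f tb \<le> cc"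
 using assms(1)
proof induction
 case (pc_step p q cc q')
 have dd: "q' - q > 0" using pc_step by simp
 have "\<theta> g * (c q' - c q) - (q' - q) * g (\<theta> g) \<le> (q' - q) * G.L ((c q' - c q) / (q' - q))"
  by (rule G.persp_ge) (use dd in auto)
 moreover have "tb * (c q' - c q) - (q' - q) * f tb \<le> (q' - q) * F.L ((c q' - c q) / (q' - q))"
  by (rule F.persp_ge) (use dd in auto)
 ultimately have "\<psi> (c q') - \<psi> (c q) - (q' - q) * f tb \<le> seg (q' - q) (c q) (c q')"
  using pc_step(4) tb(2) unfolding seg_def \<psi>_def same_side_def by (auto simp: algebra_simps)
 thus ?case using pc_step by (simp add: algebra_simps)
qed simp

lemma cr_curves_0:
 assumes "t > 0" shows "cr_curves 0 t = {}"
proof (rule ccontr)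
 assume "cr_curves 0 t \<noteq> {}"
 then obtain c t1 t2 where g: "c \<in> control_curves 0 t" "t1 < t2" "t2 < t" "three_segments c t t1 t2"
  unfolding cr_curves_def by blast
 have z: "c t = 0" using g(1) unfolding control_curves_def by simp
 have h: "segment c t1 t2" "segment c t2 t" "\<forall>s\<in>{t1<..<t2}. c s = 0"
  "(\<forall>s\<in>{0<..<t1} \<union> {t2<..<t}. c s > 0) \<or> (\<forall>s\<in>{0<..<t1} \<union> {t2<..<t}. c s < 0)"
  using g(4) unfolding three_segments_def by blast+
 have "affon c t1 t2" using h(1) segment_iff[of t1 t2] g by simp
 from affon_cont[OF this] have "c t2 = 0"
  using continuous_constant_on_closure[of "{t1<..<t2}" c 0 t2] h(3) g(2) by (auto simp: closure_greaterThanLessThan)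
 moreover have "affon c t2 t" using h(2) segment_iff[of t2 t] g by simp
 ultimately have "c ((t2 + t) / 2) = 0" using affon_between(5)[of c t2 t "(t2 + t) / 2"] g z by simp
 moreover have "(t2 + t) / 2 \<in> {0<..<t1} \<union> {t2<..<t}" using g by simp
 ultimately show False using h(4) by (metis less_irrefl)
qed

end

context target begin

lemma c0_left: assumes x: "x < 0" shows "ch f g u0 x T \<subseteq> c0_curves x T"
proof
 fix c assume "c \<in> ch f g u0 x T"
 hence cc: "c \<in> control_curves x T" and o: "isopt c T" "c T = x" using ch_iff[of T] ch_opt[of T] T by auto
 note l = left_opt[OF o(1)]
 have le: "c s \<le> 0" if "s \<in> {0..T}" for s using l(2) l(3)[of s] o(2) x that by (cases "s = 0") auto
 have "segment c 0 T" using segment_iff[of 0 T] l(1) le[of 0] le[of T] T o(2) x by (simp add: same_side_def)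
 thus "c \<in> c0_curves x T" unfolding c0_curves_def using cc le x by (auto intro: mult_nonpos_nonpos)
qed

lemma c0_right: assumes x: "R1 < x" shows "ch f g u0 x T \<subseteq> c0_curves x T"
proof
 fix c assume "c \<in> ch f g u0 x T"
 hence cc: "c \<in> control_curves x T" and o: "isopt c T" "c T = x" using ch_iff[of T] ch_opt[of T] T by auto
 note l = right_opt[OF o(1)]
 have le: "0 \<le> c s" if "s \<in> {0..T}" for s using l(2) l(3)[of s] o(2) x that by (cases "s = 0") auto
 have "segment c 0 T" using segment_iff[of 0 T] l(1) le[of 0] le[of T] T o(2) x by (simp add: same_side_def)
 thus "c \<in> c0_curves x T" unfolding c0_curves_def using cc le x R by auto
qed

lemma not_c0_mid: assumes x: "0 < x" "x < R2" shows "\<not> ch f g u0 x T \<subseteq> c0_curves x T" "ch f g u0 x T \<inter> cr_curves x T = {}"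
proof -
 have neg: "x * c 0 < 0" if "c \<in> ch f g u0 x T" for c
 proof -
  have "isopt c T" "c T = x" using that ch_opt T by auto
  hence "c 0 < 0" using mid_opt(1)[of c] x by auto
  thus ?thesis using x by (simp add: mult_pos_neg)
 qed
 have "0 \<in> {0..T}" using T by simp
 thus "\<not> ch f g u0 x T \<subseteq> c0_curves x T" "ch f g u0 x T \<inter> cr_curves x T = {}"
  using neg ch_ex[of T x] T unfolding c0_curves_def cr_curves_def by (fastforce simp: not_le)+
qed

text \<open>With start point \<open>0\<close> the calibration bounds the cost from below by that of resting at \<open>0\<close> and leaving with speed \<open>Mp\<close>, which
is possible since the line with this speed through \<open>(R1, T)\<close> meets the axis at a nonnegative time.\<close>

lemma rest_opt:
 assumes x: "R2 \<le> x" "0 < x" "x < R1"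
 shows "\<not> ch f g u0 x T \<subseteq> c0_curves x T" "ch f g u0 x T \<inter> cr_curves x T \<noteq> {}"
proof -
 obtain T1 where T1: "0 \<le> T1" "T1 \<le> T" "R1 = Mp * (T - T1)"
  using axis x unfolding axis_time_def by (auto simp: algebra_simps)
 have Mp: "0 < Mp" using T1 R(3) Mp_nonneg by (cases "Mp = 0") auto
 have "R1 \<le> Mp * T" unfolding T1(3) using Mp T1 by (intro mult_left_mono) auto
 hence lt: "x < Mp * T" using x by simp
 define s2 where "s2 = x / Mp"
 have s2: "0 < s2" "s2 < T" "x = Mp * s2" "x / s2 = Mp" using Mp lt x by (auto simp: s2_def pos_divide_less_eq mult.commute)
 let ?\<beta> = "bent T 0 s2 0 x"
 have ok: "thr_ok T 0 s2 0 x" using s2 by (simp add: thr_ok_def)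
 note B = bent_affon(4,7)[OF ok] bent_signs(1,3)[OF ok]
 have cost: "thr T 0 s2 0 x = tb * x - T * f tb"
 proof -
  have "thr T 0 s2 0 x = (T - s2) * K0 + s2 * F.L Mp" using s2(4) x by (simp add: thr_def seg_def)
  also have "\<dots> = tb * x - T * f tb" unfolding L_Mp K0_eq using s2(3) by (simp add: algebra_simps)
  finally show ?thesis .
 qed
 obtain c where c: "isopt c T" "c T = x" "c 0 = 0" using Yopt[of x] Yzero[of x] x ab by auto
 obtain cc where cc: "pc c 0 T cc" "v x T = primitive u0 0 + cc" using c unfolding isopt_def by auto
 have "tb * x - T * f tb \<le> cc" using pc_calibrate[OF cc(1)] c x by simp
 moreover have "v x T \<le> primitive u0 0 + thr T 0 s2 0 x" using v_min(2)[OF _ bent_pc[OF ok]] B(1,2) T by simp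
 ultimately have "v x T = primitive u0 0 + thr T 0 s2 0 x" using cc(2) cost by simp
 hence opt: "isopt ?\<beta> T" unfolding isopt_def using bent_pc[OF ok] B(1,2) by auto
 have ctl: "three_segments ?\<beta> T 0 (T - s2)" "?\<beta> \<in> control_curves x T" using control_bent3[OF ok] x by auto
 have ch: "?\<beta> \<in> ch f g u0 x T" using ch_iff[of T] ctl opt T by simp
 have nn: "0 \<le> ?\<beta> s" if "s \<in> {0..T}" for s
  using B(3)[of s] B(4)[of s] that x by (cases "s \<le> T - s2") auto
 have "?\<beta> \<in> cr_curves x T"
  unfolding cr_curves_def
 proof (intro CollectI conjI ballI ctl(2) exI)
  show "0 < T - s2" "T - s2 < T" using s2 by auto
  show "0 \<le> x * ?\<beta> s" if "s \<in> {0..T}" for s using nn[OF that] x by simp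
 qed (rule ctl(1))
 thus "ch f g u0 x T \<inter> cr_curves x T \<noteq> {}" using ch by blast
 have "?\<beta> \<notin> c0_curves x T"
 proof
  assume "?\<beta> \<in> c0_curves x T"
  hence "affon ?\<beta> 0 T" using segment_iff[of 0 T] T unfolding c0_curves_def by auto
  from affon_slope[OF this order_refl, of "T - s2"] have "0 = x / T"
   using B(1,2) B(3)[of "T - s2"] s2 by simp
  thus False using x T by simp
 qed
 thus "\<not> ch f g u0 x T \<subseteq> c0_curves x T" using ch by blast
qed

lemma L1_of_eq: "L1_of f g u0 T = 0"
proof -
 have "{x. x < 0 \<and> ch f g u0 x T \<subseteq> c0_curves x T} = {..<0}" using c0_left by auto
 thus ?thesis unfolding L1_of_def by (simp add: cSup_lessThan)
qed

lemma R1_of_eq: "R1_of f g u0 T = R1"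
 unfolding R1_of_def
proof (rule Inf_eqI)
 fix x assume x: "x \<in> {x. 0 < x \<and> ch f g u0 x T \<subseteq> c0_curves x T}"
 show "R1 \<le> x"
 proof (rule ccontr)
  assume "\<not> R1 \<le> x"
  thus False using not_c0_mid(1)[of x] rest_opt(1)[of x] x by (cases "x < R2") auto
 qed
next
 fix e :: real assume "e > 0"
 thus "\<exists>x\<in>{x. 0 < x \<and> ch f g u0 x T \<subseteq> c0_curves x T}. x < R1 + e"
  using c0_right[of "R1 + e / 2"] R by (intro bexI[of _ "R1 + e / 2"]) auto
qed

lemma R2_of_eq: "R2_of f g u0 T = R2"
proof -
 define X where "X = {x. 0 \<le> x \<and> x \<le> R1 \<and> ch f g u0 x T \<inter> cr_curves x T \<noteq> {}}"
 have low: "R2 \<le> x" if "x \<in> X" for x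
 proof (rule ccontr)
  assume n: "\<not> R2 \<le> x"
  show False
  proof (cases "x = 0")
   case True
   thus False using that cr_curves_0[OF T] unfolding X_def by blast
  next
   case False
   thus False using that n not_c0_mid(2)[of x] unfolding X_def by auto
  qed
 qed
 have up: "\<exists>x\<in>X. x < R2 + e" if "R2 < R1" "e > 0" for e
 proof -
  define x where "x = (R2 + min R1 (R2 + e)) / 2"
  have x: "R2 < x" "x < R1" "x < R2 + e" using that by (auto simp: x_def min_def)
  hence "x \<in> X" using rest_opt(2)[of x] R unfolding X_def by auto
  thus ?thesis using x by blast
 qed
 have "(if X = {} then R1 else Inf X) = R2"
 proof (cases "R2 < R1")
  case True
  have "Inf X = R2" using low up[OF True] by (intro Inf_eqI) auto
  moreover have "X \<noteq> {}" using up[OF True, of 1] by auto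
  ultimately show ?thesis by simp
 next
  case False
  hence e: "R2 = R1" using R by simp
  have "X = {} \<or> X = {R1}" using low e unfolding X_def by force
  thus ?thesis using e by auto
 qed
 thus ?thesis unfolding R2_of_def Let_def R1_of_eq X_def .
qed

lemma t_plus_0: "t_plus f g u0 0 T = T"
proof -
 have only: "t1 = T" if t1: "0 \<le> t1" "t1 \<le> T" "c \<in> ch f g u0 0 T" "c t1 = 0" "\<forall>s\<in>{t1<..<T}. c s > 0" for t1 c
 proof (rule ccontr)
  assume "t1 \<noteq> T"
  hence lt: "t1 < T" using t1 by simp
  have o: "isopt c T" "c T = 0" using ch_opt[of T] t1(3) T by auto
  have "affon c t1 T" by (rule opt_pos(1)[OF o(1) t1(1) lt order_refl]) (use t1 in blast)
  hence "c ((t1 + T) / 2) = 0" using affon_between(5)[of c t1 T "(t1 + T) / 2"] t1 lt o by simp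
  moreover have "0 < c ((t1 + T) / 2)" by (rule bspec[OF t1(5)]) (use lt in simp)
  ultimately show False by simp
 qed
 obtain c where "c \<in> ch f g u0 0 T" using ch_ex[of T 0] T by auto
 moreover hence "c T = 0" using ch_opt[of T] T by auto
 ultimately have "{t1. 0 \<le> t1 \<and> t1 \<le> T \<and> (\<exists>c\<in>ch f g u0 0 T. c t1 = 0 \<and> (\<forall>s\<in>{t1<..<T}. c s > 0))} = {T}"
  using only T by (intro set_eqI iffI) fastforce+
 thus ?thesis unfolding t_plus_def by simp
qed

text \<open>The infimum of the departure times is attained in the limit, as \<open>v\<close> and the cost of the last leg are continuous.\<close>

lemma t_plus_mid:
 assumes x: "0 < x" "x < R2"
 defines "t \<equiv> t_plus f g u0 x T"
 shows "0 \<le> t" "t < T" "v x T = v 0 t + seg (T - t) 0 x"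
proof -
 let ?S = "{t1. 0 \<le> t1 \<and> t1 \<le> T \<and> (\<exists>c\<in>ch f g u0 x T. c t1 = 0 \<and> (\<forall>s\<in>{t1<..<T}. c s > 0))}"
 define h where "h r = v x T - v 0 r - (T - r) * F.L (x / (T - r))" for r
 have el: "0 \<le> r \<and> r < T \<and> h r = 0" if H: "r \<in> ?S" for r
 proof -
  obtain c where c: "c \<in> ch f g u0 x T" "c r = 0" "\<forall>s\<in>{r<..<T}. c s > 0" and r: "0 \<le> r" "r \<le> T" using H by blast
  have o: "isopt c T" "c T = x" using ch_opt[of T] c T by auto
  have lt: "r < T" using r c(2) o(2) x by (cases "r = T") auto
  have "v (c T) T = v (c r) r + (T - r) * F.L ((c T - c r) / (T - r))"
   by (rule opt_pos(2)[OF o(1) r(1) lt order_refl]) (use c in blast)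
  thus ?thesis using c o r lt unfolding h_def by simp
 qed
 have ne: "?S \<noteq> {}"
 proof -
  obtain c where c: "c \<in> ch f g u0 x T" using ch_ex[of T x] T by auto
  have o: "isopt c T" "c T = x" using ch_opt[of T] c T by auto
  obtain s where s: "0 < s" "s < T" "c s \<le> 0" using mid_opt(2)[OF o(1)] o(2) x by auto
  have "continuous_on {s..T} c" by (rule continuous_on_subset[OF opt_cont[OF o(1)]]) (use s in auto)
  from last_zero[OF this _ s(3)] obtain r where "s \<le> r" "r < T" "c r = 0" "\<forall>u. r < u --> u \<le> T --> 0 < c u"
   using s o(2) x by auto
  hence "r \<in> ?S" using c s by auto
  thus ?thesis by blast
 qed
 have bdd: "bdd_below ?S" by (rule bdd_belowI[of _ 0]) auto
 obtain r where r: "r \<in> ?S" using ne by blast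
 have t: "t = Inf ?S" unfolding t_def t_plus_def ..
 show t0: "0 \<le> t" unfolding t by (rule cInf_greatest[OF ne]) auto
 have "t \<le> r" unfolding t by (rule cInf_lower[OF r bdd])
 thus tT: "t < T" using el[OF r] by simp
 have "t \<in> closure ?S" unfolding t by (rule closure_contains_Inf[OF ne bdd])
 then obtain X where X: "\<And>n. X n \<in> ?S" "X \<longlonglongrightarrow> t" unfolding closure_sequential by blast
 have vc: "continuous_on {0..<T} (%r. v 0 r)"
  by (rule continuous_on_subset[of "{0..}"], rule lipschitz_on_continuous_on[of CL])
   (use v_lip_t CL_nonneg in \<open>auto intro!: lipschitz_onI simp: dist_real_def abs_minus_commute\<close>)
 have "continuous_on {0..<T} h" unfolding h_def[abs_def]
  by (intro continuous_intros vc continuous_on_compose2[OF F.continuous_L[of UNIV]]) auto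
 from continuous_on_tendsto_compose[OF this X(2)] have "(%n. h (X n)) \<longlonglongrightarrow> h t"
  using el[OF X(1)] t0 tT by (auto intro!: always_eventually)
 moreover have "(%n. h (X n)) = (%_. 0)" using el[OF X(1)] by auto
 ultimately have "h t = 0" by (simp add: LIMSEQ_const_iff)
 thus "v x T = v 0 t + seg (T - t) 0 x" using x unfolding h_def seg_def by simp
qed

text \<open>In both regimes \<open>y\<close> is an infimum of start points of minimisers that end at \<open>x\<close>; for \<open>0 < x < R2\<close> those of minimisers that
reach the interface at time \<open>t_plus\<close>, continued to \<open>x\<close>.\<close>

lemma y_of_rep:
 assumes x: "x < R2 \<or> R1 < x"
 shows "\<exists>Z. Z \<noteq> {} \<and> Z \<subseteq> starts x \<and> y_of f g u0 T x = Inf Z"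
proof -
 have direct: "(%c. c 0) ` ch f g u0 x T \<noteq> {}" "(%c. c 0) ` ch f g u0 x T \<subseteq> starts x" for x
  using ch_ex[of T x] ch_opt[of T] T unfolding starts_def by fastforce+
 consider "x < 0 \<or> R1 < x" | "x = 0" "x \<le> R1" | "0 < x" "x < R2" using x R by linarith
 thus ?thesis
 proof cases
  case 1
  hence "y_of f g u0 T x = Inf ((%c. c 0) ` ch f g u0 x T)" unfolding y_of_def L1_of_eq R1_of_eq by simp
  thus ?thesis by (intro exI[of _ "(%c. c 0) ` ch f g u0 x T"] conjI direct)
 next
  case 2
  hence "y_of f g u0 T x = Inf ((%c. c 0) ` ch f g u0 x T)"
   unfolding y_of_def L1_of_eq R1_of_eq using t_plus_0 by (simp add: y_minus0_def)
  thus ?thesis by (intro exI[of _ "(%c. c 0) ` ch f g u0 x T"] conjI direct)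
 next
  case 3
  note t = t_plus_mid[OF 3]
  let ?t = "t_plus f g u0 x T"
  have st: "c 0 \<in> starts x" if "c \<in> ch f g u0 0 ?t" for c
  proof -
   have o: "isopt c ?t" "c ?t = 0" using ch_opt[OF t(1) that] by auto
   have "\<exists>\<eta>. isopt \<eta> T \<and> \<eta> T = x \<and> \<eta> 0 = c 0"
    by (rule line_opt[OF o(1) t(1,2)]) (use t(3) o(2) 3 in \<open>auto simp: same_side_def\<close>)
   then obtain \<eta> where "isopt \<eta> T" "\<eta> T = x" "\<eta> 0 = c 0" by blast
   thus ?thesis unfolding starts_def by (intro CollectI exI[of _ \<eta>]) simp
  qed
  have "y_of f g u0 T x = Inf ((%c. c 0) ` ch f g u0 0 ?t)"
   unfolding y_of_def L1_of_eq R1_of_eq using 3 R by (simp add: y_minus0_def)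
  moreover have "(%c. c 0) ` ch f g u0 0 ?t \<noteq> {}" using ch_ex[OF t(1)] by auto
  moreover have "(%c. c 0) ` ch f g u0 0 ?t \<subseteq> starts x" by (rule image_subsetI) (rule st)
  ultimately show ?thesis by (intro exI[of _ "(%c. c 0) ` ch f g u0 0 ?t"] conjI)
 qed
qed

lemma y_of_bounds:
 assumes x: "x < R2 \<or> R1 < x" and w: "a < w" "w < b" "w < R2 \<and> w \<noteq> 0 \<or> R1 < w"
 shows "x < w ==> y_of f g u0 T x \<le> Y w" "w < x ==> Y w \<le> y_of f g u0 T x"
proof -
 obtain Z where Z: "Z \<noteq> {}" "Z \<subseteq> starts x" "y_of f g u0 T x = Inf Z" using y_of_rep[OF x] by blast
 have bdd: "bdd_below Z" by (rule bdd_belowI[of _ "x - Q * T"]) (use start_signs(3) Z(2) in \<open>force simp: abs_le_iff\<close>)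
 obtain z where z: "z \<in> Z" using Z by blast
 show "y_of f g u0 T x \<le> Y w" if "x < w"
  using cInf_lower[OF z bdd] start_bounds(1)[of z x w] z Z x w that by fastforce
 show "Y w \<le> y_of f g u0 T x" if "w < x" unfolding Z(3)
  by (rule cInf_greatest[OF Z(1)]) (use start_bounds(2)[of _ x w] Z x w that in blast)
qed

lemma y_of_signs:
 assumes x: "x < R2 \<or> R1 < x"
 shows "x < R2 ==> y_of f g u0 T x \<le> 0" "R1 < x ==> 0 \<le> y_of f g u0 T x" "\<bar>x - y_of f g u0 T x\<bar> \<le> Q * T"
proof -
 obtain Z where Z: "Z \<noteq> {}" "Z \<subseteq> starts x" "y_of f g u0 T x = Inf Z" using y_of_rep[OF x] by blast
 have b: "x - Q * T \<le> z" "z \<le> x + Q * T" if "z \<in> Z" for z using start_signs(3)[of z x] Z(2) that by (auto simp: abs_le_iff)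
 have bdd: "bdd_below Z" by (rule bdd_belowI[of _ "x - Q * T"]) (use b in blast)
 obtain z where z: "z \<in> Z" using Z by blast
 have le: "Inf Z \<le> z" by (rule cInf_lower[OF z bdd])
 have ge: "x - Q * T \<le> Inf Z" by (rule cInf_greatest[OF Z(1)]) (rule b)
 show "\<bar>x - y_of f g u0 T x\<bar> \<le> Q * T" using le ge b[OF z] Z(3) by simp
 show "y_of f g u0 T x \<le> 0" if "x < R2" using le start_signs(1)[of z x] z Z that by fastforce
 show "0 \<le> y_of f g u0 T x" if "R1 < x" unfolding Z(3)
  by (rule cInf_greatest[OF Z(1)]) (use start_signs(2)[of _ x] Z that in blast)
qed

lemma start_mono:
 assumes z: "z1 \<in> starts x1" "z2 \<in> starts x2" and x: "x1 < R2 \<or> R1 < x1" "x2 < R2 \<or> R1 < x2" "x1 < x2"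
 shows "z1 \<le> z2"
proof -
 obtain c1 where g1: "isopt c1 T" "c1 T = x1" "c1 0 = z1" using z(1) unfolding starts_def by auto
 obtain c2 where g2: "isopt c2 T" "c2 T = x2" "c2 0 = z2" using z(2) unfolding starts_def by auto
 consider "x2 < 0" | "R1 < x1" | "x1 < R2" "R1 < x2" | "x1 < 0" "0 \<le> x2" "x2 < R2" | "0 \<le> x1" "x2 < R2" using x R by linarith
 thus ?thesis
 proof cases
  case 1
  thus ?thesis using straight_mono(1)[OF g1(1) g2(1) T, of 0] left_opt(1,2)[OF g2(1)] g1 g2 x T by auto
 next
  case 2
  thus ?thesis using straight_mono(2)[OF g2(1) g1(1) T, of 0] right_opt(1,2)[OF g1(1)] g1 g2 x T R by auto
 next
  case 3
  thus ?thesis using start_signs(1)[OF z(1)] start_signs(2)[OF z(2)] by simp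
 next
  case 4
  define w where "w = max a x1 / 2"
  have w: "a < w" "w < 0" "x1 < w" using ab 4 by (auto simp: w_def max_def)
  thus ?thesis using start_bounds(1)[OF z(1) x(1), of w] start_bounds(2)[OF z(2) x(2), of w] 4 R ab by fastforce
 next
  case 5
  define w where "w = (x1 + x2) / 2"
  have w: "0 < w" "w < R2" "x1 < w" "w < x2" using 5 x by (auto simp: w_def)
  thus ?thesis using start_bounds(1)[OF z(1) x(1), of w] start_bounds(2)[OF z(2) x(2), of w] 5 R ab by fastforce
 qed
qed

lemma y_of_mono: "mono_on ({..<R2} \<union> {R1<..}) (y_of f g u0 T)"
proof (rule mono_onI)
 fix x1 x2 assume x: "x1 \<in> {..<R2} \<union> {R1<..}" "x2 \<in> {..<R2} \<union> {R1<..}" "x1 \<le> x2"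
 show "y_of f g u0 T x1 \<le> y_of f g u0 T x2"
 proof (cases "x1 = x2")
  case False
  hence lt: "x1 < x2" using x by simp
  have dd: "x1 < R2 \<or> R1 < x1" "x2 < R2 \<or> R1 < x2" using x by auto
  obtain Z1 where Z1: "Z1 \<noteq> {}" "Z1 \<subseteq> starts x1" "y_of f g u0 T x1 = Inf Z1" using y_of_rep[OF dd(1)] by blast
  obtain Z2 where Z2: "Z2 \<noteq> {}" "Z2 \<subseteq> starts x2" "y_of f g u0 T x2 = Inf Z2" using y_of_rep[OF dd(2)] by blast
  have bdd: "bdd_below Z1" by (rule bdd_belowI[of _ "x1 - Q * T"]) (use start_signs(3) Z1(2) in \<open>force simp: abs_le_iff\<close>)
  obtain z where z: "z \<in> Z1" using Z1 by blast
  have le: "Inf Z1 \<le> z" by (rule cInf_lower[OF z bdd])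
  have "z \<le> Inf Z2" by (rule cInf_greatest[OF Z2(1)]) (use start_mono[OF _ _ dd lt] z Z1 Z2 in blast)
  thus ?thesis using le Z1 Z2 by simp
 qed simp
qed

end


context target begin

text \<open>\<open>y_of\<close> is squeezed between the values of \<open>Y\<close> on both sides of \<open>x\<close>.\<close>

lemma y_of_cont:
 assumes x: "a < x" "x < b" "x < R2 \<or> R1 < x" and cc: "isCont y x"
  and eq: "\<And>w. a < w ==> w < b ==> w < R2 \<or> R1 < w ==> Y w = y w"
 shows "y x = y_of f g u0 T x"
proof (rule ccontr)
 let ?z = "y_of f g u0 T x"
 assume ne: "y x \<noteq> ?z"
 hence "0 < \<bar>?z - y x\<bar>" by simp
 then obtain dd where dd: "dd > 0" "\<And>w. \<bar>w - x\<bar> < dd ==> \<bar>y w - y x\<bar> < \<bar>?z - y x\<bar>"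
  using cc unfolding continuous_at_eps_delta dist_real_def by metis
 have D: "a < w ==> w < b ==> w < R2 \<and> w \<noteq> 0 \<or> R1 < w ==> Y w = y w" for w using eq by blast
 show False
 proof (cases "y x < ?z")
  case True
  have "\<exists>w. x < w \<and> w < x + dd \<and> a < w \<and> w < b \<and> (w < R2 \<and> w \<noteq> 0 \<or> R1 < w)"
  proof (cases "R1 < x")
   case True
   thus ?thesis using x dd by (intro exI[of _ "(x + min (x + dd) b) / 2"]) (auto simp: min_def)
  next
   case False
   define w where "w = (x + min (x + dd) (if x < 0 then 0 else R2)) / 2"
   have "x < w" "w < x + dd" "w < R2" "w \<noteq> 0" using False x dd R by (auto simp: w_def min_def split: if_splits)
   thus ?thesis using x R ab by (intro exI[of _ w]) auto
  qed
  then obtain w where w: "x < w" "w < x + dd" "a < w" "w < b" "w < R2 \<and> w \<noteq> 0 \<or> R1 < w" by blast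
  have "?z \<le> y w" using y_of_bounds(1)[OF x(3) w(3,4,5,1)] D[OF w(3-5)] by simp
  moreover have "\<bar>y w - y x\<bar> < \<bar>?z - y x\<bar>" by (rule dd(2)) (use w in simp)
  ultimately show False using True by linarith
 next
  case False
  have "\<exists>w. w < x \<and> x - dd < w \<and> a < w \<and> w < b \<and> (w < R2 \<and> w \<noteq> 0 \<or> R1 < w)"
  proof (cases "R1 < x")
   case True
   thus ?thesis using x dd R ab by (intro exI[of _ "(x + max (x - dd) R1) / 2"]) (auto simp: max_def)
  next
   case False
   define w where "w = (x + max (x - dd) (if 0 < x then 0 else a)) / 2"
   have "w < x" "x - dd < w" "a < w" "w < R2" "w \<noteq> 0" using False x dd R ab by (auto simp: w_def max_def split: if_splits)
   thus ?thesis using x R ab by (intro exI[of _ w]) auto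
  qed
  then obtain w where w: "w < x" "x - dd < w" "a < w" "w < b" "w < R2 \<and> w \<noteq> 0 \<or> R1 < w" by blast
  have "y w \<le> ?z" using y_of_bounds(2)[OF x(3) w(3,4,5,1)] D[OF w(3-5)] by simp
  moreover have "\<bar>y w - y x\<bar> < \<bar>?z - y x\<bar>" by (rule dd(2)) (use w in simp)
  ultimately show False using False by linarith
 qed
qed

lemma y_of_limit:
 assumes lim: "(y \<longlongrightarrow> l) (at_right R1)" and le: "\<And>w. R1 < w ==> w < b ==> l \<le> y w" and eq: "\<And>w. R1 < w ==> w < b ==> Y w = y w"
 shows "(y_of f g u0 T \<longlongrightarrow> l) (at_right R1)"
proof (rule order_tendstoI)
 fix cc assume cc: "cc < l"
 have "cc < y_of f g u0 T x" if x: "R1 < x" "x < b" for x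
 proof -
  have w: "R1 < (x + R1) / 2" "(x + R1) / 2 < x" "(x + R1) / 2 < b" "a < (x + R1) / 2" using x ab R by auto
  have "Y ((x + R1) / 2) \<le> y_of f g u0 T x" by (rule y_of_bounds(2)) (use w x in auto)
  thus ?thesis using cc le[OF w(1,3)] eq[OF w(1,3)] by simp
 qed
 thus "eventually (%x. cc < y_of f g u0 T x) (at_right R1)"
  unfolding eventually_at_right_field using ab(2) by blast
next
 fix cc assume cc: "l < cc"
 obtain e where e: "R1 < e" "\<And>w. R1 < w ==> w < e ==> y w < cc"
  using order_tendstoD(2)[OF lim cc] unfolding eventually_at_right_field by blast
 define w where "w = (R1 + min e b) / 2"
 have w: "R1 < w" "w < e" "w < b" "a < w" using e ab R by (auto simp: w_def min_def)
 have "y_of f g u0 T x < cc" if x: "R1 < x" "x < w" for x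
 proof -
  have "y_of f g u0 T x \<le> Y w" by (rule y_of_bounds(1)) (use w x in auto)
  thus ?thesis using e(2)[OF w(1,2)] eq[OF w(1,3)] by simp
 qed
 thus "eventually (%x. y_of f g u0 T x < cc) (at_right R1)"
  unfolding eventually_at_right_field using w(1) by blast
qed

end

lemma mono_at_right:
 fixes h :: "real => real"
 assumes "cc < dd" and mono: "\<And>x y. cc < x ==> x < y ==> y < dd ==> h x \<le> h y" and B: "\<And>x. cc < x ==> x < dd ==> B \<le> h x"
 shows "(h \<longlongrightarrow> Lim (at_right cc) h) (at_right cc)" "cc < x ==> x < dd ==> Lim (at_right cc) h \<le> h x"
proof -
 have "\<exists>l. ((%t. h (t + cc)) \<longlongrightarrow> l) (at_right 0)"
  by (rule mono_limit_right[where r = "dd - cc" and B = B]) (use assms in auto)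
 then obtain l where l: "(h \<longlongrightarrow> l) (at_right cc)" unfolding filterlim_at_right_to_0[of h _ cc] by blast
 have e: "Lim (at_right cc) h = l" by (rule tendsto_Lim[OF _ l]) simp
 show "(h \<longlongrightarrow> Lim (at_right cc) h) (at_right cc)" using l e by simp
 assume x: "cc < x" "x < dd"
 have "l \<le> h x"
 proof (rule tendsto_upperbound[OF l])
  show "eventually (%u. h u \<le> h x) (at_right cc)"
   unfolding eventually_at_right_field using mono[of _ x] x by blast
 qed simp
 thus "Lim (at_right cc) h \<le> h x" using e by simp
qed

lemma mono_at_left:
 fixes h :: "real => real"
 assumes "cc < dd" and mono: "\<And>x y. cc < x ==> x < y ==> y < dd ==> h x \<le> h y" and B: "\<And>x. cc < x ==> x < dd ==> h x \<le> B"
  and x: "cc < x" "x < dd"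
 shows "h x \<le> Lim (at_left dd) h"
proof -
 let ?k = "%t. - h (- t)"
 have k: "(?k \<longlongrightarrow> Lim (at_right (- dd)) ?k) (at_right (- dd))" "Lim (at_right (- dd)) ?k \<le> ?k (- x)"
  by (rule mono_at_right[where dd = "- cc" and B = "- B"]; use assms in auto)+
 have "((%t. - ?k t) \<longlongrightarrow> - Lim (at_right (- dd)) ?k) (at_right (- dd))" by (rule tendsto_minus[OF k(1)])
 hence "(h \<longlongrightarrow> - Lim (at_right (- dd)) ?k) (at_left dd)" by (simp add: filterlim_at_left_to_right)
 hence "Lim (at_left dd) h = - Lim (at_right (- dd)) ?k" by (rule tendsto_Lim[rotated]) simp
 thus ?thesis using k(2) by simp
qed

theorem theorem1p2:
  fixes f g y u10 :: "real \<Rightarrow> real"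
    and T R1 R2 C1 C2 B1 B2 :: real
  assumes "convex_flux f" and "convex_flux g"
    and "f (\<theta> f) \<le> g (\<theta> g)"
    and "T > 0"
    and "(T, R1, R2, y) \<in> reachable f g T"
    and "\<forall>x\<in>{0<..<R2}. y x < 0"
    and "C1 < 0" and "0 < R1" and "R1 < C2"
    and "B1 < 0" and "0 < B2"
    and "Lim (at_right C1) y > B1"
    and "Lim (at_left C2) y < B2"
    and "Linf (- {B1<..<B2}) u10"
  shows "\<exists>ut u. Linf {B1<..<B2} ut \<and>
           (let u0 = (\<lambda>x. if x \<in> {B1<..<B2} then ut x else u10 x)
            in is_solution f g u0 u \<and>
               (T, R1_of f g u0 T, R2_of f g u0 T, y_of f g u0 T) \<in> reachable f g T \<and>
               R1 = R1_of f g u0 T \<and>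
               R2 = R2_of f g u0 T \<and>
               (\<forall>x\<in>{C1<..<R2} \<union> {R1<..<C2}. isCont y x \<longrightarrow> y x = y_of f g u0 T x))"
proof -
 interpret two_flux f g by unfold_locales (use assms in auto)
 have R: "0 \<le> R2" "R2 \<le> R1" and mono: "mono_on ({..<R2} \<union> {R1<..}) y" and sg: "\<And>x. x < R2 ==> y x \<le> 0" "\<And>x. R1 < x ==> 0 \<le> y x"
  and bdd: "bdd_above ((%x. \<bar>x - y x\<bar>) ` ({..<R2} \<union> {R1<..}))"
  and shock: "\<And>T1 \<tau> \<xi>. axis_time f g T R1 T1 ==> shock_pair f g T T1 \<tau> \<xi> ==> \<xi> \<le> Lim (at_right R1) y"
  and axis: "R2 < R1 ==> \<exists>T1. axis_time f g T R1 T1"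
  using assms(5) unfolding reachable_def by auto
 obtain D where D: "\<And>x. x < R2 \<or> R1 < x ==> \<bar>x - y x\<bar> \<le> D" using bdd unfolding bdd_above_def by auto
 have m: "y x \<le> y z" if "x < z" "x < R2 \<or> R1 < x" "z < R2 \<or> R1 < z" for x z using mono that unfolding mono_on_def by auto
 have l1: "Lim (at_right C1) y \<le> y x" if "C1 < x" "x < R2" for x
 proof (rule mono_at_right(2)[of C1 R2 y "C1 - D"])
  show "C1 - D \<le> y x" if "C1 < x" "x < R2" for x using D[of x] that by (simp add: abs_le_iff)
 qed (use m that in auto)
 have l2: "y x \<le> Lim (at_left C2) y" if "R1 < x" "x < C2" for x
 proof (rule mono_at_left[of R1 C2 y "C2 + D"])
  show "y x \<le> C2 + D" if "R1 < x" "x < C2" for x using D[of x] that by (simp add: abs_le_iff)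
 qed (use m that in auto)
 have lR: "(y \<longlongrightarrow> Lim (at_right R1) y) (at_right R1)" "R1 < x ==> x < C2 ==> Lim (at_right R1) y \<le> y x" for x
  by (rule mono_at_right[of R1 C2 y 0]; use m sg(2) assms(9) in auto)+
 define Y where "Y x = (if R2 \<le> x \<and> x \<le> R1 then 0 else y x)" for x
 have Yy: "Y x = y x" if "x < R2 \<or> R1 < x" for x using that unfolding Y_def by auto
 \<comment> \<open>Strictly between the end points of the free interval and the values of \<open>y\<close>, and on either side of \<open>0\<close>.\<close>
 define b1 where "b1 = (B1 + min (Lim (at_right C1) y) 0) / 2"
 define b2 where "b2 = (B2 + max (Lim (at_left C2) y) 0) / 2"
 have b: "B1 < b1" "b1 < 0" "b1 \<le> Lim (at_right C1) y" "0 < b2" "b2 < B2" "Lim (at_left C2) y \<le> b2"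
  using assms(10-13) unfolding b1_def b2_def by (auto simp: min_def max_def)
 have Ym: "mono_on {C1<..<C2} Y"
 proof (rule mono_onI)
  fix x z assume "x \<in> {C1<..<C2}" "z \<in> {C1<..<C2}" "x \<le> z"
  thus "Y x \<le> Y z" using m[of x z] sg(1)[of x] sg(2)[of z] R unfolding Y_def by (cases "x = z") auto
 qed
 have Yr: "Y x \<in> {b1..b2}" if "x \<in> {C1<..<C2}" for x
  using l1[of x] l2[of x] sg(1)[of x] sg(2)[of x] b that unfolding Y_def by auto
 obtain ut where ut: "Linf {B1<..<B2} ut" "Linf UNIV (%x. if x \<in> {B1<..<B2} then ut x else u10 x)"
  "\<forall>x\<in>{C1<..<C2}. \<forall>z. primitive (%x. if x \<in> {B1<..<B2} then ut x else u10 x) (Y x) + act T (Y x) x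
   \<le> primitive (%x. if x \<in> {B1<..<B2} then ut x else u10 x) z + act T z x"
  using initial_datum[OF assms(4) b(1,2,4,5) assms(14) Ym Yr] by blast
 define u0 where "u0 = (%x. if x \<in> {B1<..<B2} then ut x else u10 x)"
 note ut = ut[folded u0_def]
 obtain C u where VF: "value_function f g (primitive u0) C" and sol: "is_solution f g u0 u"
  using solution_exists[OF ut(2)] by blast
 interpret V: value_function f g "primitive u0" C by (rule VF)
 interpret X: target f g u0 C T R1 R2 C1 C2 Y
 proof (intro target.intro VF target_axioms.intro)
  show "\<exists>c. V.isopt c T \<and> c T = x \<and> c 0 = Y x" if x: "C1 < x" "x < C2" for x
  proof -
   obtain c where c: "c 0 = Y x" "c T = x" "pc c 0 T (act T (Y x) x)" using act_path[OF assms(4)] by blast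
   obtain d cc where d: "d \<in> control_curves x T" "pc d 0 T cc" "V.v x T = primitive u0 (d 0) + cc"
    using V.v_min(1)[of T x] assms(4) by auto
   have "act T (d 0) x \<le> cc" using act_le[OF assms(4) d(2)] V.control_end[OF d(1)] by simp
   moreover have "primitive u0 (Y x) + act T (Y x) x \<le> primitive u0 (d 0) + act T (d 0) x" using ut(3) x by simp
   ultimately have "primitive u0 (Y x) + act T (Y x) x \<le> V.v x T" using d(3) by simp
   moreover have "V.v x T \<le> primitive u0 (Y x) + act T (Y x) x" using V.v_min(2)[OF _ c(3,2)] c(1) assms(4) by simp
   ultimately have "V.isopt c T" unfolding V.isopt_def using c by auto
   thus ?thesis using c by blast
  qed
  show "\<xi> \<le> Y x" if "axis_time f g T R1 T1" "shock_pair f g T T1 \<tau> \<xi>" "R1 < x" "x < C2" for T1 \<tau> \<xi> x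
   using shock[OF that(1,2)] lR(2)[OF that(3,4)] Yy[of x] that by simp
  show "Y x = 0" if "R2 \<le> x" "x < R1" for x using that by (simp add: Y_def)
  show "Y x \<le> 0" if "C1 < x" "x < 0" for x using sg(1)[of x] Yy[of x] that R by simp
  show "Y x < 0" if "0 < x" "x < R2" for x using assms(6) Yy[of x] that by simp
  show "0 \<le> Y x" if "R1 < x" "x < C2" for x using sg(2)[of x] Yy[of x] that by simp
 qed (use assms R axis in auto)
 have "(y_of f g u0 T \<longlongrightarrow> Lim (at_right R1) y) (at_right R1)"
  by (rule X.y_of_limit[OF lR]) (use Yy in auto)
 hence Leq: "Lim (at_right R1) (y_of f g u0 T) = Lim (at_right R1) y" by (rule tendsto_Lim[rotated]) simp
 have "(T, R1, R2, y_of f g u0 T) \<in> reachable f g T"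
  unfolding reachable_def mem_Collect_eq prod.case
 proof (intro conjI allI impI refl R)
  show "bdd_above ((%x. \<bar>x - y_of f g u0 T x\<bar>) ` ({..<R2} \<union> {R1<..}))"
   by (rule bdd_aboveI2[of _ _ "V.Q * T"]) (rule X.y_of_signs(3), auto)
  show "\<xi> \<le> Lim (at_right R1) (y_of f g u0 T)" if "axis_time f g T R1 T1 \<and> shock_pair f g T T1 \<tau> \<xi>" for T1 \<tau> \<xi>
   unfolding Leq by (rule shock[OF conjunct1[OF that] conjunct2[OF that]])
 qed (use X.y_of_mono X.y_of_signs(1,2) axis in auto)
 moreover have "y x = y_of f g u0 T x" if "x \<in> {C1<..<R2} \<union> {R1<..<C2}" "isCont y x" for x
  by (rule X.y_of_cont[OF _ _ _ that(2)]) (use that(1) assms R Yy in auto)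
 ultimately have "is_solution f g u0 u \<and> (T, R1_of f g u0 T, R2_of f g u0 T, y_of f g u0 T) \<in> reachable f g T \<and>
   R1 = R1_of f g u0 T \<and> R2 = R2_of f g u0 T \<and> (\<forall>x\<in>{C1<..<R2} \<union> {R1<..<C2}. isCont y x --> y x = y_of f g u0 T x)"
  using sol X.R1_of_eq X.R2_of_eq by simp
 thus ?thesis using ut(1) unfolding Let_def u0_def by (intro exI[of _ ut] exI[of _ u] conjI) auto
qed


end
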